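(* Let $k$ be a field and let $A = k[X_1,\ldots,X_c]/(X_1^{a_1},\ldots,X_c^{a_c})$ with $a_i \geq 2$ for all $i$ and $c \geq 2$. Let $p$ be a prime number and assume that $p$ divides two of the $a_i$ (that is, $p \mid a_i$ and $p \mid a_j$ for some indices $i \neq j$). Then $p$ divides $\ell(E)$ for every finitely generated $A$-module $E$ with $\operatorname{cx}_A E \leq 1$.
   Context: All modules are finitely generated. $\ell(E)$ is the length of $E$ as an $A$-module. $A$ is an Artinian local ring with residue field $k$. The condition $\operatorname{cx}_A E \leq 1$ (complexity at most one) means that the Betti numbers $\beta_i^A(E) = \dim_k \operatorname{Tor}_i^A(E,k)$, $i \geq 0$, are bounded. *)

theory Defs
  imports
    "HOL-Library.Poly_Mapping"
    "HOL-Library.Extended_Nat"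
    "HOL-Algebra.Algebraic_Closure_Type"
    "Jordan_Normal_Form.Missing_VectorSpace"
begin

section \<open>Truncated polynomial rings\<close>

text \<open>A monomial is a finitely supported exponent vector \<open>nat \<Rightarrow>\<^sub>0 nat\<close>, and a polynomial is a
  finitely supported family of coefficients indexed by monomials.\<close>

definition poly_ring :: "nat \<Rightarrow> ((nat \<Rightarrow>\<^sub>0 nat) \<Rightarrow>\<^sub>0 'k::field) ring" where
  "poly_ring c = ring_of_type_algebra
     \<lparr>carrier := {f. \<forall>m \<in> Poly_Mapping.keys f. Poly_Mapping.keys m \<subseteq> {1..c}}\<rparr>"

definition poly_var :: "nat \<Rightarrow> (nat \<Rightarrow>\<^sub>0 nat) \<Rightarrow>\<^sub>0 'k::field" where
  "poly_var i = Poly_Mapping.single (Poly_Mapping.single i 1) 1"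

definition truncated_poly_ring ::
    "nat \<Rightarrow> (nat \<Rightarrow> nat) \<Rightarrow> ((nat \<Rightarrow>\<^sub>0 nat) \<Rightarrow>\<^sub>0 'k::field) set ring" where
  "truncated_poly_ring c a =
     poly_ring c Quot
       (Idl\<^bsub>poly_ring c\<^esub> {poly_var i [^]\<^bsub>poly_ring c\<^esub> a i | i. i \<in> {1..c}})"


section \<open>Finite generation and length\<close>

definition finitely_generated :: "('a, 'r) ring_scheme \<Rightarrow> ('a, 'm, 'e) module_scheme \<Rightarrow> bool" where
  "finitely_generated A M \<longleftrightarrow>
     (\<exists>S. finite S \<and> S \<subseteq> carrier M \<and> module.span A M S = carrier M)"

text \<open>The length is the supremum of the lengths \<open>n\<close> of strict chains
  \<open>N 0 \<subset> N 1 \<subset> \<dots> \<subset> N n\<close> of submodules.\<close>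

definition module_length :: "('a, 'r) ring_scheme \<Rightarrow> ('a, 'm, 'e) module_scheme \<Rightarrow> enat" where
  "module_length A M =
     Sup {enat n | n. \<exists>N. (\<forall>i\<le>n. submodule A (N i) M) \<and> (\<forall>i<n. N i \<subset> N (Suc i))}"


section \<open>Quotient modules, free modules and tensor products\<close>

text \<open>The multiplicative fields of a module record carry no meaning; as in
  \<^const>\<open>ring.func_space\<close>, they are filled with zero.\<close>

definition quot_module :: "('a, 'm, 'e) module_scheme \<Rightarrow> 'm set \<Rightarrow> ('a, 'm set) module" where
  "quot_module M N =
     \<lparr>carrier = a_rcosets\<^bsub>M\<^esub> N, monoid.mult = (\<lambda>_ _. N), one = N, zero = N, add = set_add M,
      module.smult = (\<lambda>a U. \<Union>x\<in>U. N +>\<^bsub>M\<^esub> (a \<odot>\<^bsub>M\<^esub> x))\<rparr>"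

definition free_module :: "('a, 'r) ring_scheme \<Rightarrow> 's set \<Rightarrow> ('a, 's \<Rightarrow> 'a) module" where
  "free_module A S = (ring.func_space A S)
     \<lparr>carrier := {f \<in> S \<rightarrow>\<^sub>E carrier A. finite {s \<in> S. f s \<noteq> \<zero>\<^bsub>A\<^esub>}}\<rparr>"

definition free_gen :: "('a, 'r) ring_scheme \<Rightarrow> 's set \<Rightarrow> 's \<Rightarrow> ('s \<Rightarrow> 'a)" where
  "free_gen A S s = (\<lambda>t\<in>S. if t = s then \<one>\<^bsub>A\<^esub> else \<zero>\<^bsub>A\<^esub>)"

definition tensor_relations ::
    "('a, 'r) ring_scheme \<Rightarrow> ('a, 'm, 'e) module_scheme \<Rightarrow> ('a, 'n, 'f) module_scheme \<Rightarrow>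
     ('m \<times> 'n \<Rightarrow> 'a) set" where
  "tensor_relations A M N =
     (let F = free_module A (carrier M \<times> carrier N);
          \<delta> = free_gen A (carrier M \<times> carrier N)
      in {\<delta> (x \<oplus>\<^bsub>M\<^esub> x', y) \<ominus>\<^bsub>F\<^esub> (\<delta> (x, y) \<oplus>\<^bsub>F\<^esub> \<delta> (x', y)) | x x' y.
            x \<in> carrier M \<and> x' \<in> carrier M \<and> y \<in> carrier N}
       \<union> {\<delta> (x, y \<oplus>\<^bsub>N\<^esub> y') \<ominus>\<^bsub>F\<^esub> (\<delta> (x, y) \<oplus>\<^bsub>F\<^esub> \<delta> (x, y')) | x y y'.
            x \<in> carrier M \<and> y \<in> carrier N \<and> y' \<in> carrier N}
       \<union> {\<delta> (a \<odot>\<^bsub>M\<^esub> x, y) \<ominus>\<^bsub>F\<^esub> (a \<odot>\<^bsub>F\<^esub> \<delta> (x, y)) | a x y.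
            a \<in> carrier A \<and> x \<in> carrier M \<and> y \<in> carrier N}
       \<union> {\<delta> (x, a \<odot>\<^bsub>N\<^esub> y) \<ominus>\<^bsub>F\<^esub> (a \<odot>\<^bsub>F\<^esub> \<delta> (x, y)) | a x y.
            a \<in> carrier A \<and> x \<in> carrier M \<and> y \<in> carrier N})"

definition tensor_kernel ::
    "('a, 'r) ring_scheme \<Rightarrow> ('a, 'm, 'e) module_scheme \<Rightarrow> ('a, 'n, 'f) module_scheme \<Rightarrow>
     ('m \<times> 'n \<Rightarrow> 'a) set" where
  "tensor_kernel A M N =
     module.span A (free_module A (carrier M \<times> carrier N)) (tensor_relations A M N)"

definition tensor ::
    "('a, 'r) ring_scheme \<Rightarrow> ('a, 'm, 'e) module_scheme \<Rightarrow> ('a, 'n, 'f) module_scheme \<Rightarrow>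
     ('a, ('m \<times> 'n \<Rightarrow> 'a) set) module" where
  "tensor A M N =
     quot_module (free_module A (carrier M \<times> carrier N)) (tensor_kernel A M N)"

definition pure_tensor ::
    "('a, 'r) ring_scheme \<Rightarrow> ('a, 'm, 'e) module_scheme \<Rightarrow> ('a, 'n, 'f) module_scheme \<Rightarrow>
     'm \<Rightarrow> 'n \<Rightarrow> ('m \<times> 'n \<Rightarrow> 'a) set" where
  "pure_tensor A M N x y =
     tensor_kernel A M N +>\<^bsub>free_module A (carrier M \<times> carrier N)\<^esub>
       free_gen A (carrier M \<times> carrier N) (x, y)"

text \<open>For linear \<open>f : M \<rightarrow> M'\<close>, the induced map \<open>f \<otimes> id : M \<otimes> N \<rightarrow> M' \<otimes> N\<close>.\<close>

definition tensor_map ::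
    "('a, 'r) ring_scheme \<Rightarrow> ('a, 'm, 'e) module_scheme \<Rightarrow> ('a, 'm', 'e') module_scheme \<Rightarrow>
     ('a, 'n, 'f) module_scheme \<Rightarrow> ('m \<Rightarrow> 'm') \<Rightarrow>
     ('m \<times> 'n \<Rightarrow> 'a) set \<Rightarrow> ('m' \<times> 'n \<Rightarrow> 'a) set" where
  "tensor_map A M M' N f =
     (THE g. g \<in> module_hom A (tensor A M N) (tensor A M' N) \<and>
             g \<in> extensional (carrier (tensor A M N)) \<and>
             (\<forall>x \<in> carrier M. \<forall>y \<in> carrier N.
                g (pure_tensor A M N x y) = pure_tensor A M' N (f x) y))"


section \<open>Tor\<close>

text \<open>A resolution of \<open>M\<close> by free modules of finite rank, with
  \<open>d i : A\<^bsup>n (i + 1)\<^esup> \<rightarrow> A\<^bsup>n i\<^esup>\<close> and augmentation \<open>\<epsilon> : A\<^bsup>n 0\<^esup> \<rightarrow> M\<close>.\<close>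

definition free_resolution ::
    "('a, 'r) ring_scheme \<Rightarrow> ('a, 'm, 'e) module_scheme \<Rightarrow> (nat \<Rightarrow> nat) \<Rightarrow>
     (nat \<Rightarrow> (nat \<Rightarrow> 'a) \<Rightarrow> (nat \<Rightarrow> 'a)) \<Rightarrow> ((nat \<Rightarrow> 'a) \<Rightarrow> 'm) \<Rightarrow> bool" where
  "free_resolution A M n d \<epsilon> \<longleftrightarrow>
     (let F = (\<lambda>i. free_module A {..<n i})
      in \<epsilon> \<in> module_hom A (F 0) M \<and> \<epsilon> ` carrier (F 0) = carrier M \<and>
         (\<forall>i. d i \<in> module_hom A (F (Suc i)) (F i)) \<and>
         d 0 ` carrier (F 1) = a_kernel (F 0) M \<epsilon> \<and>
         (\<forall>i. d (Suc i) ` carrier (F (Suc (Suc i))) = a_kernel (F (Suc i)) (F i) (d i)))"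

text \<open>Over a Noetherian ring every finitely generated module has such a resolution; Tor is computed
  from a chosen one (it does not depend on the choice, up to isomorphism).\<close>

definition some_resolution ::
    "('a, 'r) ring_scheme \<Rightarrow> ('a, 'm, 'e) module_scheme \<Rightarrow>
     (nat \<Rightarrow> nat) \<times> (nat \<Rightarrow> (nat \<Rightarrow> 'a) \<Rightarrow> (nat \<Rightarrow> 'a))" where
  "some_resolution A M = (SOME (n, d). \<exists>\<epsilon>. free_resolution A M n d \<epsilon>)"

definition Tor ::
    "('a, 'r) ring_scheme \<Rightarrow> nat \<Rightarrow> ('a, 'm, 'e) module_scheme \<Rightarrow> ('a, 'n, 'f) module_scheme \<Rightarrow>
     ('a, ((nat \<Rightarrow> 'a) \<times> 'n \<Rightarrow> 'a) set set) module" where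
  "Tor A i M N =
     (let n = fst (some_resolution A M);
          d = snd (some_resolution A M);
          F = (\<lambda>j. free_module A {..<n j});
          C = (\<lambda>j. tensor A (F j) N);
          D = (\<lambda>j. tensor_map A (F (Suc j)) (F j) N (d j));
          cycles = (case i of 0 \<Rightarrow> carrier (C 0) | Suc j \<Rightarrow> a_kernel (C (Suc j)) (C j) (D j));
          boundaries = D i ` carrier (C (Suc i))
      in quot_module ((C i)\<lparr>carrier := cycles\<rparr>) boundaries)"


section \<open>Betti numbers over a local ring\<close>

text \<open>The following are meant for a local ring \<open>A\<close>, which has exactly one maximal ideal.\<close>

definition max_ideal :: "('a, 'r) ring_scheme \<Rightarrow> 'a set" where
  "max_ideal A = (THE m. maximalideal m A)"

definition residue_field :: "('a, 'r) ring_scheme \<Rightarrow> 'a set ring" where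
  "residue_field A = A Quot max_ideal A"

definition residue_module :: "('a, 'r) ring_scheme \<Rightarrow> ('a, 'a set) module" where
  "residue_module A =
     (let k = residue_field A
      in \<lparr>carrier = carrier k, monoid.mult = monoid.mult k, one = one k, zero = zero k, add = add k,
          module.smult = (\<lambda>a U. (max_ideal A +>\<^bsub>A\<^esub> a) \<otimes>\<^bsub>k\<^esub> U)\<rparr>)"

text \<open>An \<open>A\<close>-module annihilated by the maximal ideal, viewed as a vector space over the residue
  field: a residue class acts through any of its representatives.\<close>

definition residue_space ::
    "('a, 'r) ring_scheme \<Rightarrow> ('a, 'm, 'e) module_scheme \<Rightarrow> ('a set, 'm) module" where
  "residue_space A M =
     \<lparr>carrier = carrier M, monoid.mult = monoid.mult M, one = one M, zero = zero M, add = add M,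
      module.smult = (\<lambda>U v. (SOME a. a \<in> U) \<odot>\<^bsub>M\<^esub> v)\<rparr>"

definition betti :: "('a, 'r) ring_scheme \<Rightarrow> nat \<Rightarrow> ('a, 'm, 'e) module_scheme \<Rightarrow> nat" where
  "betti A i M =
     vectorspace.dim (residue_field A) (residue_space A (Tor A i M (residue_module A)))"

text \<open>Complexity at most one means that the sequence of Betti numbers is bounded.\<close>

definition cx_le_one :: "('a, 'r) ring_scheme \<Rightarrow> ('a, 'm, 'e) module_scheme \<Rightarrow> bool" where
  "cx_le_one A M \<longleftrightarrow> (\<exists>b. \<forall>i. betti A i M \<le> b)"

end

theory Submission
  imports Defs
    "HOL-Library.Function_Algebras"
begin

text \<open>
  Write \<open>a\<^sub>i = p \<alpha>\<close>, \<open>a\<^sub>j = p \<beta>\<close> and let \<open>u = X\<^sub>i\<^bsup>\<alpha>\<^esup>\<close>, \<open>v = X\<^sub>j\<^bsup>\<beta>\<^esup>\<close> in \<open>A\<close>, so that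
  \<open>u\<^bsup>p\<^esup> = v\<^bsup>p\<^esup> = 0\<close>. The tensor product of the two-periodic complexes of \<open>u, u\<^bsup>p-1\<^esup>, u, \<dots>\<close> and of
  \<open>v, v\<^bsup>p-1\<^esup>, v, \<dots>\<close> is a free resolution of \<open>A/(u,v)\<close>, hence with coefficients in \<open>E\<close> its homology
  is \<open>Tor(A/(u,v), E)\<close>. By dimension shifting along a free resolution of \<open>E\<close> and a filtration of
  \<open>A/(u,v)\<close> with one-dimensional quotients, this homology is bounded by a multiple of the Betti
  numbers of \<open>E\<close>, so it has bounded dimension.

  The degree \<open>i\<close> part of the complex has dimension \<open>(i + 1) dim E\<close> and contains, for every
  scalar \<open>\<lambda>\<close>, a copy of the matrix factorization of \<open>\<lambda> u\<^bsup>p\<^esup> + v\<^bsup>p\<^esup>\<close>. Boundedness of the homology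
  forces this factorization to be exact on \<open>E\<close> for all but finitely many \<open>\<lambda>\<close>. After passing to the algebraic
  closure, \<open>v\<^bsup>p\<^esup> - c u\<^bsup>p\<^esup>\<close> is a product of \<open>p\<close> linear factors \<open>v - z u\<close>, and exactness splits \<open>dim E\<close>
  into the sum of the dimensions of the \<open>p\<close> kernels of these factors on \<open>E\<close>. For generic \<open>c\<close> all of them
  equal the generic value of \<open>dim ker (v - z u)\<close>, so \<open>p\<close> divides \<open>dim E\<close>, which is the length of \<open>E\<close>.
\<close>

section \<open>Finite-dimensional subspaces and spanning modulo a subspace\<close>

text \<open>Why the bad scalars are finitely many: the Vandermonde matrix of i div 2 + 1 distinct
  scalars splits the degree i part into as many subcomplex pieces, so the rank of the differential
  is at most the sum of the ranks of these pieces. Exactness then enters in a single form: on E the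
  kernel of v - z u is the image of the product of the other factors. Kernel dimensions therefore
  add up even if the factors coincide, as in characteristic p. The obstacle is that modules, tensor
  products and Tor are records with carrier sets. They are presented by typed vectors: A is the type
  of all polynomials modulo those supported on an upward closed set of monomials, and the dimension
  of a quotient is measured by generating one subset modulo another. Differentials are lifted to
  polynomial vectors by choice, hence are linear only up to congruence, and long exact sequences
  become relations between representatives.\<close>

locale k_space = vector_space scale
  for scale :: "'k::field \<Rightarrow> 'b::ab_group_add \<Rightarrow> 'b" (infixr "*k" 75)
begin

text \<open>The types of vectors used here are infinite-dimensional, so finiteness is recorded for
  subsets. Without it \<open>dim\<close> may take its default value 0, and inequalities between
  dimensions lose their meaning.\<close>

definition finite_span :: "'b set \<Rightarrow> bool" where
  "finite_span S \<longleftrightarrow> (\<exists>B. finite B \<and> S \<subseteq> span B)"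

lemma finite_spanI: "finite B \<Longrightarrow> S \<subseteq> span B \<Longrightarrow> finite_span S"
  by (auto simp: finite_span_def)

lemma finite_span_mono: "finite_span T \<Longrightarrow> S \<subseteq> T \<Longrightarrow> finite_span S"
  by (auto simp: finite_span_def)

lemma finite_span_independent: "finite_span T \<Longrightarrow> B \<subseteq> T \<Longrightarrow> independent B \<Longrightarrow> finite B"
  unfolding finite_span_def using independent_span_bound by (meson order_trans)

lemma finite_span_basis:
  assumes "finite_span S"
  obtains B where "finite B" "B \<subseteq> S" "independent B" "S \<subseteq> span B" "card B = dim S"
  by (metis basis_exists finite_span_independent assms)

lemma dim_mono_finite_span:
  assumes "finite_span T" "S \<subseteq> T" shows "dim S \<le> dim T"
proof -
  obtain B where B: "finite B" "T \<subseteq> span B" "card B = dim T"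
    using finite_span_basis[OF assms(1)] by metis
  then show ?thesis using dim_le_card[of S B] assms(2) by auto
qed

lemma independent_card_le_dim_finite_span:
  assumes "finite_span T" "B \<subseteq> T" "independent B" shows "card B \<le> dim T"
  using dim_mono_finite_span[OF assms(1,2)] dim_eq_card_independent[OF assms(3)] by simp

lemma subspace_eq_if_dim_le:
  assumes "finite_span T" "subspace S" "S \<subseteq> T" "dim T \<le> dim S"
  shows "S = T"
proof -
  obtain B where B: "finite B" "B \<subseteq> S" "independent B" "S \<subseteq> span B" "card B = dim S"
    using finite_span_basis[OF finite_span_mono[OF assms(1,3)]] by metis
  have "x \<in> S" if x: "x \<in> T" for x
  proof (rule ccontr)
    assume "x \<notin> S"
    then have "x \<notin> span B" using B assms(2) span_minimal by blast
    then have "independent (insert x B)" "x \<notin> B" using B independent_insertI span_base by auto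
    then have "card (insert x B) \<le> dim T"
      using B x assms(3) by (intro independent_card_le_dim_finite_span[OF assms(1)]) auto
    then show False using \<open>x \<notin> B\<close> B assms(4) by simp
  qed
  then show ?thesis using assms(3) by blast
qed

lemma dim_zero_subspace [simp]: "dim {0} = 0"
  using dim_span[of "{}"] dim_eq_card_independent[of "{}"] independent_empty by simp

text \<open>\<open>V\<close> is contained in the sum of \<open>W\<close> and the span of at most \<open>b\<close> elements of \<open>V\<close>;
  for subspaces \<open>W \<subseteq> V\<close> this says that \<open>V/W\<close> has dimension at most \<open>b\<close>.\<close>

definition spanned_mod :: "'b set \<Rightarrow> 'b set \<Rightarrow> nat \<Rightarrow> bool" where
  "spanned_mod V W b \<longleftrightarrow>
     (\<exists>S. finite S \<and> card S \<le> b \<and> S \<subseteq> V \<and> (\<forall>x\<in>V. \<exists>s\<in>span S. x - s \<in> W))"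

text \<open>The elements of \<open>S\<close> need not lie in \<open>V\<close>; the point is to
  replace them by at most as many elements of \<open>V\<close>. In the induction, an element
  \<open>x\<close> of \<open>V\<close> that involves \<open>a\<close> takes the place of
  \<open>a\<close>, and the part \<open>V1\<close> of \<open>V\<close> that does without
  \<open>a\<close> falls under the induction hypothesis.\<close>

lemma spanned_mod_subspace_aux:
  assumes "finite S" "subspace W"
  shows "subspace V \<Longrightarrow> (\<forall>x\<in>V. \<exists>s\<in>span S. x - s \<in> W) \<Longrightarrow> spanned_mod V W (card S)"
  using assms(1)
proof (induction S arbitrary: V rule: finite_induct)
  case empty
  then show ?case by (auto simp: spanned_mod_def intro!: exI[of _ "{}"])
next
  case (insert a S)
  define V1 where "V1 = {x \<in> V. \<exists>s\<in>span S. x - s \<in> W}"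
  have "subspace V1"
  proof (rule subspaceI)
    show "0 \<in> V1" using insert.prems assms(2) by (auto simp: V1_def subspace_0 intro!: bexI[of _ 0] span_zero)
    show "x + y \<in> V1" if "x \<in> V1" "y \<in> V1" for x y
    proof -
      from that obtain s t where st: "s \<in> span S" "x - s \<in> W" "t \<in> span S" "y - t \<in> W" "x \<in> V" "y \<in> V"
        by (auto simp: V1_def)
      have "x + y - (s + t) = (x - s) + (y - t)" by simp
      then have "x + y - (s + t) \<in> W" using st subspace_add[OF assms(2)] by metis
      then show ?thesis using st insert.prems by (auto simp: V1_def subspace_add intro!: bexI[of _ "s+t"] span_add)
    qed
    show "c *k x \<in> V1" if "x \<in> V1" for c x
    proof -
      from that obtain s where st: "s \<in> span S" "x - s \<in> W" "x \<in> V" by (auto simp: V1_def)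
      have "c *k x - c *k s \<in> W" using st subspace_scale[OF assms(2), of "x - s" c] by (simp add: scale_right_diff_distrib)
      then show ?thesis using st insert.prems by (auto simp: V1_def subspace_scale intro!: bexI[of _ "c *k s"] span_scale)
    qed
  qed
  moreover have "\<forall>x\<in>V1. \<exists>s\<in>span S. x - s \<in> W" by (auto simp: V1_def)
  ultimately have "spanned_mod V1 W (card S)" using insert.IH by blast
  then obtain T where T: "finite T" "card T \<le> card S" "T \<subseteq> V1" "\<And>x. x \<in> V1 \<Longrightarrow> \<exists>s\<in>span T. x - s \<in> W"
    by (auto simp: spanned_mod_def)
  show ?case
  proof (cases "V \<subseteq> V1")
    case True
    moreover have "T \<subseteq> V" using T by (auto simp: V1_def)
    ultimately show ?thesis using T insert.hyps unfolding spanned_mod_def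
      by (intro exI[of _ T]) (simp add: subset_iff)
  next
    case False
    then obtain x where x: "x \<in> V" "x \<notin> V1" by auto
    have dec: "\<exists>k. \<exists>s\<in>span S. y - k *k a - s \<in> W" if "y \<in> V" for y
    proof -
      from that insert.prems(2) obtain s where s: "s \<in> span (insert a S)" "y - s \<in> W" by auto
      then obtain k where k: "s - k *k a \<in> span S" using span_breakdown_eq by auto
      have "y - k *k a - (s - k *k a) \<in> W" using s by simp
      then show ?thesis using k by blast
    qed
    obtain k s where k: "s \<in> span S" "x - k *k a - s \<in> W" using dec x by blast
    have k0: "k \<noteq> 0" using k x by (auto simp: V1_def)
    have "\<exists>t\<in>span (insert x T). y - t \<in> W" if y: "y \<in> V" for y
    proof -
      obtain l t where l: "t \<in> span S" "y - l *k a - t \<in> W" using dec y by blast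
      \<comment> \<open>Subtracting this multiple of \<open>x\<close> removes the coefficient at
        \<open>a\<close>, so \<open>z\<close> lies in \<open>V1\<close>.\<close>
      define z where "z = y - (l/k) *k x"
      have "(y - l *k a - t) - (l/k) *k (x - k *k a - s) \<in> W"
        using l k assms(2) by (auto intro!: subspace_diff subspace_scale)
      also have "(y - l *k a - t) - (l/k) *k (x - k *k a - s) = z - (t - (l/k) *k s)"
        using k0 by (simp add: z_def scale_right_diff_distrib)
      finally have "z \<in> V1" using y x l k insert.prems
        by (auto simp: V1_def z_def intro!: subspace_diff subspace_scale bexI[of _ "t - (l/k) *k s"] span_diff span_scale)
      then obtain r where r: "r \<in> span T" "z - r \<in> W" using T by blast
      have "r \<in> span (insert x T)" "x \<in> span (insert x T)"
        using r span_mono[of T "insert x T"] span_base[of x "insert x T"] by auto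
      then have "(l/k) *k x + r \<in> span (insert x T)" by (intro span_add span_scale)
      moreover have "y - ((l/k) *k x + r) \<in> W" using r by (simp add: z_def algebra_simps)
      ultimately show ?thesis by blast
    qed
    moreover have "card (insert x T) \<le> card (insert a S)" using T insert.hyps
      by (simp add: card_insert_if)
    moreover have "insert x T \<subseteq> V" using x T by (auto simp: V1_def)
    ultimately show ?thesis using T unfolding spanned_mod_def by (intro exI[of _ "insert x T"]) auto
  qed
qed

lemma spanned_mod_subspace:
  assumes "spanned_mod V W b" "subspace V'" "V' \<subseteq> V" "subspace W"
  shows "spanned_mod V' W b"
proof -
  from assms(1) obtain S where S: "finite S" "card S \<le> b" "\<forall>x\<in>V. \<exists>s\<in>span S. x - s \<in> W"
    by (auto simp: spanned_mod_def)
  then have "spanned_mod V' W (card S)" using spanned_mod_subspace_aux assms by blast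
  with S show ?thesis unfolding spanned_mod_def by (meson order_trans)
qed

lemma spanned_mod_mono:
  "spanned_mod V W b \<Longrightarrow> b \<le> b' \<Longrightarrow> W \<subseteq> W' \<Longrightarrow> spanned_mod V W' b'"
  unfolding spanned_mod_def by (meson order_trans subsetD)

lemma spanned_mod_dim:
  assumes "spanned_mod V W b" "finite_span W" shows "dim V \<le> dim W + b"
proof -
  from assms obtain S where S: "finite S" "card S \<le> b" "\<And>x. x\<in>V \<Longrightarrow> \<exists>s\<in>span S. x - s \<in> W"
    by (auto simp: spanned_mod_def)
  obtain B where B: "finite B" "W \<subseteq> span B" "card B = dim W" using finite_span_basis[OF assms(2)] by metis
  have "x \<in> span (S \<union> B)" if xV: "x \<in> V" for x
  proof -
    obtain s where s: "s \<in> span S" "x - s \<in> W" using S(3)[OF xV] by blast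
    then have "s + (x - s) \<in> span (S \<union> B)" using B unfolding span_Un by blast
    then show ?thesis by simp
  qed
  then have "dim V \<le> card (S \<union> B)" using S B by (intro dim_le_card) auto
  also have "\<dots> \<le> b + dim W" using card_Un_le[of S B] S B by linarith
  finally show ?thesis by simp
qed

lemma dim_le_sum_dim:
  assumes "finite T" "\<And>t. t \<in> T \<Longrightarrow> finite_span (S t)"
    "\<And>x. x \<in> V \<Longrightarrow> \<exists>f. (\<forall>t\<in>T. f t \<in> S t) \<and> x = (\<Sum>t\<in>T. f t)"
  shows "dim V \<le> (\<Sum>t\<in>T. dim (S t))" "finite_span V"
proof -
  have "\<forall>t\<in>T. \<exists>B. finite B \<and> S t \<subseteq> span B \<and> card B = dim (S t)"
    using finite_span_basis assms(2) by metis
  then obtain B where B: "\<And>t. t\<in>T \<Longrightarrow> finite (B t) \<and> S t \<subseteq> span (B t) \<and> card (B t) = dim (S t)"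
    by metis
  have *: "V \<subseteq> span (\<Union>t\<in>T. B t)"
  proof
    fix x assume "x \<in> V"
    then obtain f where f: "\<forall>t\<in>T. f t \<in> S t" "x = (\<Sum>t\<in>T. f t)" using assms(3) by blast
    have "f t \<in> span (\<Union>t\<in>T. B t)" if "t \<in> T" for t
      using f B that span_mono[of "B t" "\<Union>t\<in>T. B t"] by blast
    then show "x \<in> span (\<Union>t\<in>T. B t)" unfolding f(2) by (intro span_sum) auto
  qed
  then have "dim V \<le> card (\<Union>t\<in>T. B t)" using B assms(1) by (intro dim_le_card) auto
  also have "\<dots> \<le> (\<Sum>t\<in>T. card (B t))" using assms(1) by (rule card_UN_le)
  finally show "dim V \<le> (\<Sum>t\<in>T. dim (S t))" using B by simp
  show "finite_span V" using * B assms(1) by (intro finite_spanI[OF _ *]) auto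
qed

end

section \<open>Rank and nullity on finite-dimensional subspaces\<close>

locale k_space_pair = vs1: k_space s1 + vs2: k_space s2
  for s1 :: "'k::field \<Rightarrow> 'b::ab_group_add \<Rightarrow> 'b" and s2 :: "'k \<Rightarrow> 'c::ab_group_add \<Rightarrow> 'c"
begin

sublocale vector_space_pair s1 s2 by unfold_locales

lemma finite_span_image:
  assumes "Vector_Spaces.linear s1 s2 f" "vs1.finite_span V" shows "vs2.finite_span (f ` V)"
proof -
  from assms(2) obtain B where B: "finite B" "V \<subseteq> vs1.span B" by (auto simp: vs1.finite_span_def)
  then have "f ` V \<subseteq> vs2.span (f ` B)" using linear_span_image[OF assms(1), of B] by blast
  with B show ?thesis by (auto intro: vs2.finite_spanI[of "f ` B"])
qed

lemma rank_nullity: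
  assumes f: "Vector_Spaces.linear s1 s2 f" and V: "vs1.finite_span V" "vs1.subspace V"
  shows "vs1.dim V = vs2.dim (f ` V) + vs1.dim {x\<in>V. f x = 0}"
proof -
  interpret Vector_Spaces.linear s1 s2 f by fact
  define K where "K = {x\<in>V. f x = 0}"
  have K: "vs1.finite_span K" using vs1.finite_span_mono[OF V(1)] by (auto simp: K_def)
  have sK: "vs1.subspace K" using V(2) unfolding K_def vs1.subspace_def
    by (auto simp: add scale)
  obtain B where B: "finite B" "B \<subseteq> K" "vs1.independent B" "K \<subseteq> vs1.span B" "card B = vs1.dim K"
    using vs1.finite_span_basis[OF K] by metis
  obtain C where C: "B \<subseteq> C" "C \<subseteq> V" "vs1.independent C" "V \<subseteq> vs1.span C"
    using vs1.maximal_independent_subset_extend[of B V] B by (auto simp: K_def)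
  have finC: "finite C" using vs1.finite_span_independent[OF V(1)] C by auto
  have dimV: "vs1.dim V = card C" using C vs1.basis_card_eq_dim by metis
  define D where "D = C - B"
  have sD: "vs1.span D \<subseteq> V" using C V(2) vs1.span_minimal[of D V] by (auto simp: D_def)
  \<comment> \<open>The coordinates of \<open>x\<close> with respect to \<open>C\<close> are
    supported in \<open>B\<close>, because \<open>x\<close> is in the kernel, and also in
    \<open>D\<close>; hence they vanish.\<close>
  have ker: "x = 0" if x: "x \<in> vs1.span D" "f x = 0" for x
  proof -
    have "x \<in> K" using x sD by (auto simp: K_def)
    then have xB: "x \<in> vs1.span B" using B by auto
    have "vs1.representation C x b = 0" for b
      using vs1.representation_extend[OF C(3) xB C(1)] vs1.representation_extend[OF C(3) x(1), unfolded D_def]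
        vs1.representation_ne_zero[of B x b] vs1.representation_ne_zero[of "C-B" x b]
      by (metis Diff_iff Diff_subset D_def)
    moreover have "x \<in> vs1.span C" using xB C vs1.span_mono by blast
    ultimately show ?thesis using vs1.sum_representation_eq[OF C(3) _ finC order_refl, of x] by simp
  qed
  have inj: "inj_on f (vs1.span D)"
    by (rule inj_onI) (metis ker diff eq_iff_diff_eq_0 vs1.span_diff)
  have indD: "vs1.independent D" using C vs1.independent_mono by (auto simp: D_def)
  have "vs2.independent (f ` D)" using linear_independent_injective_image f inj indD
    by (simp add: independent_injective_image)
  moreover have "f ` V \<subseteq> vs2.span (f ` D)"
  proof (rule image_subsetI)
    fix x assume "x \<in> V"
    then have "x \<in> vs1.span (B \<union> D)" using C by (auto simp: D_def Un_absorb1)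
    then obtain y z where yz: "x = y + z" "y \<in> vs1.span B" "z \<in> vs1.span D"
      using vs1.span_Un by auto
    have "y \<in> K" using yz B sK vs1.span_minimal by blast
    then have "f x = f z" using yz by (simp add: add K_def)
    then show "f x \<in> vs2.span (f ` D)" using yz linear_span_image[OF f, of D] by auto
  qed
  moreover have "f ` D \<subseteq> f ` V" using C by (auto simp: D_def)
  ultimately have "vs2.dim (f ` V) = card (f ` D)" using vs2.basis_card_eq_dim by metis
  also have "\<dots> = card D" using inj vs1.span_superset by (metis card_image inj_on_subset)
  finally have "vs2.dim (f ` V) = card C - card B" using B(1) C(1) by (simp add: D_def card_Diff_subset)
  moreover have "card B \<le> card C" using C(1) finC by (rule card_mono[rotated])
  ultimately show ?thesis using dimV B(5) unfolding K_def[symmetric] by linarith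
qed

lemma dim_image_le_finite_span:
  assumes "Vector_Spaces.linear s1 s2 f" "vs1.finite_span V" "vs1.subspace V"
  shows "vs2.dim (f ` V) \<le> vs1.dim V"
  using rank_nullity[OF assms] by simp

lemma dim_image_eq_finite_span:
  assumes "Vector_Spaces.linear s1 s2 f" "vs1.finite_span V" "vs1.subspace V" "\<And>x. x \<in> V \<Longrightarrow> f x = 0 \<Longrightarrow> x = 0"
  shows "vs2.dim (f ` V) = vs1.dim V"
proof -
  have "{x\<in>V. f x = 0} = {0}" using assms vs1.subspace_0 linear_0 by auto
  then show ?thesis using rank_nullity[OF assms(1-3)] by simp
qed

end

text \<open>In the applications \<open>R\<close> is the connecting relation of a zigzag.\<close>

lemma (in k_space_pair) spanned_mod_relation:
  assumes b: "vs1.spanned_mod V' W' b"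
    and add: "\<And>x' x y' y. R x' x \<Longrightarrow> R y' y \<Longrightarrow> R (x' + y') (x + y)"
    and scale: "\<And>c x' x. R x' x \<Longrightarrow> R (s1 c x') (s2 c x)"
    and tot: "\<And>x'. x' \<in> V' \<Longrightarrow> \<exists>x\<in>V. R x' x"
    and sur: "\<And>x. x \<in> V \<Longrightarrow> \<exists>x'\<in>V'. R x' x"
    and ker: "\<And>x' x. R x' x \<Longrightarrow> x' \<in> W' \<Longrightarrow> x \<in> W"
  shows "vs2.spanned_mod V W b"
proof -
  obtain S where S: "finite S" "card S \<le> b" "S \<subseteq> V'" "\<And>x. x \<in> V' \<Longrightarrow> \<exists>s\<in>vs1.span S. x - s \<in> W'"
    using b unfolding vs1.spanned_mod_def by blast
  obtain g where g: "\<And>s. s \<in> S \<Longrightarrow> g s \<in> V \<and> R s (g s)" using tot S(3) by (metis subsetD)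
  \<comment> \<open>As soon as some pair is related, scaling it by 0 relates 0 to 0; this starts the
    induction over the span.\<close>
  have span: "\<exists>t\<in>vs2.span (g ` S). R s t" if s: "s \<in> vs1.span S" and ne: "\<exists>x' x. R x' x" for s
    using s
  proof (induction rule: vs1.span_induct_alt)
    case base
    from ne obtain x' x where "R x' x" by auto
    then have "R 0 0" using scale[of x' x 0] by simp
    then show ?case using vs2.span_zero by blast
  next
    case (step c x y)
    then obtain t where "t \<in> vs2.span (g ` S)" "R y t" by auto
    moreover have "R (s1 c x) (s2 c (g x))" using g scale step by blast
    ultimately show ?case using add step(1) 
      by (intro bexI[of _ "s2 c (g x) + t"] vs2.span_add vs2.span_scale) (auto intro: vs2.span_base)
  qed
  have "\<exists>t\<in>vs2.span (g ` S). x - t \<in> W" if x: "x \<in> V" for x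
  proof -
    obtain x' where x': "x' \<in> V'" "R x' x" using sur x by blast
    then obtain s where s: "s \<in> vs1.span S" "x' - s \<in> W'" using S by blast
    obtain t where t: "t \<in> vs2.span (g ` S)" "R s t" using span[OF s(1)] x'(2) by blast
    have "R (x' + s1 (-1) s) (x + s2 (-1) t)" using add scale x' t by blast
    then have "x - t \<in> W" using ker s by simp
    then show ?thesis using t by blast
  qed
  then show ?thesis using S g card_image_le[of S g] unfolding vs2.spanned_mod_def
    by (intro exI[of _ "g ` S"]) auto
qed

section \<open>The two-variable Tate complex\<close>

text \<open>The differential out of degree \<open>m\<close> of the two-periodic complex of
  \<open>u\<close>; only degrees m > 0 occur in the complex below.\<close>

definition alt_op :: "('b \<Rightarrow> 'b) \<Rightarrow> nat \<Rightarrow> nat \<Rightarrow> 'b \<Rightarrow> 'b" where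
  "alt_op u p m = (if odd m then u else u ^^ (p - 1))"

text \<open>The degree \<open>i\<close> part of the complex has the basis \<open>e\<^sub>a\<^sub>,\<^sub>b\<close> with \<open>a + b = i\<close>;
  a chain is written as the family of its coefficients, indexed by \<open>a \<le> i\<close>.\<close>

definition tate :: "('b \<Rightarrow> 'b) \<Rightarrow> ('b \<Rightarrow> 'b) \<Rightarrow> nat \<Rightarrow> nat \<Rightarrow> (nat \<Rightarrow> 'b::ab_group_add) \<Rightarrow> nat \<Rightarrow> 'b" where
  "tate u v p i z = (\<lambda>a. if a < i then alt_op u p (a + 1) (z (a + 1)) +
     (if even a then alt_op v p (i - a) (z a) else - alt_op v p (i - a) (z a)) else 0)"

definition chains :: "'b::zero set \<Rightarrow> nat \<Rightarrow> (nat \<Rightarrow> 'b) set" where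
  "chains S i = {z. (\<forall>a\<le>i. z a \<in> S) \<and> (\<forall>a>i. z a = 0)}"

lemma sum_fun_apply: "(\<Sum>l\<in>L. f l) a = (\<Sum>l\<in>L. f l a)"
  for f :: "'l \<Rightarrow> 'a \<Rightarrow> 'b::comm_monoid_add"
  by (induction L rule: infinite_finite_induct) auto

text \<open>The inverse of the Vandermonde matrix of \<open>L\<close>. For i < card L the polynomial
  X^i equals its Lagrange interpolation, the sum of l^i \<open>q l\<close>; comparing coefficients
  at X^m shows that \<open>c l\<close> can be the coefficient of \<open>q l\<close> at X^m.\<close>

lemma lagrange_coefficients:
  fixes L :: "'l::field set"
  assumes "finite L" "m < card L"
  shows "\<exists>c. \<forall>i<card L. (\<Sum>l\<in>L. c l * l ^ i) = (if i = m then 1 else 0)"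
proof -
  define q where "q l = (\<Prod>r\<in>L - {l}. Polynomial.smult (1 / (l - r)) [:- r, 1:])" for l
  have deg: "Polynomial.degree (q l) < card L" if "l \<in> L" for l
  proof -
    have "Polynomial.degree (q l) \<le> (\<Sum>r\<in>L - {l}. Polynomial.degree (Polynomial.smult (1 / (l - r)) [:- r, 1:]))"
      unfolding q_def using degree_prod_sum_le[of "L - {l}" "\<lambda>r. Polynomial.smult (1 / (l - r)) [:- r, 1:]"] assms
      by (simp only: o_def finite_Diff)
    also have "\<dots> \<le> (\<Sum>r\<in>L - {l}. 1)"
    proof (rule sum_mono)
      show "Polynomial.degree (Polynomial.smult (1 / (l - r)) [:- r, 1:]) \<le> 1" for r
        using Polynomial.degree_smult_le[of "1 / (l - r)" "[:- r, 1:]"] by simp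
    qed
    also have "\<dots> < card L" using assms that by (auto simp: card_gt_0_iff)
    finally show ?thesis .
  qed
  have eval_gens: "poly (q l) r = (if l = r then 1 else 0)" if "l \<in> L" "r \<in> L" for l r
  proof (cases "l = r")
    case True
    have "poly (Polynomial.smult (1 / (l - x)) [:- x, 1:]) r = 1" if "x \<in> L - {l}" for x
    proof -
      have "l - x \<noteq> 0" using that by auto
      moreover have "poly (Polynomial.smult (1 / (l - x)) [:- x, 1:]) r = (1 / (l - x)) * (l - x)"
        using True by (simp only: poly_smult poly_pCons poly_0) (simp del: times_divide_eq_left)
      ultimately show ?thesis by simp
    qed
    then have "(\<Prod>x\<in>L - {l}. poly (Polynomial.smult (1 / (l - x)) [:- x, 1:]) r) = 1" by (rule prod.neutral[OF ballI])
    then show ?thesis using True by (simp add: q_def poly_prod del: poly_smult poly_pCons)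
  next
    case False
    have "poly (q l) r = (\<Prod>x\<in>L - {l}. poly (Polynomial.smult (1 / (l - x)) [:- x, 1:]) r)"
      by (simp only: q_def poly_prod)
    also have "\<dots> = 0" using that assms False by (intro prod_zero bexI[of _ r]) auto
    finally show ?thesis using False by simp
  qed
  have eq: "(\<Sum>l\<in>L. Polynomial.smult (l ^ i) (q l)) = Polynomial.monom 1 i" if i: "i < card L" for i
  proof (rule poly_eqI_degree[where A = L])
    show "poly (\<Sum>l\<in>L. Polynomial.smult (l ^ i) (q l)) x = poly (Polynomial.monom 1 i) x" if "x \<in> L" for x
    proof -
      have "poly (\<Sum>l\<in>L. Polynomial.smult (l ^ i) (q l)) x = (\<Sum>l\<in>L. l ^ i * (if l = x then 1 else 0))"
        using eval_gens that by (simp add: poly_sum)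
      also have "\<dots> = (\<Sum>l\<in>L. if l = x then l ^ i else 0)" by (intro sum.cong) auto
      also have "\<dots> = x ^ i" using that assms(1) by (simp add: sum.delta)
      finally show ?thesis by (simp add: poly_monom)
    qed
    have "Polynomial.degree (\<Sum>l\<in>L. Polynomial.smult (l ^ i) (q l)) \<le> card L - 1"
    proof (intro degree_sum_le assms order_trans[OF Polynomial.degree_smult_le])
      show "Polynomial.degree (q l) \<le> card L - 1" if "l \<in> L" for l using deg[OF that] by simp
    qed
    then show "Polynomial.degree (\<Sum>l\<in>L. Polynomial.smult (l ^ i) (q l)) < card L" using i by linarith
    show "Polynomial.degree (Polynomial.monom (1::'l) i) < card L" using i by (simp add: degree_monom_eq)
  qed
  have "(\<Sum>l\<in>L. poly.coeff (q l) m * l ^ i) = (if i = m then 1 else 0)" if "i < card L" for i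
  proof -
    have "(\<Sum>l\<in>L. poly.coeff (q l) m * l ^ i) = (\<Sum>l\<in>L. poly.coeff (Polynomial.smult (l ^ i) (q l)) m)"
      by (rule sum.cong) (auto simp: mult.commute)
    also have "\<dots> = poly.coeff (\<Sum>l\<in>L. Polynomial.smult (l ^ i) (q l)) m" by (simp only: coeff_sum)
    finally have "(\<Sum>l\<in>L. poly.coeff (q l) m * l ^ i) = poly.coeff (\<Sum>l\<in>L. Polynomial.smult (l ^ i) (q l)) m" .
    then show ?thesis using eq[OF that] by simp
  qed
  then show ?thesis by (intro exI[of _ "\<lambda>l. poly.coeff (q l) m"]) auto
qed

context k_space begin

abbreviation fscale :: "'k \<Rightarrow> ('i \<Rightarrow> 'b) \<Rightarrow> 'i \<Rightarrow> 'b" where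
  "fscale c z \<equiv> \<lambda>a. c *k z a"

lemma k_space_fun: "k_space (fscale :: 'k \<Rightarrow> ('i \<Rightarrow> 'b) \<Rightarrow> _)"
  by unfold_locales (auto simp: fun_eq_iff scale_right_distrib scale_left_distrib)

lemma k_space_self: "k_space scale" by unfold_locales

end

text \<open>\<open>S\<close> stands for E, or for E over the algebraic closure. Commutation is
  required on the whole type, because the action of k[U][V] introduced later is defined there, while
  nilpotency is required only on \<open>S\<close>.\<close>

locale tate_ops = k_space scale
  for scale :: "'k::field \<Rightarrow> 'b::ab_group_add \<Rightarrow> 'b" (infixr "*k" 75) +
  fixes S :: "'b set" and u v :: "'b \<Rightarrow> 'b" and p :: nat
  assumes subS: "subspace S" and finS: "finite_span S"
    and lu: "Vector_Spaces.linear scale scale u" and lv: "Vector_Spaces.linear scale scale v"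
    and uS: "x \<in> S \<Longrightarrow> u x \<in> S" and vS: "x \<in> S \<Longrightarrow> v x \<in> S"
    and uv: "u (v x) = v (u x)"
    and u0: "x \<in> S \<Longrightarrow> (u ^^ p) x = 0" and v0: "x \<in> S \<Longrightarrow> (v ^^ p) x = 0"
    and p2: "p \<ge> 2"
begin

sublocale F: k_space "fscale :: 'k \<Rightarrow> (nat \<Rightarrow> 'b) \<Rightarrow> nat \<Rightarrow> 'b" by (rule k_space_fun)
sublocale FF: k_space_pair "fscale :: 'k \<Rightarrow> (nat \<Rightarrow> 'b) \<Rightarrow> nat \<Rightarrow> 'b" "fscale :: 'k \<Rightarrow> (nat \<Rightarrow> 'b) \<Rightarrow> nat \<Rightarrow> 'b"
  by unfold_locales
sublocale BB: k_space_pair scale scale by unfold_locales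
sublocale FB: k_space_pair "fscale :: 'k \<Rightarrow> (nat \<Rightarrow> 'b) \<Rightarrow> nat \<Rightarrow> 'b" scale by unfold_locales
sublocale BF: k_space_pair scale "fscale :: 'k \<Rightarrow> (nat \<Rightarrow> 'b) \<Rightarrow> nat \<Rightarrow> 'b" by unfold_locales

lemma linear_iff': "Vector_Spaces.linear scale scale f \<longleftrightarrow> (\<forall>x y. f (x + y) = f x + f y) \<and> (\<forall>c x. f (c *k x) = c *k f x)"
  using vector_space_axioms by (auto simp: Vector_Spaces.linear_iff)

lemma linear_iffF: "Vector_Spaces.linear fscale fscale f \<longleftrightarrow>
   (\<forall>x y. f (x + y) = f x + f y) \<and> (\<forall>c x. f (fscale c x) = fscale c (f x))"
  for f :: "(nat \<Rightarrow> 'b) \<Rightarrow> nat \<Rightarrow> 'b"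
  using F.vector_space_axioms by (auto simp: Vector_Spaces.linear_iff)

lemma linear_funpow: "Vector_Spaces.linear scale scale f \<Longrightarrow> Vector_Spaces.linear scale scale (f ^^ m)"
  by (induction m) (auto simp: linear_iff')

lemma S_funpow: "x \<in> S \<Longrightarrow> (u ^^ m) x \<in> S" "x \<in> S \<Longrightarrow> (v ^^ m) x \<in> S"
  by (induction m) (auto simp: uS vS)

lemma linear_alt: "Vector_Spaces.linear scale scale (alt_op u p m)" "Vector_Spaces.linear scale scale (alt_op v p m)"
  using linear_funpow lu lv by (auto simp: alt_op_def)

lemma subspace_chains: "F.subspace (chains S i)"
  using subS by (auto simp: F.subspace_def subspace_def chains_def)

lemma dim_chains: "F.finite_span (chains S i) \<and> F.dim (chains S i) = (i + 1) * dim S"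
proof (induction i)
  define e where "e i = (\<lambda>x. (\<lambda>a. if a = i then x else 0) :: nat \<Rightarrow> 'b)" for i :: nat
  have emb: "Vector_Spaces.linear scale fscale (e i)" for i :: nat
    using vector_space_axioms F.vector_space_axioms by (auto simp: Vector_Spaces.linear_iff fun_eq_iff e_def)
  have "x = 0" if "e i x = 0" for i x using fun_cong[OF that, of i] by (simp add: e_def)
  then have dim_e: "F.finite_span (e i ` S) \<and> F.dim (e i ` S) = dim S" for i
    using BF.finite_span_image[OF emb finS] BF.dim_image_eq_finite_span[OF emb finS subS] by metis
  {
    case 0
    have "chains S 0 = e 0 ` S"
    proof (intro Set.set_eqI iffI)
      fix z :: "nat \<Rightarrow> 'b" assume "z \<in> chains S 0"
      then have "z = e 0 (z 0)" "z 0 \<in> S" by (auto simp: chains_def e_def)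
      then show "z \<in> e 0 ` S" by blast
    qed (auto simp: chains_def e_def)
    then show ?case using dim_e by simp
  next
    case (Suc i)
    have fin: "F.finite_span (chains S (Suc i))"
    proof (rule F.dim_le_sum_dim(2)[where T = "{True, False}" and S = "\<lambda>t. if t then chains S i else e (Suc i) ` S"])
      show "F.finite_span (if t then chains S i else e (Suc i) ` S)" for t using Suc dim_e by simp
      show "\<exists>f. (\<forall>t\<in>{True,False}. f t \<in> (if t then chains S i else e (Suc i) ` S)) \<and> z = (\<Sum>t\<in>{True,False}. f t)"
        if "z \<in> chains S (Suc i)" for z
        using that by (intro exI[of _ "\<lambda>t. if t then z(Suc i := 0) else e (Suc i) (z (Suc i))"])
          (auto simp: chains_def e_def fun_eq_iff)
    qed simp
    have lin: "Vector_Spaces.linear fscale scale (\<lambda>z :: nat \<Rightarrow> 'b. z (Suc i))"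
      using vector_space_axioms F.vector_space_axioms by (auto simp: Vector_Spaces.linear_iff)
    have "(\<lambda>z. z (Suc i)) ` chains S (Suc i) = S"
    proof (intro Set.set_eqI iffI)
      fix x assume "x \<in> S"
      then show "x \<in> (\<lambda>z. z (Suc i)) ` chains S (Suc i)"
        using subspace_0[OF subS] by (intro image_eqI[of _ _ "e (Suc i) x"]) (auto simp: e_def chains_def)
    qed (auto simp: chains_def)
    moreover have "{z \<in> chains S (Suc i). z (Suc i) = 0} = chains S i"
      using subspace_0[OF subS] by (auto simp: chains_def le_Suc_eq) (metis Suc_lessI)
    ultimately show ?case using FB.rank_nullity[OF lin fin subspace_chains] fin Suc by simp
  }
qed

lemma linear_tate: "Vector_Spaces.linear fscale fscale (tate u v p i)"
  using linear_alt unfolding linear_iffF linear_iff' by (auto simp: tate_def fun_eq_iff scale_right_distrib)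

text \<open>For a scalar \<open>l\<close>, the elements of the degree \<open>i\<close> part whose coefficients at
  \<open>e\<^sub>2\<^sub>m\<^sub>+\<^sub>r\<^sub>,\<^sub>b\<close> are \<open>l\<^sup>m\<close> times a fixed \<open>z r\<close>, for \<open>r = 0, 1\<close>, form a two-periodic subcomplex
  with differential \<open>pencil l i\<close>, a matrix factorization of \<open>l u\<^sup>p + v\<^sup>p\<close>.\<close>

definition geom :: "'k \<Rightarrow> nat \<Rightarrow> (nat \<Rightarrow> 'b) \<Rightarrow> nat \<Rightarrow> 'b" where
  "geom l i z = (\<lambda>a. if a \<le> i then l ^ (a div 2) *k z (a mod 2) else 0)"

definition pencil :: "'k \<Rightarrow> bool \<Rightarrow> (nat \<Rightarrow> 'b) \<Rightarrow> nat \<Rightarrow> 'b" where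
  "pencil l od z = (\<lambda>a. if a = 0 then u (z 1) + (if od then v else v ^^ (p - 1)) (z 0)
     else if a = 1 then l *k (u ^^ (p - 1)) (z 0) - (if od then v ^^ (p - 1) else v) (z 1) else 0)"

lemma op_scale: "u (c *k x) = c *k u x" "v (c *k x) = c *k v x" "(u ^^ m) (c *k x) = c *k (u ^^ m) x"
  "(v ^^ m) (c *k x) = c *k (v ^^ m) x"
  using lu lv linear_funpow[OF lu] linear_funpow[OF lv] by (auto simp: linear_iff')

lemma op_add: "u (x + y) = u x + u y" "v (x + y) = v x + v y" "(u ^^ m) (x + y) = (u ^^ m) x + (u ^^ m) y"
  "(v ^^ m) (x + y) = (v ^^ m) x + (v ^^ m) y"
  using lu lv linear_funpow[OF lu] linear_funpow[OF lv] by (auto simp: linear_iff')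

lemma linear_pencil: "Vector_Spaces.linear fscale fscale (pencil l od)"
  unfolding linear_iffF
  by (auto simp: pencil_def fun_eq_iff op_scale op_add scale_right_distrib scale_right_diff_distrib mult.commute)

lemma linear_geom: "Vector_Spaces.linear fscale fscale (geom l i)"
  unfolding linear_iffF by (auto simp: geom_def fun_eq_iff scale_right_distrib mult.commute)

lemma tate_geom:
  assumes "i \<ge> 1"
  shows "tate u v p i (geom l i z) = geom l (i - 1) (pencil l (odd i) z)"
proof
  fix a
  show "tate u v p i (geom l i z) a = geom l (i - 1) (pencil l (odd i) z) a"
  proof (cases "a < i")
    case True
    show ?thesis
    proof (cases "even a")
      case True
      then show ?thesis using \<open>a < i\<close> assms
        by (auto simp: tate_def geom_def pencil_def alt_op_def op_scale scale_right_distrib)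
    next
      case False
      \<comment> \<open>The index a + 1 belongs to the next pair of coefficients. This is where the
        extra factor \<open>l\<close> in the second row of \<open>pencil\<close> comes from.\<close>
      then have "Suc a div 2 = Suc (a div 2)" "a mod 2 = 1" "Suc a mod 2 = 0" by presburger+
      moreover have "a \<le> i - 1" using \<open>a < i\<close> by simp
      ultimately show ?thesis using False \<open>a < i\<close> assms
        by (cases "odd i") (simp_all add: tate_def geom_def pencil_def alt_op_def op_scale
          scale_right_diff_distrib power_Suc2 del: power_Suc)
    qed
  next
    case False
    then show ?thesis using assms by (auto simp: tate_def geom_def)
  qed
qed

text \<open>There are i div 2 + 1 pairs of indices 2 m, 2 m + 1 up to \<open>i\<close> and as many
  scalars, so the Vandermonde matrix is square and invertible. The coefficient of \<open>z\<close>
  at 2 m + r is distributed over the geometric sequences by its inverse. For even \<open>i\<close>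
  the last pair is incomplete, which \<open>geom\<close> respects by its cut at
  \<open>i\<close>.\<close>

lemma chains_geom_sum:
  assumes L: "finite L" "card L = i div 2 + 1" and z: "z \<in> chains S i"
  shows "\<exists>y. (\<forall>l\<in>L. y l \<in> chains S 1) \<and> z = (\<Sum>l\<in>L. geom l i (y l))"
proof -
  have "\<forall>m. \<exists>c. m < card L \<longrightarrow> (\<forall>i<card L. (\<Sum>l\<in>L. c l * l ^ i) = (if i = m then 1 else 0))"
    using lagrange_coefficients[OF L(1)] by blast
  then obtain c where c: "\<And>m i. m < card L \<Longrightarrow> i < card L \<Longrightarrow> (\<Sum>l\<in>L. c m l * l ^ i) = (if i = m then 1 else 0)"
    by metis
  define y where "y l = (\<lambda>r. if r \<le> 1 then \<Sum>m<card L. c m l *k z (2 * m + r) else 0)" for l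
  have zS: "z a \<in> S" for a using z subspace_0[OF subS] by (cases "a \<le> i") (auto simp: chains_def)
  have "z a = (\<Sum>l\<in>L. geom l i (y l)) a" for a
  proof (cases "a \<le> i")
    case True
    then have a: "a div 2 < card L" using L(2) div_le_mono[of a i 2] by linarith
    have "(\<Sum>l\<in>L. geom l i (y l)) a = (\<Sum>l\<in>L. \<Sum>m<card L. (l ^ (a div 2) * c m l) *k z (2 * m + a mod 2))"
      using True by (auto simp: geom_def y_def scale_sum_right sum_fun_apply intro!: sum.cong)
    also have "\<dots> = (\<Sum>m<card L. (\<Sum>l\<in>L. c m l * l ^ (a div 2)) *k z (2 * m + a mod 2))"
      by (subst sum.swap) (simp add: scale_sum_left mult.commute)
    also have "\<dots> = (\<Sum>m<card L. (if m = a div 2 then z (2 * m + a mod 2) else 0))"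
      using c a by (intro sum.cong) auto
    also have "\<dots> = z a" using a by simp
    finally show ?thesis by simp
  qed (use z in \<open>auto simp: chains_def geom_def sum_fun_apply\<close>)
  moreover have "y l \<in> chains S 1" for l
    using subS zS by (auto simp: chains_def y_def intro!: subspace_sum subspace_scale)
  ultimately show ?thesis by (intro exI[of _ y]) (auto simp: fun_eq_iff)
qed

text \<open>By \<open>tate_geom\<close> the differential acts on each geometric summand through the
  pencil of its scalar, so the rank is subadditive over the summands.\<close>

lemma dim_tate_image_le:
  assumes "i \<ge> 1" "finite L" "card L = i div 2 + 1"
  shows "F.dim (tate u v p i ` chains S i) \<le> (\<Sum>l\<in>L. F.dim (pencil l (odd i) ` chains S 1))"
proof -
  have fin: "F.finite_span (pencil l b ` chains S 1)" for l b
    using FF.finite_span_image[OF linear_pencil] dim_chains by blast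
  have sub: "F.subspace (pencil l b ` chains S 1)" for l b
    using FF.linear_subspace_image[OF linear_pencil subspace_chains] .
  have "F.dim (tate u v p i ` chains S i) \<le> (\<Sum>l\<in>L. F.dim (geom l (i - 1) ` pencil l (odd i) ` chains S 1))"
  proof (rule F.dim_le_sum_dim(1)[OF assms(2)])
    show "F.finite_span (geom l (i - 1) ` pencil l (odd i) ` chains S 1)" for l
      using FF.finite_span_image[OF linear_geom fin] .
    fix x assume "x \<in> tate u v p i ` chains S i"
    then obtain z where z: "z \<in> chains S i" "x = tate u v p i z" by auto
    then obtain y where y: "\<forall>l\<in>L. y l \<in> chains S 1" "z = (\<Sum>l\<in>L. geom l i (y l))"
      using chains_geom_sum[OF assms(2,3)] by blast
    have "x = (\<Sum>l\<in>L. tate u v p i (geom l i (y l)))"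
      using z y FF.linear_sum[OF linear_tate] by simp
    then show "\<exists>f. (\<forall>l\<in>L. f l \<in> geom l (i - 1) ` pencil l (odd i) ` chains S 1) \<and> x = (\<Sum>l\<in>L. f l)"
      using y(1) tate_geom[OF assms(1)] by (intro exI[of _ "\<lambda>l. tate u v p i (geom l i (y l))"]) auto
  qed
  also have "\<dots> \<le> (\<Sum>l\<in>L. F.dim (pencil l (odd i) ` chains S 1))"
    by (intro sum_mono FF.dim_image_le_finite_span linear_geom fin sub)
  finally show ?thesis .
qed

text \<open>Summing over too many bad scalars contradicts the boundedness of the homology.\<close>

lemma finite_bad_scalars:
  assumes b: "\<And>i. i \<ge> 1 \<Longrightarrow> (i + 1) * dim S \<le> F.dim (tate u v p i ` chains S i) +
      F.dim (tate u v p (i + 1) ` chains S (i + 1)) + b"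
  shows "finite {l. F.dim (pencil l True ` chains S 1) + F.dim (pencil l False ` chains S 1) < 2 * dim S}"
    (is "finite ?B")
proof (rule ccontr)
  assume "infinite ?B"
  \<comment> \<open>The degrees 2 s and 2 s + 1 both use s + 1 scalars. If all of these are bad, the
    estimate below amounts to s + 1 \<le> dim S + b, which this \<open>s\<close> violates; it also
    makes the degree 2 s positive.\<close>
  define s where "s = dim S + b + 1"
  obtain L where L: "L \<subseteq> ?B" "finite L" "card L = s + 1"
    using infinite_arbitrarily_large[OF \<open>infinite ?B\<close>] by blast
  define r where "r l od = F.dim (pencil l od ` chains S 1)" for l od
  have "(2 * s + 1) * dim S \<le> (\<Sum>l\<in>L. r l False) + (\<Sum>l\<in>L. r l True) + b"
  proof -
    have s1: "2 * s \<ge> 1" "2 * s + 1 \<ge> 1" "2 * s div 2 + 1 = s + 1" "(2 * s + 1) div 2 + 1 = s + 1"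
      by (auto simp: s_def)
    have "F.dim (tate u v p (2 * s) ` chains S (2 * s)) \<le> (\<Sum>l\<in>L. r l False)"
      using dim_tate_image_le[OF s1(1) L(2)] L(3) s1(3) by (simp add: r_def)
    moreover have "F.dim (tate u v p (2 * s + 1) ` chains S (2 * s + 1)) \<le> (\<Sum>l\<in>L. r l True)"
      using dim_tate_image_le[OF s1(2) L(2)] L(3) s1(4) by (simp add: r_def)
    ultimately show ?thesis using b[OF s1(1)] by linarith
  qed
  also have "(\<Sum>l\<in>L. r l False) + (\<Sum>l\<in>L. r l True) \<le> (\<Sum>l\<in>L. 2 * dim S - 1)"
  proof -
    have "r l False + r l True \<le> 2 * dim S - 1" if "l \<in> L" for l using L(1) that by (auto simp: r_def)
    then have "(\<Sum>l\<in>L. r l False + r l True) \<le> (\<Sum>l\<in>L. 2 * dim S - 1)" by (rule sum_mono)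
    then show ?thesis by (simp only: sum.distrib)
  qed
  finally have *: "(2 * s + 1) * dim S \<le> (s + 1) * (2 * dim S - 1) + b" using L by simp
  show False
  \<comment> \<open>The subtraction \<open>2 * dim S - 1\<close> truncates in this case, but then no
    scalar can be bad.\<close>
  proof (cases "dim S = 0")
    case True
    have "L \<noteq> {}" using L(3) by auto
    then obtain l where "l \<in> L" by blast
    then show False using L(1) True by auto
  next
    case False
    then obtain d where "dim S = Suc d" by (cases "dim S") auto
    with * have "(2 * s + 1) * (d + 1) \<le> (s + 1) * (2 * d + 1) + b" by simp
    then have "2 * s * d + 2 * s + d + 1 \<le> 2 * s * d + 2 * d + s + 1 + b" by (simp add: algebra_simps)
    then show False using \<open>dim S = Suc d\<close> by (simp add: s_def)
  qed
qed

end

section \<open>Actions of polynomial rings\<close>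

text \<open>Horner evaluation at the endomorphism \<open>v\<close>, with coefficients acting through
  \<open>act\<close>. Applied twice, it makes a space with two commuting operators a module over
  k[U][V], so that identities between operators become identities in a commutative ring.\<close>

definition poly_act :: "('r::comm_ring_1 \<Rightarrow> 'b::ab_group_add \<Rightarrow> 'b) \<Rightarrow> ('b \<Rightarrow> 'b) \<Rightarrow> 'r poly \<Rightarrow> 'b \<Rightarrow> 'b" where
  "poly_act act v f = fold_coeffs (\<lambda>a h x. act a x + v (h x)) f (\<lambda>x. 0)"

locale module_endo = Modules.module act
  for act :: "'r::comm_ring_1 \<Rightarrow> 'b::ab_group_add \<Rightarrow> 'b" +
  fixes v :: "'b \<Rightarrow> 'b"
  assumes v_add: "v (x + y) = v x + v y" and v_act: "v (act a x) = act a (v x)"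
begin

lemma v_zero: "v 0 = 0"
  using v_add[of 0 0] by simp

lemma poly_act_0 [simp]: "poly_act act v 0 x = 0"
  by (simp add: poly_act_def)

lemma poly_act_pCons [simp]: "poly_act act v (pCons a f) x = act a x + v (poly_act act v f x)"
  by (cases "a = 0 \<and> f = 0") (auto simp: poly_act_def v_zero)

lemma poly_act_add: "poly_act act v (f + g) x = poly_act act v f x + poly_act act v g x"
proof (induction f arbitrary: g)
  case (pCons a f)
  then show ?case by (cases g) (auto simp: v_add scale_left_distrib)
qed simp

lemma poly_act_add_right: "poly_act act v f (x + y) = poly_act act v f x + poly_act act v f y"
  by (induction f) (auto simp: v_add scale_right_distrib)

lemma poly_act_smult: "poly_act act v (Polynomial.smult a f) x = act a (poly_act act v f x)"
  by (induction f) (auto simp: v_act scale_right_distrib)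

lemma poly_act_mult: "poly_act act v (f * g) x = poly_act act v f (poly_act act v g x)"
  by (induction f) (auto simp: poly_act_add poly_act_smult)

lemma module_poly_act: "Modules.module (poly_act act v)"
proof
  show "poly_act act v 1 x = x" for x
    using poly_act_pCons[of 1 0 x] by (simp add: v_zero one_pCons del: poly_act_pCons)
qed (simp_all add: poly_act_add_right poly_act_add poly_act_mult)

lemma poly_act_commute:
  assumes "\<And>x y. w (x + y) = w x + w y" "\<And>a x. w (act a x) = act a (w x)" "\<And>x. w (v x) = v (w x)"
  shows "w (poly_act act v f x) = poly_act act v f (w x)"
proof (induction f)
  case 0
  then show ?case using assms(1)[of 0 0] by simp
qed (simp add: assms)

lemma poly_act_closed:
  assumes "0 \<in> S" "\<And>x y. x \<in> S \<Longrightarrow> y \<in> S \<Longrightarrow> x + y \<in> S" "\<And>a x. x \<in> S \<Longrightarrow> act a x \<in> S" "\<And>x. x \<in> S \<Longrightarrow> v x \<in> S" "x \<in> S"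
  shows "poly_act act v f x \<in> S"
  by (induction f) (auto simp: assms)

lemma poly_act_X_power: "poly_act act v ([:0, 1:] ^ m) x = (v ^^ m) x"
proof (induction m)
  case 0
  then show ?case using module_poly_act by (simp add: Modules.module_def)
next
  case (Suc m)
  then show ?case by (simp add: poly_act_mult v_zero)
qed

end

text \<open>Homogenization: for a ring homomorphism \<open>h\<close>, the coefficients of the
  product of the X - z are also those of the binary form with linear factors V - h z U. The
  induction multiplies by one more factor and compares shifted sums.\<close>

lemma homogenize_split:
  fixes U V :: "'r::comm_ring_1" and h :: "'k::comm_ring_1 \<Rightarrow> 'r"
  assumes h: "h 0 = 0" "h 1 = 1" "\<And>x y. h (x + y) = h x + h y" "\<And>x y. h (x * y) = h x * h y"
  shows "(\<Prod>z\<in>#Z. V - h z * U) =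
    (\<Sum>i\<le>size Z. h (poly.coeff (\<Prod>z\<in>#Z. [:-z, 1:]) i) * V ^ i * U ^ (size Z - i))"
proof (induction Z)
  case empty
  then show ?case by (simp add: h)
next
  case (add z Z)
  define q where "q = (\<Prod>z\<in>#Z. [:-z, 1:])"
  define n where "n = size Z"
  have "Polynomial.degree (\<Prod>z\<in>#Z. [:-z, 1:]) \<le> size Z" 
  proof (induction Z)
    case (add x Z)
    have "Polynomial.degree (\<Prod>z\<in>#add_mset x Z. [:-z, 1:]) \<le> Polynomial.degree [:-x,1:] + Polynomial.degree (\<Prod>z\<in>#Z. [:-z, 1:])"
      using degree_mult_le[of "[:-x,1:]" "\<Prod>z\<in>#Z. [:-z, 1:]"] by (simp del: mult_pCons_left)
    then show ?case using add by simp
  qed simp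
  then have top: "poly.coeff q (Suc n) = 0" unfolding q_def n_def by (intro coeff_eq_0) simp
  have hneg: "h (- x) = - h x" for x using h(3)[of x "-x"] h(1) by (simp add: add_eq_0_iff)
  have c: "poly.coeff ([:-z, 1:] * q) i = (case i of 0 \<Rightarrow> 0 | Suc j \<Rightarrow> poly.coeff q j) + (- z) * poly.coeff q i" for i
    by (cases i) auto
  have "(\<Sum>i\<le>Suc n. h (poly.coeff ([:-z, 1:] * q) i) * V ^ i * U ^ (Suc n - i)) =
     (\<Sum>i\<le>Suc n. h (case i of 0 \<Rightarrow> 0 | Suc j \<Rightarrow> poly.coeff q j) * V ^ i * U ^ (Suc n - i)) -
     (\<Sum>i\<le>Suc n. h z * (h (poly.coeff q i) * V ^ i * U ^ (Suc n - i)))"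
    unfolding c h(3,4) hneg sum_subtractf[symmetric] by (intro sum.cong) (auto simp: algebra_simps)
  also have "(\<Sum>i\<le>Suc n. h (case i of 0 \<Rightarrow> 0 | Suc j \<Rightarrow> poly.coeff q j) * V ^ i * U ^ (Suc n - i)) =
     V * (\<Sum>i\<le>n. h (poly.coeff q i) * V ^ i * U ^ (n - i))"
    unfolding sum.atMost_Suc_shift by (simp add: h sum_distrib_left algebra_simps)
  also have "(\<Sum>i\<le>Suc n. h z * (h (poly.coeff q i) * V ^ i * U ^ (Suc n - i))) =
     h z * U * (\<Sum>i\<le>n. h (poly.coeff q i) * V ^ i * U ^ (n - i))"
    unfolding sum.atMost_Suc by (simp add: top h sum_distrib_left Suc_diff_le algebra_simps)
  finally show ?case using add by (simp add: q_def n_def algebra_simps del: mult_pCons_left)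
qed

section \<open>Eigenvalues and the generic dimension of a kernel\<close>

context k_space begin

text \<open>Eigenvectors for distinct eigenvalues are independent, and those considered here lie in
  the finite-dimensional \<open>S\<close>, even if \<open>T\<close> does not preserve
  \<open>S\<close>.\<close>

lemma finite_eigenvalues:
  assumes S: "finite_span S" and T: "Vector_Spaces.linear scale scale T"
  shows "finite {e. \<exists>y\<in>S. y \<noteq> 0 \<and> T y = e *k y}"
proof (rule ccontr)
  assume inf: "infinite {e. \<exists>y\<in>S. y \<noteq> 0 \<and> T y = e *k y}"
  interpret Vector_Spaces.linear scale scale T by fact
  obtain E where E: "E \<subseteq> {e. \<exists>y\<in>S. y \<noteq> 0 \<and> T y = e *k y}" "finite E" "card E = dim S + 1"
    using infinite_arbitrarily_large[OF inf] by blast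
  then have "\<forall>e\<in>E. \<exists>y. y \<in> S \<and> y \<noteq> 0 \<and> T y = e *k y" by blast
  then obtain y where y: "\<And>e. e \<in> E \<Longrightarrow> y e \<in> S \<and> y e \<noteq> 0 \<and> T (y e) = e *k y e"
    by (elim bchoice[elim_format]) blast
  have ind: "(\<forall>e\<in>D. c e = 0)" if "D \<subseteq> E" "(\<Sum>e\<in>D. c e *k y e) = 0" for c D
    using finite_subset[OF that(1) E(2)] that
  proof (induction D arbitrary: c rule: finite_induct)
    case (insert d D)
    \<comment> \<open>Applying T - d to the relation removes the term at \<open>d\<close> and
      multiplies the others by the nonzero factors e - d.\<close>
    have "(\<Sum>e\<in>D. (c e * (e - d)) *k y e) = T (\<Sum>e\<in>insert d D. c e *k y e) - d *k (\<Sum>e\<in>insert d D. c e *k y e)"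
    proof -
      have "T (\<Sum>e\<in>insert d D. c e *k y e) - d *k (\<Sum>e\<in>insert d D. c e *k y e) =
          (\<Sum>e\<in>insert d D. c e *k T (y e) - d *k (c e *k y e))"
        by (simp only: sum scale scale_sum_right sum_subtractf)
      also have "\<dots> = (\<Sum>e\<in>insert d D. (c e * (e - d)) *k y e)"
      proof (rule sum.cong)
        fix e assume "e \<in> insert d D"
        then have "T (y e) = e *k y e" using y insert.prems by auto
        then show "c e *k T (y e) - d *k (c e *k y e) = (c e * (e - d)) *k y e"
          by (simp add: scale_left_diff_distrib right_diff_distrib mult.commute[of d])
      qed simp
      also have "\<dots> = (\<Sum>e\<in>D. (c e * (e - d)) *k y e)" using insert.hyps by simp
      finally show ?thesis by simp
    qed
    also have "\<dots> = 0" using insert.prems by simp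
    finally have *: "(\<Sum>e\<in>D. (c e * (e - d)) *k y e) = 0" .
    have "D \<subseteq> E" "d \<in> E" using insert.prems by auto
    have "\<forall>e\<in>D. c e * (e - d) = 0" by (rule insert.IH[OF \<open>D \<subseteq> E\<close> *])
    then have D: "c e = 0" if "e \<in> D" for e using insert.hyps that by (metis eq_iff_diff_eq_0 mult_eq_0_iff)
    then have "(\<Sum>e\<in>D. c e *k y e) = 0" by (intro sum.neutral) simp
    then have "c d *k y d = 0" using insert.prems(2) insert.hyps by simp
    moreover have "y d \<noteq> 0" using y[OF \<open>d \<in> E\<close>] by simp
    ultimately have "c d = 0" by simp
    then show ?case using D by simp
  qed simp
  have inj: "inj_on y E"
  proof (rule inj_onI)
    fix d e assume "d \<in> E" "e \<in> E" "y d = y e"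
    have "d *k y d = T (y d)" "T (y e) = e *k y e" "y e \<noteq> 0"
      using y[OF \<open>d \<in> E\<close>] y[OF \<open>e \<in> E\<close>] by simp_all
    then have "d *k y e = e *k y e" using \<open>y d = y e\<close> by metis
    then show "d = e" using \<open>y e \<noteq> 0\<close> by simp
  qed
  have "independent (y ` E)"
  proof (rule independent_if_scalars_zero)
    fix f x assume *: "(\<Sum>x\<in>y ` E. f x *k x) = 0" "x \<in> y ` E"
    have "(\<Sum>x\<in>y ` E. f x *k x) = (\<Sum>e\<in>E. f (y e) *k y e)"
      using sum.reindex[OF inj, of "\<lambda>x. f x *k x"] by (simp only: o_def)
    then have "(\<Sum>e\<in>E. f (y e) *k y e) = 0" using *(1) by (rule trans[OF sym])
    then have "\<forall>e\<in>E. f (y e) = 0" by (rule ind[OF order_refl])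
    then show "f x = 0" using *(2) by blast
  qed (use E in auto)
  then have "card (y ` E) \<le> dim S" using y by (intro independent_card_le_dim_finite_span S) auto
  then show False using card_image[OF inj] E by simp
qed

end

text \<open>Let \<open>z0\<close> minimize the kernel dimension and let \<open>g\<close> be a right
  inverse of \<open>T z0\<close> on its image. A larger kernel at \<open>z\<close> makes
  \<open>T z\<close> kill some nonzero g y, and then y = (z - z0) u (g y). So 1/(z - z0) is an
  eigenvalue of \<open>u \<circ> g\<close>, and there are only finitely many of those.\<close>

lemma (in k_space) generic_kernel_dim:
  assumes S: "finite_span S" "subspace S"
    and lu: "Vector_Spaces.linear scale scale u" and lv: "Vector_Spaces.linear scale scale v"
    and uS: "\<And>x. x \<in> S \<Longrightarrow> u x \<in> S" and vS: "\<And>x. x \<in> S \<Longrightarrow> v x \<in> S"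
  shows "\<exists>d. finite {z. dim {x\<in>S. v x = z *k u x} \<noteq> d}"
proof -
  interpret P: k_space_pair scale scale by unfold_locales
  define K where "K z = {x\<in>S. v x = z *k u x}" for z
  define T where "T z x = v x - z *k u x" for z x
  have lT: "Vector_Spaces.linear scale scale (T z)" for z
    using lu lv unfolding Vector_Spaces.linear_iff T_def by (auto simp: algebra_simps)
  have rn: "dim S = dim (T z ` S) + dim (K z)" for z
    using P.rank_nullity[OF lT S, of z] by (simp add: K_def T_def)
  define d where "d = (LEAST m. \<exists>z. dim (K z) = m)"
  have "\<exists>m. \<exists>z. dim (K z) = m" by blast
  from LeastI_ex[OF this] obtain z0 where z0: "dim (K z0) = d" unfolding d_def by blast
  have least: "d \<le> dim (K z)" for z unfolding d_def by (intro Least_le) auto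
  obtain g where g: "range g \<subseteq> S" "Vector_Spaces.linear scale scale g" "\<And>w. w \<in> T z0 ` S \<Longrightarrow> T z0 (g w) = w"
    using P.linear_exists_right_inverse_on[OF lT S(2), of z0] by auto
  have TS: "T z x \<in> S" if "x \<in> S" for x z using that S(2) uS vS by (auto simp: T_def subspace_diff subspace_scale)
  have fin0: "finite_span (T z ` S)" and sub0: "subspace (T z ` S)" for z
    using P.finite_span_image[OF lT S(1)] P.linear_subspace_image[OF lT S(2)] by auto
  define W where "W = g ` T z0 ` S"
  have W: "finite_span W" "subspace W" "W \<subseteq> S"
    unfolding W_def using P.finite_span_image[OF g(2) fin0] P.linear_subspace_image[OF g(2) sub0] g(1) by auto
  have dimW: "dim W = dim (T z0 ` S)" unfolding W_def
    using g(3) P.linear_0[OF lT, of z0] by (intro P.dim_image_eq_finite_span[OF g(2) fin0 sub0]) metis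
  define E where "E = {e. \<exists>y\<in>S. y \<noteq> 0 \<and> (u \<circ> g) y = e *k y}"
  have "finite E" unfolding E_def
    by (intro finite_eigenvalues[OF S(1)] Vector_Spaces.linear_compose[OF g(2) lu])
  have "z \<in> (\<lambda>e. z0 + 1 / e) ` E" if "dim (K z) \<noteq> d" for z
  proof -
    have "d < dim (K z)" using least[of z] that by simp
    then have "dim (T z ` S) < dim W" using rn[of z] rn[of z0] z0 dimW by linarith
    moreover have "dim (T z ` W) \<le> dim (T z ` S)" using W(3) by (intro dim_mono_finite_span fin0 image_mono)
    ultimately obtain w where w: "w \<in> W" "T z w = 0" "w \<noteq> 0"
      using P.dim_image_eq_finite_span[OF lT W(1,2)] by (metis leD)
    then obtain y where y: "y \<in> T z0 ` S" "w = g y" by (auto simp: W_def)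
    have "y \<noteq> 0" using y w P.linear_0[OF g(2)] by auto
    have "T z0 w = (z - z0) *k u w" using w(2) by (simp add: T_def algebra_simps)
    then have *: "y = (z - z0) *k u (g y)" using g(3) y by simp
    then have "z \<noteq> z0" using \<open>y \<noteq> 0\<close> by auto
    then have "(1 / (z - z0)) *k ((z - z0) *k u (g y)) = u (g y)" by simp
    then have "u (g y) = (1 / (z - z0)) *k y" using * by simp
    then have "1 / (z - z0) \<in> E" using y TS \<open>y \<noteq> 0\<close> by (auto simp: E_def)
    then show ?thesis by (intro image_eqI[of _ _ "1 / (z - z0)"]) auto
  qed
  then have "{z. dim (K z) \<noteq> d} \<subseteq> (\<lambda>e. z0 + 1 / e) ` E" by blast
  then show ?thesis using \<open>finite E\<close> unfolding K_def by (meson finite_imageI finite_subset)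
qed

section \<open>Divisibility of the dimension\<close>

context tate_ops begin

text \<open>The two maps of the pencil compose to l u^p + v^p, which vanishes on \<open>S\<close>,
  so the image of one lies in the kernel of the other. The rank condition on a good scalar makes the
  dimensions of image and kernel agree.\<close>

lemma pencil_exact:
  assumes good: "\<not> F.dim (pencil l True ` chains S 1) + F.dim (pencil l False ` chains S 1) < 2 * dim S"
    and z: "z \<in> chains S 1" "pencil l True z = 0"
  shows "\<exists>y\<in>chains S 1. z = pencil l False y"
proof -
  define D where "D b = pencil l b ` chains S 1" for b
  define K where "K = {z \<in> chains S 1. pencil l True z = 0}"
  have fin: "F.finite_span (chains S 1)" and dimC: "F.dim (chains S 1) = 2 * dim S"
    using dim_chains[of 1] by auto
  have rn: "2 * dim S = F.dim (D True) + F.dim K"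
    using FF.rank_nullity[OF linear_pencil fin subspace_chains, of l True] dimC by (simp add: D_def K_def)
  have Suc_p: "(u ^^ (p - 1)) (u x) = (u ^^ p) x" "u ((u ^^ (p - 1)) x) = (u ^^ p) x"
    "(v ^^ (p - 1)) (v x) = (v ^^ p) x" "v ((v ^^ (p - 1)) x) = (v ^^ p) x" for x
  proof -
    obtain q where "p = Suc q" using p2 by (cases p) auto
    then show "(u ^^ (p - 1)) (u x) = (u ^^ p) x" "u ((u ^^ (p - 1)) x) = (u ^^ p) x"
      "(v ^^ (p - 1)) (v x) = (v ^^ p) x" "v ((v ^^ (p - 1)) x) = (v ^^ p) x"
      by (simp_all add: funpow_swap1)
  qed
  have uvp: "u ((v ^^ m) x) = (v ^^ m) (u x)" for m x
    by (induction m arbitrary: x) (simp_all add: uv)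
  have vup: "v ((u ^^ m) x) = (u ^^ m) (v x)" for m x
    by (induction m arbitrary: x) (simp_all add: uv[symmetric])
  have upvp: "(u ^^ n) ((v ^^ m) x) = (v ^^ m) ((u ^^ n) x)" for n m x
    by (induction n) (simp_all add: uvp)
  have op_diff: "u (x - y) = u x - u y" "v (x - y) = v x - v y" "(u ^^ m) (x - y) = (u ^^ m) x - (u ^^ m) y"
    "(v ^^ m) (x - y) = (v ^^ m) x - (v ^^ m) y" for x y :: 'b and m :: nat
    by (metis op_add(1) add_diff_cancel_right' diff_add_cancel,
        metis op_add(2) add_diff_cancel_right' diff_add_cancel,
        metis op_add(3) add_diff_cancel_right' diff_add_cancel,
        metis op_add(4) add_diff_cancel_right' diff_add_cancel)
  have closed: "pencil l b z \<in> chains S 1" if "z \<in> chains S 1" for b z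
    using that subS by (auto simp: chains_def pencil_def intro!: subspace_add subspace_diff subspace_scale uS vS S_funpow)
  have "pencil l True (pencil l False y) = 0" if y: "y \<in> chains S 1" for y
  proof -
    have yS: "y 0 \<in> S" "y 1 \<in> S" using y by (auto simp: chains_def)
    have "pencil l True (pencil l False y) a = 0" for a
      using u0[OF yS(1)] u0[OF yS(2)] v0[OF yS(1)] v0[OF yS(2)]
      by (simp add: pencil_def op_add op_diff op_scale Suc_p[simplified] uvp vup upvp uv scale_right_distrib)
    then show ?thesis by (simp add: fun_eq_iff)
  qed
  then have sub: "D False \<subseteq> K" using closed by (auto simp: D_def K_def)
  have "F.finite_span K" using F.finite_span_mono[OF fin] by (auto simp: K_def)
  moreover have "F.subspace (D False)"
    unfolding D_def by (rule FF.linear_subspace_image[OF linear_pencil subspace_chains])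
  moreover have "F.dim K \<le> F.dim (D False)" using rn good by (simp add: D_def)
  ultimately have "D False = K" using sub by (intro F.subspace_eq_if_dim_le)
  moreover have "z \<in> K" using z by (simp add: K_def)
  ultimately show ?thesis by (auto simp: D_def)
qed

sublocale E1: module_endo scale u
  using module_axioms lu unfolding module_endo_def module_endo_axioms_def by (auto simp: linear_iff')

lemma module_act_u: "Modules.module (poly_act scale u)" by (rule E1.module_poly_act)

sublocale E2: module_endo "poly_act scale u" v
  unfolding module_endo_def module_endo_axioms_def
  using module_act_u op_add(2) E1.poly_act_commute[of v] op_scale(2) uv by auto

text \<open>The inner variable acts as \<open>u\<close>, the outer one as \<open>v\<close>. The ring
  is an integral domain, so linear factors can be cancelled in it although they act by operators
  with nontrivial kernel.\<close>

definition act :: "'k poly poly \<Rightarrow> 'b \<Rightarrow> 'b" where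
  "act = poly_act (poly_act scale u) v"

sublocale A: Modules.module act
  unfolding act_def by (rule E2.module_poly_act)

abbreviation pU :: "'k poly poly" where "pU \<equiv> [:[:0, 1:]:]"
abbreviation pV :: "'k poly poly" where "pV \<equiv> [:0, 1:]"
abbreviation pC :: "'k \<Rightarrow> 'k poly poly" where "pC c \<equiv> [:[:c:]:]"

lemma act_mult: "act (f * g) x = act f (act g x)" by (simp add: A.scale_scale)

lemma act_gens: "act pU x = u x" "act pV x = v x" "act (pC c) x = c *k x"
proof -
  show "act pV x = v x" using E2.poly_act_X_power[of 1 x] by (simp add: act_def)
  show "act (pC c) x = c *k x" by (simp add: act_def E1.v_zero E2.v_zero)
  show "act pU x = u x" using E1.poly_act_X_power[of 1 x] by (simp add: act_def E2.v_zero)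
qed

lemma act_power: "act (pU ^ m) x = (u ^^ m) x" "act (pV ^ m) x = (v ^^ m) x"
  by (induction m) (simp_all only: power_0 power_Suc act_mult act_gens A.scale_one funpow.simps id_apply o_apply)

lemma act_S: "x \<in> S \<Longrightarrow> act f x \<in> S"
  unfolding act_def using subS
  by (intro E2.poly_act_closed E1.poly_act_closed) (auto simp: subspace_def uS vS intro!: E1.poly_act_closed)

lemma linear_act: "Vector_Spaces.linear scale scale (act f)"
proof -
  have "act f (c *k x) = c *k act f x" for c x
    by (simp only: act_gens(3)[symmetric] act_mult[symmetric] mult.commute)
  then show ?thesis by (simp add: linear_iff' A.scale_right_distrib)
qed

definition line :: "'k \<Rightarrow> 'k poly poly" where "line z = pV - pC z * pU"
text \<open>The quotient of V^m - (z U)^m by \<open>line z\<close>. For m = p and z^p = c it is the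
  product of the other linear factors of V^p - c U^p.\<close>

definition cof :: "'k \<Rightarrow> nat \<Rightarrow> 'k poly poly" where
  "cof z m = (\<Sum>i<m. (pC z * pU) ^ (m - Suc i) * pV ^ i)"

lemma line_cof: "line z * cof z m = pV ^ m - (pC z * pU) ^ m"
  unfolding line_def cof_def by (rule power_diff_sumr2[symmetric])

lemma cof_Suc: "cof z (Suc m) = pV ^ m + pC z * pU * cof z m"
proof -
  have "(\<Sum>i<m. (pC z * pU) ^ (Suc m - Suc i) * pV ^ i) = (\<Sum>i<m. pC z * pU * ((pC z * pU) ^ (m - Suc i) * pV ^ i))"
    by (intro sum.cong) (auto simp: Suc_diff_Suc[symmetric] mult.assoc simp del: mult_pCons_left mult_pCons_right)
  then show ?thesis by (simp add: cof_def sum_distrib_left del: mult_pCons_left mult_pCons_right)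
qed

lemma act_line: "act (line z) x = v x - z *k u x"
  by (simp only: line_def A.scale_left_diff_distrib act_mult act_gens)

text \<open>An element \<open>x\<close> of the kernel of v - z u gives the cycle (x, - z x) of the
  pencil for l = - z^p. Writing this cycle as a boundary expresses \<open>x\<close> by the cofactor,
  up to u x' with x' in the same kernel.\<close>

lemma line_kernel_step:
  assumes good: "\<not> F.dim (pencil (- (z ^ p)) True ` chains S 1) + F.dim (pencil (- (z ^ p)) False ` chains S 1) < 2 * dim S"
    and x: "x \<in> S" "act (line z) x = 0"
  shows "\<exists>x'\<in>S. act (line z) x' = 0 \<and> (\<exists>y\<in>S. x = u x' + act (cof z p) y)"
proof -
  obtain q where q: "p = Suc q" using p2 by (cases p) auto
  define l where "l = - (z ^ p)"
  define w where "w = (\<lambda>a::nat. if a = 0 then x else if a = 1 then - (z *k x) else 0)"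
  have wC: "w \<in> chains S 1" using x subS by (auto simp: w_def chains_def subspace_neg subspace_scale)
  have vx: "v x = z *k u x" using x(2) by (simp add: act_line)
  have neg: "u (- y) = - u y" "(v ^^ m) (- y) = - (v ^^ m) y" for y m
    using op_scale(1)[of "-1" y] op_scale(4)[of m "-1" y] by simp_all
  have pm: "p - Suc 0 = q" by (simp add: q)
  have zq: "z ^ p = z * z ^ q" by (simp add: q)
  have vmx: "(v ^^ m) x = z ^ m *k (u ^^ m) x" for m
  proof -
    have "act (line z * cof z m) x = 0" using x(2) act_mult[of "cof z m" "line z" x] by (simp add: mult.commute)
    then have "act (pV ^ m) x = act ((pC z * pU) ^ m) x" by (simp only: line_cof A.scale_left_diff_distrib right_minus_eq)
    moreover have "(pC z) ^ m = pC (z ^ m)" for m by (induction m) (simp_all add: one_pCons)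
    ultimately show ?thesis by (simp only: power_mult_distrib act_power act_mult act_gens)
  qed
  have "pencil l True w a = 0" for a
    using vx vmx[of q] by (simp add: pencil_def w_def neg op_scale l_def pm zq)
  then have "pencil l True w = 0" by (simp add: fun_eq_iff)
  then obtain y where y: "y \<in> chains S 1" "w = pencil l False y"
    using pencil_exact[OF good[folded l_def] wC] by blast
  have yS: "y 0 \<in> S" "y 1 \<in> S" using y by (auto simp: chains_def)
  have e0: "x = act (pU) (y 1) + act (pV ^ q) (y 0)"
    using fun_cong[OF y(2), of 0] by (simp only: act_gens act_power) (simp add: w_def pencil_def pm)
  have e1: "- (z *k x) = l *k act (pU ^ q) (y 0) - act pV (y 1)"
    using fun_cong[OF y(2), of 1] by (simp only: act_gens act_power) (simp add: w_def pencil_def pm)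
  \<comment> \<open>By \<open>cof_Suc\<close> the cofactor of degree p is V^q + z U
    \<open>cof z q\<close>. This correction of \<open>y 1\<close> is therefore the one that turns
    the term v^q (y 0) of \<open>e0\<close> into the cofactor applied to \<open>y 0\<close>;
    equation \<open>e1\<close> then says that \<open>line z\<close> kills x'.\<close>
  define x' where "x' = y 1 - act (pC z * cof z q) (y 0)"
  have "act (pC z) x - z *k x = 0" by (simp only: act_gens diff_self)
  have zx: "z *k x = act (pC z * pU) (y 1) + act (pC z * pV ^ q) (y 0)"
    unfolding e0 by (simp only: act_gens(3)[symmetric] act_mult A.scale_right_distrib)
  have lq: "l *k act (pU ^ q) (y 0) = - act (pC z * (pC z * pU) ^ q) (y 0)"
  proof -
    have "pC z * (pC z * pU) ^ q = pC (z ^ p) * pU ^ q" 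
    proof -
      have "(pC z) ^ m = pC (z ^ m)" for m by (induction m) (simp_all add: one_pCons)
      then have "pC (z ^ p) = pC z * pC z ^ q" using zq by simp
      then show ?thesis by (simp only: power_mult_distrib mult.assoc)
    qed
    then show ?thesis by (simp only: l_def act_mult act_gens scale_minus_left)
  qed
  have "act (line z) (y 1) = act (pC z * pV ^ q - pC z * (pC z * pU) ^ q) (y 0)"
    using e1 zx lq unfolding line_def A.scale_left_diff_distrib act_gens act_mult
    by (simp add: algebra_simps)
  also have "pC z * pV ^ q - pC z * (pC z * pU) ^ q = line z * (pC z * cof z q)"
    by (simp only: mult.left_commute[of "line z" "pC z"] line_cof right_diff_distrib)
  finally have "act (line z) x' = 0" by (simp only: x'_def A.scale_right_diff_distrib act_mult diff_self)
  moreover have "x' \<in> S" using yS act_S subS by (auto simp: x'_def intro: subspace_diff)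
  moreover have "x = u x' + act (cof z p) (y 0)"
  proof -
    have "u x' = act pU (y 1) - act (pU * (pC z * cof z q)) (y 0)"
      by (simp only: x'_def act_gens(1)[symmetric] A.scale_right_diff_distrib act_mult)
    moreover have "act (cof z p) (y 0) = act (pV ^ q) (y 0) + act (pU * (pC z * cof z q)) (y 0)"
      unfolding q cof_Suc by (simp only: A.scale_left_distrib mult.assoc mult.left_commute)
    ultimately show ?thesis using e0 by simp
  qed
  ultimately show ?thesis using yS by blast
qed

text \<open>Iterating \<open>line_kernel_step\<close> p times leaves the remainder u^p x', which is
  0. So the kernel of a linear factor lies in the image of its cofactor; this is the exactness that
  makes the kernel dimensions add up.\<close>

lemma line_kernel:
  assumes good: "\<not> F.dim (pencil (- (z ^ p)) True ` chains S 1) + F.dim (pencil (- (z ^ p)) False ` chains S 1) < 2 * dim S"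
    and x: "x \<in> S" "act (line z) x = 0"
  shows "\<exists>y\<in>S. x = act (cof z p) y"
proof -
  have "\<exists>x'\<in>S. act (line z) x' = 0 \<and> (\<exists>y\<in>S. x = (u ^^ m) x' + act (cof z p) y)" for m
  proof (induction m)
    case 0
    then show ?case using x subspace_0[OF subS] by (intro bexI[of _ x] conjI bexI[of _ 0]) auto
  next
    case (Suc m)
    then obtain x' y where *: "x' \<in> S" "act (line z) x' = 0" "y \<in> S" "x = (u ^^ m) x' + act (cof z p) y" by blast
    obtain x'' y' where **: "x'' \<in> S" "act (line z) x'' = 0" "y' \<in> S" "x' = u x'' + act (cof z p) y'"
      using line_kernel_step[OF good *(1,2)] by blast
    have "(u ^^ m) (act (cof z p) y') = act (cof z p) ((u ^^ m) y')"
      by (simp only: act_power[symmetric] act_mult[symmetric] mult.commute)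
    then have "x = (u ^^ Suc m) x'' + act (cof z p) ((u ^^ m) y' + y)"
      using *(4) **(4) by (simp add: op_add A.scale_right_distrib funpow_swap1)
    then show ?case using * ** subS by (metis S_funpow(1) subspace_add)
  qed
  from this[of p] show ?thesis using u0 by auto
qed

end

section \<open>Adding up the kernels over an algebraically closed field\<close>

lemma infinite_UNIV_alg_closed: "infinite (UNIV :: 'k::alg_closed_field set)"
proof
  assume fin: "finite (UNIV :: 'k set)"
  define q :: "'k poly" where "q = (\<Prod>a\<in>UNIV. [:- a, 1:])"
  have deg: "Polynomial.degree q = card (UNIV :: 'k set)"
    unfolding q_def by (subst degree_prod_eq_sum_degree) auto
  have "card (UNIV :: 'k set) > 0" using fin by (simp add: card_gt_0_iff)
  then have "Polynomial.degree (q + [:1:]) > 0" using deg by (subst degree_add_eq_left) auto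
  then obtain x where "poly (q + [:1:]) x = 0" using alg_closed_imp_poly_has_root by blast
  moreover have "poly q x = 0" unfolding q_def poly_prod by (rule prod_zero[OF fin]) (auto intro!: bexI[of _ x])
  ultimately show False by simp
qed

locale tate_ops_closed = tate_ops scale S u v p
  for scale :: "'k::alg_closed_field \<Rightarrow> 'b::ab_group_add \<Rightarrow> 'b" (infixr "*k" 75)
    and S u v p
begin

lemma prod_roots: 
  assumes "Polynomial.monom 1 p - [:c:] = (\<Prod>z\<in>#Z. [:- z, 1:])" "size Z = p"
  shows "(\<Prod>z\<in>#Z. line z) = pV ^ p - pC c * pU ^ p"
proof -
  have "(\<Prod>z\<in>#Z. line z) = (\<Sum>i\<le>p. pC (poly.coeff (Polynomial.monom 1 p - [:c:]) i) * pV ^ i * pU ^ (p - i))"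
  proof -
    have "(\<Prod>z\<in>#Z. pV - pC z * pU) =
        (\<Sum>i\<le>size Z. pC (poly.coeff (\<Prod>z\<in>#Z. [:-z, 1:]) i) * pV ^ i * pU ^ (size Z - i))"
      by (rule homogenize_split) (simp_all add: one_pCons)
    then show ?thesis by (simp only: line_def assms)
  qed
  also have "\<dots> = (\<Sum>i\<in>{0, p}. pC (poly.coeff (Polynomial.monom 1 p - [:c:]) i) * pV ^ i * pU ^ (p - i))"
    using p2 by (intro sum.mono_neutral_right) (auto simp: coeff_pCons split: nat.splits)
  also have "\<dots> = pC (- c) * pU ^ p + pC 1 * pV ^ p"
    using p2 by (simp add: coeff_pCons split: nat.splits)
  finally have *: "(\<Prod>z\<in>#Z. line z) = pC (- c) * pU ^ p + pC 1 * pV ^ p" .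
  have "pC (- c) = - pC c" "pC 1 = 1" by (simp_all add: one_pCons)
  then show ?thesis unfolding * by (simp only: mult_minus_left mult_1_left uminus_add_conv_diff)
qed

theorem dvd_dim:
  assumes b: "\<And>i. i \<ge> 1 \<Longrightarrow> (i + 1) * dim S \<le> F.dim (tate u v p i ` chains S i) +
      F.dim (tate u v p (i + 1) ` chains S (i + 1)) + b"
  shows "p dvd dim S"
proof -
  define B where "B = {l. F.dim (pencil l True ` chains S 1) + F.dim (pencil l False ` chains S 1) < 2 * dim S}"
  have "finite B" using finite_bad_scalars[OF b] by (simp add: B_def)
  define K where "K z = {x\<in>S. v x = z *k u x}" for z
  obtain d where d: "finite {z. dim (K z) \<noteq> d}"
    using generic_kernel_dim[OF finS subS lu lv uS vS] unfolding K_def by blast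
  have "infinite (UNIV :: 'k set)" by (rule infinite_UNIV_alg_closed)
  \<comment> \<open>With - c outside \<open>B\<close>, the scalar - z^p is good for every root z of
    X^p - c. The second set keeps all these roots away from the finitely many z with an exceptional
    kernel dimension.\<close>
  then obtain c where c: "c \<notin> uminus ` B \<union> (\<lambda>z. z ^ p) ` {z. dim (K z) \<noteq> d}"
    using \<open>finite B\<close> d by (metis ex_new_if_finite finite_UnI finite_imageI)
  define q where "q = Polynomial.monom 1 p - [:c:]"
  have degq: "Polynomial.degree q = p"
    using p2 degree_add_eq_left[of "- [:c:]" "Polynomial.monom 1 p"] by (simp add: q_def degree_monom_eq del: minus_pCons)
  have lead: "Polynomial.lead_coeff q = 1" unfolding degq using p2 
    by (simp add: q_def coeff_pCons split: nat.splits)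
  \<comment> \<open>Roots are kept with multiplicity: all p of them coincide if p is the
    characteristic of k.\<close>
  obtain Z where Z: "size Z = p" "q = (\<Prod>z\<in>#Z. [:- z, 1:])"
    using alg_closed_imp_factorization[of q] lead degq by force
  have root: "z ^ p = c" if "z \<in># Z" for z
  proof -
    have "poly q z = 0" unfolding Z(2) poly_prod_mset using that
      by (auto simp: prod_mset_zero_iff image_iff)
    then show ?thesis by (simp add: q_def poly_monom)
  qed
  have Kd: "dim (K z) = d" if "z \<in># Z" for z using root[OF that] c by auto
  have Kline: "K z = {x \<in> S. act (line z) x = 0}" for z by (auto simp: K_def act_line)
  have good: "- (z ^ p) \<notin> B" if "z \<in># Z" for z using root[OF that] c by (force simp: image_iff)
  \<comment> \<open>Multiplied by \<open>line z\<close>, both sides become V^p - c U^p, and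
    \<open>line z\<close> can be cancelled.\<close>
  have cof: "(\<Prod>y\<in>#Z - {#z#}. line y) = cof z p" if z: "z \<in># Z" for z
  proof -
    have "line z \<noteq> 0" by (simp add: line_def)
    have pc: "(pC z) ^ m = pC (z ^ m)" for m by (induction m) (simp_all add: one_pCons)
    have "line z * (\<Prod>y\<in>#Z - {#z#}. line y) = (\<Prod>y\<in>#Z. line y)"
      using z by (metis image_mset_add_mset insert_DiffM prod_mset.add_mset)
    also have "\<dots> = pV ^ p - pC c * pU ^ p" using prod_roots Z by (simp add: q_def)
    also have "\<dots> = line z * cof z p" 
      unfolding line_cof power_mult_distrib pc root[OF z] by simp
    finally show ?thesis using \<open>line z \<noteq> 0\<close> by (metis mult_left_cancel)
  qed
  \<comment> \<open>When a factor at \<open>z\<close> is added, the product \<open>f\<close> of the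
    factors of \<open>M\<close> maps the enlarged kernel \<open>N\<close> onto \<open>K z\<close>,
    and the previous kernel is the kernel of this map. It is onto because \<open>K z\<close> lies in
    the image of the cofactor of \<open>z\<close>, which is \<open>f\<close> times the remaining
    factors.\<close>
  have count: "dim {x\<in>S. act (\<Prod>z\<in>#M. line z) x = 0} = size M * d" if "M \<subseteq># Z" for M
    using that
  proof (induction M)
    case empty
    have "{x\<in>S. act (\<Prod>z\<in>#{#}. line z) x = 0} = {0}" using subspace_0[OF subS] by auto
    then show ?case by simp
  next
    case (add z M)
    define f where "f = act (\<Prod>z\<in>#M. line z)"
    define N where "N = {x\<in>S. act (\<Prod>z\<in>#add_mset z M. line z) x = 0}"
    have fN: "act (\<Prod>z\<in>#add_mset z M. line z) x = act (line z) (f x)" for x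
      by (simp add: f_def A.scale_scale)
    have lf: "Vector_Spaces.linear scale scale f" unfolding f_def by (rule linear_act)
    have N: "finite_span N" "subspace N"
      using finite_span_mono[OF finS, of N] subS linear_act[of "\<Prod>z\<in>#add_mset z M. line z"]
      unfolding N_def subspace_def linear_iff' by auto
    have zZ: "z \<in># Z" using add.prems by (meson insert_subset_eq_iff)
    have im: "f ` N = K z"
    proof (intro equalityI subsetI)
      fix x assume "x \<in> K z"
      then have x: "x \<in> S" "act (line z) x = 0" by (auto simp: Kline)
      obtain y where y: "y \<in> S" "x = act (cof z p) y"
        using line_kernel[OF _ x] good[OF zZ] unfolding B_def by blast
      have "M \<subseteq># Z - {#z#}" using add.prems by (simp add: insert_subset_eq_iff)
      then obtain M' where M': "Z - {#z#} = M + M'" by (auto simp: subset_mset.le_iff_add)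
      have "x = f (act (\<Prod>z\<in>#M'. line z) y)"
        using y cof[OF zZ] unfolding M' f_def by (simp add: A.scale_scale)
      moreover have "act (\<Prod>z\<in>#M'. line z) y \<in> N"
        using x(2) calculation act_S[OF y(1)] fN by (simp add: N_def)
      ultimately show "x \<in> f ` N" by blast
    qed (auto simp: N_def fN Kline f_def intro: act_S)
    have "{x\<in>N. f x = 0} = {x\<in>S. act (\<Prod>z\<in>#M. line z) x = 0}"
    proof (intro equalityI subsetI)
      fix x assume "x \<in> {x\<in>S. act (\<Prod>z\<in>#M. line z) x = 0}"
      then have "x \<in> S" "f x = 0" by (auto simp: f_def)
      then show "x \<in> {x\<in>N. f x = 0}" unfolding N_def mem_Collect_eq fN by (simp add: A.scale_zero_right)
    qed (auto simp: N_def f_def)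
    then have "dim N = dim (K z) + size M * d"
      using BB.rank_nullity[OF lf N] add.IH add.prems im by (simp add: subset_mset.dual_order.trans[OF _ _])
    then show ?case using Kd[OF zZ] by (simp add: N_def)
  qed
  have "act (\<Prod>z\<in>#Z. line z) x = 0" if x: "x \<in> S" for x
  proof -
    have "(\<Prod>z\<in>#Z. line z) = pV ^ p - pC c * pU ^ p" using prod_roots Z by (simp add: q_def)
    then have "act (\<Prod>z\<in>#Z. line z) x = (v ^^ p) x - c *k (u ^^ p) x"
      by (simp only: A.scale_left_diff_distrib act_mult act_power act_gens)
    then show ?thesis using u0[OF x] v0[OF x] by simp
  qed
  then have "{x\<in>S. act (\<Prod>z\<in>#Z. line z) x = 0} = S" by auto
  then show ?thesis using count[of Z] Z(1) by simp
qed

end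

section \<open>Coordinates and base change\<close>

definition vec_scale :: "'k::times \<Rightarrow> ('i \<Rightarrow> 'k) \<Rightarrow> 'i \<Rightarrow> 'k" where
  "vec_scale c f = (\<lambda>i. c * f i)"

text \<open>Vectors of length \<open>n\<close> are sequences that vanish from \<open>n\<close> on,
  so that all ranks share one type; the entries are scalars or, later, polynomials.\<close>

definition coord_space :: "nat \<Rightarrow> (nat \<Rightarrow> 'k::zero) set" where
  "coord_space n = {f. \<forall>i\<ge>n. f i = 0}"

definition mat_act :: "nat \<Rightarrow> (nat \<Rightarrow> nat \<Rightarrow> 'k::comm_ring_1) \<Rightarrow> (nat \<Rightarrow> 'k) \<Rightarrow> nat \<Rightarrow> 'k" where
  "mat_act n M f = (\<lambda>i. if i < n then \<Sum>j<n. M i j * f j else 0)"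

definition unit_vec :: "nat \<Rightarrow> nat \<Rightarrow> 'k::zero_neq_one" where
  "unit_vec j = (\<lambda>i. if i = j then 1 else 0)"

interpretation vec: k_space "vec_scale :: 'k::field \<Rightarrow> (nat \<Rightarrow> 'k) \<Rightarrow> nat \<Rightarrow> 'k"
  by unfold_locales (auto simp: vec_scale_def fun_eq_iff algebra_simps)

lemma subspace_coord_space: "vec.subspace (coord_space n)"
  by (auto simp: vec.subspace_def coord_space_def vec_scale_def)

lemma vec_scale_unit_vec: "vec_scale c (unit_vec j) = (\<lambda>i. if i = j then c else (0 :: 'k::comm_ring_1))"
  by (auto simp: vec_scale_def unit_vec_def)

lemma coord_space_expand:
  fixes f :: "nat \<Rightarrow> 'k::comm_ring_1"
  assumes "f \<in> coord_space n" shows "f = (\<Sum>j<n. vec_scale (f j) (unit_vec j))"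
  using assms by (auto simp: fun_eq_iff coord_space_def sum_fun_apply vec_scale_unit_vec)

lemma unit_vec_coord_space: "j < n \<Longrightarrow> unit_vec j \<in> coord_space n"
  by (auto simp: coord_space_def unit_vec_def)

lemma coord_space_dim: "vec.finite_span (coord_space n :: (nat \<Rightarrow> 'k::field) set)" "vec.dim (coord_space n :: (nat \<Rightarrow> 'k::field) set) = n"
proof -
  let ?B = "unit_vec ` {..<n} :: (nat \<Rightarrow> 'k) set"
  have inj: "inj_on (unit_vec :: nat \<Rightarrow> nat \<Rightarrow> 'k) {..<n}"
  proof (rule inj_onI)
    fix i j assume "unit_vec i = (unit_vec j :: nat \<Rightarrow> 'k)"
    from fun_cong[OF this, of i] show "i = j" by (simp add: unit_vec_def split: if_splits)
  qed
  have sp: "coord_space n \<subseteq> vec.span ?B"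
  proof
    fix f :: "nat \<Rightarrow> 'k" assume "f \<in> coord_space n"
    then have "f = (\<Sum>j<n. vec_scale (f j) (unit_vec j))" by (rule coord_space_expand)
    also have "\<dots> \<in> vec.span ?B" by (intro vec.span_sum vec.span_scale vec.span_base) auto
    finally show "f \<in> vec.span ?B" .
  qed
  then show "vec.finite_span (coord_space n :: (nat \<Rightarrow> 'k) set)" by (intro vec.finite_spanI[of ?B]) auto
  have "vec.independent ?B"
  proof (rule vec.independent_if_scalars_zero)
    fix c :: "(nat \<Rightarrow> 'k) \<Rightarrow> 'k" and x assume *: "(\<Sum>x\<in>?B. vec_scale (c x) x) = 0" "x \<in> ?B"
    then obtain j where j: "j < n" "x = unit_vec j" by auto
    have "(\<Sum>i<n. vec_scale (c (unit_vec i)) (unit_vec i)) = 0"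
      using *(1) unfolding sum.reindex[OF inj] by (simp only: o_def)
    then have "0 = (\<Sum>i<n. vec_scale (c (unit_vec i)) (unit_vec i)) j" by simp
    also have "\<dots> = c x" using j by (simp add: sum_fun_apply vec_scale_unit_vec)
    finally show "c x = 0" by simp
  qed simp
  moreover have "?B \<subseteq> coord_space n" using unit_vec_coord_space by blast
  ultimately show "vec.dim (coord_space n :: (nat \<Rightarrow> 'k) set) = n"
    using sp vec.basis_card_eq_dim[of ?B "coord_space n"] card_image[OF inj] by simp
qed

lemma linear_mat_act: "Vector_Spaces.linear vec_scale vec_scale (mat_act n M :: (nat \<Rightarrow> 'k::field) \<Rightarrow> _)"
  using vec.vector_space_axioms
  by (auto simp: Vector_Spaces.linear_iff mat_act_def vec_scale_def fun_eq_iff algebra_simps sum.distrib sum_distrib_left)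

lemma mat_act_coord_space: "mat_act n M f \<in> coord_space n"
  by (auto simp: mat_act_def coord_space_def)

lemma mat_act_trunc: "mat_act n M f = mat_act n M (\<lambda>i. if i < n then f i else 0)"
  by (auto simp: mat_act_def intro!: sum.cong)

lemma linear_eq_coord_space:
  fixes f g :: "(nat \<Rightarrow> 'k::field) \<Rightarrow> nat \<Rightarrow> 'k"
  assumes "Vector_Spaces.linear vec_scale vec_scale f" "Vector_Spaces.linear vec_scale vec_scale g"
    and "\<And>j. j < n \<Longrightarrow> f (unit_vec j) = g (unit_vec j)" "x \<in> coord_space n"
  shows "f x = g x"
proof -
  interpret f: Vector_Spaces.linear vec_scale vec_scale f by fact
  interpret g: Vector_Spaces.linear vec_scale vec_scale g by fact
  show ?thesis by (subst (1 2) coord_space_expand[OF assms(4)]) (simp add: f.sum g.sum f.scale g.scale assms(3))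
qed

text \<open>\<open>mat_act\<close> ignores the entries from \<open>n\<close> on, so identities
  checked on the unit vectors hold for all sequences, as \<open>tate_ops\<close> demands for
  commutation.\<close>

lemma tate_ops_mat:
  fixes A B :: "nat \<Rightarrow> nat \<Rightarrow> 'k::field"
  assumes comm: "\<And>j. j < n \<Longrightarrow> mat_act n A (mat_act n B (unit_vec j)) = mat_act n B (mat_act n A (unit_vec j))"
    and pow: "\<And>j. j < n \<Longrightarrow> (mat_act n A ^^ p) (unit_vec j) = 0" "\<And>j. j < n \<Longrightarrow> (mat_act n B ^^ p) (unit_vec j) = 0"
    and p: "p \<ge> 2"
  shows "tate_ops vec_scale (coord_space n) (mat_act n A) (mat_act n B) p"
proof -
  interpret vp: k_space_pair "vec_scale :: 'k \<Rightarrow> (nat \<Rightarrow> 'k) \<Rightarrow> _" "vec_scale :: 'k \<Rightarrow> (nat \<Rightarrow> 'k) \<Rightarrow> _" by unfold_locales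
  have lin_pow: "Vector_Spaces.linear vec_scale vec_scale (mat_act n M ^^ m)" for m and M :: "nat \<Rightarrow> nat \<Rightarrow> 'k"
  proof (induction m)
    case 0
    then show ?case using vec.linear_id by (simp add: id_def)
  next
    case (Suc m)
    then show ?case using Vector_Spaces.linear_compose[OF Suc linear_mat_act] by (simp add: o_def)
  qed
  have zero: "Vector_Spaces.linear vec_scale vec_scale (\<lambda>_ :: nat \<Rightarrow> 'k. 0 :: nat \<Rightarrow> 'k)"
    using vec.vector_space_axioms by (auto simp: Vector_Spaces.linear_iff)
  have lin2: "Vector_Spaces.linear vec_scale vec_scale (\<lambda>x. mat_act n M (mat_act n N x))" for M N :: "nat \<Rightarrow> nat \<Rightarrow> 'k"
    using Vector_Spaces.linear_compose[OF linear_mat_act linear_mat_act] by (simp add: o_def)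
  show ?thesis
  proof (rule tate_ops.intro[OF vec.k_space_self], rule tate_ops_axioms.intro)
    show "mat_act n A (mat_act n B x) = mat_act n B (mat_act n A x)" for x
    proof -
      define y where "y = (\<lambda>i. if i < n then x i else 0)"
      have "y \<in> coord_space n" by (auto simp: y_def coord_space_def)
      then have "mat_act n A (mat_act n B y) = mat_act n B (mat_act n A y)"
        using linear_eq_coord_space[where f = "\<lambda>x. mat_act n A (mat_act n B x)" and
          g = "\<lambda>x. mat_act n B (mat_act n A x)", OF lin2 lin2 comm] by simp
      then show ?thesis unfolding y_def by (simp only: mat_act_trunc[of n _ x, symmetric])
    qed
    show "(mat_act n A ^^ p) x = 0" "(mat_act n B ^^ p) x = 0" if "x \<in> coord_space n" for x
      using linear_eq_coord_space[OF lin_pow zero _ that] pow by blast+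
  qed (use p subspace_coord_space coord_space_dim linear_mat_act mat_act_coord_space in auto)
qed

section \<open>Base change to the algebraic closure\<close>

definition ac_vec :: "('i \<Rightarrow> 'k::field) \<Rightarrow> 'i \<Rightarrow> 'k alg_closure" where
  "ac_vec f = (\<lambda>i. to_ac (f i))"

lemma to_ac_sum: "to_ac (sum f A) = (\<Sum>x\<in>A. to_ac (f x))"
  by (induction A rule: infinite_finite_induct) (auto simp: to_ac_0 to_ac_add)

lemma ac_vec_mat_act: "ac_vec (mat_act n M f) = mat_act n (\<lambda>i j. to_ac (M i j)) (ac_vec f)"
  by (auto simp: ac_vec_def mat_act_def fun_eq_iff to_ac_sum to_ac_mult to_ac_0)

lemma ac_vec_unit_vec: "ac_vec (unit_vec j) = unit_vec j"
  by (auto simp: ac_vec_def unit_vec_def to_ac_0 to_ac_1)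

text \<open>Independence over \<open>k\<close> survives the passage to the algebraic closure: compose a relation,
  normalized at one coefficient, with a \<open>k\<close>-linear retraction of the closure onto \<open>k\<close>.\<close>

lemma ac_retraction: "\<exists>r :: 'k::field alg_closure \<Rightarrow> 'k. r 1 = 1 \<and> (\<forall>x y. r (x + y) = r x + r y) \<and> (\<forall>c x. r (to_ac c * x) = c * r x)"
proof -
  interpret vector_space_pair "\<lambda>(c::'k) (x::'k alg_closure). to_ac c * x" "(*) :: 'k \<Rightarrow> 'k \<Rightarrow> 'k"
    by unfold_locales (auto simp: algebra_simps to_ac_add to_ac_mult to_ac_1)
  have "vs1.independent {1}" by (subst vs1.dependent_single) simp
  then obtain g where g: "Vector_Spaces.linear (\<lambda>(c::'k) (x::'k alg_closure). to_ac c * x) (*) g" "g 1 = 1"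
    using linear_independent_extend[of "{1}" "\<lambda>_. 1"] by auto
  then show ?thesis by (intro exI[of _ g]) (auto simp: Vector_Spaces.linear_iff)
qed

lemma independent_ac:
  fixes B :: "(nat \<Rightarrow> nat \<Rightarrow> 'k::field) set"
  assumes fin: "finite B" and ind: "\<not> Modules.module.dependent (\<lambda>c z a. vec_scale c (z a)) B"
  shows "\<not> Modules.module.dependent (\<lambda>c z a. vec_scale c (z a)) ((\<lambda>z a. ac_vec (z a)) ` B)"
    and "card ((\<lambda>z a. ac_vec (z a)) ` B) = card B"
proof -
  interpret K: k_space "\<lambda>c z a. vec_scale c (z a) :: nat \<Rightarrow> 'k" by (rule vec.k_space_fun)
  interpret L: k_space "\<lambda>c z a. vec_scale c (z a) :: nat \<Rightarrow> 'k alg_closure" by (rule vec.k_space_fun)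
  define h where "h = (\<lambda>(z :: nat \<Rightarrow> nat \<Rightarrow> 'k) a. ac_vec (z a))"
  have inj: "inj_on h B"
    by (auto simp: h_def ac_vec_def inj_on_def fun_eq_iff to_ac_eq_iff)
  obtain r :: "'k alg_closure \<Rightarrow> 'k" where r: "r 1 = 1" "\<And>x y. r (x + y) = r x + r y" "\<And>c x. r (to_ac c * x) = c * r x"
    using ac_retraction by blast
  have r0: "r 0 = 0" using r(3)[of 0 0] by (simp add: to_ac_0)
  have rsum: "r (sum f S) = (\<Sum>x\<in>S. r (f x))" for f and S :: "(nat \<Rightarrow> nat \<Rightarrow> 'k) set"
    by (induction S rule: infinite_finite_induct) (auto simp: r r0)
  have "L.independent (h ` B)"
  proof (rule L.independent_if_scalars_zero)
    fix c x assume *: "(\<Sum>x\<in>h ` B. (\<lambda>a. vec_scale (c x) (x a))) = 0" "x \<in> h ` B"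
    then obtain z where z: "z \<in> B" "x = h z" by auto
    show "c x = 0"
    proof (rule ccontr)
      assume c: "c x \<noteq> 0"
      \<comment> \<open>A retraction may kill nonzero scalars. After division by \<open>c x\<close>
        the coefficient at \<open>z\<close> is 1, which \<open>r\<close> preserves.\<close>
      define d where "d y = r (c (h y) / c x)" for y
      have "(\<Sum>y\<in>B. (\<lambda>a. vec_scale (d y) (y a))) = 0"
      proof (intro ext)
        fix a i
        have "(\<Sum>y\<in>h ` B. (\<lambda>a. vec_scale (c y) (y a))) a i = 0" using *(1) by simp
        moreover have "h y a i = to_ac (y a i)" for y by (simp add: h_def ac_vec_def)
        ultimately have "(\<Sum>y\<in>B. c (h y) * to_ac (y a i)) = 0"
          by (simp add: sum.reindex[OF inj] sum_fun_apply vec_scale_def)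
        then have "(1 / c x) * (\<Sum>y\<in>B. c (h y) * to_ac (y a i)) = 0" by simp
        then have "(\<Sum>y\<in>B. to_ac (y a i) * (c (h y) / c x)) = 0"
          unfolding sum_distrib_left by (simp add: mult.commute)
        then have "r (\<Sum>y\<in>B. to_ac (y a i) * (c (h y) / c x)) = 0" using r0 by simp
        then have "(\<Sum>y\<in>B. y a i * d y) = 0" unfolding rsum r(3) d_def .
        then show "(\<Sum>y\<in>B. (\<lambda>a. vec_scale (d y) (y a))) a i = 0 a i"
          by (simp add: sum_fun_apply vec_scale_def mult.commute)
      qed
      then have "d z = 0" using K.independentD[OF ind fin order_refl _ z(1), of d] by simp
      then show False using c r(1) by (simp add: d_def z(2))
    qed
  qed (use fin in simp)
  then show "\<not> L.dependent ((\<lambda>z a. ac_vec (z a)) ` B)" by (simp add: h_def)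
  show "card ((\<lambda>z a. ac_vec (z a)) ` B) = card B" using card_image[OF inj] by (simp add: h_def)
qed

lemma ac_vec_funpow: "ac_vec ((mat_act n M ^^ m) f) = (mat_act n (\<lambda>i j. to_ac (M i j)) ^^ m) (ac_vec f)"
  by (induction m) (auto simp: ac_vec_mat_act)

text \<open>\<open>dvd_dim\<close> asks for ranks over the closure that are large enough, so it
  suffices that ranks do not drop under base change: an independent family in the image over k stays
  independent. The bound on the homology itself is only used over k.\<close>

theorem dvd_matrix_dim:
  fixes A B :: "nat \<Rightarrow> nat \<Rightarrow> 'k::field"
  assumes comm: "\<And>j. j < n \<Longrightarrow> mat_act n A (mat_act n B (unit_vec j)) = mat_act n B (mat_act n A (unit_vec j))"
    and pow: "\<And>j. j < n \<Longrightarrow> (mat_act n A ^^ p) (unit_vec j) = 0" "\<And>j. j < n \<Longrightarrow> (mat_act n B ^^ p) (unit_vec j) = 0"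
    and p: "p \<ge> 2"
    and b: "\<And>i. i \<ge> 1 \<Longrightarrow> k_space.spanned_mod (\<lambda>c z a. vec_scale c (z a))
       {z \<in> chains (coord_space n) i. tate (mat_act n A) (mat_act n B) p i z = 0}
       (tate (mat_act n A) (mat_act n B) p (i + 1) ` chains (coord_space n) (i + 1)) b"
  shows "p dvd n"
proof -
  interpret K: tate_ops vec_scale "coord_space n" "mat_act n A" "mat_act n B" p
    by (rule tate_ops_mat[OF comm pow p])
  define A' B' where "A' = (\<lambda>i j. to_ac (A i j))" and "B' = (\<lambda>i j. to_ac (B i j))"
  have L: "tate_ops vec_scale (coord_space n) (mat_act n A') (mat_act n B') p"
  proof (rule tate_ops_mat)
    show "mat_act n A' (mat_act n B' (unit_vec j)) = mat_act n B' (mat_act n A' (unit_vec j))" if "j < n" for j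
      using arg_cong[OF comm[OF that], of ac_vec] by (simp add: ac_vec_mat_act ac_vec_unit_vec A'_def B'_def)
    have "ac_vec (0 :: nat \<Rightarrow> 'k) = 0" by (auto simp: ac_vec_def to_ac_0)
    then show "(mat_act n A' ^^ p) (unit_vec j) = 0" "(mat_act n B' ^^ p) (unit_vec j) = 0" if "j < n" for j
      using arg_cong[OF pow(1)[OF that], of ac_vec] arg_cong[OF pow(2)[OF that], of ac_vec]
      by (simp_all add: ac_vec_funpow ac_vec_unit_vec A'_def B'_def)
  qed (rule p)
  interpret L: tate_ops_closed vec_scale "coord_space n" "mat_act n A'" "mat_act n B'" p
    using L unfolding tate_ops_closed_def .
  define h where "h = (\<lambda>(z :: nat \<Rightarrow> nat \<Rightarrow> 'k) a. ac_vec (z a))"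
  have h_tate: "h (tate (mat_act n A) (mat_act n B) p i z) = tate (mat_act n A') (mat_act n B') p i (h z)" for i z
  proof -
    have alt: "ac_vec (alt_op (mat_act n A) p m f) = alt_op (mat_act n A') p m (ac_vec f)"
      "ac_vec (alt_op (mat_act n B) p m f) = alt_op (mat_act n B') p m (ac_vec f)" for m f
      by (auto simp: alt_op_def ac_vec_mat_act ac_vec_funpow A'_def B'_def)
    have "ac_vec (f + g) = ac_vec f + ac_vec g" "ac_vec (- g) = - ac_vec g" "ac_vec (\<lambda>_. 0) = 0" 
      for f g :: "nat \<Rightarrow> 'k" by (auto simp: ac_vec_def fun_eq_iff to_ac_add to_ac_diff to_ac_minus to_ac_0)
    then show ?thesis by (auto simp: h_def tate_def fun_eq_iff alt zero_fun_def)
  qed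
  have h_chains: "h z \<in> chains (coord_space n) i" if "z \<in> chains (coord_space n) i" for z i
    using that by (auto simp: h_def chains_def coord_space_def ac_vec_def to_ac_0 fun_eq_iff)
  have rank: "K.F.dim (tate (mat_act n A) (mat_act n B) p i ` chains (coord_space n) i) \<le>
     L.F.dim (tate (mat_act n A') (mat_act n B') p i ` chains (coord_space n) i)" for i
  proof -
    let ?K = "tate (mat_act n A) (mat_act n B) p i ` chains (coord_space n) i"
    let ?L = "tate (mat_act n A') (mat_act n B') p i ` chains (coord_space n) i"
    have finK: "K.F.finite_span ?K" using K.FF.finite_span_image[OF K.linear_tate] K.dim_chains by blast
    have finL: "L.F.finite_span ?L" using L.FF.finite_span_image[OF L.linear_tate] L.dim_chains by blast
    obtain E where E: "finite E" "E \<subseteq> ?K" "K.F.independent E" "card E = K.F.dim ?K"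
      using K.F.finite_span_basis[OF finK] by metis
    have "h ` E \<subseteq> ?L" 
    proof (rule image_subsetI)
      fix x assume "x \<in> E"
      then obtain z where z: "z \<in> chains (coord_space n) i" "x = tate (mat_act n A) (mat_act n B) p i z" using E(2) by blast
      have "h x = tate (mat_act n A') (mat_act n B') p i (h z)" unfolding z(2) by (rule h_tate)
      then show "h x \<in> ?L" using h_chains[OF z(1)] by blast
    qed
    then have "card (h ` E) \<le> L.F.dim ?L"
      using independent_ac(1)[OF E(1,3)] by (intro L.F.independent_card_le_dim_finite_span[OF finL]) (auto simp: h_def)
    then show ?thesis using independent_ac(2)[OF E(1,3)] E(4) by (simp add: h_def)
  qed
  have "p dvd vec.dim (coord_space n :: (nat \<Rightarrow> 'k alg_closure) set)"
  proof (rule L.dvd_dim)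
    fix i :: nat assume i: "i \<ge> 1"
    let ?t = "\<lambda>i. tate (mat_act n A) (mat_act n B) p i"
    have fin: "K.F.finite_span (chains (coord_space n) j)" for j using K.dim_chains by blast
    have e1: "(i + 1) * n = K.F.dim (?t i ` chains (coord_space n) i) + K.F.dim {z \<in> chains (coord_space n) i. ?t i z = 0}"
      using K.FF.rank_nullity[OF K.linear_tate fin K.subspace_chains, of i i] K.dim_chains[of i] by (simp add: coord_space_dim)
    have e2: "K.F.dim {z \<in> chains (coord_space n) i. ?t i z = 0} \<le> K.F.dim (?t (i + 1) ` chains (coord_space n) (i + 1)) + b"
      using K.F.spanned_mod_dim[OF b[OF i] K.FF.finite_span_image[OF K.linear_tate fin]] .
    show "(i + 1) * vec.dim (coord_space n :: (nat \<Rightarrow> 'k alg_closure) set) \<le>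
       L.F.dim (tate (mat_act n A') (mat_act n B') p i ` chains (coord_space n) i) +
       L.F.dim (tate (mat_act n A') (mat_act n B') p (i + 1) ` chains (coord_space n) (i + 1)) + b"
      using rank[of i] rank[of "i + 1"] e1 e2 unfolding coord_space_dim by linarith
  qed
  then show ?thesis by (simp add: coord_space_dim)
qed

section \<open>From a quotient of subspaces to matrices\<close>

context k_space begin

text \<open>Nested bases \<open>C\<close> of \<open>W\<close>, \<open>D\<close> of \<open>V\<close>
  and \<open>G\<close> of the whole type: the map reads off coordinates along D - C. Passing to
  \<open>G\<close> makes it linear everywhere, and the finite generating set \<open>T\<close> modulo
  \<open>W\<close> makes D - C finite.\<close>

lemma quotient_coordinates:
  assumes V: "subspace V" "subspace W" "W \<subseteq> V" and b: "spanned_mod V W b"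
  shows "\<exists>n f. Vector_Spaces.linear scale vec_scale f \<and> f ` V = coord_space n \<and> (\<forall>x\<in>V. f x = 0 \<longleftrightarrow> x \<in> W)"
proof -
  obtain C where C: "C \<subseteq> W" "independent C" "W \<subseteq> span C" using maximal_independent_subset by blast
  obtain D where D: "C \<subseteq> D" "D \<subseteq> V" "independent D" "V \<subseteq> span D"
    using maximal_independent_subset_extend[of C V] C V by blast
  obtain G where G0: "D \<subseteq> G" "independent G" "UNIV \<subseteq> span G"
    using maximal_independent_subset_extend[OF subset_UNIV D(3)] .
  then have G: "D \<subseteq> G" "independent G" "span G = UNIV" by auto
  obtain T where T: "finite T" "\<And>x. x \<in> V \<Longrightarrow> \<exists>s\<in>span T. x - s \<in> W"
    using b unfolding spanned_mod_def by blast
  have repD: "representation G x = representation D x" if "x \<in> V" for x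
  proof -
    have "x \<in> span D" using D(4) that by blast
    then show ?thesis by (rule representation_extend[OF G(2) _ G(1)])
  qed
  have repC: "representation G x = representation C x" if "x \<in> W" for x
  proof -
    have "x \<in> span C" "C \<subseteq> G" using C(3) G(1) D(1) that by auto
    then show ?thesis by (rule representation_extend[OF G(2)])
  qed
  \<comment> \<open>A vector of D - C outside the supports of \<open>T\<close> would have coordinate
    0 at itself, since it is the sum of an element of the span of \<open>T\<close> and one of
    \<open>W\<close>.\<close>
  have "D - C \<subseteq> (\<Union>t\<in>T. {g. representation G t g \<noteq> 0})"
  proof (rule ccontr)
    assume "\<not> D - C \<subseteq> (\<Union>t\<in>T. {g. representation G t g \<noteq> 0})"
    then obtain d where d: "d \<in> D" "d \<notin> C" "\<And>t. t \<in> T \<Longrightarrow> representation G t d = 0" by auto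
    obtain s where s: "s \<in> span T" "d - s \<in> W" using T(2) d D(2) by blast
    have "representation G s d = 0" using s(1)
    proof (induction rule: span_induct_alt)
      case base
      then show ?case by (simp add: representation_zero)
    next
      case (step c x y)
      then show ?case using d(3) G by (simp add: representation_add representation_scale)
    qed
    moreover have "representation G (d - s) d = 0"
      using repC[OF s(2)] representation_ne_zero[of C "d - s" d] d(2) by auto
    moreover have "representation G d d = 1" using representation_basis[OF G(2)] d(1) G(1) by auto
    ultimately show False using representation_diff[OF G(2), of s d] G(3) by simp
  qed
  then have fin: "finite (D - C)" using T(1) finite_representation by (meson finite_UN finite_subset)
  then obtain e where e: "bij_betw e {..<card (D - C)} (D - C)"
    using ex_bij_betw_nat_finite[OF fin] by (auto simp: atLeast0LessThan)
  define n where "n = card (D - C)"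
  define f where "f x = (\<lambda>i. if i < n then representation G x (e i) else 0)" for x
  have eD: "e i \<in> D - C" if "i < n" for i using e that unfolding n_def bij_betw_def by auto
  have lin: "Vector_Spaces.linear scale vec_scale f"
    using vector_space_axioms vec.vector_space_axioms G
    by (auto simp: Vector_Spaces.linear_iff f_def fun_eq_iff vec_scale_def representation_add representation_scale)
  have "f ` V = coord_space n"
  proof (intro equalityI subsetI)
    fix g :: "nat \<Rightarrow> 'k" assume g: "g \<in> coord_space n"
    define x where "x = (\<Sum>i<n. g i *k e i)"
    have "x \<in> V" unfolding x_def using eD D V by (intro subspace_sum subspace_scale) auto
    have unit: "f (e j) = unit_vec j" if "j < n" for j
    proof -
      have "representation G (e j) = (\<lambda>v. if v = e j then 1 else 0)"
        using representation_basis[OF G(2)] eD[OF that] G(1) by auto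
      moreover have "e i = e j \<longleftrightarrow> i = j" if "i < n" for i
        using e \<open>j < n\<close> that unfolding n_def bij_betw_def inj_on_def by auto
      ultimately show ?thesis using that by (auto simp: f_def unit_vec_def fun_eq_iff)
    qed
    interpret f: Vector_Spaces.linear scale vec_scale f by fact
    have "f x = (\<Sum>i<n. vec_scale (g i) (unit_vec i))" unfolding x_def f.sum f.scale
      by (intro sum.cong) (auto simp: unit)
    then have "f x = g" using coord_space_expand[OF g] by simp
    then show "g \<in> f ` V" using \<open>x \<in> V\<close> by blast
  qed (auto simp: f_def coord_space_def)
  moreover have "f x = 0 \<longleftrightarrow> x \<in> W" if x: "x \<in> V" for x
  proof
    assume "x \<in> W"
    have "representation G x (e i) = 0" if "i < n" for i
      using repC[OF \<open>x \<in> W\<close>] representation_ne_zero[of C x "e i"] eD[OF that] by auto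
    then show "f x = 0" by (simp add: f_def fun_eq_iff)
  next
    assume f0: "f x = 0"
    have "representation G x g = 0" if "g \<notin> C" for g
    proof (cases "g \<in> D")
      case True
      then obtain i where "i < n" "g = e i" using e \<open>g \<notin> C\<close> unfolding n_def bij_betw_def by auto
      then show ?thesis using fun_cong[OF f0, of i] by (simp add: f_def)
    next
      case False
      then show ?thesis using repD[OF x] representation_ne_zero[of D x g] by auto
    qed
    then have sub: "{g. representation G x g \<noteq> 0} \<subseteq> C" by auto
    have "x = (\<Sum>g | representation G x g \<noteq> 0. representation G x g *k g)"
      using sum_nonzero_representation_eq[OF G(2), of x] G(3) by simp
    also have "\<dots> \<in> span C" using sub by (intro span_sum span_scale span_base) auto
    also have "span C \<subseteq> W" using C V by (intro span_minimal)
    finally show "x \<in> W" .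
  qed
  ultimately show ?thesis using lin by blast
qed

end

context k_space begin

text \<open>\<open>H\<close> bounds the homology of the Tate complex on V/W in terms of
  representatives: a cycle has its differential in \<open>W\<close>, a boundary agrees with a
  differential up to \<open>W\<close>. The coordinates \<open>f\<close> turn the operators on V/W
  into matrices of size \<open>n\<close>, to which \<open>dvd_matrix_dim\<close> applies.\<close>

theorem dvd_quotient_dim:
  assumes V: "subspace V" "subspace W" "W \<subseteq> V"
    and lu: "Vector_Spaces.linear scale scale u" and lv: "Vector_Spaces.linear scale scale v"
    and uV: "\<And>x. x \<in> V \<Longrightarrow> u x \<in> V" and vV: "\<And>x. x \<in> V \<Longrightarrow> v x \<in> V"
    and uW: "\<And>x. x \<in> W \<Longrightarrow> u x \<in> W" and vW: "\<And>x. x \<in> W \<Longrightarrow> v x \<in> W"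
    and uv: "\<And>x. u (v x) = v (u x)"
    and up: "\<And>x. x \<in> V \<Longrightarrow> (u ^^ p) x \<in> W" and vp: "\<And>x. x \<in> V \<Longrightarrow> (v ^^ p) x \<in> W" and p: "p \<ge> 2"
    and f: "Vector_Spaces.linear scale vec_scale f" "f ` V = coord_space n" "\<And>x. x \<in> V \<Longrightarrow> f x = 0 \<longleftrightarrow> x \<in> W"
    and H: "\<And>i. i \<ge> 1 \<Longrightarrow> k_space.spanned_mod fscale
      {z \<in> chains V i. tate u v p i z \<in> chains W (i - 1)}
      {z \<in> chains V i. \<exists>y\<in>chains V (i + 1). z - tate u v p (i + 1) y \<in> chains W i} b"
  shows "p dvd n"
proof -
  interpret f: Vector_Spaces.linear scale vec_scale f by fact
  interpret u: Vector_Spaces.linear scale scale u by fact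
  interpret v: Vector_Spaces.linear scale scale v by fact
  have "\<forall>j. \<exists>x. j < n \<longrightarrow> x \<in> V \<and> f x = unit_vec j"
  proof
    fix j show "\<exists>x. j < n \<longrightarrow> x \<in> V \<and> f x = unit_vec j"
    proof (cases "j < n")
      case True
      then have "unit_vec j \<in> f ` V" unfolding f(2) by (rule unit_vec_coord_space)
      then obtain x where "x \<in> V" "f x = unit_vec j" by (metis imageE)
      then show ?thesis by (intro exI[of _ x]) simp
    qed simp
  qed
  then obtain e where e: "\<And>j. j < n \<Longrightarrow> e j \<in> V" "\<And>j. j < n \<Longrightarrow> f (e j) = unit_vec j" by metis
  define M where "M w = (\<lambda>i j. f (w (e j)) i)" for w :: "'b \<Rightarrow> 'b"
  have fV: "f x \<in> coord_space n" if "x \<in> V" for x using f(2) that by blast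
  have mat: "f (w x) = mat_act n (M w) (f x)"
    if w: "Vector_Spaces.linear scale scale w" "\<And>x. x \<in> V \<Longrightarrow> w x \<in> V" "\<And>x. x \<in> W \<Longrightarrow> w x \<in> W" and x: "x \<in> V" for w x
  proof -
    interpret w: Vector_Spaces.linear scale scale w by fact
    \<comment> \<open>\<open>y\<close> has the same coordinates as \<open>x\<close>, so they differ
      by an element of \<open>W\<close>, and \<open>w\<close> maps the difference into
      \<open>W\<close> again.\<close>
    define y where "y = (\<Sum>j<n. f x j *k e j)"
    have yV: "y \<in> V" unfolding y_def using e V by (intro subspace_sum subspace_scale) auto
    have "f y = (\<Sum>j<n. vec_scale (f x j) (unit_vec j))"
      unfolding y_def f.sum f.scale by (intro sum.cong) (auto simp: e)
    then have "f y = f x" using coord_space_expand[OF fV[OF x]] by simp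
    then have "x - y \<in> W" using f(3)[of "x - y"] x yV V by (simp add: f.diff subspace_diff)
    then have "f (w (x - y)) = 0" using f(3)[of "w (x - y)"] w V by blast
    then have "f (w x) = f (w y)" by (simp add: w.diff f.diff)
    also have "\<dots> = (\<Sum>j<n. vec_scale (f x j) (f (w (e j))))" unfolding y_def w.sum w.scale f.sum f.scale ..
    also have "\<dots> = mat_act n (M w) (f x)"
    proof
      fix i
      have "f (w (e j)) i = 0" if "j < n" "i \<ge> n" for j
        using fV[OF w(2)[OF e(1)[OF that(1)]]] that(2) by (simp add: coord_space_def)
      then show "(\<Sum>j<n. vec_scale (f x j) (f (w (e j)))) i = mat_act n (M w) (f x) i"
        by (auto simp: mat_act_def M_def sum_fun_apply vec_scale_def mult.commute intro!: sum.neutral)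
    qed
    finally show ?thesis .
  qed
  note matu = mat[OF lu uV uW] and matv = mat[OF lv vV vW]
  have pV: "(u ^^ m) x \<in> V" "(v ^^ m) x \<in> V" if "x \<in> V" for m x
    using that by (induction m) (auto simp: uV vV)
  have powu: "f ((u ^^ m) x) = (mat_act n (M u) ^^ m) (f x)" if "x \<in> V" for m x
    by (induction m) (auto simp: matu pV that)
  have powv: "f ((v ^^ m) x) = (mat_act n (M v) ^^ m) (f x)" if "x \<in> V" for m x
    by (induction m) (auto simp: matv pV that)
  define h where "h z = (\<lambda>a::nat. f (z a))" for z
  have h_tate: "h (tate u v p i z) = tate (mat_act n (M u)) (mat_act n (M v)) p i (h z)" if "z \<in> chains V i" for z i
  proof
    fix a
    have zV: "z (a + 1) \<in> V" "z a \<in> V" if "a < i" using \<open>z \<in> chains V i\<close> that by (auto simp: chains_def)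
    have alt: "f (alt_op u p m x) = alt_op (mat_act n (M u)) p m (f x)"
      "f (alt_op v p m x) = alt_op (mat_act n (M v)) p m (f x)" if "x \<in> V" for m x
      using that by (auto simp: alt_op_def matu matv powu powv)
    show "h (tate u v p i z) a = tate (mat_act n (M u)) (mat_act n (M v)) p i (h z) a"
      using zV by (auto simp: h_def tate_def f.add f.neg f.diff alt)
  qed
  have lh: "h (x + y) = h x + h y" "h (fscale c x) = (\<lambda>a. vec_scale c (h x a))" for x y c
    by (auto simp: h_def fun_eq_iff f.add f.scale)
  have tV: "tate u v p i z \<in> chains V (i - 1)" if "z \<in> chains V i" "i \<ge> 1" for z i
    using that V by (auto simp: chains_def tate_def alt_op_def uV vV pV intro!: subspace_add subspace_neg subspace_diff)
  have chW: "z \<in> chains W i \<longleftrightarrow> h z = 0" if "z \<in> chains V i" for z i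
  proof
    assume "z \<in> chains W i"
    then have "f (z a) = 0" for a using f(3)[of "z a"] V by (cases "a \<le> i") (auto simp: chains_def)
    then show "h z = 0" by (simp add: h_def fun_eq_iff)
  next
    assume "h z = 0"
    then have "f (z a) = 0" for a unfolding h_def by (metis zero_fun_apply)
    then show "z \<in> chains W i" using that f(3) by (auto simp: chains_def)
  qed
  have h_ch: "h z \<in> chains (coord_space n) i" if "z \<in> chains V i" for z i
    using that fV by (auto simp: chains_def h_def)
  have h_sur: "\<exists>z\<in>chains V i. h z = w" if "w \<in> chains (coord_space n) i" for w i
  proof -
    have "\<forall>a. \<exists>x. (a \<le> i \<longrightarrow> x \<in> V \<and> f x = w a) \<and> (a > i \<longrightarrow> x = 0)"
    proof
      fix a
      show "\<exists>x. (a \<le> i \<longrightarrow> x \<in> V \<and> f x = w a) \<and> (a > i \<longrightarrow> x = 0)"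
      proof (cases "a \<le> i")
        case True
        then have "w a \<in> f ` V" unfolding f(2) using that by (simp add: chains_def)
        then obtain x where "x \<in> V" "w a = f x" by blast
        then show ?thesis using True by (intro exI[of _ x]) simp
      qed auto
    qed
    then obtain z where z: "\<And>a. (a \<le> i \<longrightarrow> z a \<in> V \<and> f (z a) = w a) \<and> (a > i \<longrightarrow> z a = 0)" by metis
    then have "z \<in> chains V i" by (auto simp: chains_def)
    moreover have "h z = w"
    proof
      fix a show "h z a = w a" using z[of a] that by (cases "a \<le> i") (auto simp: h_def chains_def)
    qed
    ultimately show ?thesis by blast
  qed
  interpret Q: k_space_pair "fscale :: 'k \<Rightarrow> (nat \<Rightarrow> 'b) \<Rightarrow> nat \<Rightarrow> 'b" "\<lambda>c z a. vec_scale c (z a) :: nat \<Rightarrow> 'k"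
    using k_space_fun vec.k_space_fun by (simp add: k_space_pair_def)
  show ?thesis
  proof (rule dvd_matrix_dim)
    show "mat_act n (M u) (mat_act n (M v) (unit_vec j)) = mat_act n (M v) (mat_act n (M u) (unit_vec j))" if "j < n" for j
      using arg_cong[OF uv[of "e j"], of f] e[OF that] by (simp add: matu matv uV vV)
    have W0: "f x = 0" if "x \<in> W" for x using f(3) V that by blast
    show "(mat_act n (M u) ^^ p) (unit_vec j) = 0" "(mat_act n (M v) ^^ p) (unit_vec j) = 0" if "j < n" for j
      using W0[OF up[OF e(1)[OF that]]] W0[OF vp[OF e(1)[OF that]]] e(1)[OF that]
      by (simp_all add: powu powv e(2)[OF that])
    fix i :: nat assume i: "i \<ge> 1"
    let ?Z = "{z \<in> chains V i. tate u v p i z \<in> chains W (i - 1)}"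
    have subC: "Q.vs1.subspace (chains V j)" for j
      using V by (auto simp: Q.vs1.subspace_def subspace_def chains_def)
    show "Q.vs2.spanned_mod {z \<in> chains (coord_space n) i. tate (mat_act n (M u)) (mat_act n (M v)) p i z = 0}
      (tate (mat_act n (M u)) (mat_act n (M v)) p (i + 1) ` chains (coord_space n) (i + 1)) b"
    proof (rule Q.spanned_mod_relation[OF H[OF i], where R = "\<lambda>z w. z \<in> chains V i \<and> w = h z"])
      show "z + z' \<in> chains V i \<and> w + w' = h (z + z')" if "z \<in> chains V i \<and> w = h z" "z' \<in> chains V i \<and> w' = h z'" for z w z' w'
        using that subC by (simp add: lh Q.vs1.subspace_add)
      show "fscale c z \<in> chains V i \<and> (\<lambda>a. vec_scale c (w a)) = h (fscale c z)" if "z \<in> chains V i \<and> w = h z" for c z w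
        using that Q.vs1.subspace_scale[OF subC, of z i c] by (simp add: lh)
      show "\<exists>x\<in>{z \<in> chains (coord_space n) i. tate (mat_act n (M u)) (mat_act n (M v)) p i z = 0}. z \<in> chains V i \<and> x = h z"
        if "z \<in> ?Z" for z
        using that chW[OF tV[OF _ i]] h_tate h_ch by auto
      show "\<exists>z\<in>?Z. z \<in> chains V i \<and> x = h z"
        if x: "x \<in> {z \<in> chains (coord_space n) i. tate (mat_act n (M u)) (mat_act n (M v)) p i z = 0}" for x
      proof -
        obtain z where z: "z \<in> chains V i" "h z = x" using h_sur x by blast
        have "h (tate u v p i z) = 0" using x h_tate[OF z(1)] z(2) by simp
        then have "z \<in> ?Z" using chW[OF tV[OF z(1) i]] z(1) by simp
        then show ?thesis using z by blast
      qed
      show "w \<in> tate (mat_act n (M u)) (mat_act n (M v)) p (i + 1) ` chains (coord_space n) (i + 1)"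
        if zw: "z \<in> chains V i \<and> w = h z" and zB: "z \<in> {z \<in> chains V i. \<exists>y\<in>chains V (i + 1). z - tate u v p (i + 1) y \<in> chains W i}" for z w
      proof -
        obtain y where y: "y \<in> chains V (i + 1)" "z - tate u v p (i + 1) y \<in> chains W i" using zB by blast
        have "tate u v p (i + 1) y \<in> chains V i" using tV[OF y(1)] by simp
        then have "z - tate u v p (i + 1) y \<in> chains V i" using zw subC by (blast intro: Q.vs1.subspace_diff)
        then have "h (z - tate u v p (i + 1) y) = 0" using y(2) chW by blast
        then have "h z = h (tate u v p (i + 1) y)" by (simp add: h_def fun_eq_iff f.diff)
        then show ?thesis using h_tate[OF y(1)] h_ch[OF y(1)] zw by auto
      qed
    qed
  qed (rule p)
qed

end

text \<open>Assumptions \<open>e1\<close> and \<open>e2\<close> are the exactness of the one-variable complex of \<open>u\<close>, and of that of \<open>v\<close>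
  modulo the image of \<open>u\<close>.\<close>

lemma tate_acyclic:
  fixes u v :: "'b::ab_group_add \<Rightarrow> 'b" and I :: "'b set"
  assumes I: "0 \<in> I" "\<And>x y. x \<in> I \<Longrightarrow> y \<in> I \<Longrightarrow> x + y \<in> I" "\<And>x. x \<in> I \<Longrightarrow> - x \<in> I"
    and add: "\<And>x y. u (x + y) = u x + u y" "\<And>x y. v (x + y) = v x + v y"
    and uv: "\<And>x. u (v x) = v (u x)"
    and uI: "\<And>x. x \<in> I \<Longrightarrow> u x \<in> I" "\<And>x. x \<in> I \<Longrightarrow> v x \<in> I"
    and up: "\<And>x. (u ^^ p) x \<in> I" "\<And>x. (v ^^ p) x \<in> I" and p: "p \<ge> 2"
    and e1: "\<And>x m. alt_op u p m x \<in> I \<Longrightarrow> \<exists>y. x - alt_op u p (m + 1) y \<in> I"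
    and e2: "\<And>x y m. u y + alt_op v p m x \<in> I \<Longrightarrow> \<exists>y z. x - (u y + alt_op v p (m + 1) z) \<in> I"
    and z: "z \<in> chains UNIV i" "\<And>a. tate u v p i z a \<in> I" and i: "i \<ge> 1"
  shows "\<exists>y\<in>chains UNIV (i + 1). \<forall>a. z a - tate u v p (i + 1) y a \<in> I"
proof -
  have diffI: "x - y \<in> I" if "x \<in> I" "y \<in> I" for x y using I(2)[OF that(1) I(3)[OF that(2)]] by simp
  have add0: "u 0 = 0" "v 0 = 0" using add(1)[of 0 0] add(2)[of 0 0] by simp_all
  have neg: "u (- x) = - u x" "v (- x) = - v x" for x
    using add(1)[of "-x" x] add(2)[of "-x" x] add0 by (simp_all add: eq_neg_iff_add_eq_0)
  have padd: "(u ^^ m) (x + y) = (u ^^ m) x + (u ^^ m) y" "(v ^^ m) (x + y) = (v ^^ m) x + (v ^^ m) y"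
    "(u ^^ m) (- x) = - (u ^^ m) x" "(v ^^ m) (- x) = - (v ^^ m) x" "(u ^^ m) 0 = 0" "(v ^^ m) 0 = 0" for m x y
    by (induction m) (simp_all add: add neg add0)
  have alt_add: "alt_op u p m (x + y) = alt_op u p m x + alt_op u p m y"
    "alt_op v p m (x + y) = alt_op v p m x + alt_op v p m y"
    "alt_op u p m (- x) = - alt_op u p m x" "alt_op v p m (- x) = - alt_op v p m x"
    "alt_op u p m 0 = 0" "alt_op v p m 0 = 0" for m x y
    by (auto simp: alt_op_def add neg padd add0)
  have alt_diff: "alt_op v p m (x - y) = alt_op v p m x - alt_op v p m y" for m x y
    using alt_add(2)[of m x "- y"] alt_add(4)[of m y] by simp
  have tate_diff: "tate u v p i (x - y) a = tate u v p i x a - tate u v p i y a" for x y i a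
  proof -
    have "tate u v p i (x + - y) a = tate u v p i x a + - tate u v p i y a"
      by (simp add: tate_def alt_add del: add_uminus_conv_diff)
    then show ?thesis by simp
  qed
  have uvp: "u ((v ^^ m) x) = (v ^^ m) (u x)" for m x by (induction m arbitrary: x) (simp_all add: uv)
  have upvp: "(u ^^ n) ((v ^^ m) x) = (v ^^ m) ((u ^^ n) x)" for n m x by (induction n) (simp_all add: uvp)
  have vup: "v ((u ^^ m) x) = (u ^^ m) (v x)" for m x using upvp[of m 1 x] by simp
  obtain q where q: "p = Suc q" using p by (cases p) auto
  have alt2: "alt_op u p m (alt_op u p (m + 1) x) \<in> I" "alt_op v p (m + 1) (alt_op v p m x) \<in> I" for m x
    using up[of x] by (auto simp: alt_op_def q funpow_swap1)
  have comm: "alt_op u p m (alt_op v p n x) = alt_op v p n (alt_op u p m x)" for m n x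
    by (auto simp: alt_op_def uv uvp upvp vup)
  have dd: "tate u v p i (tate u v p (i + 1) y) a \<in> I" for y a
  proof (cases "a < i")
    case True
    define s where "s = (if even a then (1::int) else - 1)"
    have "tate u v p i (tate u v p (i + 1) y) a =
      alt_op u p (a + 1) (alt_op u p (a + 1 + 1) (y (a + 2))) + alt_op v p (i - a) (alt_op v p (i - a + 1) (y a))"
      using True by (auto simp: tate_def alt_add alt_diff comm Suc_diff_le)
    moreover have "alt_op v p (i - a) (alt_op v p (i - a + 1) (y a)) \<in> I"
      using alt2(2)[of "i - a + 1" "y a"] by (simp add: alt_op_def)
    ultimately show ?thesis using I(2) alt2(1) by simp
  qed (simp add: tate_def I(1))
  \<comment> \<open>The coefficients of \<open>y\<close> are found by increasing index. Those at 0
    and 1 come from \<open>e2\<close>; afterwards the remaining error at the next index is a cycle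
    of the one-variable complex of \<open>u\<close>, and \<open>e1\<close> corrects it.\<close>
  have "\<exists>y\<in>chains UNIV (i + 1). \<forall>a\<le>n. z a - tate u v p (i + 1) y a \<in> I" if "n \<le> i" for n
    using that
  proof (induction n)
    case 0
    have "u (z 1) + alt_op v p i (z 0) \<in> I" using z(2)[of 0] i by (simp add: tate_def alt_op_def)
    then obtain y0 y1 where y: "z 0 - (u y1 + alt_op v p (i + 1) y0) \<in> I" using e2 by blast
    define y where "y = (\<lambda>a::nat. if a = 0 then y0 else if a = 1 then y1 else 0)"
    have "tate u v p (i + 1) y 0 = u y1 + alt_op v p (i + 1) y0" by (simp add: tate_def y_def alt_op_def)
    then show ?case using y by (intro bexI[of _ y]) (auto simp: chains_def y_def)
  next
    case (Suc a)
    then obtain y where y: "y \<in> chains UNIV (i + 1)" "\<And>b. b \<le> a \<Longrightarrow> z b - tate u v p (i + 1) y b \<in> I" by auto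
    define z' where "z' = z - tate u v p (i + 1) y"
    have "tate u v p i z' a \<in> I" unfolding z'_def tate_diff using diffI z(2) dd by blast
    moreover have "alt_op v p (i - a) (z' a) \<in> I"
    proof -
      have "z' a \<in> I" using y(2)[of a] by (simp add: z'_def)
      moreover have "(v ^^ m) x \<in> I" if "x \<in> I" for m x using that by (induction m) (auto simp: uI)
      ultimately show ?thesis by (auto simp: alt_op_def uI)
    qed
    ultimately have "alt_op u p (a + 1) (z' (a + 1)) \<in> I"
      using Suc.prems diffI I(2) by (auto simp: tate_def split: if_splits) (metis add_diff_cancel_right' diff_add_cancel)+
    then obtain w where w: "z' (a + 1) - alt_op u p (a + 2) w \<in> I" using e1[of "a + 1"] by auto
    \<comment> \<open>A change at index a + 2 affects the differential only at a + 1 and a + 2, so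
      the congruences already reached up to \<open>a\<close> survive.\<close>
    define t where "t = (\<lambda>b. if b = a + 2 then w else (0::'b))"
    have t: "tate u v p (i + 1) t b = (if b = a + 1 then alt_op u p (a + 2) w else 0)" if "b \<le> a + 1" for b
      using that Suc.prems by (auto simp: tate_def t_def alt_add)
    have "\<forall>b\<le>Suc a. z b - tate u v p (i + 1) (y + t) b \<in> I"
    proof (intro allI impI)
      fix b assume b: "b \<le> Suc a"
      have "tate u v p (i + 1) (y + t) b = tate u v p (i + 1) y b + tate u v p (i + 1) t b"
        by (simp add: tate_def alt_add)
      then have eq: "z b - tate u v p (i + 1) (y + t) b = z' b - tate u v p (i + 1) t b" by (simp add: z'_def)
      show "z b - tate u v p (i + 1) (y + t) b \<in> I"
      proof (cases "b = Suc a")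
        case True
        then show ?thesis unfolding eq using w t[of b] by simp
      next
        case False
        then show ?thesis unfolding eq using y(2)[of b] t[of b] b by (simp add: z'_def)
      qed
    qed
    moreover have "y + t \<in> chains UNIV (i + 1)" using y(1) Suc.prems by (auto simp: chains_def t_def)
    ultimately show ?case by blast
  qed
  then obtain y where y: "y \<in> chains UNIV (i + 1)" "\<forall>a\<le>i. z a - tate u v p (i + 1) y a \<in> I" by blast
  have "z a - tate u v p (i + 1) y a \<in> I" for a
    using y(2) z(1) I(1) by (cases "a \<le> i") (auto simp: chains_def tate_def)
  then show ?thesis using y(1) by blast
qed

section \<open>Monomial ideals\<close>

type_synonym 'k mpoly = "(nat \<Rightarrow>\<^sub>0 nat) \<Rightarrow>\<^sub>0 'k"

abbreviation "lk \<equiv> Poly_Mapping.lookup"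
abbreviation "sg \<equiv> Poly_Mapping.single"
abbreviation "ks \<equiv> Poly_Mapping.keys"

lemma mpoly_sum: "f = (\<Sum>m\<in>ks f. sg m (lk f m))"
  by (rule poly_mapping_eqI) (auto simp: lookup_sum lookup_single when_def in_keys_iff)

lemma mono_mult_sum: "sg e c * f = (\<Sum>m\<in>ks f. sg (m + e) (c * lk f m))"
  for f :: "'k::comm_ring_1 mpoly"
  by (subst mpoly_sum) (simp add: sum_distrib_left mult_single add.commute)

lemma lookup_mono_mult:
  fixes f :: "'k::comm_ring_1 mpoly"
  shows "lk (sg e c * f) (m + e) = c * lk f m"
    and "(\<And>m. m' \<noteq> m + e) \<Longrightarrow> lk (sg e c * f) m' = 0"
proof -
  have "lk (sg e c * f) (m + e) = (\<Sum>m'\<in>ks f. if m' = m then c * lk f m' else 0)"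
    unfolding mono_mult_sum by (auto simp: lookup_sum lookup_single when_def intro!: sum.cong)
  also have "\<dots> = c * lk f m" by (simp add: in_keys_iff)
  finally show "lk (sg e c * f) (m + e) = c * lk f m" .
  show "lk (sg e c * f) m' = 0" if "\<And>m. m' \<noteq> m + e"
    unfolding mono_mult_sum using that by (fastforce simp: lookup_sum lookup_single when_def intro!: sum.neutral)
qed

text \<open>An ideal when \<open>U\<close> is an upset. The ideals used below have this form, which
  reduces membership and exactness to statements about single monomials.\<close>

definition mono_ideal :: "(nat \<Rightarrow>\<^sub>0 nat) set \<Rightarrow> 'k::comm_ring_1 mpoly set" where
  "mono_ideal U = {f. ks f \<subseteq> U}"

definition upset :: "(nat \<Rightarrow>\<^sub>0 nat) set \<Rightarrow> bool" where
  "upset U \<longleftrightarrow> (\<forall>m\<in>U. \<forall>e. m + e \<in> U)"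

lemma mono_ideal_iff: "f \<in> mono_ideal U \<longleftrightarrow> (\<forall>m. m \<notin> U \<longrightarrow> lk f m = 0)"
  by (auto simp: mono_ideal_def in_keys_iff)

lemma mono_ideal_0 [simp]: "0 \<in> mono_ideal U"
  by (simp add: mono_ideal_iff)

lemma mono_ideal_add: "f \<in> mono_ideal U \<Longrightarrow> g \<in> mono_ideal U \<Longrightarrow> f + g \<in> mono_ideal U"
  by (auto simp: mono_ideal_iff lookup_add)

lemma mono_ideal_neg: "f \<in> mono_ideal U \<Longrightarrow> - f \<in> mono_ideal U"
  by (auto simp: mono_ideal_iff)

lemma mono_ideal_diff: "f \<in> mono_ideal U \<Longrightarrow> g \<in> mono_ideal U \<Longrightarrow> f - g \<in> mono_ideal U"
  by (auto simp: mono_ideal_iff lookup_minus)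

lemma mono_ideal_sum: "(\<And>x. x \<in> A \<Longrightarrow> f x \<in> mono_ideal U) \<Longrightarrow> sum f A \<in> mono_ideal U"
  by (induction A rule: infinite_finite_induct) (auto intro: mono_ideal_add)

lemma mono_ideal_mono: "f \<in> mono_ideal U \<Longrightarrow> U \<subseteq> U' \<Longrightarrow> f \<in> mono_ideal U'"
  by (auto simp: mono_ideal_def)

lemma mono_ideal_mult: "upset U \<Longrightarrow> f \<in> mono_ideal U \<Longrightarrow> g * f \<in> mono_ideal U"
proof -
  assume U: "upset U" "f \<in> mono_ideal U"
  have "m \<in> U" if m: "m \<in> ks (g * f)" for m
  proof -
    obtain x y where "m = x + y" "y \<in> ks f" using m keys_mult[of g f] by blast
    then show ?thesis using U unfolding mono_ideal_def upset_def by (auto simp: add.commute[of x])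
  qed
  then show ?thesis by (auto simp: mono_ideal_def)
qed

lemma mono_mult_mono_ideal:
  "(\<And>m. m \<in> ks f \<Longrightarrow> m + e \<in> U) \<Longrightarrow> sg e c * f \<in> mono_ideal U"
  unfolding mono_mult_sum by (rule mono_ideal_sum) (auto simp: mono_ideal_def)

lemma mono_mult_mono_idealD:
  fixes f :: "'k::idom mpoly"
  assumes "sg e c * f \<in> mono_ideal U" "c \<noteq> 0" "m \<in> ks f" shows "m + e \<in> U"
  using assms lookup_mono_mult(1)[of e c f m] by (auto simp: mono_ideal_iff in_keys_iff)

lift_definition restr :: "'m set \<Rightarrow> ('m \<Rightarrow>\<^sub>0 'k::zero) \<Rightarrow> 'm \<Rightarrow>\<^sub>0 'k" is
  "\<lambda>U f m. if m \<in> U then f m else 0"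
  by (erule finite_subset[rotated]) auto

lemma lookup_restr: "lk (restr U f) m = (if m \<in> U then lk f m else 0)"
  by transfer simp

lemma mono_divides:
  fixes f :: "'k::comm_ring_1 mpoly"
  assumes "\<And>m. m \<in> ks f \<Longrightarrow> \<exists>m'. m = m' + e" shows "\<exists>g. f = sg e 1 * g"
proof -
  have "sg e 1 * (\<Sum>m\<in>ks f. sg (m - e) (lk f m)) = (\<Sum>m\<in>ks f. sg m (lk f m))"
    unfolding sum_distrib_left mult_single using assms
    by (intro sum.cong) (auto simp: add.commute, metis add.commute add_diff_cancel_right')
  then show ?thesis using mpoly_sum[of f] by metis
qed

abbreviation vp :: "nat \<Rightarrow> nat \<Rightarrow> 'k::comm_ring_1 mpoly" where
  "vp i n \<equiv> sg (sg i n) 1"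

lemma vp_mult: "vp i m * vp i n = (vp i (m + n) :: 'k::comm_ring_1 mpoly)"
  by (simp add: mult_single single_add)

lemma vp_power: "vp i m ^ n = (vp i (n * m) :: 'k::comm_ring_1 mpoly)"
  by (induction n) (simp_all add: vp_mult)

lemma monomial_split: fixes m :: "nat \<Rightarrow>\<^sub>0 nat" shows "lk m i \<ge> n \<Longrightarrow> \<exists>m'. m = m' + sg i n"
  by (rule exI[of _ "m - sg i n"], rule poly_mapping_eqI)
    (auto simp: lookup_add lookup_minus lookup_single when_def)

text \<open>The monomials that vanish in A. Those with a variable outside 1..c are included, so that
  A becomes a quotient of the whole type of polynomials in infinitely many variables.\<close>

definition nonbox :: "nat \<Rightarrow> (nat \<Rightarrow> nat) \<Rightarrow> (nat \<Rightarrow>\<^sub>0 nat) set" where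
  "nonbox c a = {m. \<not> ks m \<subseteq> {1..c} \<or> (\<exists>i\<in>{1..c}. lk m i \<ge> a i)}"

lemma lookup_le_add: "lk m i \<le> lk (m + e) i" for m e :: "nat \<Rightarrow>\<^sub>0 nat"
  by (simp add: lookup_add)

lemma upset_nonbox: "upset (nonbox c a)"
proof -
  have "ks m \<subseteq> ks (m + e)" for m e :: "nat \<Rightarrow>\<^sub>0 nat" by (auto simp: in_keys_iff lookup_add)
  then have "m + e \<in> nonbox c a" if "m \<in> nonbox c a" for m e
  proof (cases "ks m \<subseteq> {1..c}")
    case True
    then obtain i where "i \<in> {1..c}" "a i \<le> lk m i" using \<open>m \<in> nonbox c a\<close> by (auto simp: nonbox_def)
    then have "a i \<le> lk (m + e) i" using lookup_le_add[of m i e] by linarith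
    then show ?thesis using \<open>i \<in> {1..c}\<close> unfolding nonbox_def by blast
  next
    case False
    then have "\<not> ks (m + e) \<subseteq> {1..c}" using \<open>ks m \<subseteq> ks (m + e)\<close> by (metis subset_trans)
    then show ?thesis by (simp add: nonbox_def)
  qed
  then show ?thesis by (simp add: upset_def)
qed

lemma finite_box: "finite (- nonbox c a)"
proof -
  have "inj_on lk (- nonbox c a)" by (rule inj_onI) (simp only: poly_mapping_eq_iff)
  have "lk ` (- nonbox c a) \<subseteq> {f. \<forall>i. (i \<in> {1..c} \<longrightarrow> f i \<in> {..<Max (a ` {1..c})}) \<and> (i \<notin> {1..c} \<longrightarrow> f i = 0)}"
  proof (intro image_subsetI CollectI allI conjI impI)
    fix m i assume m: "m \<in> - nonbox c a"
    show "lk m i \<in> {..<Max (a ` {1..c})}" if "i \<in> {1..c}"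
    proof -
      have "lk m i < a i" using m that by (auto simp: nonbox_def not_le)
      also have "a i \<le> Max (a ` {1..c})" using that by (intro Max_ge) auto
      finally show ?thesis by simp
    qed
    show "lk m i = 0" if "i \<notin> {1..c}" using m that by (auto simp: nonbox_def in_keys_iff)
  qed
  moreover have "finite {f. \<forall>i. (i \<in> {1..c} \<longrightarrow> f i \<in> {..<Max (a ` {1..c})}) \<and> (i \<notin> {1..c} \<longrightarrow> f i = (0::nat))}"
    by (rule finite_set_of_finite_funs) auto
  ultimately have "finite (lk ` (- nonbox c a))" by (rule finite_subset)
  then show ?thesis using \<open>inj_on lk (- nonbox c a)\<close> by (rule finite_imageD)
qed

definition mdeg :: "(nat \<Rightarrow>\<^sub>0 nat) \<Rightarrow> nat" where
  "mdeg m = (\<Sum>i\<in>ks m. lk m i)"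

lemma mdeg_add: "mdeg (m + e) = mdeg m + mdeg e"
proof -
  have *: "mdeg m = (\<Sum>i\<in>A. lk m i)" if "finite A" "ks m \<subseteq> A" for A m
    unfolding mdeg_def using that by (intro sum.mono_neutral_left) (auto simp: in_keys_iff)
  have "ks (m + e) \<subseteq> ks m \<union> ks e" by (rule Poly_Mapping.keys_add)
  then show ?thesis using *[of "ks m \<union> ks e" m] *[of "ks m \<union> ks e" e] *[of "ks m \<union> ks e" "m + e"]
    by (simp add: lookup_add sum.distrib)
qed

lemma mdeg_pos: "e \<noteq> 0 \<Longrightarrow> mdeg e > 0"
  unfolding mdeg_def by (rule sum_pos) (auto simp: in_keys_iff)

text \<open>A monomial of largest degree has this property. It serves to find socle elements: a
  monomial outside an ideal whose proper multiples all lie inside.\<close>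

lemma maximal_monomial:
  fixes A :: "(nat \<Rightarrow>\<^sub>0 nat) set"
  assumes "finite A" "A \<noteq> {}"
  shows "\<exists>m\<in>A. \<forall>e. e \<noteq> 0 \<longrightarrow> m + e \<notin> A"
proof -
  have "Max (mdeg ` A) \<in> mdeg ` A" using assms by (intro Max_in) auto
  then obtain m where m: "m \<in> A" "mdeg m = Max (mdeg ` A)" by auto
  have "m + e \<notin> A" if "e \<noteq> 0" for e
  proof
    assume "m + e \<in> A"
    then have "mdeg (m + e) \<le> Max (mdeg ` A)" using assms(1) by simp
    then show False using m(2) mdeg_pos[OF that] by (simp add: mdeg_add)
  qed
  then show ?thesis using m(1) by blast
qed

section \<open>The Tate complex over a truncated polynomial ring\<close>

locale two_powers =
  fixes c :: nat and a :: "nat \<Rightarrow> nat" and i j p \<alpha> \<beta> :: nat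
  assumes ij: "i \<in> {1..c}" "j \<in> {1..c}" "i \<noteq> j" and ai: "a i = p * \<alpha>" and aj: "a j = p * \<beta>"
    and p2: "p \<ge> 2" and pos: "\<alpha> > 0" "\<beta> > 0"
begin

abbreviation "N \<equiv> nonbox c a"

lemma funpow_mult: "((*) (vp l n) ^^ m) f = vp l (m * n) * (f :: 'k::comm_ring_1 mpoly)"
  by (induction m) (simp_all add: mult.assoc[symmetric] vp_mult)

definition e_exp :: "nat \<Rightarrow> nat \<Rightarrow> nat" where "e_exp n m = (if odd m then n else (p - 1) * n)"

lemma alt_mult: "alt_op ((*) (vp l n)) p m f = vp l (e_exp n m) * (f :: 'k::comm_ring_1 mpoly)"
  by (auto simp: alt_op_def e_exp_def funpow_mult)

lemma e_exp_add: "e_exp n m + e_exp n (m + 1) = p * n"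
proof -
  obtain q where q: "p = Suc q" using p2 by (cases p) auto
  then have "n + (p - 1) * n = p * n" by simp
  then show ?thesis by (simp add: e_exp_def)
qed

text \<open>Only the exponent at \<open>l\<close> changes, so a monomial outside \<open>N\<close>
  can enter it only by reaching the exponent a l there. In other words, the annihilator of X_l^k in
  A is generated by X_l^(a l - k).\<close>

lemma nonbox_shift:
  assumes "m + sg l k \<in> N" "l \<in> {1..c}" "a l = k + k'" shows "m \<in> N \<or> lk m l \<ge> k'"
proof (rule ccontr)
  assume "\<not> ?thesis"
  then have m: "ks m \<subseteq> {1..c}" "\<And>i. i \<in> {1..c} \<Longrightarrow> lk m i < a i" "lk m l < k'"
    by (auto simp: nonbox_def not_le)
  have "ks (m + sg l k) \<subseteq> {1..c}" using m(1) assms(2) Poly_Mapping.keys_add[of m "sg l k"]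
    by (auto split: if_splits)
  moreover have "\<forall>i\<in>{1..c}. lk (m + sg l k) i < a i"
  proof
    fix i assume "i \<in> {1..c}"
    then show "lk (m + sg l k) i < a i"
      using m(2) m(3) assms(3) by (auto simp: lookup_add lookup_single when_def)
  qed
  ultimately show False using assms(1) unfolding nonbox_def mem_Collect_eq by (meson not_le)
qed

lemma acyclic_u:
  fixes f :: "'k::field mpoly"
  assumes "alt_op ((*) (vp i \<alpha>)) p m f \<in> mono_ideal N"
  shows "\<exists>g. f - alt_op ((*) (vp i \<alpha>)) p (m + 1) g \<in> mono_ideal N"
proof -
  define k where "k = e_exp \<alpha> (m + 1)"
  have key: "m0 \<in> N \<or> lk m0 i \<ge> k" if "m0 \<in> ks f" for m0
    using mono_mult_mono_idealD[OF assms[unfolded alt_mult] _ that] nonbox_shift[of m0 i "e_exp \<alpha> m" k]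
      ij(1) ai e_exp_add[of \<alpha> m] by (simp add: k_def)
  have "\<exists>g. restr {m. lk m i \<ge> k} f = vp i k * g"
    by (rule mono_divides) (auto simp: in_keys_iff lookup_restr split: if_splits intro: monomial_split)
  then obtain g where g: "restr {m. lk m i \<ge> k} f = vp i k * g" by blast
  have "f - restr {m. lk m i \<ge> k} f \<in> mono_ideal N"
    using key by (auto simp: mono_ideal_iff lookup_minus lookup_restr in_keys_iff)
  then have "f - vp i k * g \<in> mono_ideal N" unfolding g .
  then show ?thesis unfolding alt_mult k_def by blast
qed

text \<open>Exactness for \<open>v\<close> over A/(u). Enlarging \<open>N\<close> by the multiples
  of \<open>u\<close> absorbs the summand with \<open>h\<close>; then every monomial of
  \<open>f\<close> vanishes in A, is divisible by \<open>u\<close>, or is divisible by the next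
  power of X_j. \<open>B\<close> excludes \<open>A\<close> so that no monomial is used
  twice.\<close>

lemma acyclic_uv:
  fixes f :: "'k::field mpoly"
  assumes "vp i \<alpha> * h + alt_op ((*) (vp j \<beta>)) p m f \<in> mono_ideal N"
  shows "\<exists>g g'. f - (vp i \<alpha> * g + alt_op ((*) (vp j \<beta>)) p (m + 1) g') \<in> mono_ideal N"
proof -
  define k where "k = e_exp \<beta> (m + 1)"
  define A where "A = {m :: nat \<Rightarrow>\<^sub>0 nat. lk m i \<ge> \<alpha>}"
  define B where "B = {m :: nat \<Rightarrow>\<^sub>0 nat. lk m j \<ge> k} - A"
  have "vp i \<alpha> * h \<in> mono_ideal (N \<union> A)"
    by (rule mono_mult_mono_ideal) (simp add: A_def lookup_add)
  moreover have "vp i \<alpha> * h + alt_op ((*) (vp j \<beta>)) p m f \<in> mono_ideal (N \<union> A)"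
    using assms by (rule mono_ideal_mono) auto
  ultimately have "alt_op ((*) (vp j \<beta>)) p m f \<in> mono_ideal (N \<union> A)"
    using mono_ideal_diff by fastforce
  then have key: "m0 \<in> N \<or> m0 \<in> A \<or> m0 \<in> B" if "m0 \<in> ks f" for m0
    using mono_mult_mono_idealD[of "sg j (e_exp \<beta> m)" 1 f "N \<union> A" m0] nonbox_shift[of m0 j "e_exp \<beta> m" k]
      ij aj e_exp_add[of \<beta> m] that
    by (auto simp: alt_mult k_def A_def B_def lookup_add lookup_single when_def)
  have "\<exists>g. restr A f = vp i \<alpha> * g"
    by (rule mono_divides) (auto simp: A_def in_keys_iff lookup_restr split: if_splits intro: monomial_split)
  then obtain g where g: "restr A f = vp i \<alpha> * g" by blast
  have "\<exists>g. restr B f = vp j k * g"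
    by (rule mono_divides) (auto simp: B_def in_keys_iff lookup_restr split: if_splits intro: monomial_split)
  then obtain g' where g': "restr B f = vp j k * g'" by blast
  have "f - (restr A f + restr B f) \<in> mono_ideal N"
    using key by (auto simp: mono_ideal_iff lookup_minus lookup_add lookup_restr in_keys_iff B_def)
  then show ?thesis unfolding g g' alt_mult k_def by blast
qed

definition uop :: "('t \<Rightarrow> 'k::comm_ring_1 mpoly) \<Rightarrow> 't \<Rightarrow> 'k mpoly" where "uop f = (\<lambda>t. vp i \<alpha> * f t)"
definition vop :: "('t \<Rightarrow> 'k::comm_ring_1 mpoly) \<Rightarrow> 't \<Rightarrow> 'k mpoly" where "vop f = (\<lambda>t. vp j \<beta> * f t)"

lemma uop_funpow: "(uop ^^ m) f t = ((*) (vp i \<alpha>) ^^ m) (f t)"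
  by (induction m) (simp_all add: uop_def)

lemma vop_funpow: "(vop ^^ m) f t = ((*) (vp j \<beta>) ^^ m) (f t)"
  by (induction m) (simp_all add: vop_def)

lemma tate_component: "tate uop vop p l z b t = tate ((*) (vp i \<alpha>)) ((*) (vp j \<beta>)) p l (\<lambda>b. z b t) b"
  by (simp add: tate_def alt_op_def uop_def vop_def uop_funpow vop_funpow)

lemma vp_power_ideal: "vp i (p * \<alpha>) * f \<in> mono_ideal N" "vp j (p * \<beta>) * f \<in> mono_ideal N"
proof -
  have "m + sg i (p * \<alpha>) \<in> N" for m using ij(1) ai by (auto simp: nonbox_def lookup_add intro!: bexI[of _ i])
  then show "vp i (p * \<alpha>) * f \<in> mono_ideal N" by (intro mono_mult_mono_ideal)
  have "m + sg j (p * \<beta>) \<in> N" for m using ij(2) aj by (auto simp: nonbox_def lookup_add intro!: bexI[of _ j])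
  then show "vp j (p * \<beta>) * f \<in> mono_ideal N" by (intro mono_mult_mono_ideal)
qed

lemma uop_pow: "(uop ^^ p) f t \<in> mono_ideal N" "(vop ^^ p) f t \<in> mono_ideal N"
  by (simp_all add: uop_funpow vop_funpow funpow_mult vp_power_ideal)

lemma tate_vec_acyclic:
  fixes z :: "nat \<Rightarrow> nat \<Rightarrow> 'k::field mpoly"
  assumes z: "z \<in> chains (coord_space n) l" "\<And>a t. tate uop vop p l z a t \<in> mono_ideal N" and l: "l \<ge> 1"
  shows "\<exists>y\<in>chains (coord_space n) (l + 1). \<forall>a t. z a t - tate uop vop p (l + 1) y a t \<in> mono_ideal N"
proof -
  let ?u = "(*) (vp i \<alpha>) :: 'k mpoly \<Rightarrow> _" and ?v = "(*) (vp j \<beta>) :: 'k mpoly \<Rightarrow> _"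
  have ex: "\<exists>y\<in>chains UNIV (l + 1). \<forall>a. z a t - tate ?u ?v p (l + 1) y a \<in> mono_ideal N" for t
  proof (rule tate_acyclic)
    show "(?u ^^ p) x \<in> mono_ideal N" "(?v ^^ p) x \<in> mono_ideal N" for x
      by (simp_all add: funpow_mult vp_power_ideal)
    show "(\<lambda>a. z a t) \<in> chains UNIV l" using z(1) by (auto simp: chains_def)
    show "tate ?u ?v p l (\<lambda>a. z a t) a \<in> mono_ideal N" for a using z(2)[of a t] by (simp add: tate_component)
    show "\<exists>y. x - alt_op ?u p (m + 1) y \<in> mono_ideal N" if "alt_op ?u p m x \<in> mono_ideal N" for x m
      using acyclic_u[OF that] .
    show "\<exists>y z. x - (?u y + alt_op ?v p (m + 1) z) \<in> mono_ideal N" if "?u y + alt_op ?v p m x \<in> mono_ideal N" for x y m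
      using acyclic_uv[OF that] .
  qed (use l p2 in \<open>auto simp: distrib_left mult.left_commute intro: mono_ideal_add mono_ideal_neg mono_ideal_mult[OF upset_nonbox]\<close>)
  then obtain y where y: "\<And>t. y t \<in> chains UNIV (l + 1)" "\<And>t a. z a t - tate ?u ?v p (l + 1) (y t) a \<in> mono_ideal N"
    by metis
  define y' where "y' = (\<lambda>a t. if t < n then y t a else 0)"
  have "y' \<in> chains (coord_space n) (l + 1)"
    using y(1) by (auto simp: y'_def chains_def coord_space_def fun_eq_iff)
  moreover have "z a t - tate uop vop p (l + 1) y' a t \<in> mono_ideal N" for a t
  proof (cases "t < n")
    case True
    then show ?thesis using y(2)[of a t] by (simp add: tate_component y'_def)
  next
    case False
    then have "z a t = 0" using z(1) by (cases "a \<le> l") (auto simp: chains_def coord_space_def)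
    moreover have "tate ?u ?v p (l + 1) (\<lambda>a. 0) a = 0" by (auto simp: tate_def alt_mult)
    ultimately show ?thesis using False by (simp add: tate_component y'_def)
  qed
  ultimately show ?thesis by blast
qed

text \<open>The monomials that vanish in A/(u,v).\<close>

definition J :: "(nat \<Rightarrow>\<^sub>0 nat) set" where "J = N \<union> {m. lk m i \<ge> \<alpha>} \<union> {m. lk m j \<ge> \<beta>}"

lemma upset_J: "upset J"
  using upset_nonbox[of c a] by (auto simp: upset_def J_def lookup_add)

lemma N_le_J: "N \<subseteq> J" by (auto simp: J_def)

lemma J_decomp:
  fixes f :: "'k::comm_ring_1 mpoly"
  assumes "f \<in> mono_ideal J" shows "\<exists>g h. f - (vp i \<alpha> * g + vp j \<beta> * h) \<in> mono_ideal N"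
proof -
  define A where "A = {m :: nat \<Rightarrow>\<^sub>0 nat. lk m i \<ge> \<alpha>}"
  define B where "B = {m :: nat \<Rightarrow>\<^sub>0 nat. lk m j \<ge> \<beta>} - A"
  have "\<exists>g. restr A f = vp i \<alpha> * g"
    by (rule mono_divides) (auto simp: A_def in_keys_iff lookup_restr split: if_splits intro: monomial_split)
  then obtain g where g: "restr A f = vp i \<alpha> * g" by blast
  have "\<exists>g. restr B f = vp j \<beta> * g"
    by (rule mono_divides) (auto simp: B_def in_keys_iff lookup_restr split: if_splits intro: monomial_split)
  then obtain g' where g': "restr B f = vp j \<beta> * g'" by blast
  have "f - (restr A f + restr B f) \<in> mono_ideal N"
    using assms by (auto simp: mono_ideal_iff lookup_minus lookup_add lookup_restr A_def B_def J_def)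
  then show ?thesis unfolding g g' by blast
qed

lemma vp_mult_J: "vp i \<alpha> * (f :: 'k::comm_ring_1 mpoly) \<in> mono_ideal J" "vp j \<beta> * (f :: 'k mpoly) \<in> mono_ideal J"
  by (rule mono_mult_mono_ideal; simp add: J_def lookup_add)+

end

section \<open>Bounding the homology by the Betti numbers\<close>

context k_space begin

lemma spanned_mod_subset: "V \<subseteq> W \<Longrightarrow> spanned_mod V W b"
  unfolding spanned_mod_def by (intro exI[of _ "{}"]) (auto intro!: bexI[of _ 0] span_zero)

text \<open>Generators modulo \<open>W1\<close> leave a remainder in the intersection of
  \<open>V\<close> and \<open>W1\<close>, which the second family of generators takes care
  of.\<close>

lemma spanned_mod_trans:
  assumes "spanned_mod V W1 b1" "spanned_mod (V \<inter> W1) W b2" "subspace V"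
  shows "spanned_mod V W (b1 + b2)"
proof -
  obtain S1 where S1: "finite S1" "card S1 \<le> b1" "S1 \<subseteq> V" "\<And>x. x \<in> V \<Longrightarrow> \<exists>s\<in>span S1. x - s \<in> W1"
    using assms(1) unfolding spanned_mod_def by blast
  obtain S2 where S2: "finite S2" "card S2 \<le> b2" "S2 \<subseteq> V \<inter> W1" "\<And>x. x \<in> V \<inter> W1 \<Longrightarrow> \<exists>s\<in>span S2. x - s \<in> W"
    using assms(2) unfolding spanned_mod_def by blast
  have "\<exists>s\<in>span (S1 \<union> S2). x - s \<in> W" if x: "x \<in> V" for x
  proof -
    obtain s where s: "s \<in> span S1" "x - s \<in> W1" using S1(4)[OF x] by blast
    have "s \<in> V" using s(1) S1(3) assms(3) span_minimal by blast
    then have "x - s \<in> V \<inter> W1" using s(2) x assms(3) subspace_diff by blast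
    then obtain t where t: "t \<in> span S2" "x - s - t \<in> W" using S2(4) by blast
    have "s + t \<in> span (S1 \<union> S2)" unfolding span_Un using s(1) t(1) by blast
    moreover have "x - (s + t) \<in> W" using t(2) by (simp add: diff_diff_eq)
    ultimately show ?thesis by blast
  qed
  moreover have "card (S1 \<union> S2) \<le> b1 + b2" using card_Un_le[of S1 S2] S1(2) S2(2) by linarith
  moreover have "S1 \<union> S2 \<subseteq> V" using S1(3) S2(3) by blast
  ultimately show ?thesis using S1(1) S2(1) unfolding spanned_mod_def by (intro exI[of _ "S1 \<union> S2"]) simp
qed

end

lemma upsetD: "upset U \<Longrightarrow> m \<in> U \<Longrightarrow> e + m \<in> U"
  by (auto simp: upset_def add.commute[of e])

definition poly_scale :: "'k::field \<Rightarrow> ('t \<Rightarrow> 'k mpoly) \<Rightarrow> 't \<Rightarrow> 'k mpoly" where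
  "poly_scale c f = (\<lambda>t. sg 0 c * f t)"

definition smul :: "'k::field mpoly \<Rightarrow> ('t \<Rightarrow> 'k mpoly) \<Rightarrow> 't \<Rightarrow> 'k mpoly" where
  "smul x f = (\<lambda>t. x * f t)"

interpretation pv: k_space "poly_scale :: 'k::field \<Rightarrow> (nat \<Rightarrow> 'k mpoly) \<Rightarrow> nat \<Rightarrow> 'k mpoly"
  by unfold_locales
    (auto simp: poly_scale_def fun_eq_iff distrib_left distrib_right single_add mult_single mult.assoc[symmetric])

lemma poly_scale_smul: "poly_scale c = smul (sg 0 c)"
  by (auto simp: poly_scale_def smul_def fun_eq_iff)

definition vec_ideal :: "(nat \<Rightarrow>\<^sub>0 nat) set \<Rightarrow> nat \<Rightarrow> (nat \<Rightarrow> 'k::field mpoly) set" where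
  "vec_ideal U n = {f \<in> coord_space n. \<forall>t. f t \<in> mono_ideal U}"

lemma smul_coord: "f \<in> coord_space n \<Longrightarrow> smul x f \<in> coord_space n"
  by (auto simp: coord_space_def smul_def)

lemma coord_add: "f \<in> coord_space n \<Longrightarrow> g \<in> coord_space n \<Longrightarrow> f + g \<in> coord_space n" for f g :: "nat \<Rightarrow> 'k::field mpoly"
  by (auto simp: coord_space_def)

lemma coord_diff: "f \<in> coord_space n \<Longrightarrow> g \<in> coord_space n \<Longrightarrow> f - g \<in> coord_space n" for f g :: "nat \<Rightarrow> 'k::field mpoly"
  by (auto simp: coord_space_def)

lemma vec_ideal_coord: "f \<in> vec_ideal U n \<Longrightarrow> f \<in> coord_space n"
  by (simp add: vec_ideal_def)

lemma vec_ideal_smul: "upset U \<Longrightarrow> f \<in> vec_ideal U n \<Longrightarrow> smul x f \<in> vec_ideal U n"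
  by (auto simp: vec_ideal_def smul_coord) (auto simp: smul_def intro: mono_ideal_mult)

lemma vec_ideal_add: "f \<in> vec_ideal U n \<Longrightarrow> g \<in> vec_ideal U n \<Longrightarrow> f + g \<in> vec_ideal U n"
  by (auto simp: vec_ideal_def coord_add intro: mono_ideal_add)

lemma vec_ideal_diff: "f \<in> vec_ideal U n \<Longrightarrow> g \<in> vec_ideal U n \<Longrightarrow> f - g \<in> vec_ideal U n"
  by (auto simp: vec_ideal_def coord_diff intro: mono_ideal_diff)

lemma vec_ideal_0: "0 \<in> vec_ideal U n"
  by (auto simp: vec_ideal_def coord_space_def)

lemma vec_ideal_mono: "f \<in> vec_ideal U n \<Longrightarrow> U \<subseteq> U' \<Longrightarrow> f \<in> vec_ideal U' n"
  by (auto simp: vec_ideal_def intro: mono_ideal_mono)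

lemma smul_add: "smul x (f + g) = smul x f + smul x g" "smul (x + y) f = smul x f + smul y f"
  "smul x (f - g) = smul x f - smul x g" "smul x (smul y f) = smul (x * y) f" "smul x 0 = 0" "smul 1 f = f"
  by (auto simp: smul_def fun_eq_iff algebra_simps)

lemma poly_subspaceI:
  assumes "0 \<in> W" "\<And>f g. f \<in> W \<Longrightarrow> g \<in> W \<Longrightarrow> f + g \<in> W" "\<And>c f. f \<in> W \<Longrightarrow> smul c f \<in> W"
  shows "pv.subspace W"
  using assms by (auto simp: pv.subspace_def poly_scale_smul)

text \<open>A sequence of maps between free modules over the polynomial ring that becomes a free resolution
  modulo the monomial ideal \<open>mono_ideal N\<close>; \<open>syz j\<close> are the relations of its \<open>j\<close>-th syzygy module.\<close>

locale poly_resolution =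
  fixes N :: "(nat \<Rightarrow>\<^sub>0 nat) set" and n :: "nat \<Rightarrow> nat"
    and D :: "nat \<Rightarrow> (nat \<Rightarrow> 'k::field mpoly) \<Rightarrow> nat \<Rightarrow> 'k mpoly"
    and syz :: "nat \<Rightarrow> (nat \<Rightarrow> 'k mpoly) set"
  assumes upN: "upset N" and finN: "finite (- N)"
    and D_add: "f \<in> coord_space (n (Suc j)) \<Longrightarrow> g \<in> coord_space (n (Suc j)) \<Longrightarrow> D j (f + g) - (D j f + D j g) \<in> vec_ideal N (n j)"
    and D_smul: "f \<in> coord_space (n (Suc j)) \<Longrightarrow> D j (smul x f) - smul x (D j f) \<in> vec_ideal N (n j)"
    and D_coord: "f \<in> coord_space (n (Suc j)) \<Longrightarrow> D j f \<in> coord_space (n j)"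
    and D_ideal: "f \<in> vec_ideal N (n (Suc j)) \<Longrightarrow> D j f \<in> vec_ideal N (n j)"
    and syz: "f \<in> syz j \<longleftrightarrow> f \<in> coord_space (n j) \<and> (\<exists>g\<in>coord_space (n (Suc j)). f - D j g \<in> vec_ideal N (n j))"
    and exact: "f \<in> coord_space (n (Suc j)) \<Longrightarrow> f \<in> syz (Suc j) \<longleftrightarrow> D j f \<in> vec_ideal N (n j)"
begin

lemma D_diff:
  assumes "f \<in> coord_space (n (Suc j))" "g \<in> coord_space (n (Suc j))"
  shows "D j (f - g) - (D j f - D j g) \<in> vec_ideal N (n j)"
proof -
  have "D j (f - g + g) - (D j (f - g) + D j g) \<in> vec_ideal N (n j)"
    by (rule D_add) (use assms coord_diff in auto)
  from vec_ideal_diff[OF vec_ideal_0 this] show ?thesis by (simp add: algebra_simps)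
qed

lemma syz_coord: "f \<in> syz j \<Longrightarrow> f \<in> coord_space (n j)"
  by (simp add: syz)

lemma D_syz: "f \<in> coord_space (n (Suc j)) \<Longrightarrow> D j f \<in> syz j"
  unfolding syz using D_coord vec_ideal_0 by (intro conjI bexI[of _ f]) auto

lemma syz_add: assumes "f \<in> syz j" "g \<in> syz j" shows "f + g \<in> syz j"
proof -
  from assms obtain f' g' where *: "f \<in> coord_space (n j)" "g \<in> coord_space (n j)"
    "f' \<in> coord_space (n (Suc j))" "g' \<in> coord_space (n (Suc j))"
    "f - D j f' \<in> vec_ideal N (n j)" "g - D j g' \<in> vec_ideal N (n j)" unfolding syz by blast
  have "(f - D j f') + (g - D j g') - (D j (f' + g') - (D j f' + D j g')) \<in> vec_ideal N (n j)"
    by (rule vec_ideal_diff[OF vec_ideal_add[OF *(5,6)] D_add[OF *(3,4)]])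
  then have "f + g - D j (f' + g') \<in> vec_ideal N (n j)" by (simp add: algebra_simps)
  then show ?thesis unfolding syz using * coord_add by blast
qed

lemma syz_smul: assumes "f \<in> syz j" shows "smul x f \<in> syz j"
proof -
  from assms obtain f' where *: "f \<in> coord_space (n j)"
    "f' \<in> coord_space (n (Suc j))" "f - D j f' \<in> vec_ideal N (n j)" unfolding syz by blast
  have "smul x (f - D j f') - (D j (smul x f') - smul x (D j f')) \<in> vec_ideal N (n j)"
    by (rule vec_ideal_diff[OF vec_ideal_smul[OF upN *(3)] D_smul[OF *(2)]])
  then have "smul x f - D j (smul x f') \<in> vec_ideal N (n j)" by (simp add: smul_add)
  then show ?thesis unfolding syz using * smul_coord by blast
qed

lemma ideal_syz: "f \<in> vec_ideal N (n j) \<Longrightarrow> f \<in> syz j"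
proof -
  assume f: "f \<in> vec_ideal N (n j)"
  have "D j 0 \<in> vec_ideal N (n j)" using vec_ideal_0 D_ideal by blast
  then show ?thesis unfolding syz using f vec_ideal_diff[OF f] vec_ideal_coord[OF f] vec_ideal_coord[OF vec_ideal_0] by blast
qed

lemma subspace_syz: "pv.subspace (syz j)"
  using ideal_syz[OF vec_ideal_0] syz_add syz_smul by (intro poly_subspaceI)

text \<open>A vector over the ideal of \<open>U\<close> is a sum of monomials of \<open>U\<close>
  times constant vectors \<open>h m\<close>, and \<open>D\<close> commutes with multiplication by
  monomials up to the ideal of \<open>N\<close>, which is contained in that of
  \<open>U\<close>.\<close>

lemma D_vec_ideal:
  assumes U: "upset U" "N \<subseteq> U" and f: "f \<in> vec_ideal U (n (Suc j))"
  shows "D j f \<in> vec_ideal U (n j)"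
proof -
  define M where "M = (\<Union>t\<in>{..<n (Suc j)}. ks (f t))"
  define h where "h m = (\<lambda>t. sg 0 (lk (f t) m) :: 'k mpoly)" for m :: "nat \<Rightarrow>\<^sub>0 nat"
  have fc: "f \<in> coord_space (n (Suc j))" using f vec_ideal_coord by blast
  have hc: "h m \<in> coord_space (n (Suc j))" for m using fc by (auto simp: h_def coord_space_def)
  have finM: "finite M" by (simp add: M_def)
  have MU: "M \<subseteq> U" using f by (auto simp: M_def vec_ideal_def mono_ideal_def)
  have "f t = (\<Sum>m\<in>M. smul (sg m 1) (h m)) t" for t
  proof (cases "t < n (Suc j)")
    case True
    have "f t = (\<Sum>m\<in>M. sg m (lk (f t) m))" using True finM
      by (subst mpoly_sum) (auto simp: M_def in_keys_iff intro!: sum.mono_neutral_left)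
    then show ?thesis by (simp add: sum_fun_apply smul_def h_def mult_single)
  next
    case False
    then show ?thesis using fc by (simp add: sum_fun_apply smul_def h_def coord_space_def)
  qed
  then have f_eq: "f = (\<Sum>m\<in>M. smul (sg m 1) (h m))" by auto
  have "(\<Sum>m\<in>K. smul (sg m 1) (h m)) \<in> coord_space (n (Suc j)) \<and>
      D j (\<Sum>m\<in>K. smul (sg m 1) (h m)) \<in> vec_ideal U (n j)" if "K \<subseteq> M" for K
    using finite_subset[OF that finM] that
  proof (induction K rule: finite_induct)
    case empty
    have "D j 0 \<in> vec_ideal N (n j)" using vec_ideal_0 D_ideal by blast
    then show ?case using vec_ideal_mono[OF _ U(2)] vec_ideal_coord[OF vec_ideal_0] unfolding sum.empty by blast
  next
    case (insert m K)
    let ?s = "\<Sum>m\<in>K. smul (sg m 1) (h m)"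
    have s: "?s \<in> coord_space (n (Suc j))" "D j ?s \<in> vec_ideal U (n j)" using insert by auto
    have c: "smul (sg m 1) (h m) \<in> coord_space (n (Suc j))" using hc smul_coord by blast
    have "smul (sg m 1) (D j (h m)) \<in> vec_ideal U (n j)"
      unfolding vec_ideal_def mem_Collect_eq
    proof (intro conjI allI smul_coord D_coord hc)
      fix t show "smul (sg m 1) (D j (h m)) t \<in> mono_ideal U" unfolding smul_def
        using insert.prems MU by (intro mono_mult_mono_ideal upsetD[OF U(1)]) auto
    qed
    then have "D j (smul (sg m 1) (h m)) \<in> vec_ideal U (n j)"
      using vec_ideal_add[OF vec_ideal_mono[OF D_smul[OF hc, of "sg m 1" m] U(2)]] by fastforce
    note h = this
    have "(D j (smul (sg m 1) (h m) + ?s) - (D j (smul (sg m 1) (h m)) + D j ?s)) + (D j (smul (sg m 1) (h m)) + D j ?s) \<in> vec_ideal U (n j)"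
      by (rule vec_ideal_add[OF vec_ideal_mono[OF D_add[OF c s(1)] U(2)] vec_ideal_add[OF h s(2)]])
    note this[unfolded diff_add_cancel]
    then show ?case unfolding sum.insert[OF insert.hyps] by (rule conjI[OF coord_add[OF c s(1)]])
  qed
  from this[of M] show ?thesis using f_eq by simp
qed

text \<open>\<open>cyc U j\<close> and \<open>bnd U j\<close> are the cycles and boundaries in
  degree j + 1 of the resolution tensored with the quotient by \<open>mono_ideal U\<close>, so their
  quotient is a Tor in degree j + 1.\<close>

definition cyc :: "(nat \<Rightarrow>\<^sub>0 nat) set \<Rightarrow> nat \<Rightarrow> (nat \<Rightarrow> 'k mpoly) set" where
  "cyc U j = {f \<in> coord_space (n (Suc j)). D j f \<in> vec_ideal U (n j)}"

definition bnd :: "(nat \<Rightarrow>\<^sub>0 nat) set \<Rightarrow> nat \<Rightarrow> (nat \<Rightarrow> 'k mpoly) set" where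
  "bnd U j = {x + y | x y. x \<in> vec_ideal U (n (Suc j)) \<and> y \<in> syz (Suc j)}"

lemma subspace_cyc: assumes "upset U" "N \<subseteq> U" shows "pv.subspace (cyc U j)"
proof (rule poly_subspaceI)
  show "0 \<in> cyc U j" using D_vec_ideal[OF assms vec_ideal_0] vec_ideal_coord[OF vec_ideal_0] by (auto simp: cyc_def)
  show "f + g \<in> cyc U j" if "f \<in> cyc U j" "g \<in> cyc U j" for f g
  proof -
    have "(D j (f + g) - (D j f + D j g)) + (D j f + D j g) \<in> vec_ideal U (n j)"
      using that by (intro vec_ideal_add vec_ideal_mono[OF D_add assms(2)]) (auto simp: cyc_def)
    then show ?thesis using that coord_add by (auto simp: cyc_def)
  qed
  show "smul x f \<in> cyc U j" if "f \<in> cyc U j" for x f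
  proof -
    have "(D j (smul x f) - smul x (D j f)) + smul x (D j f) \<in> vec_ideal U (n j)"
      using that by (intro vec_ideal_add vec_ideal_mono[OF D_smul assms(2)] vec_ideal_smul assms) (auto simp: cyc_def)
    then show ?thesis using that smul_coord by (auto simp: cyc_def)
  qed
qed

lemma bndI: "x \<in> vec_ideal U (n (Suc j)) \<Longrightarrow> y \<in> syz (Suc j) \<Longrightarrow> x + y \<in> bnd U j"
  by (auto simp: bnd_def)

lemma subspace_bnd: assumes "upset U" shows "pv.subspace (bnd U j)"
proof (rule poly_subspaceI)
  show "0 \<in> bnd U j" using bndI[OF vec_ideal_0 ideal_syz[OF vec_ideal_0]] by simp
  show "f + g \<in> bnd U j" if fg: "f \<in> bnd U j" "g \<in> bnd U j" for f g
  proof -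
    from fg obtain a b a' b' where *: "f = a + b" "g = a' + b'" "a \<in> vec_ideal U (n (Suc j))" "a' \<in> vec_ideal U (n (Suc j))"
      "b \<in> syz (Suc j)" "b' \<in> syz (Suc j)" by (auto simp: bnd_def)
    have "(a + a') + (b + b') \<in> bnd U j" using * by (intro bndI vec_ideal_add syz_add)
    then show ?thesis using * by (simp add: algebra_simps)
  qed
  show "smul x f \<in> bnd U j" if f: "f \<in> bnd U j" for x f
  proof -
    from f obtain a b where *: "f = a + b" "a \<in> vec_ideal U (n (Suc j))" "b \<in> syz (Suc j)" by (auto simp: bnd_def)
    have "smul x a + smul x b \<in> bnd U j" using * by (intro bndI vec_ideal_smul assms syz_smul)
    then show ?thesis using * by (simp add: smul_add)
  qed
qed

sublocale PP: k_space_pair "poly_scale :: 'k \<Rightarrow> (nat \<Rightarrow> 'k mpoly) \<Rightarrow> _" "poly_scale :: 'k \<Rightarrow> (nat \<Rightarrow> 'k mpoly) \<Rightarrow> _"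
  by unfold_locales

text \<open>Filtering \<open>mono_ideal U\<close> by adding one monomial at a time, each step contributing a copy of the
  homology modulo the maximal ideal.\<close>

lemma spanned_mod_upset:
  assumes b: "\<And>j. pv.spanned_mod (cyc (- {0}) j) (bnd (- {0}) j) b"
    and U: "upset U" "N \<subseteq> U"
  shows "pv.spanned_mod (cyc U j) (bnd U j) (card (- U) * b)"
  using U
proof (induction "card (- U)" arbitrary: U)
  case 0
  have "finite (- U)" by (rule finite_subset[OF _ finN]) (use 0(3) in auto)
  then have "U = UNIV" using 0 by auto
  have "cyc U j \<subseteq> bnd U j"
  proof
    fix f assume "f \<in> cyc U j"
    then have "f \<in> vec_ideal U (n (Suc j))" by (auto simp: cyc_def vec_ideal_def mono_ideal_def \<open>U = UNIV\<close>)
    from bndI[OF this ideal_syz[OF vec_ideal_0]] show "f \<in> bnd U j" by simp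
  qed
  then show ?case by (rule pv.spanned_mod_subset)
next
  case (Suc r)
  have fin: "finite (- U)" by (rule finite_subset[OF _ finN]) (use Suc.prems(2) in auto)
  have "- U \<noteq> {}" using Suc by auto
  \<comment> \<open>All proper multiples of \<open>m\<close> lie in \<open>U\<close>, so adding
    \<open>m\<close> gives an upset again and the two ideals differ by a copy of k.\<close>
  then obtain m where m: "m \<notin> U" "\<And>e. e \<noteq> 0 \<Longrightarrow> m + e \<in> U" using maximal_monomial[OF fin] by auto
  define U' where "U' = insert m U"
  have "x + e \<in> U'" if x: "x \<in> U'" for x e
  proof (cases "x \<in> U")
    case True
    then show ?thesis using upsetD[OF Suc.prems(1), of x e] by (simp add: U'_def add.commute)
  next
    case False
    then show ?thesis using x m(2)[of e] by (cases "e = 0") (auto simp: U'_def)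
  qed
  then have up': "upset U'" unfolding upset_def by blast
  have "- U' = - U - {m}" by (auto simp: U'_def)
  then have card': "card (- U') = r" using Suc(2) m(1) fin by (simp add: card_Diff_singleton)
  have N': "N \<subseteq> U'" using Suc.prems by (auto simp: U'_def)
  have "pv.spanned_mod (cyc U' j) (bnd U' j) (card (- U') * b)" using Suc(1)[of U'] card' up' N' by simp
  \<comment> \<open>The induction hypothesis bounds the homology for U', hence also the image in it
    of the homology for \<open>U\<close>.\<close>
  then have s1: "pv.spanned_mod (cyc U j) (bnd U' j) (r * b)"
    unfolding card'
  proof (rule pv.spanned_mod_subspace)
    show "cyc U j \<subseteq> cyc U' j" by (auto simp: cyc_def U'_def intro: vec_ideal_mono)
  qed (use subspace_cyc[OF Suc.prems] subspace_bnd[OF up'] in auto)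
  have mult_m: "smul (sg m 1) f \<in> vec_ideal U k" if "f \<in> vec_ideal (- {0}) k" for f :: "nat \<Rightarrow> 'k mpoly" and k
    unfolding vec_ideal_def mem_Collect_eq
  proof (intro conjI allI smul_coord vec_ideal_coord[OF that])
    fix t show "smul (sg m 1) f t \<in> mono_ideal U" unfolding smul_def
    proof (rule mono_mult_mono_ideal)
      fix x assume "x \<in> ks (f t)"
      then have "x \<noteq> 0" using that by (auto simp: vec_ideal_def mono_ideal_def)
      from m(2)[OF this] show "x + m \<in> U" by (simp only: add.commute)
    qed
  qed
  \<comment> \<open>The kernel of the map between these homologies comes from the homology modulo
    the maximal ideal through multiplication by the monomial \<open>m\<close>: the exactness of Tor
    in the middle term, with the relation as the graph of that map.\<close>
  have s2: "pv.spanned_mod (cyc U j \<inter> bnd U' j) (bnd U j) b"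
  proof (rule PP.spanned_mod_relation[OF b[of j], where R = "\<lambda>g f. g \<in> coord_space (n (Suc j)) \<and> f - smul (sg m 1) g \<in> bnd U j"])
    note sub = subspace_bnd[OF Suc.prems(1), of j]
    show "x' + y' \<in> coord_space (n (Suc j)) \<and> x + y - smul (sg m 1) (x' + y') \<in> bnd U j"
      if "x' \<in> coord_space (n (Suc j)) \<and> x - smul (sg m 1) x' \<in> bnd U j"
        "y' \<in> coord_space (n (Suc j)) \<and> y - smul (sg m 1) y' \<in> bnd U j" for x x' y y' :: "nat \<Rightarrow> 'k mpoly"
    proof -
      have "(x - smul (sg m 1) x') + (y - smul (sg m 1) y') \<in> bnd U j" using that by (intro pv.subspace_add[OF sub]) auto
      moreover have "(x - smul (sg m 1) x') + (y - smul (sg m 1) y') = x + y - smul (sg m 1) (x' + y')"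
        by (simp only: smul_add add_diff_add)
      ultimately show ?thesis using that coord_add[of x' _ y'] by simp
    qed
    show "poly_scale c x' \<in> coord_space (n (Suc j)) \<and> poly_scale c x - smul (sg m 1) (poly_scale c x') \<in> bnd U j"
      if "x' \<in> coord_space (n (Suc j)) \<and> x - smul (sg m 1) x' \<in> bnd U j" for c and x x' :: "nat \<Rightarrow> 'k mpoly"
    proof -
      have "poly_scale c (x - smul (sg m 1) x') \<in> bnd U j" using that by (intro pv.subspace_scale[OF sub]) auto
      moreover have "poly_scale c (x - smul (sg m 1) x') = poly_scale c x - smul (sg m 1) (poly_scale c x')"
        by (simp only: poly_scale_smul smul_add mult.commute)
      ultimately show ?thesis using that smul_coord[of x'] by (simp add: poly_scale_smul)
    qed
    show "\<exists>f\<in>cyc U j \<inter> bnd U' j. g \<in> coord_space (n (Suc j)) \<and> f - smul (sg m 1) g \<in> bnd U j"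
      if g: "g \<in> cyc (- {0}) j" for g :: "nat \<Rightarrow> 'k mpoly"
    proof -
      have gc: "g \<in> coord_space (n (Suc j))" using g by (simp add: cyc_def)
      have "smul (sg m 1) (D j g) \<in> vec_ideal U (n j)" using g by (intro mult_m) (simp add: cyc_def)
      then have "(D j (smul (sg m 1) g) - smul (sg m 1) (D j g)) + smul (sg m 1) (D j g) \<in> vec_ideal U (n j)"
        by (intro vec_ideal_add vec_ideal_mono[OF D_smul[OF gc] Suc.prems(2)])
      then have "smul (sg m 1) g \<in> cyc U j" using smul_coord[OF gc] by (simp add: cyc_def)
      moreover have "smul (sg m 1) g \<in> vec_ideal U' (n (Suc j))"
        unfolding vec_ideal_def mem_Collect_eq
      proof (intro conjI allI smul_coord gc)
        fix t show "smul (sg m 1) g t \<in> mono_ideal U'" unfolding smul_def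
          by (intro mono_mult_mono_ideal) (metis U'_def up' insertI1 upsetD)
      qed
      from bndI[OF this ideal_syz[OF vec_ideal_0]] have "smul (sg m 1) g \<in> bnd U' j" by simp
      moreover have "smul (sg m 1) g - smul (sg m 1) g \<in> bnd U j" using pv.subspace_0[OF sub] by simp
      ultimately show ?thesis using gc by blast
    qed
    show "\<exists>g\<in>cyc (- {0}) j. g \<in> coord_space (n (Suc j)) \<and> f - smul (sg m 1) g \<in> bnd U j"
      if f: "f \<in> cyc U j \<inter> bnd U' j" for f
    proof -
      from f obtain a b where ab: "f = a + b" "a \<in> vec_ideal U' (n (Suc j))" "b \<in> syz (Suc j)" by (auto simp: bnd_def)
      \<comment> \<open>Modulo \<open>U\<close>, a vector over U' is the monomial \<open>m\<close>
        times a constant vector; \<open>g\<close> collects the coefficients at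
        \<open>m\<close>.\<close>
      define g where "g = (\<lambda>t. sg 0 (lk (a t) m) :: 'k mpoly)"
      have gc: "g \<in> coord_space (n (Suc j))" using ab(2) by (auto simp: g_def vec_ideal_def coord_space_def)
      have a': "a - smul (sg m 1) g \<in> vec_ideal U (n (Suc j))"
        unfolding vec_ideal_def mem_Collect_eq
      proof (intro conjI allI coord_diff smul_coord gc vec_ideal_coord[OF ab(2)])
        fix t
        have "a t \<in> mono_ideal U'" using ab(2) by (simp add: vec_ideal_def)
        then show "(a - smul (sg m 1) g) t \<in> mono_ideal U"
          by (auto simp: smul_def g_def mult_single mono_ideal_iff lookup_minus lookup_single when_def U'_def)
      qed
      have eq: "f - smul (sg m 1) g = (a - smul (sg m 1) g) + b" using ab(1) by simp
      have fc: "f \<in> coord_space (n (Suc j))" using f by (simp add: cyc_def)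
      have bc: "b \<in> coord_space (n (Suc j))" by (rule syz_coord[OF ab(3)])
      have "D j b \<in> vec_ideal U (n j)" using exact[OF bc] ab(3) vec_ideal_mono[OF _ Suc.prems(2)] by blast
      moreover have "D j (a - smul (sg m 1) g) \<in> vec_ideal U (n j)" by (rule D_vec_ideal[OF Suc.prems a'])
      ultimately have "(D j ((a - smul (sg m 1) g) + b) - (D j (a - smul (sg m 1) g) + D j b)) + (D j (a - smul (sg m 1) g) + D j b) \<in> vec_ideal U (n j)"
        by (intro vec_ideal_add vec_ideal_mono[OF D_add Suc.prems(2)] vec_ideal_coord[OF a'] bc)
      then have D1: "D j (f - smul (sg m 1) g) \<in> vec_ideal U (n j)" unfolding eq by simp
      have "D j f \<in> vec_ideal U (n j)" using f by (simp add: cyc_def)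
      \<comment> \<open>The terms cancel to the monomial \<open>m\<close> times
        \<open>D j g\<close>; each bracket is in the ideal of \<open>U\<close> by a congruence for
        \<open>D\<close>.\<close>
      then have "D j f - ((D j (f - smul (sg m 1) g)) - (D j (f - smul (sg m 1) g) - (D j f - D j (smul (sg m 1) g))))
          - (D j (smul (sg m 1) g) - smul (sg m 1) (D j g)) \<in> vec_ideal U (n j)"
        by (rule vec_ideal_diff[OF vec_ideal_diff[OF _ vec_ideal_diff[OF D1 vec_ideal_mono[OF D_diff[OF fc smul_coord[OF gc]] Suc.prems(2)]]]
          vec_ideal_mono[OF D_smul[OF gc] Suc.prems(2)]])
      then have "smul (sg m 1) (D j g) \<in> vec_ideal U (n j)" by simp
      \<comment> \<open>A constant term of \<open>D j g t\<close> would put the monomial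
        \<open>m\<close> itself into \<open>U\<close>.\<close>
      have "D j g t \<in> mono_ideal (- {0})" for t
      proof -
        have "sg m 1 * D j g t \<in> mono_ideal U"
          using \<open>smul (sg m 1) (D j g) \<in> vec_ideal U (n j)\<close> by (simp add: vec_ideal_def smul_def)
        then have "e + m \<in> U" if "e \<in> ks (D j g t)" for e by (rule mono_mult_mono_idealD[OF _ one_neq_zero that])
        then have "0 \<notin> ks (D j g t)" using m(1) by force
        then show ?thesis by (auto simp: mono_ideal_def)
      qed
      then have "g \<in> cyc (- {0}) j" using gc D_coord by (simp add: cyc_def vec_ideal_def)
      moreover have "f - smul (sg m 1) g \<in> bnd U j" unfolding eq using a' ab(3) by (rule bndI)
      ultimately show ?thesis using gc by blast
    qed
    show "f \<in> bnd U j" if R: "g \<in> coord_space (n (Suc j)) \<and> f - smul (sg m 1) g \<in> bnd U j" and g: "g \<in> bnd (- {0}) j" for g f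
    proof -
      from g obtain a b where ab: "g = a + b" "a \<in> vec_ideal (- {0}) (n (Suc j))" "b \<in> syz (Suc j)" by (auto simp: bnd_def)
      have "smul (sg m 1) a + smul (sg m 1) b \<in> bnd U j" using ab by (intro bndI mult_m syz_smul)
      then have "(f - smul (sg m 1) g) + smul (sg m 1) g \<in> bnd U j" using R ab(1) by (intro pv.subspace_add[OF sub]) (auto simp: smul_add)
      then show ?thesis by simp
    qed
  qed
  have "pv.spanned_mod (cyc U j) (bnd U j) (r * b + b)"
    by (rule pv.spanned_mod_trans[OF s1 s2 subspace_cyc[OF Suc.prems]])
  then show ?case using Suc(2) by (metis add.commute mult_Suc)
qed

end

section \<open>Dimension shifting along the resolution\<close>

locale tate_resolution = two_powers c a i j p \<alpha> \<beta> + poly_resolution "nonbox c a" n D syz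
  for c a i j p \<alpha> \<beta> n D and syz :: "nat \<Rightarrow> (nat \<Rightarrow> 'k::field mpoly) set"
begin

abbreviation "CS k \<equiv> coord_space (n k) :: (nat \<Rightarrow> 'k mpoly) set"
abbreviation "T \<equiv> tate (uop :: (nat \<Rightarrow> 'k mpoly) \<Rightarrow> _) vop p"

text \<open>Equality in the free A-module of rank \<open>n k\<close>, expressed for polynomial
  representatives.\<close>

definition cg :: "nat \<Rightarrow> (nat \<Rightarrow> 'k mpoly) \<Rightarrow> (nat \<Rightarrow> 'k mpoly) \<Rightarrow> bool" where
  "cg k f g \<longleftrightarrow> f - g \<in> vec_ideal N (n k)"

lemma cg_refl: "cg k f f" by (simp add: cg_def vec_ideal_0)

lemma cg_sym: "cg k f g \<Longrightarrow> cg k g f"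
  unfolding cg_def using vec_ideal_diff[OF vec_ideal_0, of "f - g"] by simp

lemma cg_trans: "cg k f g \<Longrightarrow> cg k g h \<Longrightarrow> cg k f h"
  unfolding cg_def using vec_ideal_add[of "f - g" N "n k" "g - h"] by simp

lemma cg_add: "cg k f g \<Longrightarrow> cg k f' g' \<Longrightarrow> cg k (f + f') (g + g')"
  unfolding cg_def add_diff_add by (rule vec_ideal_add)

lemma cg_diff: "cg k f g \<Longrightarrow> cg k f' g' \<Longrightarrow> cg k (f - f') (g - g')"
  unfolding cg_def using vec_ideal_diff[of "f - g" N "n k" "f' - g'"] by (simp add: algebra_simps)

lemma cg_smul: "cg k f g \<Longrightarrow> cg k (smul x f) (smul x g)"
  unfolding cg_def smul_add(3)[symmetric] by (rule vec_ideal_smul[OF upN])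

lemma cg_D_add: "f \<in> CS (Suc k) \<Longrightarrow> g \<in> CS (Suc k) \<Longrightarrow> cg k (D k (f + g)) (D k f + D k g)"
  unfolding cg_def by (rule D_add)

lemma cg_D_smul: "f \<in> CS (Suc k) \<Longrightarrow> cg k (D k (smul x f)) (smul x (D k f))"
  unfolding cg_def by (rule D_smul)

lemma cg_D: "f \<in> CS (Suc k) \<Longrightarrow> g \<in> CS (Suc k) \<Longrightarrow> cg (Suc k) f g \<Longrightarrow> cg k (D k f) (D k g)"
  unfolding cg_def using vec_ideal_diff[OF D_ideal D_diff, of "f - g" k f g] by simp

lemma cg_D_0: "cg k (D k 0) 0"
  unfolding cg_def using D_ideal[OF vec_ideal_0] by simp

lemma cg_syz: "cg k f g \<Longrightarrow> g \<in> syz k \<Longrightarrow> f \<in> syz k"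
  unfolding cg_def using syz_add[OF ideal_syz, of "f - g" k g] by simp

lemma cg_J: "cg k f g \<Longrightarrow> g \<in> vec_ideal J (n k) \<Longrightarrow> f \<in> vec_ideal J (n k)"
  unfolding cg_def using vec_ideal_add[OF vec_ideal_mono[OF _ N_le_J], of "f - g" "n k" g] by simp

lemma syz_exact: "f \<in> CS (Suc k) \<Longrightarrow> f \<in> syz (Suc k) \<longleftrightarrow> cg k (D k f) 0"
  using exact by (simp add: cg_def)

lemma syz_preimage: "f \<in> syz k \<Longrightarrow> \<exists>g\<in>CS (Suc k). cg k f (D k g)"
  by (simp add: cg_def syz)

definition tx :: "nat \<Rightarrow> 'k mpoly" where "tx b = vp i (e_exp \<alpha> (b + 1))"
definition ty :: "nat \<Rightarrow> nat \<Rightarrow> 'k mpoly" where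
  "ty l b = (if even b then vp j (e_exp \<beta> (l - b)) else - vp j (e_exp \<beta> (l - b)))"

lemma T_smul: "T l z b = (if b < l then smul (tx b) (z (b + 1)) + smul (ty l b) (z b) else 0)"
proof -
  have "alt_op (uop :: (nat \<Rightarrow> 'k mpoly) \<Rightarrow> _) p m f = smul (vp i (e_exp \<alpha> m)) f" for m f
    by (auto simp: alt_op_def e_exp_def uop_funpow funpow_mult smul_def uop_def)
  moreover have "alt_op (vop :: (nat \<Rightarrow> 'k mpoly) \<Rightarrow> _) p m f = smul (vp j (e_exp \<beta> m)) f" for m f
    by (auto simp: alt_op_def e_exp_def vop_funpow funpow_mult smul_def vop_def)
  moreover have "smul (- x) f = - smul x f" for x :: "'k mpoly" and f :: "nat \<Rightarrow> 'k mpoly"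
    by (auto simp: smul_def)
  ultimately show ?thesis by (simp add: tate_def tx_def ty_def)
qed

lemma T_add: "T l (z + z') = T l z + T l z'"
  by (rule ext) (simp add: T_smul smul_add)

lemma T_add_apply: "T l (z + z') b = T l z b + T l z' b"
  by (simp add: T_add)

lemma fun2_add: "(f + g) b = f b + g b" for f g :: "nat \<Rightarrow> nat \<Rightarrow> 'k mpoly"
  by simp

lemma T_diff: "T l (z - z') = T l z - T l z'"
  by (rule ext) (simp add: T_smul smul_add)

lemma T_diff_apply: "T l (z - z') b = T l z b - T l z' b"
  by (simp add: T_diff)

lemma T_scale: "T l (pv.fscale x z) = pv.fscale x (T l z)"
  by (rule ext) (auto simp: T_smul smul_add poly_scale_smul mult.commute)

lemma T_coord: "z \<in> chains (CS k) l \<Longrightarrow> T l z b \<in> CS k"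
  by (auto simp: T_smul chains_def intro!: coord_add smul_coord vec_ideal_coord[OF vec_ideal_0])

lemma T_T: "z \<in> chains (CS k) (l + 1) \<Longrightarrow> cg k (T l (T (l + 1) z) b) 0"
proof (cases "b < l")
  case True
  assume z: "z \<in> chains (CS k) (l + 1)"
  have c: "tx b * ty (l + 1) (b + 1) + ty l b * tx b = 0" by (simp add: tx_def ty_def mult.commute)
  have ideal: "smul x (z d) \<in> vec_ideal N (n k)" if "\<And>f. x * f \<in> mono_ideal N" for x d
  proof -
    have "z d \<in> CS k" using z by (cases "d \<le> l + 1") (auto simp: chains_def coord_space_def)
    then show ?thesis using smul_coord that by (auto simp: vec_ideal_def) (simp add: smul_def)
  qed
  have x: "tx b * tx (b + 1) = vp i (p * \<alpha>)"
    using e_exp_add[of \<alpha> "b + 1"] by (simp add: tx_def vp_mult)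
  have "ty l b * ty (l + 1) b = vp j (e_exp \<beta> (l - b) + e_exp \<beta> (l + 1 - b))"
    by (auto simp: ty_def vp_mult)
  also have "l + 1 - b = l - b + 1" using True by simp
  finally have y: "ty l b * ty (l + 1) b = vp j (p * \<beta>)" unfolding e_exp_add .
  have "T l (T (l + 1) z) b = smul (tx b * tx (b + 1)) (z (b + 2))
      + smul (tx b * ty (l + 1) (b + 1) + ty l b * tx b) (z (b + 1)) + smul (ty l b * ty (l + 1) b) (z b)"
    using True by (simp add: T_smul smul_add)
  also have "\<dots> = smul (vp i (p * \<alpha>)) (z (b + 2)) + smul (vp j (p * \<beta>)) (z b)"
    unfolding c x y by (simp add: smul_def fun_eq_iff)
  finally show ?thesis unfolding cg_def diff_zero
    by (simp only: vec_ideal_add[OF ideal[OF vp_power_ideal(1)] ideal[OF vp_power_ideal(2)]])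
qed (simp add: T_smul cg_refl)

text \<open>The cut at \<open>l\<close> is explicit because \<open>D k 0\<close> is only congruent
  to 0.\<close>

definition DD :: "nat \<Rightarrow> nat \<Rightarrow> (nat \<Rightarrow> nat \<Rightarrow> 'k mpoly) \<Rightarrow> nat \<Rightarrow> nat \<Rightarrow> 'k mpoly" where
  "DD k l z = (\<lambda>b. if b \<le> l then D k (z b) else 0)"

lemma DD_chains: "z \<in> chains (CS (Suc k)) l \<Longrightarrow> DD k l z \<in> chains (CS k) l"
  by (auto simp: DD_def chains_def intro: D_coord)

lemma DD_syz: "z \<in> chains (CS (Suc k)) l \<Longrightarrow> DD k l z b \<in> syz k"
  using D_syz ideal_syz[OF vec_ideal_0] by (auto simp: DD_def chains_def)

lemma DD_T: assumes z: "z \<in> chains (CS (Suc k)) l" shows "cg k (T l (DD k l z) b) (D k (T l z b))"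
proof (cases "b < l")
  case True
  then have zb: "z (b + 1) \<in> CS (Suc k)" "z b \<in> CS (Suc k)" using z by (auto simp: chains_def)
  have "cg k (D k (smul (tx b) (z (b + 1)) + smul (ty l b) (z b))) (D k (smul (tx b) (z (b + 1))) + D k (smul (ty l b) (z b)))"
    by (rule cg_D_add[OF smul_coord[OF zb(1)] smul_coord[OF zb(2)]])
  note eq = cg_trans[OF this cg_add[OF cg_D_smul[OF zb(1)] cg_D_smul[OF zb(2)]]]
  have "T l (DD k l z) b = smul (tx b) (D k (z (b + 1))) + smul (ty l b) (D k (z b))"
    and "T l z b = smul (tx b) (z (b + 1)) + smul (ty l b) (z b)" using True by (simp_all add: T_smul DD_def)
  then show ?thesis using cg_sym[OF eq] by simp
qed (simp add: T_smul cg_sym[OF cg_D_0])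

text \<open>With coefficients in a free A-module the Tate complex has no homology in positive
  degrees. This is what permits dimension shifting along the resolution.\<close>

lemma acyclic:
  assumes z: "z \<in> chains (CS k) l" "\<And>b. b < l \<Longrightarrow> cg k (T l z b) 0" and l: "l \<ge> 1"
  shows "\<exists>y\<in>chains (CS k) (l + 1). \<forall>b. cg k (z b) (T (l + 1) y b)"
proof -
  have "T l z b t \<in> mono_ideal N" for b t
    using z(2)[of b] by (cases "b < l") (auto simp: cg_def vec_ideal_def T_smul)
  from tate_vec_acyclic[OF z(1) this l] obtain y where y: "y \<in> chains (CS k) (l + 1)"
    "\<And>b t. z b t - T (l + 1) y b t \<in> mono_ideal N" by blast
  have "z b \<in> CS k" for b
    using z(1) vec_ideal_coord[OF vec_ideal_0] by (cases "b \<le> l") (auto simp: chains_def)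
  then have "z b - T (l + 1) y b \<in> CS k" for b by (rule coord_diff[OF _ T_coord[OF y(1)]])
  then show ?thesis using y by (intro bexI[of _ y]) (auto simp: cg_def vec_ideal_def)
qed

text \<open>\<open>Zc k l\<close> modulo \<open>Bc k l\<close> is the homology in degree
  \<open>l\<close> of the Tate complex with coefficients in the quotient of the free module of rank
  \<open>n k\<close> by \<open>syz k\<close>. For k = 0 that quotient is E, for larger k a syzygy
  module of E.\<close>

definition Zc where "Zc k l = {z \<in> chains (CS k) l. T l z \<in> chains (syz k) (l - 1)}"
definition Bc where "Bc k l = {z \<in> chains (CS k) l. \<exists>y\<in>chains (CS k) (l + 1). z - T (l + 1) y \<in> chains (syz k) l}"

lemma Zc_iff: "l \<ge> 1 \<Longrightarrow> z \<in> Zc k l \<longleftrightarrow> z \<in> chains (CS k) l \<and> (\<forall>b<l. T l z b \<in> syz k)"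
  by (auto simp: Zc_def chains_def) (auto simp: T_smul)

lemma BcI:
  assumes z: "z \<in> chains (CS k) l" and y: "y \<in> chains (CS k) (l + 1)" and s: "\<And>b. b \<le> l \<Longrightarrow> z b - T (l + 1) y b \<in> syz k"
  shows "z \<in> Bc k l"
  unfolding Bc_def mem_Collect_eq using z y s
  by (intro conjI bexI[of _ y]) (auto simp: chains_def T_smul)

sublocale FP: k_space "pv.fscale :: 'k \<Rightarrow> (nat \<Rightarrow> nat \<Rightarrow> 'k mpoly) \<Rightarrow> _" by (rule pv.k_space_fun)
sublocale PFP: k_space_pair "poly_scale :: 'k \<Rightarrow> (nat \<Rightarrow> 'k mpoly) \<Rightarrow> _" "pv.fscale :: 'k \<Rightarrow> (nat \<Rightarrow> nat \<Rightarrow> 'k mpoly) \<Rightarrow> _"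
  by (intro k_space_pair.intro pv.k_space_fun) unfold_locales
sublocale FFP: k_space_pair "pv.fscale :: 'k \<Rightarrow> (nat \<Rightarrow> nat \<Rightarrow> 'k mpoly) \<Rightarrow> _" "pv.fscale :: 'k \<Rightarrow> (nat \<Rightarrow> nat \<Rightarrow> 'k mpoly) \<Rightarrow> _"
  by (simp add: k_space_pair_def pv.k_space_fun)

lemma chains_add: "z \<in> chains (CS k) l \<Longrightarrow> z' \<in> chains (CS k) l \<Longrightarrow> z + z' \<in> chains (CS k) l"
  by (auto simp: chains_def intro: coord_add)

lemma chains_diff: "z \<in> chains (CS k) l \<Longrightarrow> z' \<in> chains (CS k) l \<Longrightarrow> z - z' \<in> chains (CS k) l"
  by (auto simp: chains_def intro: coord_diff)

lemma chains_scale: "z \<in> chains (CS k) l \<Longrightarrow> pv.fscale x z \<in> chains (CS k) l"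
  by (auto simp: chains_def poly_scale_smul smul_add intro: smul_coord)

lemma cg_scale: "f' \<in> CS (Suc k) \<Longrightarrow> cg k f (D k f') \<Longrightarrow> cg k (poly_scale x f) (D k (poly_scale x f'))"
  unfolding poly_scale_smul by (rule cg_trans[OF cg_smul cg_sym[OF cg_D_smul]])

lemma J_vec_decomp:
  assumes "f \<in> vec_ideal J (n k)"
  shows "\<exists>g\<in>CS k. \<exists>h\<in>CS k. cg k f (smul (vp i \<alpha>) g + smul (vp j \<beta>) h)"
proof -
  have "\<forall>t. \<exists>g h. f t - (vp i \<alpha> * g + vp j \<beta> * h) \<in> mono_ideal N"
    using assms J_decomp by (auto simp: vec_ideal_def)
  then obtain g h where gh: "\<And>t. f t - (vp i \<alpha> * g t + vp j \<beta> * h t) \<in> mono_ideal N" by metis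
  define g' where "g' = (\<lambda>t. if t < n k then g t else 0)"
  define h' where "h' = (\<lambda>t. if t < n k then h t else 0)"
  have c: "g' \<in> CS k" "h' \<in> CS k" by (auto simp: g'_def h'_def coord_space_def)
  have fc: "f \<in> CS k" using assms by (rule vec_ideal_coord)
  have "f - (smul (vp i \<alpha>) g' + smul (vp j \<beta>) h') \<in> CS k"
    by (rule coord_diff[OF fc coord_add[OF smul_coord[OF c(1)] smul_coord[OF c(2)]]])
  moreover have "(f - (smul (vp i \<alpha>) g' + smul (vp j \<beta>) h')) t \<in> mono_ideal N" for t
    using gh[of t] fc by (cases "t < n k") (auto simp: smul_def g'_def h'_def coord_space_def)
  ultimately have "cg k f (smul (vp i \<alpha>) g' + smul (vp j \<beta>) h')" by (auto simp: cg_def vec_ideal_def)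
  then show ?thesis using c by blast
qed

lemma T_one: "T 1 z 0 = smul (vp i \<alpha>) (z 1) + smul (vp j \<beta>) (z 0)"
  by (simp add: T_smul tx_def ty_def e_exp_def)

text \<open>Both quotients are (Z \<inter> J F)/(J Z), where Z is \<open>syz k\<close> in the free
  module F of rank \<open>n k\<close> and J is the ideal (u,v). A cycle \<open>f\<close> of the
  resolution enters through D f, a Tate cycle \<open>z\<close> through u z_1 + v z_0, and the
  relation equates these two elements.\<close>

lemma spanned_base:
  assumes b: "pv.spanned_mod (cyc J k) (bnd J k) b"
  shows "FP.spanned_mod (Zc k 1) (Bc k 1) b"
proof (rule PFP.spanned_mod_relation[OF b, where R = "\<lambda>f z. z \<in> chains (CS k) 1 \<and> f \<in> CS (Suc k) \<and> cg k (T 1 z 0) (D k f)"])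
  show "x + y \<in> chains (CS k) 1 \<and> x' + y' \<in> CS (Suc k) \<and> cg k (T 1 (x + y) 0) (D k (x' + y'))"
    if "x \<in> chains (CS k) 1 \<and> x' \<in> CS (Suc k) \<and> cg k (T 1 x 0) (D k x')"
      "y \<in> chains (CS k) 1 \<and> y' \<in> CS (Suc k) \<and> cg k (T 1 y 0) (D k y')" for x y x' y'
  proof -
    have "cg k (T 1 x 0 + T 1 y 0) (D k (x' + y'))"
      by (rule cg_trans[OF cg_add cg_sym[OF cg_D_add]]) (use that in auto)
    then show ?thesis unfolding T_add_apply
      by (intro conjI chains_add coord_add) (use that in \<open>simp_all only:\<close>)
  qed
  show "pv.fscale c x \<in> chains (CS k) 1 \<and> poly_scale c x' \<in> CS (Suc k) \<and> cg k (T 1 (pv.fscale c x) 0) (D k (poly_scale c x'))"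
    if "x \<in> chains (CS k) 1 \<and> x' \<in> CS (Suc k) \<and> cg k (T 1 x 0) (D k x')" for c x x'
    unfolding T_scale by (intro conjI chains_scale cg_scale smul_coord[of x' _ "sg 0 c", folded poly_scale_smul]) (use that in \<open>simp_all only:\<close>)
  show "\<exists>x\<in>Zc k 1. x \<in> chains (CS k) 1 \<and> f \<in> CS (Suc k) \<and> cg k (T 1 x 0) (D k f)" if f: "f \<in> cyc J k" for f
  proof -
    have fc: "f \<in> CS (Suc k)" "D k f \<in> vec_ideal J (n k)" using f by (auto simp: cyc_def)
    obtain g h where gh: "g \<in> CS k" "h \<in> CS k" "cg k (D k f) (smul (vp i \<alpha>) g + smul (vp j \<beta>) h)"
      using J_vec_decomp[OF fc(2)] by blast
    define z where "z = (\<lambda>b::nat. if b = 0 then h else if b = 1 then g else 0)"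
    have z: "z \<in> chains (CS k) 1" using gh by (auto simp: z_def chains_def)
    have T: "cg k (T 1 z 0) (D k f)" unfolding T_one using cg_sym[OF gh(3)] by (simp add: z_def)
    then have "T 1 z 0 \<in> syz k" using cg_syz D_syz[OF fc(1)] by blast
    then have "z \<in> Zc k 1" using z by (simp add: Zc_iff)
    then show ?thesis using z fc(1) T by blast
  qed
  show "\<exists>f\<in>cyc J k. z \<in> chains (CS k) 1 \<and> f \<in> CS (Suc k) \<and> cg k (T 1 z 0) (D k f)" if z: "z \<in> Zc k 1" for z
  proof -
    have zc: "z \<in> chains (CS k) 1" "T 1 z 0 \<in> syz k" using z by (auto simp: Zc_iff)
    obtain f where f: "f \<in> CS (Suc k)" "cg k (T 1 z 0) (D k f)" using syz_preimage[OF zc(2)] by blast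
    have "T 1 z 0 \<in> vec_ideal J (n k)" unfolding vec_ideal_def mem_Collect_eq
    proof (intro conjI allI T_coord[OF zc(1)])
      show "T 1 z 0 t \<in> mono_ideal J" for t unfolding T_one using vp_mult_J by (auto simp: smul_def intro: mono_ideal_add)
    qed
    then have "f \<in> cyc J k" using cg_J[OF cg_sym[OF f(2)]] f(1) by (simp add: cyc_def)
    then show ?thesis using f zc by blast
  qed
  show "z \<in> Bc k 1" if R: "z \<in> chains (CS k) 1 \<and> f \<in> CS (Suc k) \<and> cg k (T 1 z 0) (D k f)" and f: "f \<in> bnd J k" for f z
  proof -
    obtain x y where xy: "f = x + y" "x \<in> vec_ideal J (n (Suc k))" "y \<in> syz (Suc k)" using f by (auto simp: bnd_def)
    obtain g h where gh: "g \<in> CS (Suc k)" "h \<in> CS (Suc k)" "cg (Suc k) x (smul (vp i \<alpha>) g + smul (vp j \<beta>) h)"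
      using J_vec_decomp[OF xy(2)] by blast
    note xc = vec_ideal_coord[OF xy(2)] and yc = syz_coord[OF xy(3)]
    have "cg k (D k f) (D k x + D k y)" unfolding xy(1) by (rule cg_D_add[OF xc yc])
    moreover have "cg k (D k x + D k y) (D k x + 0)" using xy(3) by (intro cg_add cg_refl) (simp add: syz_exact[OF yc])
    ultimately have fx: "cg k (D k f) (D k x)" using cg_trans by fastforce
    \<comment> \<open>Since \<open>x\<close> is u g + v h modulo \<open>N\<close>, the differentials
      of \<open>z\<close> and of D z' agree there. So z - D z' is a cycle with free coefficients,
      and \<open>acyclic\<close> makes it a boundary.\<close>
    define z' where "z' = (\<lambda>b::nat. if b = 0 then h else if b = 1 then g else 0)"
    have z': "z' \<in> chains (CS (Suc k)) 1" using gh by (auto simp: z'_def chains_def)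
    have "cg (Suc k) x (T 1 z' 0)" unfolding T_one using gh(3) by (simp add: z'_def)
    from cg_D[OF xc T_coord[OF z'] this] have "cg k (D k x) (D k (T 1 z' 0))" .
    then have "cg k (T 1 z 0) (T 1 (DD k 1 z') 0)"
      using cg_trans[OF cg_trans[OF conjunct2[OF conjunct2[OF R]] fx]] cg_trans cg_sym[OF DD_T[OF z']] by blast
    then have T0: "cg k (T 1 (z - DD k 1 z') b) 0" if "b < 1" for b
      using that by (simp add: T_diff cg_def)
    have "z - DD k 1 z' \<in> chains (CS k) 1" using R chains_diff DD_chains[OF z'] by blast
    from acyclic[OF this T0] obtain w where w: "w \<in> chains (CS k) (1 + 1)" "\<And>b. cg k ((z - DD k 1 z') b) (T (1 + 1) w b)" by auto
    have "z b - T (1 + 1) w b \<in> syz k" for b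
    proof -
      have "((z - DD k 1 z') b - T (1 + 1) w b) + DD k 1 z' b \<in> syz k"
        by (intro syz_add DD_syz z' ideal_syz) (use w(2)[of b] in \<open>simp only: cg_def\<close>)
      then show ?thesis by (simp add: algebra_simps)
    qed
    then show ?thesis using BcI[OF _ w(1)] R by blast
  qed
qed

text \<open>The quotient M of the free module by \<open>syz k\<close> and the next quotient M' fit
  into 0 -> M' -> F -> M -> 0 with F free, hence acyclic. So the homology of M in degree l + 1 is
  that of M' in degree \<open>l\<close>; the relation between T z and D z' is the connecting
  map.\<close>

lemma spanned_step:
  assumes l: "l \<ge> 1" and b: "FP.spanned_mod (Zc (Suc k) l) (Bc (Suc k) l) b"
  shows "FP.spanned_mod (Zc k (l + 1)) (Bc k (l + 1)) b"
proof (rule FFP.spanned_mod_relation[OF b, where R = "\<lambda>z' z. z \<in> chains (CS k) (l + 1) \<and> z' \<in> chains (CS (Suc k)) l \<and>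
      (\<forall>b\<le>l. cg k (T (l + 1) z b) (D k (z' b)))"])
  show "x + y \<in> chains (CS k) (l + 1) \<and> x' + y' \<in> chains (CS (Suc k)) l \<and> (\<forall>b\<le>l. cg k (T (l + 1) (x + y) b) (D k ((x' + y') b)))"
    if *: "x \<in> chains (CS k) (l + 1) \<and> x' \<in> chains (CS (Suc k)) l \<and> (\<forall>b\<le>l. cg k (T (l + 1) x b) (D k (x' b)))"
      "y \<in> chains (CS k) (l + 1) \<and> y' \<in> chains (CS (Suc k)) l \<and> (\<forall>b\<le>l. cg k (T (l + 1) y b) (D k (y' b)))" for x y x' y'
  proof -
    have "cg k (T (l + 1) x b + T (l + 1) y b) (D k (x' b + y' b))" if "b \<le> l" for b
      by (rule cg_trans[OF cg_add cg_sym[OF cg_D_add]]) (use * that in \<open>auto simp: chains_def\<close>)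
    then have "cg k (T (l + 1) (x + y) b) (D k ((x' + y') b))" if "b \<le> l" for b
      using that by (simp only: T_add_apply fun2_add)
    then show ?thesis by (intro conjI chains_add allI impI) (use * in \<open>simp_all only:\<close>)
  qed
  show "pv.fscale c x \<in> chains (CS k) (l + 1) \<and> pv.fscale c x' \<in> chains (CS (Suc k)) l \<and>
      (\<forall>b\<le>l. cg k (T (l + 1) (pv.fscale c x) b) (D k (pv.fscale c x' b)))"
    if *: "x \<in> chains (CS k) (l + 1) \<and> x' \<in> chains (CS (Suc k)) l \<and> (\<forall>b\<le>l. cg k (T (l + 1) x b) (D k (x' b)))" for c x x'
  proof -
    have "cg k (poly_scale c (T (l + 1) x b)) (D k (poly_scale c (x' b)))" if "b \<le> l" for b
      by (rule cg_scale) (use * that in \<open>auto simp: chains_def\<close>)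
    then show ?thesis using * chains_scale unfolding T_scale by blast
  qed
  show "\<exists>z\<in>Zc k (l + 1). z \<in> chains (CS k) (l + 1) \<and> z' \<in> chains (CS (Suc k)) l \<and> (\<forall>b\<le>l. cg k (T (l + 1) z b) (D k (z' b)))"
    if z': "z' \<in> Zc (Suc k) l" for z'
  proof -
    have zc: "z' \<in> chains (CS (Suc k)) l" "\<And>b. b < l \<Longrightarrow> T l z' b \<in> syz (Suc k)" using z' l by (auto simp: Zc_iff)
    have "cg k (T l (DD k l z') b) 0" if "b < l" for b
      using cg_trans[OF DD_T[OF zc(1)]] zc(2)[OF that] syz_exact[OF T_coord[OF zc(1)]] by blast
    from acyclic[OF DD_chains[OF zc(1)] this l] obtain z where
      z: "z \<in> chains (CS k) (l + 1)" "\<And>b. cg k (DD k l z' b) (T (l + 1) z b)" by blast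
    have eq: "cg k (T (l + 1) z b) (D k (z' b))" if "b \<le> l" for b
      using cg_sym[OF z(2)[of b]] that by (simp add: DD_def)
    have "T (l + 1) z b \<in> syz k" for b
      using cg_syz[OF cg_sym[OF z(2)] DD_syz[OF zc(1)]] .
    then have "z \<in> Zc k (l + 1)" using z by (simp add: Zc_iff)
    then show ?thesis using z(1) zc(1) eq by blast
  qed
  show "\<exists>z'\<in>Zc (Suc k) l. z \<in> chains (CS k) (l + 1) \<and> z' \<in> chains (CS (Suc k)) l \<and> (\<forall>b\<le>l. cg k (T (l + 1) z b) (D k (z' b)))"
    if z: "z \<in> Zc k (l + 1)" for z
  proof -
    have zc: "z \<in> chains (CS k) (l + 1)" "\<And>b. b \<le> l \<Longrightarrow> T (l + 1) z b \<in> syz k" using z by (auto simp: Zc_iff)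
    have "\<forall>b. \<exists>f. (b \<le> l \<longrightarrow> f \<in> CS (Suc k) \<and> cg k (T (l + 1) z b) (D k f)) \<and> (b > l \<longrightarrow> f = 0)"
    proof
      fix b show "\<exists>f. (b \<le> l \<longrightarrow> f \<in> CS (Suc k) \<and> cg k (T (l + 1) z b) (D k f)) \<and> (b > l \<longrightarrow> f = 0)"
      proof (cases "b \<le> l")
        case True
        then obtain f where "f \<in> CS (Suc k)" "cg k (T (l + 1) z b) (D k f)" using syz_preimage[OF zc(2)] by blast
        then show ?thesis using True by (intro exI[of _ f]) simp
      qed auto
    qed
    from choice[OF this] obtain z' where
      z': "\<And>b. (b \<le> l \<longrightarrow> z' b \<in> CS (Suc k) \<and> cg k (T (l + 1) z b) (D k (z' b))) \<and> (b > l \<longrightarrow> z' b = 0)" by blast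
    have z'c: "z' \<in> chains (CS (Suc k)) l" using z' by (simp add: chains_def)
    have "T l z' b \<in> syz (Suc k)" if "b < l" for b
    proof -
      have "cg k (smul (tx b) (T (l + 1) z (b + 1)) + smul (ty l b) (T (l + 1) z b))
          (smul (tx b) (D k (z' (b + 1))) + smul (ty l b) (D k (z' b)))"
        using z' that by (intro cg_add cg_smul) auto
      moreover have "T l (DD k l z') b = smul (tx b) (D k (z' (b + 1))) + smul (ty l b) (D k (z' b))"
        using that by (simp add: T_smul[of l "DD k l z'" b]) (simp add: DD_def)
      moreover have "T l (T (l + 1) z) b = smul (tx b) (T (l + 1) z (b + 1)) + smul (ty l b) (T (l + 1) z b)"
        by (simp only: T_smul[of l "T (l + 1) z" b] that if_True)
      ultimately have e: "cg k (T l (T (l + 1) z) b) (T l (DD k l z') b)" by (simp only:)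
      have "cg k (D k (T l z' b)) 0"
        by (rule cg_trans[OF cg_trans[OF cg_sym[OF DD_T[OF z'c]] cg_sym[OF e]] T_T[OF zc(1)]])
      then show ?thesis using syz_exact[OF T_coord[OF z'c]] by blast
    qed
    then have "z' \<in> Zc (Suc k) l" using z'c l by (simp add: Zc_iff)
    then show ?thesis using z' z'c zc(1) by (intro bexI[of _ z'] conjI allI impI) auto
  qed
  show "z \<in> Bc k (l + 1)"
    if R: "z \<in> chains (CS k) (l + 1) \<and> z' \<in> chains (CS (Suc k)) l \<and> (\<forall>b\<le>l. cg k (T (l + 1) z b) (D k (z' b)))"
      and z': "z' \<in> Bc (Suc k) l" for z z'
  proof -
    obtain y where y: "y \<in> chains (CS (Suc k)) (l + 1)" "z' - T (l + 1) y \<in> chains (syz (Suc k)) l"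
      using z' by (auto simp: Bc_def)
    let ?w = "z - DD k (l + 1) y"
    have T0: "cg k (T (l + 1) ?w b) 0" if b: "b < l + 1" for b
    proof -
      have zb: "z' b \<in> CS (Suc k)" using R b by (simp add: chains_def)
      have s: "z' b - T (l + 1) y b \<in> syz (Suc k)" using y(2) b by (auto simp: chains_def)
      then have "cg k (D k (z' b - T (l + 1) y b)) 0" using syz_exact[OF syz_coord[OF s]] by blast
      moreover have "cg k (D k (z' b - T (l + 1) y b)) (D k (z' b) - D k (T (l + 1) y b))"
        unfolding cg_def by (rule D_diff[OF zb T_coord[OF y(1)]])
      ultimately have 1: "cg k (D k (z' b) - D k (T (l + 1) y b)) 0" using cg_trans cg_sym by blast
      have "cg k (T (l + 1) z b - T (l + 1) (DD k (l + 1) y) b) (D k (z' b) - D k (T (l + 1) y b))"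
        using R b by (intro cg_diff DD_T[OF y(1)]) simp
      from cg_trans[OF this 1] show ?thesis by (simp only: T_diff_apply)
    qed
    have "?w \<in> chains (CS k) (l + 1)" using R chains_diff DD_chains[OF y(1)] by blast
    from acyclic[OF this T0] obtain w where w: "w \<in> chains (CS k) (l + 1 + 1)" "\<And>b. cg k (?w b) (T (l + 1 + 1) w b)" by auto
    have "z b - T (l + 1 + 1) w b \<in> syz k" for b
    proof -
      have "(?w b - T (l + 1 + 1) w b) + DD k (l + 1) y b \<in> syz k"
        by (intro syz_add DD_syz y ideal_syz) (use w(2)[of b] in \<open>simp only: cg_def\<close>)
      then show ?thesis by (simp add: algebra_simps)
    qed
    then show ?thesis using BcI[OF _ w(1)] R by blast
  qed
qed

text \<open>Each step down in degree passes to the next syzygy module, until degree 1 is reached.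
  The factor \<open>card (- J)\<close> is the dimension of A/(u,v), the number of steps in its
  monomial filtration.\<close>

lemma spanned_homology:
  assumes b: "\<And>k. pv.spanned_mod (cyc (- {0}) k) (bnd (- {0}) k) b" and l: "l \<ge> 1"
  shows "FP.spanned_mod (Zc k l) (Bc k l) (card (- J) * b)"
  using l
proof (induction l arbitrary: k rule: dec_induct)
  case base
  show ?case by (rule spanned_base[OF spanned_mod_upset[OF b upset_J N_le_J]])
next
  case (step l)
  show ?case using spanned_step[OF step(1) step(3)] by simp
qed

end

section \<open>Quotients of the polynomial ring by monomial ideals\<close>

lemma upset_pos: "upset (- {0})"
proof -
  have "m + e \<noteq> 0" if "m \<noteq> 0" for m e :: "nat \<Rightarrow>\<^sub>0 nat"
    using mdeg_pos[OF that] mdeg_add[of m e] by (auto simp: mdeg_def)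
  then show ?thesis by (auto simp: upset_def)
qed

lemma mono_ideal_pos: "x \<in> mono_ideal (- {0}) \<longleftrightarrow> lk x 0 = 0"
  by (auto simp: mono_ideal_iff)

lemma const_mult: "lk (x * y) 0 = lk x 0 * lk y 0" for x y :: "'k::comm_ring_1 mpoly"
proof -
  let ?x = "x - sg 0 (lk x 0)"
  have "y * ?x \<in> mono_ideal (- {0})"
    by (rule mono_ideal_mult[OF upset_pos]) (simp add: mono_ideal_pos lookup_minus)
  then have "lk (?x * y) 0 = 0" by (simp add: mono_ideal_pos mult.commute)
  moreover have "lk (sg 0 (lk x 0) * y) 0 = lk x 0 * lk y 0"
    using lookup_mono_mult(1)[of 0 "lk x 0" y 0] by simp
  ultimately show ?thesis by (simp add: left_diff_distrib lookup_minus)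
qed

lemma const_one: "lk (1 :: 'k::comm_ring_1 mpoly) 0 = 1"
  by (metis lookup_single_eq single_one)

text \<open>Scaled to constant term 1, \<open>x\<close> is 1 - g with g free of constant term. Only
  finitely many monomials lie outside \<open>N\<close>, so g is nilpotent modulo \<open>N\<close>
  and a finite geometric series inverts 1 - g.\<close>

lemma unit_mod:
  fixes x :: "'k::field mpoly"
  assumes N: "finite (- N)" and x: "lk x 0 \<noteq> 0"
  shows "\<exists>y. x * y - 1 \<in> mono_ideal N"
proof -
  define g where "g = 1 - sg 0 (1 / lk x 0) * x"
  \<comment> \<open>\<open>M\<close> exceeds the degree of every monomial outside \<open>N\<close>;
    the inserted 0 keeps \<open>Max\<close> defined if there is none.\<close>
  define M where "M = Suc (Max (insert 0 (mdeg ` (- N))))"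
  have g0: "lk g 0 = 0" unfolding g_def using x by (simp only: lookup_minus const_mult const_one) simp
  have "g ^ r \<in> mono_ideal {m. mdeg m \<ge> r}" for r
  proof (induction r)
    case (Suc r)
    have "mdeg m \<ge> Suc r" if m: "m \<in> ks (g * g ^ r)" for m
    proof -
      obtain b d where bd: "m = b + d" "b \<in> ks g" "d \<in> ks (g ^ r)" using m keys_mult[of g "g ^ r"] by blast
      have "b \<noteq> 0" using bd(2) g0 by (auto simp: in_keys_iff)
      then show ?thesis using bd Suc mdeg_pos[of b] by (auto simp: mdeg_add mono_ideal_def)
    qed
    then show ?case by (auto simp: mono_ideal_def)
  qed (simp add: mono_ideal_def)
  moreover have "{m. mdeg m \<ge> M} \<subseteq> N"
  proof
    fix m assume m: "m \<in> {m. mdeg m \<ge> M}"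
    show "m \<in> N"
    proof (rule ccontr)
      assume "m \<notin> N"
      then have "mdeg m \<le> Max (insert 0 (mdeg ` (- N)))" using N by (intro Max_ge) auto
      then show False using m by (simp add: M_def)
    qed
  qed
  ultimately have gM: "g ^ M \<in> mono_ideal N" using mono_ideal_mono by blast
  have "x * (sg 0 (1 / lk x 0) * (\<Sum>r<M. g ^ r)) = (1 - g) * (\<Sum>r<M. g ^ r)"
    by (simp add: g_def mult.assoc[symmetric] mult.commute[of x])
  also have "\<dots> = 1 - g ^ M" by (rule one_diff_power_eq[symmetric])
  finally have "x * (sg 0 (1 / lk x 0) * (\<Sum>r<M. g ^ r)) - 1 = - (g ^ M)" by simp
  then show ?thesis using mono_ideal_neg[OF gM] by metis
qed

text \<open>\<theta> presents the record ring \<open>A\<close> as the quotient of a whole type of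
  polynomials, so that computations in \<open>A\<close> become congruences in a type of commutative
  rings. As the monomial 0 is outside \<open>N\<close>, elements of \<open>A\<close> have a
  well-defined constant coefficient.\<close>

locale trunc_ring =
  fixes A :: "('a, 'r) ring_scheme" (structure) and \<theta> :: "'k::field mpoly \<Rightarrow> 'a" and N :: "(nat \<Rightarrow>\<^sub>0 nat) set"
  assumes cr: "cring A" and \<theta>_range: "range \<theta> = carrier A"
    and \<theta>_add: "\<theta> (x + y) = \<theta> x \<oplus> \<theta> y" and \<theta>_mult: "\<theta> (x * y) = \<theta> x \<otimes> \<theta> y" and \<theta>_one: "\<theta> 1 = \<one>"
    and \<theta>_eq: "\<theta> x = \<theta> y \<longleftrightarrow> x - y \<in> mono_ideal N"
    and up: "upset N" and fin: "finite (- N)" and N0: "0 \<notin> N"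
begin

sublocale A: cring A by (rule cr)

lemma \<theta>_closed [simp]: "\<theta> x \<in> carrier A" using \<theta>_range by auto

lemma \<theta>_zero: "\<theta> 0 = \<zero>"
proof -
  have "\<theta> 0 \<oplus> \<theta> 0 = \<theta> 0" using \<theta>_add[of 0 0] by simp
  then show ?thesis using A.add.r_cancel_one[OF \<theta>_closed \<theta>_closed, of 0 0] by simp
qed

lemma const_eq: "\<theta> x = \<theta> y \<Longrightarrow> lk x 0 = lk y 0"
  using N0 by (auto simp: \<theta>_eq mono_ideal_iff lookup_minus)

definition mm where "mm = \<theta> ` mono_ideal (- {0})"

lemma \<theta>_mm: "\<theta> x \<in> mm \<longleftrightarrow> lk x 0 = 0"
proof
  assume "\<theta> x \<in> mm"
  then obtain y where y: "\<theta> x = \<theta> y" "lk y 0 = 0" by (auto simp: mm_def mono_ideal_pos)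
  show "lk x 0 = 0" using const_eq[OF y(1)] y(2) by simp
qed (auto simp: mm_def mono_ideal_pos)

lemma ideal_mm: "ideal mm A"
proof (rule idealI)
  show "subgroup mm (add_monoid A)"
  proof (rule A.add.subgroupI)
    show "mm \<subseteq> carrier A" by (auto simp: mm_def)
    show "mm \<noteq> {}" unfolding mm_def using mono_ideal_0[of "- {0}"] by blast
    show "x \<oplus> y \<in> mm" if xy: "x \<in> mm" "y \<in> mm" for x y
    proof -
      obtain f g where "x = \<theta> f" "y = \<theta> g" "f \<in> mono_ideal (- {0})" "g \<in> mono_ideal (- {0})"
        using xy by (auto simp: mm_def)
      then show ?thesis unfolding mm_def by (simp only: \<theta>_add[symmetric] imageI mono_ideal_add)
    qed
    show "\<ominus> x \<in> mm" if xm: "x \<in> mm" for x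
    proof -
      obtain f where f: "x = \<theta> f" "lk f 0 = 0" using xm by (auto simp: mm_def mono_ideal_pos)
      have "\<theta> (- f) \<oplus> x = \<zero>" by (simp add: f \<theta>_add[symmetric] \<theta>_zero)
      then have "\<ominus> x = \<theta> (- f)" using f(1) by (simp add: A.minus_equality)
      then show ?thesis using f(2) \<theta>_mm by simp
    qed
  qed
  have *: "x \<otimes> a \<in> mm" if am: "a \<in> mm" and x: "x \<in> carrier A" for a x
  proof -
    obtain g where "x = \<theta> g" using x \<theta>_range by auto
    moreover obtain f where "a = \<theta> f" "lk f 0 = 0" using am by (auto simp: mm_def mono_ideal_pos)
    ultimately show ?thesis by (simp add: \<theta>_mult[symmetric] \<theta>_mm const_mult)
  qed
  show "x \<otimes> a \<in> mm" if "a \<in> mm" "x \<in> carrier A" for a x using * that .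
  have "mm \<subseteq> carrier A" by (auto simp: mm_def)
  then show "a \<otimes> x \<in> mm" if "a \<in> mm" "x \<in> carrier A" for a x using * that A.m_comm[of a x] by (metis subsetD)
qed (rule A.ring_axioms)

lemma ideal_unit: "ideal I A \<Longrightarrow> \<theta> x \<in> I \<Longrightarrow> lk x 0 \<noteq> 0 \<Longrightarrow> I = carrier A"
proof -
  assume I: "ideal I A" "\<theta> x \<in> I" "lk x 0 \<noteq> 0"
  obtain y where "x * y - 1 \<in> mono_ideal N" using unit_mod[OF fin I(3)] by blast
  then have "\<theta> x \<otimes> \<theta> y = \<one>" using \<theta>_eq[of "x * y" 1] by (simp add: \<theta>_mult \<theta>_one)
  then have "\<one> \<in> I" using ideal.I_r_closed[OF I(1,2) \<theta>_closed[of y]] by simp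
  then show ?thesis by (rule ideal.one_imp_carrier[OF I(1)])
qed

lemma mm_proper: "mm \<noteq> carrier A"
proof
  assume eq: "mm = carrier A"
  have "\<theta> 1 \<in> mm" by (simp only: eq \<theta>_closed)
  then show False using \<theta>_mm[of 1] by (simp add: const_one)
qed

lemma maximal_mm: "maximalideal mm A"
proof (rule maximalidealI[OF ideal_mm mm_proper[symmetric]])
  show "I = mm \<or> I = carrier A" if I: "ideal I A" "mm \<subseteq> I" "I \<subseteq> carrier A" for I
  proof (rule disjCI)
    assume ne: "I \<noteq> carrier A"
    have "y \<in> mm" if y: "y \<in> I" for y
    proof -
      obtain f where f: "y = \<theta> f" using y I(3) \<theta>_range by auto
      then show ?thesis using ideal_unit[OF I(1), of f] y ne \<theta>_mm by auto
    qed
    then show "I = mm" using I(2) by blast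
  qed
qed

lemma max_ideal_eq: "max_ideal A = mm"
  unfolding max_ideal_def
proof (rule the_equality[where P = "\<lambda>m. maximalideal m A", OF maximal_mm])
  fix I assume I: "maximalideal I A"
  then interpret I: maximalideal I A .
  have "y \<in> mm" if y: "y \<in> I" for y
  proof -
    obtain f where f: "y = \<theta> f" using y I.a_subset \<theta>_range by auto
    then show ?thesis using ideal_unit[OF I.ideal_axioms, of f] y I.I_notcarr \<theta>_mm by auto
  qed
  then have "I \<subseteq> mm" by blast
  from I.I_maximal[OF ideal_mm this] mm_proper show "I = mm" using ideal.Icarr[OF ideal_mm] by blast
qed

definition \<kappa> where "\<kappa> x = mm +>\<^bsub>A\<^esub> \<theta> x"

lemma \<kappa>_image: "\<kappa> x = \<theta> ` {y. lk y 0 = lk x 0}"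
proof (intro Set.set_eqI iffI)
  fix a assume "a \<in> \<kappa> x"
  then obtain h where "a = \<theta> h \<oplus> \<theta> x" "lk h 0 = 0" by (auto simp: \<kappa>_def a_r_coset_def' mm_def mono_ideal_pos)
  then show "a \<in> \<theta> ` {y. lk y 0 = lk x 0}" by (auto simp: \<theta>_add[symmetric] lookup_add)
next
  fix a assume "a \<in> \<theta> ` {y. lk y 0 = lk x 0}"
  then obtain y where y: "a = \<theta> y" "lk y 0 = lk x 0" by auto
  then have "a = \<theta> (y - x) \<oplus> \<theta> x" "\<theta> (y - x) \<in> mm" by (simp_all add: \<theta>_add[symmetric] \<theta>_mm lookup_minus)
  then show "a \<in> \<kappa> x" by (auto simp: \<kappa>_def a_r_coset_def')
qed

lemma \<kappa>_eq: "\<kappa> x = \<kappa> y \<longleftrightarrow> lk x 0 = lk y 0"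
proof
  assume "\<kappa> x = \<kappa> y"
  then have "\<theta> x \<in> \<theta> ` {z. lk z 0 = lk y 0}" using \<kappa>_image by blast
  then obtain z where z: "\<theta> x = \<theta> z" "lk z 0 = lk y 0" by auto
  then show "lk x 0 = lk y 0" using const_eq[OF z(1)] by simp
qed (simp add: \<kappa>_image)

abbreviation "K \<equiv> residue_field A"

lemma K_eq: "K = A Quot mm" by (simp add: residue_field_def max_ideal_eq)

lemma field_K: "field K"
  unfolding K_eq by (rule maximalideal.quotient_is_field[OF maximal_mm cr])

lemma carrier_K: "carrier K = range \<kappa>"
  unfolding K_eq FactRing_def A_RCOSETS_def' by (auto simp: \<kappa>_def \<theta>_range[symmetric])

lemma K_ops: "\<kappa> x \<oplus>\<^bsub>K\<^esub> \<kappa> y = \<kappa> (x + y)" "\<kappa> x \<otimes>\<^bsub>K\<^esub> \<kappa> y = \<kappa> (x * y)" "\<one>\<^bsub>K\<^esub> = \<kappa> 1" "\<zero>\<^bsub>K\<^esub> = \<kappa> 0"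
proof -
  have hom: "(+>) mm \<in> ring_hom A (A Quot mm)" by (rule ideal.rcos_ring_hom[OF ideal_mm])
  show "\<kappa> x \<oplus>\<^bsub>K\<^esub> \<kappa> y = \<kappa> (x + y)" "\<kappa> x \<otimes>\<^bsub>K\<^esub> \<kappa> y = \<kappa> (x * y)" "\<one>\<^bsub>K\<^esub> = \<kappa> 1"
    using ring_hom_add[OF hom] ring_hom_mult[OF hom] ring_hom_one[OF hom]
    by (simp_all add: K_eq \<kappa>_def \<theta>_add \<theta>_mult \<theta>_one)
  have "mono_ideal (- {0}) = {y :: 'k mpoly. lk y 0 = 0}" by (auto simp: mono_ideal_pos)
  then show "\<zero>\<^bsub>K\<^esub> = \<kappa> 0" by (simp add: K_eq FactRing_def \<kappa>_image mm_def)
qed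

end

section \<open>Modules presented by typed vectors\<close>

text \<open>The corresponding setting for modules. It leaves scalars and vectors open, because it is
  used with several index types for vectors of polynomials and, over the residue field, with k as
  the scalars.\<close>

locale scalars =
  fixes A :: "('a, 'r) ring_scheme" (structure) and \<theta> :: "'s::comm_ring_1 \<Rightarrow> 'a" and act :: "'s \<Rightarrow> 'z::ab_group_add \<Rightarrow> 'z"
  assumes cringA: "cring A" and range: "range \<theta> = carrier A"
    and th_add: "\<theta> (x + y) = \<theta> x \<oplus> \<theta> y" and th_mult: "\<theta> (x * y) = \<theta> x \<otimes> \<theta> y" and th_one: "\<theta> 1 = \<one>"
    and act_add: "act x (z + w) = act x z + act x w" and act_add2: "act (x + y) z = act x z + act y z"
    and act_mult: "act (x * y) z = act x (act y z)" and act_one: "act 1 z = z"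
begin

lemma act_neg: "act (-1) z = - z"
proof -
  have "act 0 z + act 0 z = act 0 z" using act_add2[of 0 0 z] by simp
  then have "act (1 + -1) z = 0" by simp
  then have "z + act (-1) z = 0" unfolding act_add2 act_one .
  then show ?thesis by (metis minus_unique)
qed

definition sub :: "'z set \<Rightarrow> bool" where
  "sub Z \<longleftrightarrow> 0 \<in> Z \<and> (\<forall>z\<in>Z. \<forall>w\<in>Z. z + w \<in> Z) \<and> (\<forall>x. \<forall>z\<in>Z. act x z \<in> Z)"

lemma subD: "sub Z \<Longrightarrow> 0 \<in> Z" "sub Z \<Longrightarrow> z \<in> Z \<Longrightarrow> w \<in> Z \<Longrightarrow> z + w \<in> Z" "sub Z \<Longrightarrow> z \<in> Z \<Longrightarrow> act x z \<in> Z"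
  by (auto simp: sub_def)

lemma sub_neg: "sub Z \<Longrightarrow> z \<in> Z \<Longrightarrow> - z \<in> Z"
  using subD(3)[of Z z "-1"] by (simp add: act_neg)

lemma sub_diff: "sub Z \<Longrightarrow> z \<in> Z \<Longrightarrow> w \<in> Z \<Longrightarrow> z - w \<in> Z"
  using subD(2)[of Z z "- w"] sub_neg by simp

text \<open>\<open>model Z M \<Phi>\<close>: the map \<open>\<Phi>\<close> makes the module \<open>M\<close> a quotient of the typed module \<open>Z\<close>.\<close>

definition model :: "'z set \<Rightarrow> ('a, 'm, 'e) module_scheme \<Rightarrow> ('z \<Rightarrow> 'm) \<Rightarrow> bool" where
  "model Z M \<Phi> \<longleftrightarrow> sub Z \<and> carrier M = \<Phi> ` Z \<and> \<zero>\<^bsub>M\<^esub> = \<Phi> 0 \<and>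
     (\<forall>z\<in>Z. \<forall>w\<in>Z. \<Phi> z \<oplus>\<^bsub>M\<^esub> \<Phi> w = \<Phi> (z + w)) \<and> (\<forall>x. \<forall>z\<in>Z. \<theta> x \<odot>\<^bsub>M\<^esub> \<Phi> z = \<Phi> (act x z))"

lemma modelD:
  assumes "model Z M \<Phi>"
  shows "sub Z" "carrier M = \<Phi> ` Z" "\<zero>\<^bsub>M\<^esub> = \<Phi> 0" "z \<in> Z \<Longrightarrow> w \<in> Z \<Longrightarrow> \<Phi> z \<oplus>\<^bsub>M\<^esub> \<Phi> w = \<Phi> (z + w)"
    "z \<in> Z \<Longrightarrow> \<theta> x \<odot>\<^bsub>M\<^esub> \<Phi> z = \<Phi> (act x z)"
  using assms by (auto simp: model_def)

lemma module_model:
  assumes m: "model Z M \<Phi>" shows "module A M"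
proof -
  note md = modelD[OF m]
  show ?thesis
  proof (rule moduleI)
    show "cring A" by (rule cringA)
    show "abelian_group M"
    proof (rule abelian_groupI)
      show "\<exists>y\<in>carrier M. y \<oplus>\<^bsub>M\<^esub> x = \<zero>\<^bsub>M\<^esub>" if x: "x \<in> carrier M" for x
      proof -
        obtain z where z: "z \<in> Z" "x = \<Phi> z" using x md(2) by auto
        show ?thesis using z sub_neg[OF md(1) z(1)] by (intro bexI[of _ "\<Phi> (- z)"]) (auto simp: md)
      qed
    qed (auto simp: md(2,3,4) subD[OF md(1)] ac_simps)
    show "\<one> \<odot>\<^bsub>M\<^esub> u = u" if u: "u \<in> carrier M" for u
      using u md(5)[of _ 1] by (auto simp: md(2) th_one act_one)
    fix x y u v assume "x \<in> carrier A" "y \<in> carrier A" "u \<in> carrier M" "v \<in> carrier M"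
    note el = this[folded range, unfolded md(2)]
    obtain a b where eq: "x = \<theta> a" "y = \<theta> b" using el(1,2) by blast
    obtain z w where zw: "z \<in> Z" "w \<in> Z" and eq': "u = \<Phi> z" "v = \<Phi> w" using el(3,4) by blast
    have aZ: "act x z \<in> Z" "act x w \<in> Z" for x using zw subD(3)[OF md(1)] by auto
    show "x \<odot>\<^bsub>M\<^esub> u \<in> carrier M" unfolding eq eq' using md(2,5) zw aZ by auto
    show "(x \<oplus> y) \<odot>\<^bsub>M\<^esub> u = (x \<odot>\<^bsub>M\<^esub> u) \<oplus>\<^bsub>M\<^esub> (y \<odot>\<^bsub>M\<^esub> u)"
      unfolding eq eq' th_add[symmetric] md(5)[OF zw(1)] md(4)[OF aZ(1) aZ(1)] act_add2 ..
    show "x \<odot>\<^bsub>M\<^esub> (u \<oplus>\<^bsub>M\<^esub> v) = (x \<odot>\<^bsub>M\<^esub> u) \<oplus>\<^bsub>M\<^esub> (x \<odot>\<^bsub>M\<^esub> v)"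
      unfolding eq eq' md(4)[OF zw] md(5)[OF zw(1)] md(5)[OF zw(2)] md(4)[OF aZ] md(5)[OF subD(2)[OF md(1) zw]] act_add ..
    show "(x \<otimes> y) \<odot>\<^bsub>M\<^esub> u = x \<odot>\<^bsub>M\<^esub> (y \<odot>\<^bsub>M\<^esub> u)"
      unfolding eq eq' th_mult[symmetric] md(5)[OF zw(1)] md(5)[OF aZ(1)] act_mult ..
  qed
qed

lemma model_minus:
  assumes m: "model Z M \<Phi>" and zw: "z \<in> Z" "w \<in> Z" shows "\<Phi> z \<ominus>\<^bsub>M\<^esub> \<Phi> w = \<Phi> (z - w)"
proof -
  note md = modelD[OF m]
  interpret M: module A M by (rule module_model[OF m])
  have c: "\<Phi> w \<in> carrier M" "\<Phi> (- w) \<in> carrier M" using zw sub_neg[OF md(1)] md(2) by auto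
  have "\<Phi> (- w) \<oplus>\<^bsub>M\<^esub> \<Phi> w = \<zero>\<^bsub>M\<^esub>" using md(4)[OF sub_neg[OF md(1) zw(2)] zw(2)] md(3) by simp
  then have "\<ominus>\<^bsub>M\<^esub> \<Phi> w = \<Phi> (- w)" using c by (simp add: M.minus_equality)
  then show ?thesis using md(4)[OF zw(1) sub_neg[OF md(1) zw(2)]] by (simp add: a_minus_def)
qed

lemma submodule_model:
  assumes m: "model Z M \<Phi>" and B: "sub B" "B \<subseteq> Z" shows "submodule A (\<Phi> ` B) M"
proof -
  note md = modelD[OF m]
  show ?thesis
  proof (rule submodule.intro)
    show "module A M" by (rule module_model[OF m])
    show "\<Phi> ` B \<subseteq> carrier M" using B md(2) by auto
    show "\<zero>\<^bsub>M\<^esub> \<in> \<Phi> ` B" using md(3) subD(1)[OF B(1)] by simp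
    show "v \<oplus>\<^bsub>M\<^esub> w \<in> \<Phi> ` B" if vw: "v \<in> \<Phi> ` B" "w \<in> \<Phi> ` B" for v w
    proof -
      obtain b b' where b: "b \<in> B" "b' \<in> B" "v = \<Phi> b" "w = \<Phi> b'" using vw by auto
      then have "v \<oplus>\<^bsub>M\<^esub> w = \<Phi> (b + b')" using md(4)[of b b'] B(2) by auto
      then show ?thesis using subD(2)[OF B(1)] b by auto
    qed
    show "c \<odot>\<^bsub>M\<^esub> v \<in> \<Phi> ` B" if cv: "c \<in> carrier A" "v \<in> \<Phi> ` B" for c v
    proof -
      obtain b where b: "b \<in> B" "v = \<Phi> b" using cv by auto
      obtain x where x: "c = \<theta> x" using cv range by auto
      have "c \<odot>\<^bsub>M\<^esub> v = \<Phi> (act x b)" using md(5)[of b x] b x B(2) by auto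
      then show ?thesis using subD(3)[OF B(1) b(1)] by auto
    qed
  qed
qed

text \<open>By \<open>ker\<close>, vectors with the same image under \<Phi> differ by an element of
  \<open>B\<close>, so cosets of the image of \<open>B\<close> correspond to classes modulo
  \<open>B\<close>. This replaces the quotients in the definitions of the tensor product and of Tor
  by typed ones.\<close>

lemma model_quot:
  assumes m: "model Z M \<Phi>" and B: "sub B" "B \<subseteq> Z" and ker: "\<And>z w. z \<in> Z \<Longrightarrow> w \<in> Z \<Longrightarrow> \<Phi> z = \<Phi> w \<Longrightarrow> z - w \<in> B"
  shows "model Z (quot_module M (\<Phi> ` B)) (\<lambda>z. \<Phi> ` B +>\<^bsub>M\<^esub> \<Phi> z)"
    and "z \<in> Z \<Longrightarrow> w \<in> Z \<Longrightarrow> \<Phi> ` B +>\<^bsub>M\<^esub> \<Phi> z = \<Phi> ` B +>\<^bsub>M\<^esub> \<Phi> w \<longleftrightarrow> z - w \<in> B"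
proof -
  note md = modelD[OF m]
  have BZ: "b + z \<in> Z" if "b \<in> B" "z \<in> Z" for b z using that B(2) subD(2)[OF md(1)] by auto
  have cos: "\<Phi> ` B +>\<^bsub>M\<^esub> \<Phi> z = (\<lambda>b. \<Phi> (b + z)) ` B" if z: "z \<in> Z" for z
    using B(2) md(4)[OF _ z] unfolding a_r_coset_def' by (auto simp: image_iff subset_iff)
  have eq: "\<Phi> ` B +>\<^bsub>M\<^esub> \<Phi> z = \<Phi> ` B +>\<^bsub>M\<^esub> \<Phi> w \<longleftrightarrow> z - w \<in> B" if zw: "z \<in> Z" "w \<in> Z" for z w
  proof
    assume "\<Phi> ` B +>\<^bsub>M\<^esub> \<Phi> z = \<Phi> ` B +>\<^bsub>M\<^esub> \<Phi> w"
    moreover have "\<Phi> z \<in> (\<lambda>b. \<Phi> (b + z)) ` B" using subD(1)[OF B(1)] by (intro image_eqI[of _ _ 0]) auto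
    ultimately obtain b where b: "b \<in> B" "\<Phi> z = \<Phi> (b + w)" using cos zw by auto
    have "z - (b + w) + b \<in> B" by (rule subD(2)[OF B(1) ker[OF zw(1) BZ[OF b(1) zw(2)] b(2)] b(1)])
    then show "z - w \<in> B" by simp
  next
    assume d: "z - w \<in> B"
    have "\<Phi> (b + z) \<in> (\<lambda>b. \<Phi> (b + w)) ` B" if "b \<in> B" for b
      using subD(2)[OF B(1) that d] by (intro image_eqI[of _ _ "b + (z - w)"]) auto
    moreover have "\<Phi> (b + w) \<in> (\<lambda>b. \<Phi> (b + z)) ` B" if "b \<in> B" for b
      using sub_diff[OF B(1) that d] by (intro image_eqI[of _ _ "b - (z - w)"]) auto
    ultimately show "\<Phi> ` B +>\<^bsub>M\<^esub> \<Phi> z = \<Phi> ` B +>\<^bsub>M\<^esub> \<Phi> w" unfolding cos[OF zw(1)] cos[OF zw(2)] by blast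
  qed
  then show "z \<in> Z \<Longrightarrow> w \<in> Z \<Longrightarrow> \<Phi> ` B +>\<^bsub>M\<^esub> \<Phi> z = \<Phi> ` B +>\<^bsub>M\<^esub> \<Phi> w \<longleftrightarrow> z - w \<in> B" .
  show "model Z (quot_module M (\<Phi> ` B)) (\<lambda>z. \<Phi> ` B +>\<^bsub>M\<^esub> \<Phi> z)"
    unfolding model_def
  proof (intro conjI ballI allI)
    show "sub Z" by (rule md(1))
    show "carrier (quot_module M (\<Phi> ` B)) = (\<lambda>z. \<Phi> ` B +>\<^bsub>M\<^esub> \<Phi> z) ` Z"
      unfolding quot_module_def A_RCOSETS_def' by (auto simp: md(2))
    show "\<zero>\<^bsub>quot_module M (\<Phi> ` B)\<^esub> = \<Phi> ` B +>\<^bsub>M\<^esub> \<Phi> 0"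
      unfolding cos[OF subD(1)[OF md(1)]] by (simp add: quot_module_def)
    fix z w assume zw: "z \<in> Z" "w \<in> Z"
    have zw': "z + w \<in> Z" by (rule subD(2)[OF md(1) zw])
    have "(\<lambda>b. \<Phi> (b + z)) ` B <+>\<^bsub>M\<^esub> (\<lambda>b. \<Phi> (b + w)) ` B = (\<lambda>b. \<Phi> (b + (z + w))) ` B"
    proof (intro Set.set_eqI iffI)
      fix u assume "u \<in> (\<lambda>b. \<Phi> (b + z)) ` B <+>\<^bsub>M\<^esub> (\<lambda>b. \<Phi> (b + w)) ` B"
      then obtain b b' where b: "b \<in> B" "b' \<in> B" "u = \<Phi> (b + z) \<oplus>\<^bsub>M\<^esub> \<Phi> (b' + w)" by (auto simp: set_add_def')
      then have "u = \<Phi> ((b + b') + (z + w))" using md(4)[OF BZ[OF b(1) zw(1)] BZ[OF b(2) zw(2)]] by (simp add: algebra_simps)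
      then show "u \<in> (\<lambda>b. \<Phi> (b + (z + w))) ` B" using subD(2)[OF B(1) b(1,2)] by auto
    next
      fix u assume "u \<in> (\<lambda>b. \<Phi> (b + (z + w))) ` B"
      then obtain b where b: "b \<in> B" "u = \<Phi> (b + (z + w))" by auto
      have "u = \<Phi> (b + z) \<oplus>\<^bsub>M\<^esub> \<Phi> (0 + w)"
        using md(4)[OF BZ[OF b(1) zw(1)] BZ[OF subD(1)[OF B(1)] zw(2)]] b(2) by (simp add: algebra_simps)
      then show "u \<in> (\<lambda>b. \<Phi> (b + z)) ` B <+>\<^bsub>M\<^esub> (\<lambda>b. \<Phi> (b + w)) ` B"
        using b(1) subD(1)[OF B(1)] unfolding set_add_def' by blast
    qed
    then show "(\<Phi> ` B +>\<^bsub>M\<^esub> \<Phi> z) \<oplus>\<^bsub>quot_module M (\<Phi> ` B)\<^esub> (\<Phi> ` B +>\<^bsub>M\<^esub> \<Phi> w) = \<Phi> ` B +>\<^bsub>M\<^esub> \<Phi> (z + w)"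
      unfolding cos[OF zw(1)] cos[OF zw(2)] cos[OF zw'] by (simp add: quot_module_def)
  next
    fix x z assume z: "z \<in> Z"
    have aZ: "act x y \<in> Z" if "y \<in> Z" for y using subD(3)[OF md(1) that] .
    \<comment> \<open>Scalar multiplication in \<open>quot_module\<close> is a union over all
      representatives; every member of that union is the same coset.\<close>
    have "\<Phi> ` B +>\<^bsub>M\<^esub> (\<theta> x \<odot>\<^bsub>M\<^esub> \<Phi> (b + z)) = \<Phi> ` B +>\<^bsub>M\<^esub> \<Phi> (act x z)" if b: "b \<in> B" for b
      unfolding md(5)[OF BZ[OF b z]] eq[OF aZ[OF BZ[OF b z]] aZ[OF z]]
      using subD(3)[OF B(1) b] by (simp add: act_add)
    then have "(\<Union>y\<in>(\<lambda>b. \<Phi> (b + z)) ` B. \<Phi> ` B +>\<^bsub>M\<^esub> (\<theta> x \<odot>\<^bsub>M\<^esub> y)) = \<Phi> ` B +>\<^bsub>M\<^esub> \<Phi> (act x z)"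
      using subD(1)[OF B(1)] by auto
    then show "\<theta> x \<odot>\<^bsub>quot_module M (\<Phi> ` B)\<^esub> (\<Phi> ` B +>\<^bsub>M\<^esub> \<Phi> z) = \<Phi> ` B +>\<^bsub>M\<^esub> \<Phi> (act x z)"
      unfolding cos[OF z] by (simp add: quot_module_def)
  qed
qed

end

section \<open>Tensoring free modules with the residue field\<close>

text \<open>Coordinates for \<open>free_module A S\<close>, where \<open>S\<close> may be infinite,
  such as the set of pairs that generates a tensor product.\<close>

definition fvecs :: "'t set \<Rightarrow> ('t \<Rightarrow> 'k::zero) set" where
  "fvecs S = {g. finite {s. g s \<noteq> 0} \<and> (\<forall>s. s \<notin> S \<longrightarrow> g s = 0)}"

definition delta_vec :: "'t \<Rightarrow> 't \<Rightarrow> 'k::zero_neq_one" where "delta_vec s = (\<lambda>t. if t = s then 1 else 0)"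

lemma delta_vec_fvecs: "s \<in> S \<Longrightarrow> delta_vec s \<in> fvecs S"
  by (auto simp: delta_vec_def fvecs_def)

lemma fvecs_coord: "fvecs {..<n} = (coord_space n :: (nat \<Rightarrow> 'k::comm_ring_1 mpoly) set)"
proof -
  have "finite {s. g s \<noteq> 0}" if "\<forall>s. \<not> s < n \<longrightarrow> g s = 0" for g :: "nat \<Rightarrow> 'k mpoly"
    using that by (intro finite_subset[OF _ finite_lessThan[of n]]) auto
  then show ?thesis by (auto simp: fvecs_def coord_space_def not_less)
qed

lemma fvecs_decomp: "z \<in> fvecs S \<Longrightarrow> z = (\<Sum>s\<in>{s. z s \<noteq> 0}. smul (z s) (delta_vec s))" for z :: "'t \<Rightarrow> 'k::field mpoly"
proof (rule ext)
  fix t assume z: "z \<in> fvecs S"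
  have "(\<Sum>s\<in>{s. z s \<noteq> 0}. smul (z s) (delta_vec s)) t = (\<Sum>s\<in>{s. z s \<noteq> 0}. if s = t then z s else 0)"
    unfolding sum_fun_apply by (intro sum.cong) (auto simp: smul_def delta_vec_def)
  also have "\<dots> = z t" using z by (simp add: fvecs_def)
  finally show "z t = (\<Sum>s\<in>{s. z s \<noteq> 0}. smul (z s) (delta_vec s)) t" ..
qed

lemma smul_apply: "smul x f t = x * f t"
  by (simp add: smul_def)

lemma (in scalars) sub_sum: "sub Z \<Longrightarrow> (\<And>i. i \<in> I \<Longrightarrow> f i \<in> Z) \<Longrightarrow> sum f I \<in> Z"
  by (induction I rule: infinite_finite_induct) (auto intro: subD)

context trunc_ring
begin

lemma scalars_smul: "scalars A \<theta> (smul :: 'k mpoly \<Rightarrow> ('t \<Rightarrow> 'k mpoly) \<Rightarrow> _)"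
  by unfold_locales (use \<theta>_range \<theta>_add \<theta>_mult \<theta>_one in \<open>auto simp: smul_add\<close>)

sublocale v: scalars A \<theta> "smul :: 'k mpoly \<Rightarrow> (nat \<Rightarrow> 'k mpoly) \<Rightarrow> _" by (rule scalars_smul)
sublocale w: scalars A \<theta> "smul :: 'k mpoly \<Rightarrow> ((nat \<Rightarrow> 'a) \<times> 'a set \<Rightarrow> 'k mpoly) \<Rightarrow> _" by (rule scalars_smul)

definition \<Theta> :: "'t set \<Rightarrow> ('t \<Rightarrow> 'k mpoly) \<Rightarrow> 't \<Rightarrow> 'a" where "\<Theta> S g = (\<lambda>s\<in>S. \<theta> (g s))"

lemma \<Theta>_eq: "\<Theta> S g = \<Theta> S h \<longleftrightarrow> (\<forall>s\<in>S. g s - h s \<in> mono_ideal N)"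
  unfolding \<Theta>_def fun_eq_iff by (auto simp: \<theta>_eq restrict_def)

lemma model_free: "scalars.model \<theta> smul (fvecs S) (free_module A S) (\<Theta> S)"
proof -
  interpret x: scalars A \<theta> "smul :: 'k mpoly \<Rightarrow> ('b \<Rightarrow> 'k mpoly) \<Rightarrow> _" by (rule scalars_smul)
  show ?thesis unfolding x.model_def
  proof (intro conjI ballI allI)
    show "x.sub (fvecs S)" unfolding x.sub_def
    proof (intro conjI ballI allI)
      fix z w :: "'b \<Rightarrow> 'k mpoly" assume zw: "z \<in> fvecs S" "w \<in> fvecs S"
      have "{s. (z + w) s \<noteq> 0} \<subseteq> {s. z s \<noteq> 0} \<union> {s. w s \<noteq> 0}" by auto
      then show "z + w \<in> fvecs S" using zw finite_subset by (auto simp: fvecs_def)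
    next
      fix x and z :: "'b \<Rightarrow> 'k mpoly" assume z: "z \<in> fvecs S"
      have "{s. smul x z s \<noteq> 0} \<subseteq> {s. z s \<noteq> 0}" by (auto simp: smul_def)
      then show "smul x z \<in> fvecs S" using z finite_subset by (auto simp: fvecs_def smul_def)
    qed (auto simp: fvecs_def)
    show "carrier (free_module A S) = \<Theta> S ` fvecs S"
    proof (intro equalityI subsetI)
      fix f assume "f \<in> carrier (free_module A S)"
      then have f: "f \<in> S \<rightarrow>\<^sub>E carrier A" "finite {s \<in> S. f s \<noteq> \<zero>}" by (auto simp: free_module_def)
      define g where "g s = (if s \<in> S \<and> f s \<noteq> \<zero> then (SOME x. \<theta> x = f s) else 0)" for s
      have g: "\<theta> (g s) = f s" if s: "s \<in> S" for s
      proof (cases "f s = \<zero>")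
        case False
        have "\<exists>x. \<theta> x = f s" using f(1) s \<theta>_range by (metis PiE_mem imageE)
        from someI_ex[OF this] show ?thesis using False s by (simp add: g_def)
      qed (simp add: g_def \<theta>_zero)
      have "{s. g s \<noteq> 0} \<subseteq> {s \<in> S. f s \<noteq> \<zero>}" by (auto simp: g_def)
      then have "g \<in> fvecs S" using finite_subset[OF _ f(2)] by (auto simp: fvecs_def g_def)
      moreover have "f = \<Theta> S g" unfolding \<Theta>_def using f(1) g by (auto simp: PiE_iff extensional_def)
      ultimately show "f \<in> \<Theta> S ` fvecs S" by blast
    next
      fix f assume "f \<in> \<Theta> S ` fvecs S"
      then obtain g where g: "g \<in> fvecs S" "f = \<Theta> S g" by blast
      have "{s \<in> S. f s \<noteq> \<zero>} \<subseteq> {s. g s \<noteq> 0}" by (auto simp: g(2) \<Theta>_def \<theta>_zero)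
      then have "finite {s \<in> S. f s \<noteq> \<zero>}" using g(1) finite_subset by (auto simp: fvecs_def)
      then show "f \<in> carrier (free_module A S)" by (auto simp: free_module_def g(2) \<Theta>_def)
    qed
    show "\<zero>\<^bsub>free_module A S\<^esub> = \<Theta> S 0"
      by (simp add: free_module_def A.func_space_def \<Theta>_def \<theta>_zero)
    show "\<Theta> S z \<oplus>\<^bsub>free_module A S\<^esub> \<Theta> S w = \<Theta> S (z + w)" for z w
      by (auto simp: free_module_def A.func_space_def \<Theta>_def \<theta>_add restrict_def fun_eq_iff)
    show "\<theta> x \<odot>\<^bsub>free_module A S\<^esub> \<Theta> S z = \<Theta> S (smul x z)" for x z
      by (auto simp: free_module_def A.func_space_def \<Theta>_def \<theta>_mult restrict_def fun_eq_iff smul_def)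
  qed
qed

lemma free_gen_eq: "free_gen A S s = \<Theta> S (delta_vec s)"
  by (auto simp: free_gen_def \<Theta>_def delta_vec_def \<theta>_one \<theta>_zero fun_eq_iff)

abbreviation "R \<equiv> residue_module A"

lemma carrier_R: "carrier R = range \<kappa>"
  by (simp add: residue_module_def Let_def carrier_K)

lemma R_ops: "\<kappa> x \<oplus>\<^bsub>R\<^esub> \<kappa> y = \<kappa> (x + y)" "\<theta> x \<odot>\<^bsub>R\<^esub> \<kappa> y = \<kappa> (x * y)"
  using K_ops by (simp_all add: residue_module_def Let_def max_ideal_eq \<kappa>_def)

text \<open>Constant coefficients of ring elements and of residue classes; by
  \<open>const_eq\<close> they do not depend on the representatives chosen.\<close>

definition cA :: "'a \<Rightarrow> 'k" where "cA a = lk (SOME x. \<theta> x = a) 0"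
definition cK :: "'a set \<Rightarrow> 'k" where "cK U = cA (SOME a. a \<in> U)"

lemma cA: "cA (\<theta> x) = lk x 0"
proof -
  have "\<theta> (SOME y. \<theta> y = \<theta> x) = \<theta> x" by (rule someI[of "\<lambda>y. \<theta> y = \<theta> x" x]) simp
  from const_eq[OF this] show ?thesis by (simp add: cA_def)
qed

lemma cK: "cK (\<kappa> x) = lk x 0"
proof -
  have "\<theta> x \<in> \<kappa> x" unfolding \<kappa>_image by blast
  then have "(SOME a. a \<in> \<kappa> x) \<in> \<kappa> x" by (rule someI)
  then obtain y where "(SOME a. a \<in> \<kappa> x) = \<theta> y" "lk y 0 = lk x 0" unfolding \<kappa>_image by auto
  then show ?thesis by (simp add: cK_def cA)
qed

context
  fixes r :: nat
begin

abbreviation "Fm \<equiv> free_module A {..<r}"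
abbreviation "Sr \<equiv> carrier Fm \<times> carrier R"
abbreviation "tk \<equiv> tensor_kernel A Fm R"
abbreviation "Cr \<equiv> coord_space r :: (nat \<Rightarrow> 'k mpoly) set"
abbreviation "\<pi> \<equiv> \<Theta> {..<r}"

lemma model_F: "v.model Cr Fm \<pi>"
  using model_free[of "{..<r}"] by (simp add: fvecs_coord)

lemma model_Fr: "w.model (fvecs Sr) (free_module A Sr) (\<Theta> Sr)"
  by (rule model_free)

lemma Sr_cases: "s \<in> Sr \<Longrightarrow> (\<And>f h. f \<in> Cr \<Longrightarrow> s = (\<pi> f, \<kappa> h) \<Longrightarrow> P) \<Longrightarrow> P"
  unfolding v.modelD(2)[OF model_F] carrier_R by blast

lemma SrI: "f \<in> Cr \<Longrightarrow> (\<pi> f, \<kappa> h) \<in> Sr"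
  unfolding v.modelD(2)[OF model_F] carrier_R by blast

text \<open>The product of the constant term of the \<open>t\<close>-th coordinate with that of the
  residue class is bilinear. Its linear extension \<open>const_functional\<close> vanishes on the
  tensor relations and so keeps the tensor product from being smaller than k^r.\<close>

definition const_weight :: "nat \<Rightarrow> (nat \<Rightarrow> 'a) \<times> 'a set \<Rightarrow> 'k" where "const_weight t s = cA (fst s t) * cK (snd s)"

lemma const_weight: "t < r \<Longrightarrow> const_weight t (\<pi> f, \<kappa> h) = lk (f t) 0 * lk h 0"
  by (simp add: const_weight_def \<Theta>_def cA cK)

definition const_functional :: "nat \<Rightarrow> ((nat \<Rightarrow> 'a) \<times> 'a set \<Rightarrow> 'k mpoly) \<Rightarrow> 'k" where
  "const_functional t z = (\<Sum>s\<in>{s. z s \<noteq> 0}. lk (z s) 0 * const_weight t s)"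

lemma const_functional_sum: "finite T \<Longrightarrow> {s. z s \<noteq> 0} \<subseteq> T \<Longrightarrow> const_functional t z = (\<Sum>s\<in>T. lk (z s) 0 * const_weight t s)"
  unfolding const_functional_def by (rule sum.mono_neutral_left) auto

lemma const_functional_lin:
  assumes "z \<in> fvecs S" "y \<in> fvecs S"
  shows "const_functional t (z + y) = const_functional t z + const_functional t y" "const_functional t (z - y) = const_functional t z - const_functional t y" "const_functional t (smul x z) = lk x 0 * const_functional t z"
proof -
  let ?T = "{s. z s \<noteq> 0} \<union> {s. y s \<noteq> 0}"
  have T: "finite ?T" "{s. z s \<noteq> 0} \<subseteq> ?T" "{s. y s \<noteq> 0} \<subseteq> ?T" "{s. (z + y) s \<noteq> 0} \<subseteq> ?T" "{s. (z - y) s \<noteq> 0} \<subseteq> ?T"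
    "{s. smul x z s \<noteq> 0} \<subseteq> ?T" using assms by (auto simp: fvecs_def smul_def)
  show "const_functional t (z + y) = const_functional t z + const_functional t y" "const_functional t (z - y) = const_functional t z - const_functional t y"
    unfolding const_functional_sum[OF T(1,2)] const_functional_sum[OF T(1,3)] const_functional_sum[OF T(1,4)] const_functional_sum[OF T(1,5)]
    by (simp_all add: lookup_add lookup_minus distrib_right left_diff_distrib sum.distrib sum_subtractf)
  show "const_functional t (smul x z) = lk x 0 * const_functional t z"
    unfolding const_functional_sum[OF T(1,2)] const_functional_sum[OF T(1,6)]
    by (simp add: smul_def const_mult sum_distrib_left mult.assoc)
qed

lemma const_functional_smul: "z \<in> fvecs S \<Longrightarrow> const_functional t (smul x z) = lk x 0 * const_functional t z"
  by (rule const_functional_lin(3))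

lemma const_functional_dl: "const_functional t (delta_vec s) = const_weight t s"
proof -
  have "const_functional t (delta_vec s) = (\<Sum>s'\<in>{s}. lk (delta_vec s s' :: 'k mpoly) 0 * const_weight t s')" by (rule const_functional_sum) (auto simp: delta_vec_def)
  then show ?thesis by (simp add: delta_vec_def const_one)
qed

lemma const_functional_cong:
  assumes "z \<in> fvecs Sr" "y \<in> fvecs Sr" "\<Theta> Sr z = \<Theta> Sr y" shows "const_functional t z = const_functional t y"
proof -
  let ?T = "{s. z s \<noteq> 0} \<union> {s. y s \<noteq> 0}"
  have T: "finite ?T" "{s. z s \<noteq> 0} \<subseteq> ?T" "{s. y s \<noteq> 0} \<subseteq> ?T" using assms by (auto simp: fvecs_def)
  have "lk (z s) 0 = lk (y s) 0" for s
  proof (cases "s \<in> Sr")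
    case True
    then have "z s - y s \<in> mono_ideal N" using assms(3) unfolding \<Theta>_eq by blast
    then show ?thesis using const_eq[of "z s" "y s"] by (simp add: \<theta>_eq)
  next
    case False
    have "z s = 0" using assms(1) False unfolding fvecs_def by blast
    moreover have "y s = 0" using assms(2) False unfolding fvecs_def by blast
    ultimately show ?thesis by simp
  qed
  then show ?thesis using const_functional_sum[OF T(1,2), of t] const_functional_sum[OF T(1,3), of t] by simp
qed

abbreviation "delta_pair f h \<equiv> delta_vec (\<pi> f, \<kappa> h) :: (nat \<Rightarrow> 'a) \<times> 'a set \<Rightarrow> 'k mpoly"

definition typed_relations where
  "typed_relations = {delta_pair (f + f') h - (delta_pair f h + delta_pair f' h) | f f' h. f \<in> Cr \<and> f' \<in> Cr}
    \<union> {delta_pair f (h + h') - (delta_pair f h + delta_pair f h') | f h h'. f \<in> Cr}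
    \<union> {delta_pair (smul x f) h - smul x (delta_pair f h) | x f h. f \<in> Cr}
    \<union> {delta_pair f (x * h) - smul x (delta_pair f h) | x f h. f \<in> Cr}"

lemma delta_pair: "f \<in> Cr \<Longrightarrow> delta_pair f h \<in> fvecs Sr"
  by (intro delta_vec_fvecs SrI)

lemma typed_relations_fvecs: "typed_relations \<subseteq> fvecs Sr"
proof -
  note sb = w.modelD(1)[OF model_Fr]
  show ?thesis unfolding typed_relations_def
    by (auto intro!: w.sub_diff[OF sb] w.subD(2,3)[OF sb] delta_pair coord_add smul_coord)
qed

lemma typed_relations_eq: "tensor_relations A Fm R = \<Theta> Sr ` typed_relations"
proof -
  note sb = w.modelD(1)[OF model_Fr]
  note mF = v.modelD[OF model_F]
  have m1: "\<Theta> Sr (delta_pair f h) \<ominus>\<^bsub>free_module A Sr\<^esub> (\<Theta> Sr (delta_pair f' h') \<oplus>\<^bsub>free_module A Sr\<^esub> \<Theta> Sr (delta_pair f'' h''))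
      = \<Theta> Sr (delta_pair f h - (delta_pair f' h' + delta_pair f'' h''))" if "f \<in> Cr" "f' \<in> Cr" "f'' \<in> Cr" for f f' f'' h h' h''
    using w.modelD(4)[OF model_Fr delta_pair[OF that(2)] delta_pair[OF that(3)]]
      w.model_minus[OF model_Fr delta_pair[OF that(1)] w.subD(2)[OF sb delta_pair[OF that(2)] delta_pair[OF that(3)]]] by simp
  have m2: "\<Theta> Sr (delta_pair f h) \<ominus>\<^bsub>free_module A Sr\<^esub> (\<theta> x \<odot>\<^bsub>free_module A Sr\<^esub> \<Theta> Sr (delta_pair f' h'))
      = \<Theta> Sr (delta_pair f h - smul x (delta_pair f' h'))" if "f \<in> Cr" "f' \<in> Cr" for f f' h h' x
    using w.modelD(5)[OF model_Fr delta_pair[OF that(2)]]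
      w.model_minus[OF model_Fr delta_pair[OF that(1)] w.subD(3)[OF sb delta_pair[OF that(2)]]] by simp
  have "tensor_relations A Fm R =
     {\<Theta> Sr (delta_pair (f + f') h - (delta_pair f h + delta_pair f' h)) | f f' h. f \<in> Cr \<and> f' \<in> Cr}
    \<union> {\<Theta> Sr (delta_pair f (h + h') - (delta_pair f h + delta_pair f h')) | f h h'. f \<in> Cr}
    \<union> {\<Theta> Sr (delta_pair (smul x f) h - smul x (delta_pair f h)) | x f h. f \<in> Cr}
    \<union> {\<Theta> Sr (delta_pair f (x * h) - smul x (delta_pair f h)) | x f h. f \<in> Cr}"
    unfolding tensor_relations_def Let_def free_gen_eq
  proof (intro arg_cong2[where f = "(\<union>)"])
    let ?d = "\<lambda>s. \<Theta> Sr (delta_vec s)" and ?F = "free_module A Sr"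
    show "{?d (x \<oplus>\<^bsub>Fm\<^esub> x', y) \<ominus>\<^bsub>?F\<^esub> (?d (x, y) \<oplus>\<^bsub>?F\<^esub> ?d (x', y)) | x x' y. x \<in> carrier Fm \<and> x' \<in> carrier Fm \<and> y \<in> carrier R}
        = {\<Theta> Sr (delta_pair (f + f') h - (delta_pair f h + delta_pair f' h)) | f f' h. f \<in> Cr \<and> f' \<in> Cr}" (is "?L = ?R")
    proof (intro equalityI subsetI)
      fix u assume "u \<in> ?L"
      then obtain f f' h where f: "f \<in> Cr" "f' \<in> Cr" "u = ?d (\<pi> f \<oplus>\<^bsub>Fm\<^esub> \<pi> f', \<kappa> h) \<ominus>\<^bsub>?F\<^esub> (?d (\<pi> f, \<kappa> h) \<oplus>\<^bsub>?F\<^esub> ?d (\<pi> f', \<kappa> h))"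
        unfolding mF(2) carrier_R by blast
      then show "u \<in> ?R" unfolding mF(4)[OF f(1,2)] m1[OF coord_add[OF f(1,2)] f(1,2)] by blast
    next
      fix u assume "u \<in> ?R"
      then obtain f f' h where f: "f \<in> Cr" "f' \<in> Cr" "u = \<Theta> Sr (delta_pair (f + f') h - (delta_pair f h + delta_pair f' h))" by blast
      from f(3) have "u = ?d (\<pi> f \<oplus>\<^bsub>Fm\<^esub> \<pi> f', \<kappa> h) \<ominus>\<^bsub>?F\<^esub> (?d (\<pi> f, \<kappa> h) \<oplus>\<^bsub>?F\<^esub> ?d (\<pi> f', \<kappa> h))"
        unfolding mF(4)[OF f(1,2)] m1[OF coord_add[OF f(1,2)] f(1,2)] .
      then show "u \<in> ?L" using f(1,2) unfolding mF(2) carrier_R by blast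
    qed
    show "{?d (x, y \<oplus>\<^bsub>R\<^esub> y') \<ominus>\<^bsub>?F\<^esub> (?d (x, y) \<oplus>\<^bsub>?F\<^esub> ?d (x, y')) | x y y'. x \<in> carrier Fm \<and> y \<in> carrier R \<and> y' \<in> carrier R}
        = {\<Theta> Sr (delta_pair f (h + h') - (delta_pair f h + delta_pair f h')) | f h h'. f \<in> Cr}" (is "?L = ?R")
    proof (intro equalityI subsetI)
      fix u assume "u \<in> ?L"
      then obtain f h h' where f: "f \<in> Cr" "u = ?d (\<pi> f, \<kappa> h \<oplus>\<^bsub>R\<^esub> \<kappa> h') \<ominus>\<^bsub>?F\<^esub> (?d (\<pi> f, \<kappa> h) \<oplus>\<^bsub>?F\<^esub> ?d (\<pi> f, \<kappa> h'))"
        unfolding mF(2) carrier_R by blast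
      then show "u \<in> ?R" unfolding R_ops m1[OF f(1) f(1) f(1)] by blast
    next
      fix u assume "u \<in> ?R"
      then obtain f h h' where f: "f \<in> Cr" "u = \<Theta> Sr (delta_pair f (h + h') - (delta_pair f h + delta_pair f h'))" by blast
      from f(2) have "u = ?d (\<pi> f, \<kappa> h \<oplus>\<^bsub>R\<^esub> \<kappa> h') \<ominus>\<^bsub>?F\<^esub> (?d (\<pi> f, \<kappa> h) \<oplus>\<^bsub>?F\<^esub> ?d (\<pi> f, \<kappa> h'))"
        unfolding R_ops m1[OF f(1) f(1) f(1)] .
      then show "u \<in> ?L" using f(1) unfolding mF(2) carrier_R by blast
    qed
    show "{?d (a \<odot>\<^bsub>Fm\<^esub> x, y) \<ominus>\<^bsub>?F\<^esub> (a \<odot>\<^bsub>?F\<^esub> ?d (x, y)) | a x y. a \<in> carrier A \<and> x \<in> carrier Fm \<and> y \<in> carrier R}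
        = {\<Theta> Sr (delta_pair (smul x f) h - smul x (delta_pair f h)) | x f h. f \<in> Cr}" (is "?L = ?R")
    proof (intro equalityI subsetI)
      fix u assume "u \<in> ?L"
      then obtain x f h where f: "f \<in> Cr" "u = ?d (\<theta> x \<odot>\<^bsub>Fm\<^esub> \<pi> f, \<kappa> h) \<ominus>\<^bsub>?F\<^esub> (\<theta> x \<odot>\<^bsub>?F\<^esub> ?d (\<pi> f, \<kappa> h))"
        unfolding mF(2) carrier_R \<theta>_range[symmetric] by blast
      then show "u \<in> ?R" unfolding mF(5)[OF f(1)] m2[OF smul_coord[OF f(1)] f(1)] by blast
    next
      fix u assume "u \<in> ?R"
      then obtain x f h where f: "f \<in> Cr" "u = \<Theta> Sr (delta_pair (smul x f) h - smul x (delta_pair f h))" by blast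
      from f(2) have "u = ?d (\<theta> x \<odot>\<^bsub>Fm\<^esub> \<pi> f, \<kappa> h) \<ominus>\<^bsub>?F\<^esub> (\<theta> x \<odot>\<^bsub>?F\<^esub> ?d (\<pi> f, \<kappa> h))"
        unfolding mF(5)[OF f(1)] m2[OF smul_coord[OF f(1)] f(1)] .
      then show "u \<in> ?L" using f(1) unfolding mF(2) carrier_R \<theta>_range[symmetric] by blast
    qed
    show "{?d (x, a \<odot>\<^bsub>R\<^esub> y) \<ominus>\<^bsub>?F\<^esub> (a \<odot>\<^bsub>?F\<^esub> ?d (x, y)) | a x y. a \<in> carrier A \<and> x \<in> carrier Fm \<and> y \<in> carrier R}
        = {\<Theta> Sr (delta_pair f (x * h) - smul x (delta_pair f h)) | x f h. f \<in> Cr}" (is "?L = ?R")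
    proof (intro equalityI subsetI)
      fix u assume "u \<in> ?L"
      then obtain x f h where f: "f \<in> Cr" "u = ?d (\<pi> f, \<theta> x \<odot>\<^bsub>R\<^esub> \<kappa> h) \<ominus>\<^bsub>?F\<^esub> (\<theta> x \<odot>\<^bsub>?F\<^esub> ?d (\<pi> f, \<kappa> h))"
        unfolding mF(2) carrier_R \<theta>_range[symmetric] by blast
      then show "u \<in> ?R" unfolding R_ops m2[OF f(1) f(1)] by blast
    next
      fix u assume "u \<in> ?R"
      then obtain x f h where f: "f \<in> Cr" "u = \<Theta> Sr (delta_pair f (x * h) - smul x (delta_pair f h))" by blast
      from f(2) have "u = ?d (\<pi> f, \<theta> x \<odot>\<^bsub>R\<^esub> \<kappa> h) \<ominus>\<^bsub>?F\<^esub> (\<theta> x \<odot>\<^bsub>?F\<^esub> ?d (\<pi> f, \<kappa> h))"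
        unfolding R_ops m2[OF f(1) f(1)] .
      then show "u \<in> ?L" using f(1) unfolding mF(2) carrier_R \<theta>_range[symmetric] by blast
    qed
  qed
  note eq = this
  show ?thesis unfolding eq typed_relations_def image_Un by (intro arg_cong2[where f = "(\<union>)"]; blast)
qed

definition tB where "tB = {z \<in> fvecs Sr. \<Theta> Sr z \<in> tk}"

lemma tk_sub: "submodule A tk (free_module A Sr)" "\<Theta> Sr ` typed_relations \<subseteq> tk"
proof -
  interpret Fr: module A "free_module A Sr" by (rule w.module_model[OF model_Fr])
  have "tensor_relations A Fm R \<subseteq> carrier (free_module A Sr)"
    unfolding typed_relations_eq w.modelD(2)[OF model_Fr] using typed_relations_fvecs by blast
  from Fr.span_is_submodule[OF this] Fr.in_own_span[OF this]
  show "submodule A tk (free_module A Sr)" "\<Theta> Sr ` typed_relations \<subseteq> tk"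
    unfolding tensor_kernel_def typed_relations_eq by auto
qed

lemma sub_tB: "w.sub tB"
  unfolding w.sub_def
proof (intro conjI ballI allI)
  note md = w.modelD[OF model_Fr] and sm = submodule.m_closed[OF tk_sub(1)] submodule.zero_closed[OF tk_sub(1)] submodule.smult_closed[OF tk_sub(1)]
  show "0 \<in> tB" using sm(2) w.subD(1)[OF md(1)] by (simp add: tB_def md(3))
  show "z + y \<in> tB" if "z \<in> tB" "y \<in> tB" for z y
    using that w.subD(2)[OF md(1)] md(4)[of z y] sm(1)[of "\<Theta> Sr z" "\<Theta> Sr y"] by (simp add: tB_def)
  show "smul x z \<in> tB" if "z \<in> tB" for x z
    using that w.subD(3)[OF md(1)] md(5)[of z x] sm(3)[of "\<theta> x" "\<Theta> Sr z"] by (simp add: tB_def)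
qed

lemma tB_image: "\<Theta> Sr ` tB = tk" "tB \<subseteq> fvecs Sr"
  using submodule.subset[OF tk_sub(1)] unfolding tB_def w.modelD(2)[OF model_Fr] by auto

lemma typed_relations_tB: "typed_relations \<subseteq> tB"
  using tk_sub(2) typed_relations_fvecs by (auto simp: tB_def)

text \<open>The vectors killed by the functional form a submodule that contains the relations, so
  its image contains their span. Membership in \<open>tB\<close> concerns only that image, and
  \<open>const_functional_cong\<close> leads back from it to \<open>z\<close>.\<close>

lemma const_functional_tB: assumes z: "z \<in> tB" and t: "t < r" shows "const_functional t z = 0"
proof -
  interpret Fr: module A "free_module A Sr" by (rule w.module_model[OF model_Fr])
  note sb = w.modelD(1)[OF model_Fr]
  define B0 where "B0 = {z \<in> fvecs Sr. const_functional t z = 0}"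
  have "const_functional t 0 = 0" by (simp add: const_functional_def)
  then have B0: "w.sub B0" "B0 \<subseteq> fvecs Sr"
    unfolding w.sub_def B0_def using w.subD[OF sb] const_functional_lin by auto
  have "typed_relations \<subseteq> B0"
  proof
    fix u assume u: "u \<in> typed_relations"
    note cl = delta_pair coord_add smul_coord w.subD(2,3)[OF sb]
    have "const_functional t u = 0" using u unfolding typed_relations_def
      by (auto simp: const_functional_lin(1,2)[where S = Sr] const_functional_smul[where S = Sr] cl const_functional_dl const_weight t lookup_add const_mult smul_apply distrib_right distrib_left mult.assoc mult.left_commute)
    then show "u \<in> B0" using u typed_relations_fvecs by (auto simp: B0_def)
  qed
  then have "tensor_relations A Fm R \<subseteq> \<Theta> Sr ` B0" unfolding typed_relations_eq by (rule image_mono)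
  from Fr.span_is_subset[OF this w.submodule_model[OF model_Fr B0]] have "tk \<subseteq> \<Theta> Sr ` B0" by (simp add: tensor_kernel_def)
  then obtain y where y: "y \<in> fvecs Sr" "\<Theta> Sr z = \<Theta> Sr y" "const_functional t y = 0" using z by (auto simp: tB_def B0_def)
  show ?thesis using const_functional_cong[OF _ y(1,2), of t] z y(3) by (simp add: tB_def)
qed

abbreviation "Tn \<equiv> tensor A Fm R"
definition "\<Phi> z = tk +>\<^bsub>free_module A Sr\<^esub> \<Theta> Sr z"

lemma tB_ker: assumes "z \<in> fvecs Sr" "y \<in> fvecs Sr" "\<Theta> Sr z = \<Theta> Sr y" shows "z - y \<in> tB"
proof -
  have "\<Theta> Sr (z - y) = \<Theta> Sr 0" using assms(3) unfolding \<Theta>_eq by simp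
  then show ?thesis using submodule.zero_closed[OF tk_sub(1)] w.sub_diff[OF w.modelD(1)[OF model_Fr] assms(1,2)]
    by (simp add: tB_def w.modelD(3)[OF model_Fr])
qed

lemma model_\<Phi>: "w.model (fvecs Sr) Tn \<Phi>"
  unfolding tensor_def \<Phi>_def[abs_def]
  by (rule w.model_quot(1)[OF model_Fr sub_tB tB_image(2) tB_ker, unfolded tB_image(1)])

lemma \<Phi>_eq: "z \<in> fvecs Sr \<Longrightarrow> y \<in> fvecs Sr \<Longrightarrow> \<Phi> z = \<Phi> y \<longleftrightarrow> z - y \<in> tB"
  unfolding \<Phi>_def
  by (rule w.model_quot(2)[OF model_Fr sub_tB tB_image(2) tB_ker, unfolded tB_image(1)])

text \<open>The map f \<mapsto> f \<otimes> 1. By \<open>\<Psi>_eq\<close> its kernel is the maximal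
  ideal times the free module, so it describes the tensor product with the residue field by vectors
  modulo \<open>- {0}\<close>.\<close>

definition \<Psi> :: "(nat \<Rightarrow> 'k mpoly) \<Rightarrow> ((nat \<Rightarrow> 'a) \<times> 'a set \<Rightarrow> 'a) set" where "\<Psi> f = \<Phi> (delta_pair f 1)"

lemma pure_\<Phi>: "pure_tensor A Fm R (\<pi> f) (\<kappa> h) = \<Phi> (delta_pair f h)"
  by (simp add: pure_tensor_def \<Phi>_def free_gen_eq)

lemma \<Phi>_scal: assumes f: "f \<in> Cr" shows "\<Phi> (delta_pair f (x * h)) = \<Phi> (smul x (delta_pair f h))"
proof -
  have "delta_pair f (x * h) - smul x (delta_pair f h) \<in> tB" using typed_relations_tB f unfolding typed_relations_def by blast
  then show ?thesis using \<Phi>_eq[OF delta_pair[OF f] w.subD(3)[OF w.modelD(1)[OF model_Fr] delta_pair[OF f]]] by blast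
qed

lemma \<Psi>_add: assumes f: "f \<in> Cr" "g \<in> Cr" shows "\<Psi> f \<oplus>\<^bsub>Tn\<^esub> \<Psi> g = \<Psi> (f + g)"
proof -
  note sb = w.modelD(1)[OF model_Fr]
  have "delta_pair (f + g) 1 - (delta_pair f 1 + delta_pair g 1) \<in> tB" using typed_relations_tB f unfolding typed_relations_def by blast
  then have "\<Phi> (delta_pair (f + g) 1) = \<Phi> (delta_pair f 1 + delta_pair g 1)"
    using \<Phi>_eq[OF delta_pair[OF coord_add[OF f]] w.subD(2)[OF sb delta_pair[OF f(1)] delta_pair[OF f(2)]]] by blast
  then show ?thesis using w.modelD(4)[OF model_\<Phi> delta_pair[OF f(1)] delta_pair[OF f(2)]] by (simp add: \<Psi>_def)
qed

lemma \<Psi>_smul: assumes f: "f \<in> Cr" shows "\<theta> x \<odot>\<^bsub>Tn\<^esub> \<Psi> f = \<Psi> (smul x f)" "\<Psi> (smul x f) = \<Phi> (smul x (delta_pair f 1))"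
proof -
  note sb = w.modelD(1)[OF model_Fr]
  have "delta_pair (smul x f) 1 - smul x (delta_pair f 1) \<in> tB" using typed_relations_tB f unfolding typed_relations_def by blast
  then show "\<Psi> (smul x f) = \<Phi> (smul x (delta_pair f 1))" unfolding \<Psi>_def
    using \<Phi>_eq[OF delta_pair[OF smul_coord[OF f]] w.subD(3)[OF sb delta_pair[OF f]]] by blast
  then show "\<theta> x \<odot>\<^bsub>Tn\<^esub> \<Psi> f = \<Psi> (smul x f)"
    using w.modelD(5)[OF model_\<Phi> delta_pair[OF f]] by (simp add: \<Psi>_def)
qed

lemma pure_\<Psi>: "f \<in> Cr \<Longrightarrow> pure_tensor A Fm R (\<pi> f) (\<kappa> h) = \<Psi> (smul h f)"
  unfolding pure_\<Phi> \<Psi>_smul(2) using \<Phi>_scal[of f h 1] by simp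

lemma zero_Cr: "0 \<in> Cr" by (simp add: coord_space_def)

lemma \<Psi>_zero: "\<Psi> 0 = \<Phi> 0"
  using \<Psi>_smul(2)[OF zero_Cr, of 0] by (simp add: smul_add(5)) (simp add: smul_def zero_fun_def)

text \<open>A pure tensor f \<otimes> h is (h f) \<otimes> 1. Hence the vectors whose class is in
  the range of \<Psi> form a submodule that contains all generators
  \<open>delta_vec s\<close>.\<close>

lemma model_\<Psi>: "v.model Cr Tn \<Psi>"
  unfolding v.model_def
proof (intro conjI ballI allI)
  note sb = w.modelD(1)[OF model_Fr]
  show "v.sub Cr" using v.modelD(1)[OF model_F] .
  show "\<zero>\<^bsub>Tn\<^esub> = \<Psi> 0" unfolding \<Psi>_zero by (rule w.modelD(3)[OF model_\<Phi>])
  show "\<Psi> f \<oplus>\<^bsub>Tn\<^esub> \<Psi> g = \<Psi> (f + g)" if "f \<in> Cr" "g \<in> Cr" for f g using \<Psi>_add[OF that] .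
  show "\<theta> x \<odot>\<^bsub>Tn\<^esub> \<Psi> f = \<Psi> (smul x f)" if "f \<in> Cr" for f x using \<Psi>_smul(1)[OF that] .
  define G where "G = {z \<in> fvecs Sr. \<exists>f\<in>Cr. \<Phi> z = \<Psi> f}"
  have G: "w.sub G" unfolding w.sub_def
  proof (intro conjI ballI allI)
    show "0 \<in> G" using \<Psi>_zero zero_Cr w.subD(1)[OF sb] by (auto simp: G_def intro!: bexI[of _ 0])
    show "z + y \<in> G" if zy: "z \<in> G" "y \<in> G" for z y
    proof -
      obtain f g where f: "z \<in> fvecs Sr" "y \<in> fvecs Sr" "f \<in> Cr" "g \<in> Cr" "\<Phi> z = \<Psi> f" "\<Phi> y = \<Psi> g" using zy by (auto simp: G_def)
      then have "\<Phi> (z + y) = \<Psi> (f + g)" using w.modelD(4)[OF model_\<Phi> f(1,2)] \<Psi>_add[OF f(3,4)] by simp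
      then show ?thesis using coord_add[OF f(3,4)] w.subD(2)[OF sb f(1,2)] by (auto simp: G_def)
    qed
    show "smul x z \<in> G" if z: "z \<in> G" for x z
    proof -
      obtain f where f: "z \<in> fvecs Sr" "f \<in> Cr" "\<Phi> z = \<Psi> f" using z by (auto simp: G_def)
      then have "\<Phi> (smul x z) = \<Psi> (smul x f)" using w.modelD(5)[OF model_\<Phi> f(1), of x] \<Psi>_smul(1)[OF f(2), of x] by simp
      then show ?thesis using smul_coord[OF f(2)] w.subD(3)[OF sb f(1)] by (auto simp: G_def)
    qed
  qed
  have "delta_vec s \<in> G" if s: "s \<in> Sr" for s
  proof (rule Sr_cases[OF s])
    fix f h assume f: "f \<in> Cr" "s = (\<pi> f, \<kappa> h)"
    have "\<Phi> (delta_vec s) = \<Psi> (smul h f)" using \<Phi>_scal[OF f(1), of h 1] \<Psi>_smul(2)[OF f(1), of h] by (simp add: f(2))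
    then show "delta_vec s \<in> G" using delta_vec_fvecs[OF s] smul_coord[OF f(1)] by (auto simp: G_def)
  qed
  then have "z \<in> G" if z: "z \<in> fvecs Sr" for z
    by (subst fvecs_decomp[OF z]) (use z in \<open>auto simp: fvecs_def intro!: w.sub_sum[OF G] w.subD(3)[OF G]\<close>)
  then have "\<Phi> ` fvecs Sr \<subseteq> \<Psi> ` Cr" by (auto simp: G_def)
  moreover have "\<Psi> ` Cr \<subseteq> \<Phi> ` fvecs Sr" using delta_pair by (auto simp: \<Psi>_def)
  ultimately show "carrier Tn = \<Psi> ` Cr" unfolding w.modelD(2)[OF model_\<Phi>] by blast
qed

text \<open>The functionals \<open>const_functional t\<close> separate the constant terms of the
  coordinates, which gives one direction. For the other, a coefficient without constant term has the
  residue class of 0 and can be moved across the tensor sign.\<close>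

lemma \<Psi>_eq: assumes fg: "f \<in> Cr" "g \<in> Cr" shows "\<Psi> f = \<Psi> g \<longleftrightarrow> f - g \<in> vec_ideal (- {0}) r"
proof
  assume "\<Psi> f = \<Psi> g"
  then have "delta_pair f 1 - delta_pair g 1 \<in> tB" using \<Phi>_eq[OF delta_pair[OF fg(1)] delta_pair[OF fg(2)]] by (simp add: \<Psi>_def)
  then have "const_functional t (delta_pair f 1 - delta_pair g 1) = 0" if "t < r" for t using const_functional_tB that by blast
  then have "lk (f t) 0 = lk (g t) 0" if "t < r" for t
    using that by (simp add: const_functional_lin(2)[OF delta_pair[OF fg(1)] delta_pair[OF fg(2)]] const_functional_dl const_weight const_one)
  moreover have "f t = 0 \<and> g t = 0" if "\<not> t < r" for t using fg that by (auto simp: coord_space_def)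
  ultimately have "lk ((f - g) t) 0 = 0" for t by (cases "t < r") (auto simp: lookup_minus)
  then show "f - g \<in> vec_ideal (- {0}) r" using coord_diff[OF fg] by (simp add: vec_ideal_def mono_ideal_pos)
next
  assume fg': "f - g \<in> vec_ideal (- {0}) r"
  note sb = w.modelD(1)[OF model_Fr]
  define G where "G = {h \<in> Cr. \<Psi> h = \<Psi> 0}"
  have G: "v.sub G" unfolding v.sub_def
  proof (intro conjI ballI allI)
    show "0 \<in> G" using zero_Cr by (simp add: G_def)
    show "z + y \<in> G" if "z \<in> G" "y \<in> G" for z y
      using that coord_add[of z r y] \<Psi>_add[of z y] \<Psi>_add[OF zero_Cr zero_Cr] by (simp add: G_def)
    show "smul x z \<in> G" if "z \<in> G" for x z
      using that smul_coord[of z r x] \<Psi>_smul(1)[of z x] \<Psi>_smul(1)[OF zero_Cr, of x] by (simp add: G_def smul_add(5))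
  qed
  have gen: "smul x u \<in> G" if u: "u \<in> Cr" and x: "lk x 0 = 0" for x u
  proof -
    have "\<kappa> x = \<kappa> 0" using x by (simp add: \<kappa>_eq)
    then have "\<Psi> (smul x u) = \<Psi> (smul 0 u)" using \<Phi>_scal[OF u, of x 1] \<Phi>_scal[OF u, of 0 1] \<Psi>_smul(2)[OF u] by simp
    then show ?thesis using smul_coord[OF u] by (simp add: G_def smul_def zero_fun_def)
  qed
  have "f - g \<in> fvecs {..<r}" using coord_diff[OF fg] by (simp add: fvecs_coord)
  then have "f - g \<in> G"
  proof (subst fvecs_decomp, assumption, intro v.sub_sum[OF G] gen)
    fix t assume t: "t \<in> {s. (f - g) s \<noteq> 0}"
    show "lk ((f - g) t) 0 = 0" using fg' by (auto simp: vec_ideal_def mono_ideal_pos)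
    show "delta_vec t \<in> Cr" using t coord_diff[OF fg] by (auto simp: coord_space_def delta_vec_def not_less[symmetric])
  qed
  then have fgC: "f - g \<in> Cr" and eq0: "\<Psi> (f - g) = \<Psi> 0" by (auto simp: G_def)
  have "\<Psi> (g + (f - g)) = \<Psi> (g + 0)"
    unfolding \<Psi>_add[OF fg(2) fgC, symmetric] \<Psi>_add[OF fg(2) zero_Cr, symmetric] eq0 ..
  then show "\<Psi> f = \<Psi> g" by simp
qed

end

end

section \<open>Betti numbers\<close>

text \<open>\<open>vectorspace.dim\<close> is the least size of a finite spanning set and says
  something only if such a set exists. The bound \<open>sp\<close>, however crude, provides one; a
  minimal set is then lifted to representatives.\<close>

lemma (in scalars) dim_model:
  fixes sc :: "'c::field \<Rightarrow> 'z \<Rightarrow> 'z"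
  assumes K: "field A" and m: "model Z V \<Phi>" and B: "sub B" "B \<subseteq> Z"
    and eq: "\<And>z w. z \<in> Z \<Longrightarrow> w \<in> Z \<Longrightarrow> \<Phi> z = \<Phi> w \<longleftrightarrow> z - w \<in> B"
    and kv: "k_space sc" and sc: "\<And>c z. sc c z = act (h c) z" and h: "surj h"
    and sp: "k_space.spanned_mod sc Z B m"
  shows "k_space.spanned_mod sc Z B (vectorspace.dim A V)"
proof -
  interpret k: k_space sc by (rule kv)
  note md = modelD[OF m]
  have subk: "sub W \<longleftrightarrow> k.subspace W" for W
  proof
    assume "sub W" then show "k.subspace W" by (auto simp: sub_def k.subspace_def sc)
  next
    assume W: "k.subspace W"
    have "act x z \<in> W" if z: "z \<in> W" for x z
    proof -
      obtain c where "x = h c" using h by blast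
      then show ?thesis using k.subspace_scale[OF W z, of c] by (simp add: sc)
    qed
    then show "sub W" using W by (auto simp: sub_def k.subspace_def)
  qed
  interpret V: vectorspace A V using K module_model[OF m] by (intro vectorspace.intro)
  obtain S0 where S0: "finite S0" "S0 \<subseteq> Z" "\<And>z. z \<in> Z \<Longrightarrow> \<exists>s\<in>k.span S0. z - s \<in> B"
    using sp unfolding k.spanned_mod_def by blast
  have S0c: "\<Phi> ` S0 \<subseteq> carrier V" using S0(2) md(2) by auto
  note sm = V.span_is_submodule[OF S0c]
  have in_sp: "s \<in> Z \<and> \<Phi> s \<in> V.span (\<Phi> ` S0)" if "s \<in> k.span S0" for s
    using that
  proof (induction rule: k.span_induct_alt)
    case base
    then show ?case using subD(1)[OF md(1)] submodule.zero_closed[OF sm] by (simp add: md(3))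
  next
    case (step c x y)
    then have x: "x \<in> Z" "\<Phi> x \<in> V.span (\<Phi> ` S0)" using S0(2) V.in_own_span[OF S0c] by auto
    have cx: "sc c x \<in> Z" unfolding sc by (rule subD(3)[OF md(1) x(1)])
    have "\<theta> (h c) \<odot>\<^bsub>V\<^esub> \<Phi> x \<in> V.span (\<Phi> ` S0)"
      by (rule submodule.smult_closed[OF sm _ x(2)]) (use range in auto)
    then have "\<Phi> (sc c x) \<in> V.span (\<Phi> ` S0)" using md(5)[OF x(1)] by (simp add: sc)
    then have "\<Phi> (sc c x) \<oplus>\<^bsub>V\<^esub> \<Phi> y \<in> V.span (\<Phi> ` S0)" using step.IH by (intro submodule.m_closed[OF sm]) auto
    then show ?case using md(4)[OF cx] subD(2)[OF md(1) cx] step.IH by simp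
  qed
  have "carrier V \<subseteq> V.span (\<Phi> ` S0)"
  proof
    fix v assume "v \<in> carrier V"
    then obtain z where z: "z \<in> Z" "v = \<Phi> z" using md(2) by auto
    obtain s where s: "s \<in> k.span S0" "z - s \<in> B" using S0(3)[OF z(1)] by blast
    have "\<Phi> z = \<Phi> s" using eq[OF z(1)] in_sp[OF s(1)] s(2) by blast
    then show "v \<in> V.span (\<Phi> ` S0)" using in_sp[OF s(1)] z(2) by simp
  qed
  then have "V.span (\<Phi> ` S0) = carrier V" using submodule.subset[OF sm] by blast
  then have "\<exists>m A'. finite A' \<and> card A' = m \<and> A' \<subseteq> carrier V \<and> V.span A' = carrier V"
    using S0(1) S0c by blast
  then have "\<exists>A'. finite A' \<and> card A' = V.dim \<and> A' \<subseteq> carrier V \<and> V.span A' = carrier V"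
    unfolding V.dim_def by (rule LeastI_ex)
  then obtain A' where A': "finite A'" "card A' = V.dim" "A' \<subseteq> \<Phi> ` Z" "V.span A' = carrier V"
    unfolding md(2) by blast
  obtain S where S: "S \<subseteq> Z" "finite S" "card S \<le> V.dim" "A' = \<Phi> ` S"
  proof -
    have "\<forall>a\<in>A'. \<exists>z. z \<in> Z \<and> \<Phi> z = a" using A'(3) by blast
    from bchoice[OF this] obtain g where g: "\<And>a. a \<in> A' \<Longrightarrow> g a \<in> Z \<and> \<Phi> (g a) = a" by blast
    have "\<Phi> ` g ` A' = A'" using g by (simp add: image_image)
    moreover have "card (g ` A') \<le> V.dim" using card_image_le[OF A'(1), of g] A'(2) by simp
    ultimately show thesis using that[of "g ` A'"] g A'(1) by blast
  qed
  have spS: "sub (k.span S)" "k.span S \<subseteq> Z"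
    using k.subspace_span k.span_minimal[OF S(1)] md(1) by (simp_all add: subk)
  have "A' \<subseteq> \<Phi> ` k.span S" unfolding S(4) by (intro image_mono k.span_superset)
  from V.span_is_subset[OF this submodule_model[OF m spS]] have le: "carrier V \<subseteq> \<Phi> ` k.span S" unfolding A'(4) .
  have "\<exists>s\<in>k.span S. z - s \<in> B" if z: "z \<in> Z" for z
  proof -
    obtain s where s: "s \<in> k.span S" "\<Phi> z = \<Phi> s" using le z md(2) by auto
    then show ?thesis using eq[OF z, of s] spS(2) by blast
  qed
  then show ?thesis unfolding k.spanned_mod_def using S by blast
qed

context trunc_ring
begin

lemma \<pi>_eq: "f \<in> coord_space r \<Longrightarrow> g \<in> coord_space r \<Longrightarrow> \<pi> r f = \<pi> r g \<longleftrightarrow> f - g \<in> vec_ideal N r"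
proof -
  assume fg: "f \<in> coord_space r" "g \<in> coord_space r"
  have "f t - g t \<in> mono_ideal N" if "\<not> t < r" for t using fg that by (auto simp: coord_space_def)
  then show ?thesis unfolding \<Theta>_eq vec_ideal_def using coord_diff[OF fg] by (auto simp: fun_diff_def)
qed

lemma N_pos: "N \<subseteq> - {0}" using N0 by auto

end

section \<open>Tor and the Betti numbers in coordinates\<close>

locale resolved_module = trunc_ring A \<theta> N
  for A :: "('a, 'r) ring_scheme" and \<theta> :: "'k::field mpoly \<Rightarrow> 'a" and N +
  fixes E :: "('a, 'm, 'e) module_scheme" and n d and \<epsilon> :: "(nat \<Rightarrow> 'a) \<Rightarrow> 'm"
  assumes res: "free_resolution A E n d \<epsilon>"
begin

abbreviation "CS k \<equiv> coord_space (n k) :: (nat \<Rightarrow> 'k mpoly) set"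
abbreviation "F k \<equiv> Fm (n k)"

lemma resD: "\<epsilon> \<in> module_hom A (F 0) E" "\<epsilon> ` carrier (F 0) = carrier E"
  "d i \<in> module_hom A (F (Suc i)) (F i)" "d 0 ` carrier (F 1) = a_kernel (F 0) E \<epsilon>"
  "d (Suc i) ` carrier (F (Suc (Suc i))) = a_kernel (F (Suc i)) (F i) (d i)"
  using res unfolding free_resolution_def Let_def by blast+

text \<open>The lifts are chosen vector by vector, so additivity and homogeneity hold only after
  applying \<theta>. This is the reason for the congruences in the assumptions of
  \<open>poly_resolution\<close>.\<close>

definition D :: "nat \<Rightarrow> (nat \<Rightarrow> 'k mpoly) \<Rightarrow> nat \<Rightarrow> 'k mpoly" where
  "D k f = (SOME g. g \<in> CS k \<and> \<pi> (n k) g = d k (\<pi> (n (Suc k)) f))"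

lemma F_carrier: "carrier (F k) = \<pi> (n k) ` CS k"
  by (rule v.modelD(2)[OF model_F])

lemma D: assumes f: "f \<in> CS (Suc k)" shows "D k f \<in> CS k" "\<pi> (n k) (D k f) = d k (\<pi> (n (Suc k)) f)"
proof -
  have "d k (\<pi> (n (Suc k)) f) \<in> carrier (F k)"
    using resD(3)[of k] f F_carrier[of "Suc k"] by (auto simp: module_hom_def)
  then have "\<exists>g. g \<in> CS k \<and> \<pi> (n k) g = d k (\<pi> (n (Suc k)) f)" unfolding F_carrier by (metis imageE)
  from someI_ex[OF this] show "D k f \<in> CS k" "\<pi> (n k) (D k f) = d k (\<pi> (n (Suc k)) f)" unfolding D_def by auto
qed

lemma D_add0: assumes fg: "f \<in> CS (Suc k)" "g \<in> CS (Suc k)" shows "\<pi> (n k) (D k (f + g)) = \<pi> (n k) (D k f + D k g)"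
proof -
  note c = D(1)[OF fg(1)] D(1)[OF fg(2)]
  have "d k (\<pi> (n (Suc k)) f \<oplus>\<^bsub>F (Suc k)\<^esub> \<pi> (n (Suc k)) g) = d k (\<pi> (n (Suc k)) f) \<oplus>\<^bsub>F k\<^esub> d k (\<pi> (n (Suc k)) g)"
    using resD(3)[of k] fg F_carrier[of "Suc k"] by (auto simp: module_hom_def)
  then show ?thesis
    unfolding v.modelD(4)[OF model_F fg] D(2)[OF fg(1), symmetric] D(2)[OF fg(2), symmetric] D(2)[OF coord_add[OF fg], symmetric]
      v.modelD(4)[OF model_F c] .
qed

lemma D_smul0: assumes f: "f \<in> CS (Suc k)" shows "\<pi> (n k) (D k (smul x f)) = \<pi> (n k) (smul x (D k f))"
proof -
  have "d k (\<theta> x \<odot>\<^bsub>F (Suc k)\<^esub> \<pi> (n (Suc k)) f) = \<theta> x \<odot>\<^bsub>F k\<^esub> d k (\<pi> (n (Suc k)) f)"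
    using resD(3)[of k] f F_carrier[of "Suc k"] by (auto simp: module_hom_def)
  then show ?thesis
    unfolding v.modelD(5)[OF model_F f] D(2)[OF f, symmetric] D(2)[OF smul_coord[OF f], symmetric]
      v.modelD(5)[OF model_F D(1)[OF f]] .
qed

lemma D_zero0: "\<pi> (n k) (D k 0) = \<pi> (n k) 0"
proof -
  have "smul 0 f = 0" for f :: "nat \<Rightarrow> 'k mpoly" by (auto simp: smul_def)
  then show ?thesis using D_smul0[OF zero_Cr, of k 0] by simp
qed

definition syz :: "nat \<Rightarrow> (nat \<Rightarrow> 'k mpoly) set" where
  "syz j = {f \<in> CS j. \<exists>g\<in>CS (Suc j). f - D j g \<in> vec_ideal N (n j)}"

lemma syz_image: assumes f: "f \<in> CS j" shows "f \<in> syz j \<longleftrightarrow> \<pi> (n j) f \<in> d j ` carrier (F (Suc j))"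
proof -
  have "f - D j g \<in> vec_ideal N (n j) \<longleftrightarrow> \<pi> (n j) f = d j (\<pi> (n (Suc j)) g)" if "g \<in> CS (Suc j)" for g
    using \<pi>_eq[OF f D(1)[OF that]] D(2)[OF that] by simp
  then show ?thesis unfolding syz_def F_carrier using f by auto
qed

sublocale poly_resolution N n D syz
proof
  note s = scalars_smul
  show "D j (f + g) - (D j f + D j g) \<in> vec_ideal N (n j)" if "f \<in> CS (Suc j)" "g \<in> CS (Suc j)" for f g j
    using D_add0[OF that] \<pi>_eq[OF D(1)[OF coord_add[OF that]] coord_add[OF D(1)[OF that(1)] D(1)[OF that(2)]]] by blast
  show "D j (smul x f) - smul x (D j f) \<in> vec_ideal N (n j)" if "f \<in> CS (Suc j)" for f x j
    using D_smul0[OF that] \<pi>_eq[OF D(1)[OF smul_coord[OF that]] smul_coord[OF D(1)[OF that]]] by blast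
  show "D j f \<in> CS j" if "f \<in> CS (Suc j)" for f j using D(1)[OF that] .
  show "D j f \<in> vec_ideal N (n j)" if f: "f \<in> vec_ideal N (n (Suc j))" for f j
  proof -
    have fc: "f \<in> CS (Suc j)" using f by (rule vec_ideal_coord)
    have "\<pi> (n (Suc j)) f = \<pi> (n (Suc j)) 0" using \<pi>_eq[OF fc zero_Cr] f by simp
    then have "\<pi> (n j) (D j f) = \<pi> (n j) 0" using D(2)[OF fc] D(2)[OF zero_Cr, of j] D_zero0[of j] by simp
    then show ?thesis using \<pi>_eq[OF D(1)[OF fc] zero_Cr] by simp
  qed
  show "f \<in> syz j \<longleftrightarrow> f \<in> CS j \<and> (\<exists>g\<in>CS (Suc j). f - D j g \<in> vec_ideal N (n j))" for f j by (simp add: syz_def)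
  show "f \<in> syz (Suc j) \<longleftrightarrow> D j f \<in> vec_ideal N (n j)" if f: "f \<in> CS (Suc j)" for f j
  proof -
    have "f \<in> syz (Suc j) \<longleftrightarrow> d j (\<pi> (n (Suc j)) f) = \<zero>\<^bsub>F j\<^esub>"
      unfolding syz_image[OF f] resD(5) using f F_carrier[of "Suc j"] by (auto simp: a_kernel_def')
    also have "\<dots> \<longleftrightarrow> \<pi> (n j) (D j f) = \<pi> (n j) 0" unfolding D(2)[OF f] v.modelD(3)[OF model_F] ..
    also have "\<dots> \<longleftrightarrow> D j f \<in> vec_ideal N (n j)" using \<pi>_eq[OF D(1)[OF f] zero_Cr] by simp
    finally show ?thesis .
  qed
qed (rule up, rule fin)

lemma syz_0: "f \<in> syz 0 \<longleftrightarrow> f \<in> CS 0 \<and> \<epsilon> (\<pi> (n 0) f) = \<zero>\<^bsub>E\<^esub>"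
proof (cases "f \<in> CS 0")
  case True
  then show ?thesis using syz_image[OF True] resD(4) F_carrier[of 0] by (auto simp: a_kernel_def')
qed (simp add: syz_def)

abbreviation "P k \<equiv> \<Psi> (n k)"
abbreviation "C k \<equiv> Tn (n k)"

lemma P_eq: "f \<in> CS k \<Longrightarrow> g \<in> CS k \<Longrightarrow> P k f = P k g \<longleftrightarrow> f - g \<in> vec_ideal (- {0}) (n k)"
  by (rule \<Psi>_eq)

text \<open>\<open>tensor_map\<close> is a definite description, so a map with the required
  properties has to be exhibited and shown to be unique. The candidate applies \<open>D\<close> to a
  representative; by \<open>D_vec_ideal\<close> for the maximal ideal the choice does not matter,
  and uniqueness holds because every tensor has the form f \<otimes> 1.\<close>

lemma tensor_map_P:
  assumes f: "f \<in> CS (Suc k)"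
  shows "tensor_map A (F (Suc k)) (F k) R (d k) (P (Suc k) f) = P k (D k f)"
proof -
  let ?M = "C (Suc k)" and ?M' = "C k"
  note m = v.modelD[OF model_\<Psi>[of "n (Suc k)"]] and m' = v.modelD[OF model_\<Psi>[of "n k"]]
  define g where "g = (\<lambda>U\<in>carrier ?M. P k (D k (SOME f. f \<in> CS (Suc k) \<and> P (Suc k) f = U)))"
  have vN: "h \<in> vec_ideal N (n k) \<Longrightarrow> h \<in> vec_ideal (- {0}) (n k)" for h :: "nat \<Rightarrow> 'k mpoly"
    using vec_ideal_mono N_pos by blast
  have g: "g (P (Suc k) f) = P k (D k f)" if f: "f \<in> CS (Suc k)" for f
  proof -
    define f' where "f' = (SOME h. h \<in> CS (Suc k) \<and> P (Suc k) h = P (Suc k) f)"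
    have f': "f' \<in> CS (Suc k)" "P (Suc k) f' = P (Suc k) f"
      using someI[of "\<lambda>h. h \<in> CS (Suc k) \<and> P (Suc k) h = P (Suc k) f" f] f by (auto simp: f'_def)
    then have "f' - f \<in> vec_ideal (- {0}) (n (Suc k))" using P_eq[OF f'(1) f] by blast
    then have "D k (f' - f) \<in> vec_ideal (- {0}) (n k)" by (rule D_vec_ideal[OF upset_pos N_pos])
    from vec_ideal_diff[OF this vN[OF D_diff[OF f'(1) f]]] have "D k f' - D k f \<in> vec_ideal (- {0}) (n k)" by simp
    then have "P k (D k f') = P k (D k f)" using P_eq[OF D(1)[OF f'(1)] D(1)[OF f]] by blast
    moreover have "P (Suc k) f \<in> carrier ?M" using m(2) f by blast
    ultimately show ?thesis by (simp add: g_def f'_def)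
  qed
  have hom: "g \<in> module_hom A ?M ?M'" unfolding module_hom_def
  proof (intro CollectI conjI allI impI Pi_I)
    show "g U \<in> carrier ?M'" if "U \<in> carrier ?M" for U
      using that g D(1) unfolding m(2) m'(2) by auto
    show "g (U \<oplus>\<^bsub>?M\<^esub> U') = g U \<oplus>\<^bsub>?M'\<^esub> g U'" if UU: "U \<in> carrier ?M \<and> U' \<in> carrier ?M" for U U'
    proof -
      obtain f f' where f: "f \<in> CS (Suc k)" "f' \<in> CS (Suc k)" "U = P (Suc k) f" "U' = P (Suc k) f'" using UU unfolding m(2) by blast
      have "P k (D k (f + f')) = P k (D k f + D k f')"
        using P_eq[OF D(1)[OF coord_add[OF f(1,2)]] coord_add[OF D(1)[OF f(1)] D(1)[OF f(2)]]] vN[OF D_add[OF f(1,2)]] by blast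
      then show ?thesis unfolding f(3,4) m(4)[OF f(1,2)] g[OF f(1)] g[OF f(2)] g[OF coord_add[OF f(1,2)]]
          m'(4)[OF D(1)[OF f(1)] D(1)[OF f(2)]] .
    qed
    show "g (a \<odot>\<^bsub>?M\<^esub> U) = a \<odot>\<^bsub>?M'\<^esub> g U" if aU: "a \<in> carrier A \<and> U \<in> carrier ?M" for a U
    proof -
      obtain x f where f: "f \<in> CS (Suc k)" "U = P (Suc k) f" "a = \<theta> x" using aU unfolding m(2) \<theta>_range[symmetric] by blast
      have "P k (D k (smul x f)) = P k (smul x (D k f))"
        using P_eq[OF D(1)[OF smul_coord[OF f(1)]] smul_coord[OF D(1)[OF f(1)]]] vN[OF D_smul[OF f(1)]] by blast
      then show ?thesis unfolding f(2,3) m(5)[OF f(1)] g[OF f(1)] g[OF smul_coord[OF f(1)]] m'(5)[OF D(1)[OF f(1)]] .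
    qed
  qed
  have pure: "g (pure_tensor A (F (Suc k)) R x y) = pure_tensor A (F k) R (d k x) y" if xy: "x \<in> carrier (F (Suc k))" "y \<in> carrier R" for x y
  proof -
    obtain f h where f: "f \<in> CS (Suc k)" "x = \<pi> (n (Suc k)) f" "y = \<kappa> h" using xy unfolding F_carrier carrier_R by blast
    have "P k (D k (smul h f)) = P k (smul h (D k f))"
      using P_eq[OF D(1)[OF smul_coord[OF f(1)]] smul_coord[OF D(1)[OF f(1)]]] vN[OF D_smul[OF f(1)]] by blast
    then show ?thesis unfolding f(2,3) D(2)[OF f(1), symmetric] pure_\<Psi>[OF f(1)] pure_\<Psi>[OF D(1)[OF f(1)]] g[OF smul_coord[OF f(1)]] .
  qed
  have "tensor_map A (F (Suc k)) (F k) R (d k) = g" unfolding tensor_map_def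
  proof (rule the_equality)
    show "g \<in> module_hom A ?M ?M' \<and> g \<in> extensional (carrier ?M) \<and>
      (\<forall>x\<in>carrier (F (Suc k)). \<forall>y\<in>carrier R. g (pure_tensor A (F (Suc k)) R x y) = pure_tensor A (F k) R (d k x) y)"
      using hom pure by (auto simp: g_def)
    fix g' assume g': "g' \<in> module_hom A ?M ?M' \<and> g' \<in> extensional (carrier ?M) \<and>
      (\<forall>x\<in>carrier (F (Suc k)). \<forall>y\<in>carrier R. g' (pure_tensor A (F (Suc k)) R x y) = pure_tensor A (F k) R (d k x) y)"
    show "g' = g"
    proof (rule extensionalityI[of _ "carrier ?M"])
      show "g' \<in> extensional (carrier ?M)" "g \<in> extensional (carrier ?M)" using g' by (auto simp: g_def)
      fix U assume "U \<in> carrier ?M"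
      then obtain f where f: "f \<in> CS (Suc k)" "U = P (Suc k) f" unfolding m(2) by blast
      have U: "U = pure_tensor A (F (Suc k)) R (\<pi> (n (Suc k)) f) (\<kappa> 1)" using pure_\<Psi>[OF f(1), of 1] f(2) by (simp add: smul_add(6))
      have c: "\<pi> (n (Suc k)) f \<in> carrier (F (Suc k))" "\<kappa> 1 \<in> carrier R" using f(1) by (auto simp: F_carrier carrier_R)
      have "g' U = pure_tensor A (F k) R (d k (\<pi> (n (Suc k)) f)) (\<kappa> 1)" unfolding U using g' c by blast
      then show "g' U = g U" unfolding U pure[OF c] .
    qed
  qed
  then show ?thesis using g[OF f] by simp
qed

lemma sub_cyc: "v.sub (cyc (- {0}) k)"
proof -
  have s: "pv.subspace (cyc (- {0}) k)" by (rule subspace_cyc[OF upset_pos N_pos])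
  have "smul x f \<in> cyc (- {0}) k" if f: "f \<in> cyc (- {0}) k" for x f
  proof -
    have "(D k (smul x f) - smul x (D k f)) + smul x (D k f) \<in> vec_ideal (- {0}) (n k)"
      using f by (intro vec_ideal_add vec_ideal_mono[OF D_smul N_pos] vec_ideal_smul upset_pos) (auto simp: cyc_def)
    then show ?thesis using f smul_coord by (auto simp: cyc_def)
  qed
  then show ?thesis using s by (auto simp: v.sub_def pv.subspace_def)
qed

lemma bnd_le_cyc: "bnd (- {0}) k \<subseteq> cyc (- {0}) k"
proof
  fix f assume "f \<in> bnd (- {0}) k"
  then obtain x y where xy: "f = x + y" "x \<in> vec_ideal (- {0}) (n (Suc k))" "y \<in> syz (Suc k)" by (auto simp: bnd_def)
  note yc = syz_coord[OF xy(3)]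
  have "D k y \<in> vec_ideal (- {0}) (n k)" using exact[OF yc] xy(3) vec_ideal_mono[OF _ N_pos] by blast
  then have "y \<in> cyc (- {0}) k" using yc by (simp add: cyc_def)
  moreover have "x \<in> cyc (- {0}) k" using D_vec_ideal[OF upset_pos N_pos xy(2)] vec_ideal_coord[OF xy(2)] by (simp add: cyc_def)
  ultimately show "f \<in> cyc (- {0}) k" unfolding xy(1) by (intro v.subD(2)[OF sub_cyc])
qed

lemma sub_bnd: "v.sub (bnd (- {0}) k)"
proof -
  have s: "pv.subspace (bnd (- {0}) k)" by (rule subspace_bnd[OF upset_pos])
  have "smul x f \<in> bnd (- {0}) k" if f: "f \<in> bnd (- {0}) k" for x f
  proof -
    from f obtain a b where *: "f = a + b" "a \<in> vec_ideal (- {0}) (n (Suc k))" "b \<in> syz (Suc k)" by (auto simp: bnd_def)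
    have "smul x a + smul x b \<in> bnd (- {0}) k" using * by (intro bndI vec_ideal_smul upset_pos syz_smul)
    then show ?thesis using * by (simp add: smul_add)
  qed
  then show ?thesis using s by (auto simp: v.sub_def pv.subspace_def)
qed

text \<open>A crude bound by the rank of the free module; it supplies the finiteness that
  \<open>dim_model\<close> asks for.\<close>

lemma spanned_cyc: "pv.spanned_mod (cyc (- {0}) k) (bnd (- {0}) k) (n (Suc k))"
proof -
  let ?r = "n (Suc k)"
  let ?S = "delta_vec ` {..<?r} :: (nat \<Rightarrow> 'k mpoly) set"
  have dlC: "delta_vec t \<in> CS (Suc k)" if "t < ?r" for t using that by (auto simp: coord_space_def delta_vec_def)
  have "\<exists>s\<in>pv.span ?S. f - s \<in> vec_ideal (- {0}) ?r" if f: "f \<in> CS (Suc k)" for f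
  proof (intro bexI)
    let ?s = "\<Sum>t<?r. poly_scale (lk (f t) 0) (delta_vec t)"
    show "?s \<in> pv.span ?S" by (intro pv.span_sum pv.span_scale pv.span_base) auto
    have "?s \<in> CS (Suc k)" unfolding poly_scale_smul
      by (rule v.sub_sum[OF v.modelD(1)[OF model_F]]) (auto intro: smul_coord dlC)
    then have "f - ?s \<in> CS (Suc k)" by (rule coord_diff[OF f])
    moreover have "lk ((f - ?s) t) 0 = 0" for t
    proof (cases "t < ?r")
      case True
      have "?s t = (\<Sum>t'<?r. if t' = t then sg 0 (lk (f t') 0) else 0)"
        unfolding sum_fun_apply poly_scale_def by (intro sum.cong) (auto simp: delta_vec_def)
      also have "\<dots> = sg 0 (lk (f t) 0)" using True by simp
      finally show ?thesis by (simp add: lookup_minus)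
    next
      case False
      then show ?thesis using \<open>f - ?s \<in> CS (Suc k)\<close> unfolding coord_space_def by auto
    qed
    ultimately show "f - ?s \<in> vec_ideal (- {0}) ?r" by (simp add: vec_ideal_def mono_ideal_pos)
  qed
  then have "pv.spanned_mod (CS (Suc k)) (vec_ideal (- {0}) ?r) (card ?S)"
    unfolding pv.spanned_mod_def using dlC by (intro exI[of _ ?S]) auto
  moreover have "card ?S \<le> ?r" using card_image_le[of "{..<?r}" "delta_vec :: nat \<Rightarrow> nat \<Rightarrow> 'k mpoly"] by simp
  moreover have le: "vec_ideal (- {0}) ?r \<subseteq> bnd (- {0}) k" using bndI[OF _ ideal_syz[OF vec_ideal_0]] by fastforce
  ultimately have "pv.spanned_mod (CS (Suc k)) (bnd (- {0}) k) ?r" using pv.spanned_mod_mono by blast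
  then show ?thesis
    by (rule pv.spanned_mod_subspace) (use subspace_cyc[OF upset_pos N_pos] subspace_bnd[OF upset_pos] in \<open>auto simp: cyc_def\<close>)
qed

text \<open>\<open>mono_ideal (- {0})\<close> induces the maximal ideal of \<open>A\<close>, so
  cycles modulo boundaries for it form the Tor with the residue field in degree k + 1. The
  hypothesis \<open>nd\<close> says that the resolution of the locale is the one from which
  \<open>Tor\<close> is computed.\<close>

lemma spanned_betti:
  assumes nd: "some_resolution A E = (n, d)"
  shows "pv.spanned_mod (cyc (- {0}) k) (bnd (- {0}) k) (betti A (Suc k) E)"
proof -
  let ?Z = "cyc (- {0}) k" and ?B = "bnd (- {0}) k"
  note m = v.modelD[OF model_\<Psi>[of "n (Suc k)"]] and m' = v.modelD[OF model_\<Psi>[of "n k"]] and m'' = v.modelD[OF model_\<Psi>[of "n (Suc (Suc k))"]]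
  define M where "M = (C (Suc k))\<lparr>carrier := P (Suc k) ` ?Z\<rparr>"
  have ZC: "?Z \<subseteq> CS (Suc k)" by (auto simp: cyc_def)
  have cycles: "a_kernel (C (Suc k)) (C k) (tensor_map A (F (Suc k)) (F k) R (d k)) = P (Suc k) ` ?Z"
  proof -
    have "tensor_map A (F (Suc k)) (F k) R (d k) (P (Suc k) f) = \<zero>\<^bsub>C k\<^esub> \<longleftrightarrow> f \<in> ?Z" if f: "f \<in> CS (Suc k)" for f
      unfolding tensor_map_P[OF f] m'(3) using P_eq[OF D(1)[OF f] zero_Cr] f by (simp add: cyc_def)
    then show ?thesis using ZC unfolding a_kernel_def' m(2) by auto
  qed
  have bounds: "tensor_map A (F (Suc (Suc k))) (F (Suc k)) R (d (Suc k)) ` carrier (C (Suc (Suc k))) = P (Suc k) ` ?B"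
  proof (intro equalityI subsetI)
    fix U assume "U \<in> tensor_map A (F (Suc (Suc k))) (F (Suc k)) R (d (Suc k)) ` carrier (C (Suc (Suc k)))"
    then obtain g where g: "g \<in> CS (Suc (Suc k))" "U = P (Suc k) (D (Suc k) g)" unfolding m''(2) using tensor_map_P by auto
    have "0 + D (Suc k) g \<in> ?B" by (rule bndI[OF vec_ideal_0 D_syz[OF g(1)]])
    then show "U \<in> P (Suc k) ` ?B" using g(2) by simp
  next
    fix U assume "U \<in> P (Suc k) ` ?B"
    then obtain x y where xy: "U = P (Suc k) (x + y)" "x \<in> vec_ideal (- {0}) (n (Suc k))" "y \<in> syz (Suc k)" by (auto simp: bnd_def)
    obtain g where g: "g \<in> CS (Suc (Suc k))" "y - D (Suc k) g \<in> vec_ideal N (n (Suc k))" using xy(3) unfolding syz by blast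
    have "x + (y - D (Suc k) g) \<in> vec_ideal (- {0}) (n (Suc k))" by (rule vec_ideal_add[OF xy(2) vec_ideal_mono[OF g(2) N_pos]])
    then have "(x + y) - D (Suc k) g \<in> vec_ideal (- {0}) (n (Suc k))" by (simp add: algebra_simps)
    then have "U = P (Suc k) (D (Suc k) g)"
      unfolding xy(1) using P_eq[OF coord_add[OF vec_ideal_coord[OF xy(2)] syz_coord[OF xy(3)]] D(1)[OF g(1)]] by blast
    then show "U \<in> tensor_map A (F (Suc (Suc k))) (F (Suc k)) R (d (Suc k)) ` carrier (C (Suc (Suc k)))"
      unfolding m''(2) using tensor_map_P[OF g(1)] g(1) by (intro image_eqI[of _ _ "P (Suc (Suc k)) g"]) auto
  qed
  have Tor: "Tor A (Suc k) E R = quot_module M (P (Suc k) ` ?B)"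
    unfolding Tor_def nd fst_conv snd_conv Let_def M_def by (simp add: cycles bounds)
  have mM: "v.model ?Z M (P (Suc k))"
    unfolding v.model_def M_def using sub_cyc m ZC by (auto simp: subset_iff)
  have ker: "z - w \<in> ?B" if zw: "z \<in> ?Z" "w \<in> ?Z" "P (Suc k) z = P (Suc k) w" for z w
  proof -
    have "z - w \<in> vec_ideal (- {0}) (n (Suc k))" using P_eq[of z "Suc k" w] zw ZC by blast
    from bndI[OF this ideal_syz[OF vec_ideal_0]] show ?thesis by simp
  qed
  define \<phi> where "\<phi> = (\<lambda>z. P (Suc k) ` ?B +>\<^bsub>M\<^esub> P (Suc k) z)"
  have mT: "v.model ?Z (Tor A (Suc k) E R) \<phi>" unfolding Tor \<phi>_def
    by (rule v.model_quot(1)[OF mM sub_bnd bnd_le_cyc ker])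
  have \<phi>_eq: "\<phi> z = \<phi> w \<longleftrightarrow> z - w \<in> ?B" if "z \<in> ?Z" "w \<in> ?Z" for z w
    unfolding \<phi>_def by (rule v.model_quot(2)[OF mM sub_bnd bnd_le_cyc ker that])
  note t = v.modelD[OF mT]
  \<comment> \<open>\<rho> identifies k with the residue field through constant polynomials, so that
    both have the same dimensions.\<close>
  define \<rho> where "\<rho> c = \<kappa> (sg 0 c)" for c
  have fK: "field K" by (rule field_K)
  have \<kappa>\<rho>: "\<kappa> x = \<rho> (lk x 0)" for x by (simp add: \<rho>_def \<kappa>_eq)
  interpret x: scalars K \<rho> "poly_scale :: 'k \<Rightarrow> (nat \<Rightarrow> 'k mpoly) \<Rightarrow> _"
  proof (rule scalars.intro)
    show "cring K" using fK unfolding field_def domain_def by blast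
    show "range \<rho> = carrier K" unfolding carrier_K using \<kappa>\<rho> \<rho>_def by auto
    show "\<rho> (x + y) = \<rho> x \<oplus>\<^bsub>K\<^esub> \<rho> y" for x y unfolding \<rho>_def K_ops single_add ..
    show "\<rho> (x * y) = \<rho> x \<otimes>\<^bsub>K\<^esub> \<rho> y" for x y unfolding \<rho>_def K_ops mult_single by simp
    show "\<rho> 1 = \<one>\<^bsub>K\<^esub>" unfolding \<rho>_def K_ops single_one ..
  qed (auto simp: pv.scale_right_distrib pv.scale_left_distrib)
  let ?V = "residue_space A (Tor A (Suc k) E R)"
  have subx: "x.sub W" if "v.sub W" for W using that by (auto simp: x.sub_def v.sub_def poly_scale_smul)
  have mV: "x.model ?Z ?V \<phi>" unfolding x.model_def
  proof (intro conjI ballI allI)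
    show "x.sub ?Z" by (rule subx[OF sub_cyc])
    show "carrier ?V = \<phi> ` ?Z" "\<zero>\<^bsub>?V\<^esub> = \<phi> 0" using t(2,3) by (simp_all add: residue_space_def)
    show "\<phi> z \<oplus>\<^bsub>?V\<^esub> \<phi> w = \<phi> (z + w)" if "z \<in> ?Z" "w \<in> ?Z" for z w using t(4)[OF that] by (simp add: residue_space_def)
    show "\<rho> c \<odot>\<^bsub>?V\<^esub> \<phi> z = \<phi> (poly_scale c z)" if z: "z \<in> ?Z" for c z
    proof -
      \<comment> \<open>\<open>residue_space\<close> acts through an arbitrary representative
        \<theta> y of the class of \<open>c\<close>. The difference y - c has no constant term, so
        (y - c) z lies in the maximal ideal times the free module and is a boundary.\<close>
      have "\<theta> (sg 0 c) \<in> \<rho> c" unfolding \<rho>_def \<kappa>_image by blast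
      then have "(SOME a. a \<in> \<rho> c) \<in> \<rho> c" by (rule someI)
      then obtain y where y: "(SOME a. a \<in> \<rho> c) = \<theta> y" "lk y 0 = c" unfolding \<rho>_def \<kappa>_image by auto
      have zc: "z \<in> CS (Suc k)" using z ZC by blast
      have "smul (y - sg 0 c) z \<in> vec_ideal (- {0}) (n (Suc k))"
        using smul_coord[OF zc] y(2) by (simp add: vec_ideal_def mono_ideal_pos smul_apply const_mult lookup_minus)
      from bndI[OF this ideal_syz[OF vec_ideal_0]] have "smul y z - smul (sg 0 c) z \<in> ?B"
        by (simp add: smul_def left_diff_distrib fun_diff_def)
      then have "\<phi> (smul y z) = \<phi> (poly_scale c z)"
        using \<phi>_eq[OF v.subD(3)[OF sub_cyc z] v.subD(3)[OF sub_cyc z]] by (simp add: poly_scale_smul)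
      then show ?thesis using t(5)[OF z, of y] y(1) by (simp add: residue_space_def)
    qed
  qed
  have "pv.spanned_mod ?Z ?B (vectorspace.dim K ?V)"
    by (rule x.dim_model[OF fK mV subx[OF sub_bnd] bnd_le_cyc \<phi>_eq _ _ _ spanned_cyc, where h = "\<lambda>c. c"])
      (auto intro: pv.k_space_axioms k_space.intro pv.vector_space_axioms)
  then show ?thesis by (simp add: betti_def)
qed

end

section \<open>Length\<close>

lemma spanned_coord:
  assumes N: "finite (- N)"
  shows "\<exists>b. pv.spanned_mod (coord_space r :: (nat \<Rightarrow> 'k::field mpoly) set) (vec_ideal N r) b"
proof -
  let ?g = "\<lambda>t m. smul (sg m 1) (delta_vec t) :: nat \<Rightarrow> 'k mpoly"
  let ?S = "(\<lambda>(t, m). ?g t m) ` ({..<r} \<times> - N)"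
  have gC: "?g t m \<in> coord_space r" if "t < r" for t m
    using that by (auto simp: coord_space_def smul_def delta_vec_def)
  have "\<exists>s\<in>pv.span ?S. f - s \<in> vec_ideal N r" if f: "f \<in> coord_space r" for f
  proof (intro bexI)
    let ?s = "\<Sum>t<r. \<Sum>m\<in>- N. poly_scale (lk (f t) m) (?g t m)"
    show "?s \<in> pv.span ?S" by (intro pv.span_sum pv.span_scale pv.span_base) auto
    have s: "?s t' = (if t' < r then \<Sum>m\<in>- N. sg m (lk (f t') m) else 0)" for t'
    proof -
      have "?s t' = (\<Sum>t<r. if t = t' then \<Sum>m\<in>- N. sg m (lk (f t') m) else 0)"
        unfolding sum_fun_apply by (intro sum.cong) (auto simp: poly_scale_def smul_def delta_vec_def mult_single intro: sum.neutral)
      then show ?thesis by simp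
    qed
    have "(f - ?s) t \<in> mono_ideal N" for t
    proof (cases "t < r")
      case True
      have "lk (\<Sum>m\<in>- N. sg m (lk (f t) m)) m' = lk (f t) m'" if "m' \<notin> N" for m'
      proof -
        have "lk (\<Sum>m\<in>- N. sg m (lk (f t) m)) m' = (\<Sum>m\<in>- N. if m = m' then lk (f t) m' else 0)"
          unfolding lookup_sum by (intro sum.cong) (auto simp: lookup_single when_def)
        then show ?thesis using N that by simp
      qed
      then show ?thesis using True s[of t] by (simp add: mono_ideal_iff lookup_minus)
    next
      case False
      have "f t = 0" using f False by (simp add: coord_space_def)
      then show ?thesis using False s[of t] by simp
    qed
    moreover have "f - ?s \<in> coord_space r" using f s by (auto simp: coord_space_def)
    ultimately show "f - ?s \<in> vec_ideal N r" by (simp add: vec_ideal_def)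
  qed
  then have "pv.spanned_mod (coord_space r :: (nat \<Rightarrow> 'k mpoly) set) (vec_ideal N r) (card ?S)"
    unfolding pv.spanned_mod_def using N gC by (intro exI[of _ ?S]) auto
  then show ?thesis by (rule exI)
qed

lemma smul_zero: "smul 0 f = 0"
  by (auto simp: smul_def)

lemma monomial_sub:
  fixes x :: "'k::field mpoly"
  assumes "\<And>f g. P f \<Longrightarrow> P g \<Longrightarrow> P (f + g)" "P 0" "\<And>m c. m \<in> ks x \<Longrightarrow> P (sg m c)"
  shows "P x"
proof -
  have "P (\<Sum>m\<in>M. sg m (lk x m))" if "finite M" "M \<subseteq> ks x" for M
    using that by (induction M rule: finite_induct) (auto intro: assms)
  then show ?thesis using mpoly_sum[of x] by (metis finite_keys order_refl)
qed

lemma (in k_space) dim_psubset: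
  assumes "finite_span T" "subspace S" "S \<subset> T" shows "dim S < dim T"
proof (rule ccontr)
  assume "\<not> ?thesis"
  then have "dim T \<le> dim S" by simp
  from subspace_eq_if_dim_le[OF assms(1,2) _ this] assms(3) show False by blast
qed

context resolved_module
begin

context
  assumes E: "module A E"
begin

interpretation E: module A E by (rule E)

definition \<eta> :: "(nat \<Rightarrow> 'k mpoly) \<Rightarrow> 'm" where "\<eta> f = \<epsilon> (\<pi> (n 0) f)"

lemma zero_syz: "0 \<in> syz j" by (rule ideal_syz[OF vec_ideal_0])

lemma model_\<eta>: "v.model (CS 0) E \<eta>"
  unfolding v.model_def
proof (intro conjI ballI allI)
  note mF = v.modelD[OF model_F[of "n 0"]]
  show "v.sub (CS 0)" by (rule mF(1))
  show "carrier E = \<eta> ` CS 0" unfolding \<eta>_def[abs_def] using resD(2) unfolding F_carrier by (simp add: image_image)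
  show "\<zero>\<^bsub>E\<^esub> = \<eta> 0" using zero_syz[of 0] by (simp add: syz_0 \<eta>_def)
  show "\<eta> z \<oplus>\<^bsub>E\<^esub> \<eta> w = \<eta> (z + w)" if "z \<in> CS 0" "w \<in> CS 0" for z w
    using module_hom_add[OF resD(1), of "\<pi> (n 0) z" "\<pi> (n 0) w"] that mF(4)[OF that] F_carrier[of 0] by (simp add: \<eta>_def)
  show "\<theta> x \<odot>\<^bsub>E\<^esub> \<eta> z = \<eta> (smul x z)" if "z \<in> CS 0" for x z
    using module_hom_smult[OF resD(1) \<theta>_closed, of "\<pi> (n 0) z" x] that mF(5)[OF that] F_carrier[of 0] by (simp add: \<eta>_def)
qed

lemma \<eta>_eq: assumes fg: "f \<in> CS 0" "g \<in> CS 0" shows "\<eta> f = \<eta> g \<longleftrightarrow> f - g \<in> syz 0"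
proof -
  note m = v.modelD[OF model_\<eta>]
  have ng: "- g \<in> CS 0" by (rule v.sub_neg[OF m(1) fg(2)])
  have d: "f - g \<in> CS 0" by (rule coord_diff[OF fg])
  have z: "\<eta> (f - g) = \<eta> 0 \<longleftrightarrow> f - g \<in> syz 0" using syz_0[of "f - g"] d m(3) by (simp add: \<eta>_def)
  have "\<eta> (f - g) = \<eta> f \<oplus>\<^bsub>E\<^esub> \<eta> (- g)" using m(4)[OF fg(1) ng] by simp
  moreover have "\<eta> 0 = \<eta> g \<oplus>\<^bsub>E\<^esub> \<eta> (- g)" using m(4)[OF fg(2) ng] by simp
  moreover have "\<eta> f = \<eta> g \<oplus>\<^bsub>E\<^esub> \<eta> (f - g)" using m(4)[OF fg(2) d] by simp
  moreover have "\<eta> g = \<eta> g \<oplus>\<^bsub>E\<^esub> \<eta> 0" using m(4)[OF fg(2) zero_Cr] by simp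
  ultimately show ?thesis unfolding z[symmetric] by metis
qed

lemma syz_CS: "syz j \<subseteq> CS j" using syz_coord by blast

lemma subspace_CS: "pv.subspace (CS k)"
  using v.modelD(1)[OF model_F[of "n k"]] by (auto simp: v.sub_def pv.subspace_def poly_scale_smul)

lemma ideal_le_syz: "vec_ideal N (n j) \<subseteq> syz j" using ideal_syz by blast

lemma quotient_dim:
  "\<exists>l f. Vector_Spaces.linear poly_scale vec_scale f \<and> f ` CS 0 = coord_space l \<and> (\<forall>x\<in>CS 0. f x = 0 \<longleftrightarrow> x \<in> syz 0)"
proof -
  obtain b where "pv.spanned_mod (CS 0) (vec_ideal N (n 0)) b" using spanned_coord[OF fin] by blast
  then have "pv.spanned_mod (CS 0) (syz 0) b" using pv.spanned_mod_mono ideal_le_syz by blast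
  from pv.quotient_coordinates[OF subspace_CS subspace_syz syz_CS this] show ?thesis .
qed

context
  fixes l :: nat and f :: "(nat \<Rightarrow> 'k mpoly) \<Rightarrow> nat \<Rightarrow> 'k"
  assumes lin: "Vector_Spaces.linear poly_scale vec_scale f" and im: "f ` CS 0 = coord_space l"
    and ker: "\<And>x. x \<in> CS 0 \<Longrightarrow> f x = 0 \<longleftrightarrow> x \<in> syz 0"
begin

interpretation f: Vector_Spaces.linear poly_scale vec_scale f by (rule lin)

lemma f_eq: "x \<in> CS 0 \<Longrightarrow> y \<in> CS 0 \<Longrightarrow> f x = f y \<longleftrightarrow> x - y \<in> syz 0"
  using ker[OF coord_diff[of x "n 0" y]] by (simp add: f.diff)

lemma subspace_f: "pv.subspace S \<Longrightarrow> vec.subspace (f ` S)"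
  unfolding vec.subspace_def pv.subspace_def
  by (auto simp: f.add[symmetric] f.scale[symmetric] f.zero[symmetric] simp del: f.zero intro!: imageI)

lemma finite_f: "S \<subseteq> CS 0 \<Longrightarrow> vec.finite_span (f ` S)"
  by (rule vec.finite_span_mono[OF coord_space_dim(1)[of l]]) (use im in blast)

text \<open>The coordinates \<open>f x\<close> determine \<eta> x, so a strict chain of submodules
  of \<open>E\<close> yields a strict chain of subspaces of k^l, whose dimension grows at each
  step.\<close>

lemma length_le:
  assumes Y: "\<And>i. i \<le> k \<Longrightarrow> submodule A (Y i) E" "\<And>i. i < k \<Longrightarrow> Y i \<subset> Y (Suc i)"
  shows "k \<le> l"
proof -
  note m = v.modelD[OF model_\<eta>]
  define Q where "Q i = {x \<in> CS 0. \<eta> x \<in> Y i}" for i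
  have Qs: "pv.subspace (Q i)" if i: "i \<le> k" for i
  proof (rule poly_subspaceI)
    note s = submodule.zero_closed[OF Y(1)[OF i]] submodule.m_closed[OF Y(1)[OF i]] submodule.smult_closed[OF Y(1)[OF i]]
    show "0 \<in> Q i" using s(1) m(3) zero_Cr by (simp add: Q_def)
    show "x + y \<in> Q i" if "x \<in> Q i" "y \<in> Q i" for x y using that s(2)[of "\<eta> x" "\<eta> y"] m(4)[of x y] coord_add[of x _ y] by (simp add: Q_def)
    show "smul c x \<in> Q i" if "x \<in> Q i" for c x using that s(3)[of "\<theta> c" "\<eta> x"] m(5)[of x c] smul_coord[of x] by (simp add: Q_def)
  qed
  have "i \<le> vec.dim (f ` Q i)" if "i \<le> k" for i
    using that
  proof (induction i)
    case (Suc i)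
    have "f ` Q i \<subset> f ` Q (Suc i)"
    proof
      show "f ` Q i \<subseteq> f ` Q (Suc i)" using Y(2)[of i] Suc.prems by (intro image_mono) (auto simp: Q_def)
      obtain w where w: "w \<in> Y (Suc i)" "w \<notin> Y i" using Y(2)[of i] Suc.prems by auto
      obtain x where x: "x \<in> CS 0" "w = \<eta> x" using w(1) submodule.subset[OF Y(1)[OF Suc.prems]] m(2) by auto
      have "f x \<notin> f ` Q i"
      proof
        assume "f x \<in> f ` Q i"
        then obtain y where y: "y \<in> Q i" "f x = f y" by auto
        then have yC: "y \<in> CS 0" by (simp add: Q_def)
        have "\<eta> x = \<eta> y" using \<eta>_eq[OF x(1) yC] f_eq[OF x(1) yC] y(2) by blast
        then show False using y w x by (simp add: Q_def)
      qed
      then show "f ` Q i \<noteq> f ` Q (Suc i)" using x w(1) by (auto simp: Q_def)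
    qed
    then have "vec.dim (f ` Q i) < vec.dim (f ` Q (Suc i))"
      using Suc.prems by (intro vec.dim_psubset finite_f subspace_f Qs) (auto simp: Q_def)
    then show ?case using Suc by simp
  qed simp
  then have "k \<le> vec.dim (f ` Q k)" by simp
  moreover have "f ` Q k \<subseteq> coord_space l" unfolding im[symmetric] by (intro image_mono) (simp add: Q_def)
  then have "vec.dim (f ` Q k) \<le> l" using vec.dim_mono_finite_span[OF coord_space_dim(1)[of l]] by (simp add: coord_space_dim(2))
  ultimately show ?thesis by simp
qed

text \<open>These correspond to the submodules of \<open>E\<close>, which is the quotient of
  \<open>CS 0\<close> by \<open>syz 0\<close>.\<close>

definition mid :: "(nat \<Rightarrow> 'k mpoly) set \<Rightarrow> bool" where "mid S \<longleftrightarrow> v.sub S \<and> syz 0 \<subseteq> S \<and> S \<subseteq> CS 0"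

text \<open>Multiplying an element outside \<open>S\<close> by a maximal monomial that keeps it outside \<open>S\<close>
  gives an element of the socle of the quotient by \<open>S\<close>.\<close>

lemma mid_extend:
  assumes S: "mid S" "S \<noteq> CS 0"
  shows "\<exists>S'. mid S' \<and> S \<subset> S' \<and> vec.dim (f ` S') \<le> Suc (vec.dim (f ` S))"
proof -
  have Ss: "v.sub S" "syz 0 \<subseteq> S" "S \<subseteq> CS 0" using S(1) by (auto simp: mid_def)
  obtain x where x: "x \<in> CS 0" "x \<notin> S" using S(2) Ss(3) by blast
  define M where "M = {m. smul (sg m 1) x \<notin> S}"
  have "M \<subseteq> - N"
  proof
    fix m assume m: "m \<in> M"
    have "smul (sg m 1) x \<in> vec_ideal N (n 0)" if "m \<in> N"
      by (auto simp: vec_ideal_def smul_apply intro!: mono_mult_mono_ideal smul_coord[OF x(1)] upsetD[OF up that])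
    then show "m \<in> - N" using m ideal_le_syz Ss(2) by (auto simp: M_def)
  qed
  then have fM: "finite M" by (rule finite_subset[OF _ fin])
  have "0 \<in> M" using x(2) by (simp add: M_def smul_add(6))
  then have neM: "M \<noteq> {}" by auto
  from maximal_monomial[OF fM neM] obtain m where m0: "m \<in> M" and m1: "\<forall>e. e \<noteq> 0 \<longrightarrow> m + e \<notin> M" ..
  note m = m0 m1[rule_format]
  define z where "z = smul (sg m 1) x"
  have z: "z \<in> CS 0" "z \<notin> S" using m(1) smul_coord[OF x(1)] by (auto simp: z_def M_def)
  have zS: "smul g z \<in> S" if g: "lk g 0 = 0" for g
  proof (rule monomial_sub[where P = "\<lambda>g. smul g z \<in> S"])
    show "smul (f + g) z \<in> S" if "smul f z \<in> S" "smul g z \<in> S" for f g using v.subD(2)[OF Ss(1) that] by (simp add: smul_add)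
    show "smul 0 z \<in> S" using v.subD(1)[OF Ss(1)] by (simp add: smul_zero)
    show "smul (sg e c) z \<in> S" if e: "e \<in> ks g" for e c
    proof -
      have "e \<noteq> 0" using e g by (auto simp: in_keys_iff)
      then have "smul (sg (m + e) 1) x \<in> S" using m(2) by (auto simp: M_def)
      from v.subD(3)[OF Ss(1) this, of "sg 0 c"] show ?thesis by (simp add: z_def smul_add mult_single add.commute)
    qed
  qed
  \<comment> \<open>Scalar multiples of \<open>z\<close> are enough for a submodule: by
    \<open>zS\<close> a polynomial acts on \<open>z\<close> modulo \<open>S\<close> through its
    constant term.\<close>
  define S' where "S' = {y + smul (sg 0 c) z | y c. y \<in> S}"
  have S'I: "y + smul (sg 0 c) z \<in> S'" if "y \<in> S" for y c using that by (auto simp: S'_def)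
  have "v.sub S'" unfolding v.sub_def
  proof (intro conjI ballI allI)
    show "0 \<in> S'" using S'I[OF v.subD(1)[OF Ss(1)], of 0] by (simp add: smul_zero)
    show "g + h \<in> S'" if gh: "g \<in> S'" "h \<in> S'" for g h
    proof -
      obtain y c y' c' where *: "g = y + smul (sg 0 c) z" "y \<in> S" "h = y' + smul (sg 0 c') z" "y' \<in> S" using gh by (auto simp: S'_def)
      have "(y + y') + smul (sg 0 (c + c')) z \<in> S'" by (rule S'I[OF v.subD(2)[OF Ss(1) *(2,4)]])
      moreover have "(y + y') + smul (sg 0 (c + c')) z = g + h" unfolding * by (simp add: single_add smul_add)
      ultimately show ?thesis by simp
    qed
    show "smul a g \<in> S'" if g: "g \<in> S'" for a g
    proof -
      obtain y c where *: "g = y + smul (sg 0 c) z" "y \<in> S" using g by (auto simp: S'_def)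
      have "smul (a * sg 0 c - sg 0 (lk a 0 * c)) z \<in> S"
        by (rule zS) (simp add: lookup_minus const_mult)
      then have "(smul a y + smul (a * sg 0 c - sg 0 (lk a 0 * c)) z) + smul (sg 0 (lk a 0 * c)) z \<in> S'"
        by (intro S'I v.subD(2)[OF Ss(1) v.subD(3)[OF Ss(1) *(2)]])
      moreover have "(smul a y + smul (a * sg 0 c - sg 0 (lk a 0 * c)) z) + smul (sg 0 (lk a 0 * c)) z = smul a g"
        unfolding *(1) by (rule ext) (simp add: smul_apply algebra_simps)
      ultimately show ?thesis by simp
    qed
  qed
  moreover have SS': "S \<subseteq> S'"
  proof
    fix y assume "y \<in> S" from S'I[OF this, of 0] show "y \<in> S'" by (simp add: smul_zero)
  qed
  moreover have "S' \<subseteq> CS 0" using Ss(3) z(1) by (auto simp: S'_def intro!: coord_add smul_coord)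
  ultimately have mS': "mid S'" using Ss(2) by (auto simp: mid_def)
  have "z \<in> S'" using S'I[OF v.subD(1)[OF Ss(1)], of 1] by (simp add: smul_add(6))
  then have "S \<noteq> S'" using z(2) by auto
  then have lt: "S \<subset> S'" using SS' by simp
  have "vec.spanned_mod (f ` S') (f ` S) 1"
    unfolding vec.spanned_mod_def
  proof (intro exI[of _ "{f z}"] conjI ballI)
    show "{f z} \<subseteq> f ` S'" using \<open>z \<in> S'\<close> by simp
    fix w assume "w \<in> f ` S'"
    then obtain y c where *: "w = f (y + smul (sg 0 c) z)" "y \<in> S" by (auto simp: S'_def)
    have "w - vec_scale c (f z) \<in> f ` S" using *(2) unfolding *(1) poly_scale_smul[symmetric] by (simp add: f.add f.scale)
    then show "\<exists>s\<in>vec.span {f z}. w - s \<in> f ` S"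
      by (rule bexI[of _ "vec_scale c (f z)"]) (intro vec.span_scale vec.span_base, simp)
  qed auto
  then have "vec.dim (f ` S') \<le> vec.dim (f ` S) + 1" by (rule vec.spanned_mod_dim[OF _ finite_f[OF Ss(3)]])
  then show ?thesis using mS' lt by (intro exI[of _ S']) simp
qed

text \<open>Each extension raises the dimension by at most one, so the k-th member has dimension at
  most k and is proper as long as k < l.\<close>

lemma mid_chain:
  "k \<le> l \<Longrightarrow> \<exists>S. (\<forall>i\<le>k. mid (S i)) \<and> (\<forall>i<k. S i \<subset> S (Suc i)) \<and> vec.dim (f ` S k) \<le> k"
proof (induction k)
  case 0
  have "v.sub (syz 0)" using zero_syz syz_add syz_smul by (auto simp: v.sub_def)
  then have "mid (syz 0)" using syz_CS by (simp add: mid_def)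
  moreover have "f ` syz 0 = {0}" using ker syz_CS zero_syz[of 0] by (auto simp: image_iff) (metis subsetD)+
  ultimately show ?case by (intro exI[of _ "\<lambda>_. syz 0"]) simp
next
  case (Suc k)
  then obtain S where S: "\<forall>i\<le>k. mid (S i)" "\<forall>i<k. S i \<subset> S (Suc i)" "vec.dim (f ` S k) \<le> k" by auto
  have "S k \<noteq> CS 0" using S(3) Suc.prems coord_space_dim(2)[of l, where 'k = 'k] im by auto
  then obtain S' where S': "mid S'" "S k \<subset> S'" "vec.dim (f ` S') \<le> Suc (vec.dim (f ` S k))" using mid_extend S(1) by blast
  show ?case
  proof (intro exI[of _ "S(Suc k := S')"] conjI allI impI)
    show "mid ((S(Suc k := S')) i)" if "i \<le> Suc k" for i using that S S' by (cases "i = Suc k") auto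
    show "(S(Suc k := S')) i \<subset> (S(Suc k := S')) (Suc i)" if "i < Suc k" for i using that S S' by (cases "i = k") auto
    show "vec.dim (f ` (S(Suc k := S')) (Suc k)) \<le> Suc k" using S'(3) S(3) by simp
  qed
qed

lemma module_length_eq: "module_length A E = enat l"
  unfolding module_length_def
proof (intro antisym Sup_least Sup_upper)
  fix x assume "x \<in> {enat k | k. \<exists>N. (\<forall>i\<le>k. submodule A (N i) E) \<and> (\<forall>i<k. N i \<subset> N (Suc i))}"
  then obtain k M where kM: "x = enat k" "\<forall>i\<le>k. submodule A (M i) E" "\<forall>i<k. M i \<subset> M (Suc i)" by blast
  have "k \<le> l" by (rule length_le[of k M]) (simp_all only: kM(2,3)[rule_format])
  then show "x \<le> enat l" by (simp add: kM(1))
next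
  obtain S where S: "\<forall>i\<le>l. mid (S i)" "\<forall>i<l. S i \<subset> S (Suc i)" using mid_chain[of l] by auto
  have sm: "submodule A (\<eta> ` S i) E" if "i \<le> l" for i
    using S(1) that by (intro v.submodule_model[OF model_\<eta>]) (auto simp: mid_def)
  have st: "\<eta> ` S i \<subset> \<eta> ` S (Suc i)" if i: "i < l" for i
  proof
    have m: "mid (S i)" "mid (S (Suc i))" and lt: "S i \<subset> S (Suc i)" using S i by auto
    show "\<eta> ` S i \<subseteq> \<eta> ` S (Suc i)" using lt by (intro image_mono) auto
    obtain y where y: "y \<in> S (Suc i)" "y \<notin> S i" using lt by auto
    have "\<eta> y \<notin> \<eta> ` S i"
    proof
      assume "\<eta> y \<in> \<eta> ` S i"
      then obtain y' where y': "y' \<in> S i" "\<eta> y = \<eta> y'" by auto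
      then have "y - y' \<in> S i" using \<eta>_eq[of y y'] y(1) m by (auto simp: mid_def)
      from v.subD(2)[OF _ this y'(1)] show False using y(2) m by (simp add: mid_def)
    qed
    then show "\<eta> ` S i \<noteq> \<eta> ` S (Suc i)"
    proof (rule contrapos_nn)
      assume "\<eta> ` S i = \<eta> ` S (Suc i)"
      then show "\<eta> y \<in> \<eta> ` S i" using imageI[OF y(1), of \<eta>] by (simp only:)
    qed
  qed
  show "enat l \<in> {enat k | k. \<exists>N. (\<forall>i\<le>k. submodule A (N i) E) \<and> (\<forall>i<k. N i \<subset> N (Suc i))}"
    by (intro CollectI exI[of _ l] exI[of _ "\<lambda>i. \<eta> ` S i"] conjI allI impI sm st refl)
qed

end

end

end

section \<open>Existence of free resolutions\<close>

definition lin_comb :: "(nat \<Rightarrow> nat \<Rightarrow> 'k::field mpoly) \<Rightarrow> nat \<Rightarrow> (nat \<Rightarrow> 'k mpoly) \<Rightarrow> nat \<Rightarrow> 'k mpoly" where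
  "lin_comb e m x = (\<Sum>t<m. smul (x t) (e t))"

lemma lin_comb_add: "lin_comb e m (x + y) = lin_comb e m x + lin_comb e m y"
  by (simp add: lin_comb_def smul_add sum.distrib)

lemma lin_comb_smul: "lin_comb e m (smul c x) = smul c (lin_comb e m x)"
  by (rule ext) (simp add: lin_comb_def sum_fun_apply smul_apply sum_distrib_left mult.assoc)

context trunc_ring
begin

definition lift :: "nat \<Rightarrow> (nat \<Rightarrow> 'a) \<Rightarrow> nat \<Rightarrow> 'k mpoly" where
  "lift r y = (\<lambda>t. if t < r then SOME x. \<theta> x = y t else 0)"

lemma lift: "f \<in> coord_space r \<Longrightarrow> lift r (\<pi> r f) \<in> coord_space r"
  "f \<in> coord_space r \<Longrightarrow> \<pi> r (lift r (\<pi> r f)) = \<pi> r f"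
proof -
  have "\<theta> (SOME x. \<theta> x = \<theta> (f t)) = \<theta> (f t)" for t by (rule someI[of _ "f t"]) simp
  then show "f \<in> coord_space r \<Longrightarrow> \<pi> r (lift r (\<pi> r f)) = \<pi> r f"
    by (auto simp: lift_def \<Theta>_def restrict_def fun_eq_iff)
qed (simp add: lift_def coord_space_def)

definition psub :: "nat \<Rightarrow> (nat \<Rightarrow> 'k mpoly) set \<Rightarrow> bool" where
  "psub r W \<longleftrightarrow> v.sub W \<and> vec_ideal N r \<subseteq> W \<and> W \<subseteq> coord_space r"

definition presents :: "nat \<Rightarrow> (nat \<Rightarrow> 'k mpoly) set \<Rightarrow> nat \<Rightarrow> (nat \<Rightarrow> nat \<Rightarrow> 'k mpoly) \<Rightarrow> bool" where
  "presents r W m e \<longleftrightarrow> (\<forall>t<m. e t \<in> W) \<and> (\<forall>w\<in>W. \<exists>x\<in>coord_space m. w - lin_comb e m x \<in> vec_ideal N r)"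

text \<open>Finite generation comes from finite dimension over k: finitely many vectors that span
  \<open>W\<close> modulo the ideal of \<open>N\<close> over k also generate it over the
  polynomials.\<close>

lemma presents_exists: assumes W: "psub r W" shows "\<exists>m e. presents r W m e"
proof -
  have s: "v.sub W" "vec_ideal N r \<subseteq> W" "W \<subseteq> coord_space r" using W by (auto simp: psub_def)
  obtain b where b: "pv.spanned_mod (coord_space r :: (nat \<Rightarrow> 'k mpoly) set) (vec_ideal N r) b" using spanned_coord[OF fin] by blast
  have "pv.subspace W" using s(1) by (auto simp: v.sub_def pv.subspace_def poly_scale_smul)
  moreover have "pv.subspace (vec_ideal N r)" using vec_ideal_0 vec_ideal_add vec_ideal_smul[OF up] by (intro poly_subspaceI)
  ultimately have "pv.spanned_mod W (vec_ideal N r) b" using pv.spanned_mod_subspace[OF b] s(3) by blast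
  then obtain S where S: "finite S" "S \<subseteq> W" "\<And>w. w \<in> W \<Longrightarrow> \<exists>s\<in>pv.span S. w - s \<in> vec_ideal N r"
    unfolding pv.spanned_mod_def by blast
  obtain e where e: "S = e ` {i::nat. i < card S}" using finite_imp_nat_seg_image_inj_on[OF S(1)] by (metis card_Collect_less_nat card_image)
  define m where "m = card S"
  have "pv.span S \<subseteq> lin_comb e m ` coord_space m"
  proof (rule pv.span_minimal)
    show "S \<subseteq> lin_comb e m ` coord_space m"
    proof
      fix s assume "s \<in> S"
      then obtain t where t: "t < m" "s = e t" using e by (auto simp: m_def)
      have "lin_comb e m (delta_vec t) = (\<Sum>t'<m. if t' = t then e t else 0)"
        unfolding lin_comb_def by (intro sum.cong) (auto simp: delta_vec_def smul_add smul_def zero_fun_def)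
      then have "lin_comb e m (delta_vec t) = s" using t by simp
      moreover have "delta_vec t \<in> (coord_space m :: (nat \<Rightarrow> 'k mpoly) set)" using t by (auto simp: coord_space_def delta_vec_def)
      ultimately show "s \<in> lin_comb e m ` coord_space m" by blast
    qed
    show "pv.subspace (lin_comb e m ` coord_space m)"
    proof (rule poly_subspaceI)
      have "lin_comb e m 0 = 0" by (rule ext) (simp add: lin_comb_def sum_fun_apply smul_apply)
      then show "0 \<in> lin_comb e m ` coord_space m" using zero_Cr by (metis imageI)
      show "f + g \<in> lin_comb e m ` coord_space m" if fg: "f \<in> lin_comb e m ` coord_space m" "g \<in> lin_comb e m ` coord_space m" for f g
      proof -
        obtain x y where "f = lin_comb e m x" "g = lin_comb e m y" "x \<in> coord_space m" "y \<in> coord_space m" using fg by blast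
        then show ?thesis using lin_comb_add[of e m x y] coord_add[of x m y] by (metis imageI)
      qed
      show "smul c f \<in> lin_comb e m ` coord_space m" if f: "f \<in> lin_comb e m ` coord_space m" for c f
      proof -
        obtain x where "f = lin_comb e m x" "x \<in> coord_space m" using f by blast
        then show ?thesis using lin_comb_smul[of e m c x] smul_coord[of x m c] by (metis imageI)
      qed
    qed
  qed
  then have "presents r W m e" unfolding presents_def using S(2,3) e by (fastforce simp: m_def)
  then show ?thesis by blast
qed

lemma lin_comb_W: "v.sub W \<Longrightarrow> (\<And>t. t < m \<Longrightarrow> e t \<in> W) \<Longrightarrow> lin_comb e m x \<in> W"
  unfolding lin_comb_def by (intro v.sub_sum v.subD(3)) auto

text \<open>The relations between the generators \<open>e\<close>, that is, the next syzygy
  module.\<close>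

definition rel :: "nat \<Rightarrow> nat \<Rightarrow> (nat \<Rightarrow> nat \<Rightarrow> 'k mpoly) \<Rightarrow> (nat \<Rightarrow> 'k mpoly) set" where
  "rel r m e = {x \<in> coord_space m. lin_comb e m x \<in> vec_ideal N r}"

lemma psub_rel: assumes e: "\<And>t. t < m \<Longrightarrow> e t \<in> coord_space r" shows "psub m (rel r m e)"
proof -
  have "lin_comb e m 0 = 0" by (rule ext) (simp add: lin_comb_def sum_fun_apply smul_apply)
  then have "v.sub (rel r m e)" unfolding v.sub_def rel_def
    using zero_Cr vec_ideal_0 vec_ideal_add vec_ideal_smul[OF up] coord_add smul_coord by (auto simp: lin_comb_add lin_comb_smul)
  moreover have "x \<in> rel r m e" if x: "x \<in> vec_ideal N m" for x
  proof -
    have "lin_comb e m x \<in> coord_space r" unfolding lin_comb_def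
      by (rule v.sub_sum[OF v.modelD(1)[OF model_F]]) (auto intro: smul_coord e)
    moreover have "lin_comb e m x t \<in> mono_ideal N" for t
      unfolding lin_comb_def sum_fun_apply smul_apply using x mono_ideal_mult[OF up]
      by (intro mono_ideal_sum) (auto simp: vec_ideal_def mult.commute)
    ultimately show ?thesis using vec_ideal_coord[OF x] by (simp add: rel_def vec_ideal_def)
  qed
  ultimately show ?thesis unfolding psub_def by (auto simp: rel_def)
qed

text \<open>Dependent choice runs over pairs of a rank and a submodule, with \<open>psub\<close> as
  the invariant and the clause for k = 0 fixing the start; the generators come from a second
  choice.\<close>

lemma resolution_data:
  assumes W: "psub r W"
  shows "\<exists>n S e. n 0 = r \<and> S 0 = W \<and> (\<forall>k. psub (n k) (S k) \<and> presents (n k) (S k) (n (Suc k)) (e k)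
    \<and> S (Suc k) = rel (n k) (n (Suc k)) (e k))"
proof -
  have "\<exists>s. \<forall>k. (psub (fst (s k)) (snd (s k)) \<and> (k = 0 \<longrightarrow> s k = (r, W))) \<and>
      (\<exists>e. presents (fst (s k)) (snd (s k)) (fst (s (Suc k))) e \<and> snd (s (Suc k)) = rel (fst (s k)) (fst (s (Suc k))) e)"
  proof (rule dependent_nat_choice)
    show "\<exists>x. psub (fst x) (snd x) \<and> (0 = (0::nat) \<longrightarrow> x = (r, W))" using W by (intro exI[of _ "(r, W)"]) simp
    fix x :: "nat \<times> (nat \<Rightarrow> 'k mpoly) set" and k :: nat
    assume x: "psub (fst x) (snd x) \<and> (k = 0 \<longrightarrow> x = (r, W))"
    then obtain m e where e: "presents (fst x) (snd x) m e" using presents_exists by blast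
    have "psub m (rel (fst x) m e)" using e x by (intro psub_rel) (auto simp: presents_def psub_def)
    then show "\<exists>y. (psub (fst y) (snd y) \<and> (Suc k = 0 \<longrightarrow> y = (r, W))) \<and>
        (\<exists>e. presents (fst x) (snd x) (fst y) e \<and> snd y = rel (fst x) (fst y) e)"
      using e by (intro exI[of _ "(m, rel (fst x) m e)"]) auto
  qed
  then obtain s where s: "\<And>k. psub (fst (s k)) (snd (s k))" "s 0 = (r, W)"
    "\<And>k. \<exists>e. presents (fst (s k)) (snd (s k)) (fst (s (Suc k))) e \<and> snd (s (Suc k)) = rel (fst (s k)) (fst (s (Suc k))) e" by blast
  have "\<forall>k. \<exists>e. presents (fst (s k)) (snd (s k)) (fst (s (Suc k))) e \<and> snd (s (Suc k)) = rel (fst (s k)) (fst (s (Suc k))) e"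
    by (intro allI s(3))
  from choice[OF this] obtain e where
    e: "\<And>k. presents (fst (s k)) (snd (s k)) (fst (s (Suc k))) (e k) \<and> snd (s (Suc k)) = rel (fst (s k)) (fst (s (Suc k))) (e k)" by blast
  show ?thesis
    by (intro exI[of _ "\<lambda>k. fst (s k)"] exI[of _ "\<lambda>k. snd (s k)"] exI[of _ e]) (use s(1,2) e in simp)
qed

primrec eval_gens :: "('a, 'm, 'e) module_scheme \<Rightarrow> (nat \<Rightarrow> 'm) \<Rightarrow> nat \<Rightarrow> (nat \<Rightarrow> 'k mpoly) \<Rightarrow> 'm" where
  "eval_gens E g 0 f = \<zero>\<^bsub>E\<^esub>"
| "eval_gens E g (Suc k) f = eval_gens E g k f \<oplus>\<^bsub>E\<^esub> (\<theta> (f k) \<odot>\<^bsub>E\<^esub> g k)"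

text \<open>The kernel \<open>W\<close> of the evaluation at finitely many generators is the first
  syzygy module, and \<open>resolution_data\<close> continues from there. The result ensures that
  \<open>some_resolution\<close> picks a true resolution, so that the Betti numbers mean what they
  should.\<close>

theorem free_resolution_exists:
  assumes E: "module A E" and fg: "finitely_generated A E"
  shows "\<exists>n d \<epsilon>. free_resolution A E n d \<epsilon>"
proof -
  interpret E: module A E by (rule E)
  obtain G where G: "finite G" "G \<subseteq> carrier E" "E.span G = carrier E" using fg by (auto simp: finitely_generated_def)
  obtain g where g: "G = g ` {i::nat. i < card G}" using finite_imp_nat_seg_image_inj_on[OF G(1)] by (metis card_Collect_less_nat card_image)
  define r where "r = card G"
  have gE: "g t \<in> carrier E" if "t < r" for t using g G(2) that by (auto simp: r_def)
  let ?C = "coord_space r :: (nat \<Rightarrow> 'k mpoly) set"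
  have evE: "eval_gens E g k f \<in> carrier E" if "k \<le> r" for k f using that gE by (induction k) auto
  have eval_gens_add: "eval_gens E g k (f + f') = eval_gens E g k f \<oplus>\<^bsub>E\<^esub> eval_gens E g k f'" if "k \<le> r" for k f f'
    using that
  proof (induction k)
    case (Suc k)
    have c: "eval_gens E g k f \<in> carrier E" "eval_gens E g k f' \<in> carrier E" "\<theta> (f k) \<odot>\<^bsub>E\<^esub> g k \<in> carrier E" "\<theta> (f' k) \<odot>\<^bsub>E\<^esub> g k \<in> carrier E"
      using Suc.prems evE gE by auto
    show ?case using Suc c gE[of k] by (simp add: \<theta>_add E.smult_l_distr E.add.m_ac)
  qed simp
  have eval_gens_smul: "eval_gens E g k (smul x f) = \<theta> x \<odot>\<^bsub>E\<^esub> eval_gens E g k f" if "k \<le> r" for k x f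
    using that
  proof (induction k)
    case (Suc k)
    have c: "eval_gens E g k f \<in> carrier E" "\<theta> (f k) \<odot>\<^bsub>E\<^esub> g k \<in> carrier E" using Suc.prems evE gE by auto
    show ?case using Suc c gE[of k] by (simp add: \<theta>_mult E.smult_r_distr E.smult_assoc1 smul_apply)
  qed simp
  have eval_gens_cong: "eval_gens E g k f = eval_gens E g k f'" if "\<And>t. t < k \<Longrightarrow> \<theta> (f t) = \<theta> (f' t)" for k f f'
    using that by (induction k) auto
  have ev0: "eval_gens E g k 0 = \<zero>\<^bsub>E\<^esub>" if "k \<le> r" for k
    using that by (induction k) (use gE in \<open>auto simp: \<theta>_zero\<close>)
  have mod_ev: "v.model ?C E (eval_gens E g r)" unfolding v.model_def
  proof (intro conjI ballI allI)
    show sC: "v.sub ?C" by (rule v.modelD(1)[OF model_F])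
    show "carrier E = eval_gens E g r ` ?C"
    proof
      have "submodule A (eval_gens E g r ` ?C) E"
      proof (rule submodule.intro[OF E])
        show "eval_gens E g r ` ?C \<subseteq> carrier E" using evE by blast
        show "\<zero>\<^bsub>E\<^esub> \<in> eval_gens E g r ` ?C" using ev0[of r] zero_Cr by (metis imageI order_refl)
        show "v \<oplus>\<^bsub>E\<^esub> w \<in> eval_gens E g r ` ?C" if vw: "v \<in> eval_gens E g r ` ?C" "w \<in> eval_gens E g r ` ?C" for v w
        proof -
          obtain f f' where f: "v = eval_gens E g r f" "w = eval_gens E g r f'" "f \<in> ?C" "f' \<in> ?C" using vw by blast
          show ?thesis unfolding f eval_gens_add[OF order_refl, symmetric] by (intro imageI coord_add f)
        qed
        show "c \<odot>\<^bsub>E\<^esub> w \<in> eval_gens E g r ` ?C" if cw: "c \<in> carrier A" "w \<in> eval_gens E g r ` ?C" for c w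
        proof -
          obtain x f where f: "c = \<theta> x" "w = eval_gens E g r f" "f \<in> ?C" using cw unfolding \<theta>_range[symmetric] by blast
          show ?thesis unfolding f eval_gens_smul[OF order_refl, symmetric] by (intro imageI smul_coord f)
        qed
      qed
      moreover have "G \<subseteq> eval_gens E g r ` ?C"
      proof
        fix y assume "y \<in> G"
        then obtain t where t: "t < r" "y = g t" using g by (auto simp: r_def)
        have "eval_gens E g k (delta_vec t) = (if t < k then g t else \<zero>\<^bsub>E\<^esub>)" if "k \<le> r" for k
          using that by (induction k) (use gE t in \<open>auto simp: delta_vec_def \<theta>_one \<theta>_zero less_Suc_eq\<close>)
        then have "eval_gens E g r (delta_vec t) = y" using t by simp
        moreover have "delta_vec t \<in> ?C" using t by (auto simp: coord_space_def delta_vec_def)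
        ultimately show "y \<in> eval_gens E g r ` ?C" by blast
      qed
      ultimately show "carrier E \<subseteq> eval_gens E g r ` ?C" using E.span_is_subset G(3) by blast
    qed (use evE in blast)
    show "\<zero>\<^bsub>E\<^esub> = eval_gens E g r 0" by (simp add: ev0)
  qed (use eval_gens_add eval_gens_smul in auto)
  note me = v.modelD[OF mod_ev]
  have eval_gens_ideal: "eval_gens E g r f = eval_gens E g r f'" if "f - f' \<in> vec_ideal N r" for f f'
    using that by (intro eval_gens_cong) (auto simp: vec_ideal_def \<theta>_eq)
  define W where "W = {f \<in> ?C. eval_gens E g r f = \<zero>\<^bsub>E\<^esub>}"
  have W: "psub r W" unfolding psub_def
  proof (intro conjI subsetI)
    show "v.sub W" unfolding v.sub_def W_def
      using ev0[of r] zero_Cr coord_add smul_coord E.smult_r_null by (auto simp: eval_gens_add eval_gens_smul)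
    show "f \<in> W" if "f \<in> vec_ideal N r" for f
      using that eval_gens_ideal[of f 0] vec_ideal_coord[OF that] by (simp add: W_def ev0)
  qed (auto simp: W_def)
  obtain n S e where n: "n 0 = r" "S 0 = W" and S: "\<And>k. psub (n k) (S k)"
    and e: "\<And>k. presents (n k) (S k) (n (Suc k)) (e k)" and Srel: "\<And>k. S (Suc k) = rel (n k) (n (Suc k)) (e k)"
    using resolution_data[OF W] by blast
  define \<epsilon> where "\<epsilon> y = eval_gens E g r (lift r y)" for y
  define d where "d k y = \<pi> (n k) (lin_comb (e k) (n (Suc k)) (lift (n (Suc k)) y))" for k y
  let ?F = "\<lambda>k. Fm (n k)" and ?CS = "\<lambda>k. coord_space (n k) :: (nat \<Rightarrow> 'k mpoly) set"
  have Fc: "carrier (?F k) = \<pi> (n k) ` ?CS k" for k by (rule v.modelD(2)[OF model_F])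
  have \<epsilon>: "\<epsilon> (\<pi> r f) = eval_gens E g r f" if f: "f \<in> ?C" for f
    unfolding \<epsilon>_def by (rule eval_gens_ideal) (use \<pi>_eq[OF lift(1)[OF f] f] lift(2)[OF f] in blast)
  have cC: "lin_comb (e k) (n (Suc k)) x \<in> ?CS k" for k x
    using lin_comb_W[of "S k" "n (Suc k)" "e k" x] S[of k] e[of k] by (auto simp: psub_def presents_def)
  have d: "d k (\<pi> (n (Suc k)) x) = \<pi> (n k) (lin_comb (e k) (n (Suc k)) x)" if x: "x \<in> ?CS (Suc k)" for k x
  proof -
    let ?y = "lift (n (Suc k)) (\<pi> (n (Suc k)) x)"
    have "?y - x \<in> vec_ideal N (n (Suc k))" using \<pi>_eq[OF lift(1)[OF x] x] lift(2)[OF x] by blast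
    then have "?y - x \<in> rel (n k) (n (Suc k)) (e k)" using S[of "Suc k"] unfolding Srel psub_def by blast
    then have "lin_comb (e k) (n (Suc k)) (?y - x) \<in> vec_ideal N (n k)" by (simp add: rel_def)
    moreover have "lin_comb (e k) (n (Suc k)) (?y - x + x) = lin_comb (e k) (n (Suc k)) (?y - x) + lin_comb (e k) (n (Suc k)) x" by (rule lin_comb_add)
    ultimately have "lin_comb (e k) (n (Suc k)) ?y - lin_comb (e k) (n (Suc k)) x \<in> vec_ideal N (n k)" by simp
    then show ?thesis unfolding d_def using \<pi>_eq[OF cC cC] by blast
  qed
  have Sim: "\<pi> (n k) ` S k = d k ` carrier (?F (Suc k))" for k
  proof (intro equalityI subsetI)
    fix u assume "u \<in> \<pi> (n k) ` S k"
    then obtain w where w: "w \<in> S k" "u = \<pi> (n k) w" by blast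
    then obtain x where x: "x \<in> ?CS (Suc k)" "w - lin_comb (e k) (n (Suc k)) x \<in> vec_ideal N (n k)" using e[of k] by (auto simp: presents_def)
    have "w \<in> ?CS k" using w S[of k] by (auto simp: psub_def)
    then have "u = d k (\<pi> (n (Suc k)) x)" unfolding d[OF x(1)] w(2) using \<pi>_eq[OF _ cC] x(2) by blast
    then show "u \<in> d k ` carrier (?F (Suc k))" unfolding Fc using x(1) by blast
  next
    fix u assume "u \<in> d k ` carrier (?F (Suc k))"
    then obtain x where x: "x \<in> ?CS (Suc k)" "u = d k (\<pi> (n (Suc k)) x)" unfolding Fc by blast
    have "lin_comb (e k) (n (Suc k)) x \<in> S k" using S[of k] e[of k] by (intro lin_comb_W) (auto simp: psub_def presents_def)
    then show "u \<in> \<pi> (n k) ` S k" unfolding x(2) d[OF x(1)] by blast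
  qed
  have "free_resolution A E n d \<epsilon>" unfolding free_resolution_def Let_def
  proof (intro conjI allI)
    show "\<epsilon> \<in> module_hom A (?F 0) E" unfolding module_hom_def n(1)
    proof (intro CollectI conjI allI impI Pi_I)
      note mF = v.modelD[OF model_F[of r]]
      show "\<epsilon> x \<in> carrier E" if "x \<in> carrier (Fm r)" for x using that evE[of r] \<epsilon> unfolding mF(2) by auto
      show "\<epsilon> (x \<oplus>\<^bsub>Fm r\<^esub> y) = \<epsilon> x \<oplus>\<^bsub>E\<^esub> \<epsilon> y" if xy: "x \<in> carrier (Fm r) \<and> y \<in> carrier (Fm r)" for x y
      proof -
        obtain f h where f: "f \<in> ?C" "h \<in> ?C" "x = \<pi> r f" "y = \<pi> r h" using xy unfolding mF(2) by blast
        show ?thesis unfolding f(3,4) mF(4)[OF f(1,2)] \<epsilon>[OF f(1)] \<epsilon>[OF f(2)] \<epsilon>[OF coord_add[OF f(1,2)]] by (rule eval_gens_add) simp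
      qed
      show "\<epsilon> (a \<odot>\<^bsub>Fm r\<^esub> x) = a \<odot>\<^bsub>E\<^esub> \<epsilon> x" if ax: "a \<in> carrier A \<and> x \<in> carrier (Fm r)" for a x
      proof -
        obtain b f where f: "f \<in> ?C" "x = \<pi> r f" "a = \<theta> b" using ax unfolding mF(2) \<theta>_range[symmetric] by blast
        show ?thesis unfolding f(2,3) mF(5)[OF f(1)] \<epsilon>[OF f(1)] \<epsilon>[OF smul_coord[OF f(1)]] by (rule eval_gens_smul) simp
      qed
    qed
    have F0: "carrier (Fm r) = \<pi> r ` ?C" by (rule v.modelD(2)[OF model_F])
    show "\<epsilon> ` carrier (?F 0) = carrier E" unfolding n(1) F0 me(2) image_image by (rule image_cong[OF refl \<epsilon>])
    show "d k \<in> module_hom A (?F (Suc k)) (?F k)" for k unfolding module_hom_def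
    proof (intro CollectI conjI allI impI Pi_I)
      note mF = v.modelD[OF model_F[of "n (Suc k)"]] and mF' = v.modelD[OF model_F[of "n k"]]
      show "d k x \<in> carrier (?F k)" if "x \<in> carrier (?F (Suc k))" for x using that d cC unfolding Fc by auto
      show "d k (x \<oplus>\<^bsub>?F (Suc k)\<^esub> y) = d k x \<oplus>\<^bsub>?F k\<^esub> d k y" if xy: "x \<in> carrier (?F (Suc k)) \<and> y \<in> carrier (?F (Suc k))" for x y
      proof -
        obtain f h where f: "f \<in> ?CS (Suc k)" "h \<in> ?CS (Suc k)" "x = \<pi> (n (Suc k)) f" "y = \<pi> (n (Suc k)) h" using xy unfolding Fc by blast
        show ?thesis unfolding f(3,4) mF(4)[OF f(1,2)] d[OF f(1)] d[OF f(2)] d[OF coord_add[OF f(1,2)]] mF'(4)[OF cC cC] lin_comb_add ..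
      qed
      show "d k (a \<odot>\<^bsub>?F (Suc k)\<^esub> x) = a \<odot>\<^bsub>?F k\<^esub> d k x" if ax: "a \<in> carrier A \<and> x \<in> carrier (?F (Suc k))" for a x
      proof -
        obtain b f where f: "f \<in> ?CS (Suc k)" "x = \<pi> (n (Suc k)) f" "a = \<theta> b" using ax unfolding Fc \<theta>_range[symmetric] by blast
        show ?thesis unfolding f(2,3) mF(5)[OF f(1)] d[OF f(1)] d[OF smul_coord[OF f(1)]] mF'(5)[OF cC] lin_comb_smul ..
      qed
    qed
    have "a_kernel (?F 0) E \<epsilon> = \<pi> (n 0) ` S 0" unfolding a_kernel_def' n F0 using \<epsilon> by (auto simp: W_def)
    then show "d 0 ` carrier (?F 1) = a_kernel (?F 0) E \<epsilon>" using Sim[of 0] by simp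
    have "a_kernel (?F (Suc k)) (?F k) (d k) = \<pi> (n (Suc k)) ` S (Suc k)" for k
    proof -
      have "d k (\<pi> (n (Suc k)) x) = \<zero>\<^bsub>?F k\<^esub> \<longleftrightarrow> x \<in> S (Suc k)" if x: "x \<in> ?CS (Suc k)" for x
        unfolding d[OF x] v.modelD(3)[OF model_F] Srel rel_def using \<pi>_eq[OF cC zero_Cr] x by simp
      moreover have "S (Suc k) \<subseteq> ?CS (Suc k)" using S[of "Suc k"] by (simp add: psub_def)
      ultimately show ?thesis unfolding a_kernel_def' Fc by auto
    qed
    then show "d (Suc k) ` carrier (?F (Suc (Suc k))) = a_kernel (?F (Suc k)) (?F k) (d k)" for k using Sim[of "Suc k"] by simp
  qed
  then show ?thesis by (intro exI)
qed

end

section \<open>The truncated polynomial ring\<close>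

definition bounded_polys :: "nat \<Rightarrow> 'k::field mpoly set" where
  "bounded_polys c = {f. \<forall>m\<in>ks f. ks m \<subseteq> {1..c}}"

lemma bounded_polys_mult: "f \<in> bounded_polys c \<Longrightarrow> g \<in> bounded_polys c \<Longrightarrow> f * g \<in> bounded_polys c"
proof -
  assume fg: "f \<in> bounded_polys c" "g \<in> bounded_polys c"
  have "ks m \<subseteq> {1..c}" if m: "m \<in> ks (f * g)" for m
  proof -
    obtain x y where xy: "m = x + y" "x \<in> ks f" "y \<in> ks g" using m keys_mult[of f g] by blast
    have "ks m \<subseteq> ks x \<union> ks y" unfolding xy(1) by (rule Poly_Mapping.keys_add)
    then show ?thesis using xy fg unfolding bounded_polys_def by blast
  qed
  then show ?thesis by (simp add: bounded_polys_def)
qed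

lemma bounded_polys_add: "f \<in> bounded_polys c \<Longrightarrow> g \<in> bounded_polys c \<Longrightarrow> f + g \<in> bounded_polys c"
  using Poly_Mapping.keys_add[of f g] unfolding bounded_polys_def by blast

lemma bounded_polys_neg: "f \<in> bounded_polys c \<Longrightarrow> - f \<in> bounded_polys c"
  by (simp add: bounded_polys_def)

lemma bounded_polys_diff: "f \<in> bounded_polys c \<Longrightarrow> g \<in> bounded_polys c \<Longrightarrow> f - g \<in> bounded_polys c"
  using bounded_polys_add[OF _ bounded_polys_neg, of f c g] by simp

lemma bounded_polys_one: "1 \<in> bounded_polys c"
  by (simp add: bounded_polys_def keys_one)

lemma bounded_polys_zero: "0 \<in> bounded_polys c"
  by (simp add: bounded_polys_def)

lemma poly_ring_simps:
  "carrier (poly_ring c) = bounded_polys c" "x \<otimes>\<^bsub>poly_ring c\<^esub> y = x * y" "x \<oplus>\<^bsub>poly_ring c\<^esub> y = x + y"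
  "\<one>\<^bsub>poly_ring c\<^esub> = 1" "\<zero>\<^bsub>poly_ring c\<^esub> = 0"
  by (simp_all add: poly_ring_def ring_of_type_algebra_def bounded_polys_def)

lemma cring_poly_ring: "cring (poly_ring c :: ((nat \<Rightarrow>\<^sub>0 nat) \<Rightarrow>\<^sub>0 'k::field) ring)"
proof (rule cringI)
  show "abelian_group (poly_ring c :: ((nat \<Rightarrow>\<^sub>0 nat) \<Rightarrow>\<^sub>0 'k) ring)"
  proof (rule abelian_groupI)
    show "\<exists>y\<in>carrier (poly_ring c). y \<oplus>\<^bsub>poly_ring c\<^esub> x = \<zero>\<^bsub>poly_ring c\<^esub>" if "x \<in> carrier (poly_ring c)" for x :: "'k mpoly"
      using that bounded_polys_neg by (intro bexI[of _ "- x"]) (auto simp: poly_ring_simps)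
  qed (auto simp: poly_ring_simps bounded_polys_add bounded_polys_zero add.assoc add.commute)
  show "Group.comm_monoid (poly_ring c :: ((nat \<Rightarrow>\<^sub>0 nat) \<Rightarrow>\<^sub>0 'k) ring)"
    by (rule comm_monoidI) (auto simp: poly_ring_simps bounded_polys_mult bounded_polys_one mult.assoc mult.commute)
qed (auto simp: poly_ring_simps distrib_right)

definition trunc_ideal :: "nat \<Rightarrow> (nat \<Rightarrow> nat) \<Rightarrow> 'k::field mpoly set" where
  "trunc_ideal c a = bounded_polys c \<inter> mono_ideal (nonbox c a)"

lemma ideal_trunc: "ideal (trunc_ideal c a :: 'k::field mpoly set) (poly_ring c)"
proof -
  interpret R: cring "poly_ring c :: 'k mpoly ring" by (rule cring_poly_ring)
  have neg: "\<ominus>\<^bsub>poly_ring c\<^esub> f = - f" if "f \<in> bounded_polys c" for f :: "'k mpoly"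
    using that bounded_polys_neg by (intro R.minus_equality) (auto simp: poly_ring_simps)
  show ?thesis
  proof (rule idealI[OF R.ring_axioms])
    show "subgroup (trunc_ideal c a) (add_monoid (poly_ring c :: 'k mpoly ring))"
    proof (rule R.add.subgroupI)
      show "\<ominus>\<^bsub>poly_ring c\<^esub> f \<in> trunc_ideal c a" if "f \<in> trunc_ideal c a" for f :: "'k mpoly"
        using that neg[of f] bounded_polys_neg mono_ideal_neg by (auto simp: trunc_ideal_def)
      have "0 \<in> (trunc_ideal c a :: 'k mpoly set)" by (simp add: trunc_ideal_def bounded_polys_def)
      then show "trunc_ideal c a \<noteq> ({} :: 'k mpoly set)" by blast
    qed (auto simp: poly_ring_simps trunc_ideal_def bounded_polys_add mono_ideal_add)
    show "x \<otimes>\<^bsub>poly_ring c\<^esub> f \<in> trunc_ideal c a" if "f \<in> trunc_ideal c a" "x \<in> carrier (poly_ring c)" for f x :: "'k mpoly"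
      using that mono_ideal_mult[OF upset_nonbox] by (auto simp: poly_ring_simps trunc_ideal_def bounded_polys_mult)
    show "f \<otimes>\<^bsub>poly_ring c\<^esub> x \<in> trunc_ideal c a" if "f \<in> trunc_ideal c a" "x \<in> carrier (poly_ring c)" for f x :: "'k mpoly"
      using that mono_ideal_mult[OF upset_nonbox, of f c a x] by (auto simp: poly_ring_simps trunc_ideal_def bounded_polys_mult mult.commute)
  qed
qed

text \<open>Among the monomials in the variables 1..c, those in \<open>nonbox\<close> are exactly
  the multiples of some X_i^(a i).\<close>

lemma Idl_eq: "Idl\<^bsub>poly_ring c\<^esub> {poly_var i [^]\<^bsub>poly_ring c\<^esub> a i | i. i \<in> {1..c}} = (trunc_ideal c a :: 'k::field mpoly set)"
proof -
  interpret R: cring "poly_ring c :: 'k mpoly ring" by (rule cring_poly_ring)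
  have "x [^]\<^bsub>poly_ring c\<^esub> n = x ^ n" for x :: "'k mpoly" and n :: nat
    by (induction n) (simp_all add: poly_ring_simps mult.commute)
  then have pow: "poly_var i [^]\<^bsub>poly_ring c\<^esub> a i = (vp i (a i) :: 'k mpoly)" for i
    using vp_power[of i 1 "a i"] by (simp add: poly_var_def)
  let ?G = "{poly_var i [^]\<^bsub>poly_ring c\<^esub> a i | i. i \<in> {1..c}} :: 'k mpoly set"
  have Geq: "?G = {vp i (a i) | i. i \<in> {1..c}}" by (simp only: pow)
  have G: "?G \<subseteq> trunc_ideal c a"
  proof
    fix g assume "g \<in> ?G"
    then obtain i where i: "i \<in> {1..c}" "g = vp i (a i)" unfolding pow by blast
    have "ks (sg i (a i)) \<subseteq> {1..c}" using i(1) by auto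
    moreover have "sg i (a i) \<in> nonbox c a" using i(1) unfolding nonbox_def by (auto intro!: bexI[of _ i])
    ultimately show "g \<in> trunc_ideal c a" by (simp add: i(2) trunc_ideal_def bounded_polys_def mono_ideal_def)
  qed
  have GC: "?G \<subseteq> carrier (poly_ring c)" using G unfolding poly_ring_simps trunc_ideal_def by blast
  interpret I: ideal "Idl\<^bsub>poly_ring c\<^esub> ?G" "poly_ring c" by (rule R.genideal_ideal[OF GC])
  have mono: "sg m b \<in> Idl\<^bsub>poly_ring c\<^esub> ?G" if m: "m \<in> nonbox c a" "ks m \<subseteq> {1..c}" for m b
  proof -
    obtain i where i: "i \<in> {1..c}" "a i \<le> lk m i" using m by (auto simp: nonbox_def)
    obtain m' where m': "m = m' + sg i (a i)" using monomial_split[OF i(2)] by blast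
    have "ks m' \<subseteq> ks m" unfolding m' by (auto simp: in_keys_iff lookup_add)
    then have "sg m' b \<in> carrier (poly_ring c)" using m(2) by (auto simp: poly_ring_simps bounded_polys_def)
    moreover have "vp i (a i) \<in> ?G" unfolding Geq using i(1) by (intro CollectI exI[of _ i] conjI refl)
    then have "vp i (a i) \<in> Idl\<^bsub>poly_ring c\<^esub> ?G" by (rule subsetD[OF R.genideal_self[OF GC]])
    ultimately have "sg m' b \<otimes>\<^bsub>poly_ring c\<^esub> vp i (a i) \<in> Idl\<^bsub>poly_ring c\<^esub> ?G" by (intro I.I_l_closed)
    then show ?thesis by (simp add: poly_ring_simps mult_single m')
  qed
  have "f \<in> Idl\<^bsub>poly_ring c\<^esub> ?G" if f: "f \<in> trunc_ideal c a" for f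
  proof (rule monomial_sub[where P = "\<lambda>f. f \<in> Idl\<^bsub>poly_ring c\<^esub> ?G"])
    show "g + h \<in> Idl\<^bsub>poly_ring c\<^esub> ?G" if "g \<in> Idl\<^bsub>poly_ring c\<^esub> ?G" "h \<in> Idl\<^bsub>poly_ring c\<^esub> ?G" for g h
      using I.a_closed[OF that] by (simp add: poly_ring_simps)
    show "0 \<in> Idl\<^bsub>poly_ring c\<^esub> ?G" using I.zero_closed by (simp add: poly_ring_simps)
    show "sg m b \<in> Idl\<^bsub>poly_ring c\<^esub> ?G" if "m \<in> ks f" for m b
      using that f by (intro mono) (auto simp: trunc_ideal_def bounded_polys_def mono_ideal_def)
  qed
  then show ?thesis using R.genideal_minimal[OF ideal_trunc G] by blast
qed

text \<open>Removing the monomials of \<open>nonbox\<close> first leaves only the variables 1..c, so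
  that the map to the truncated ring is defined on the whole type and kills all other
  variables.\<close>

definition normal_form :: "nat \<Rightarrow> (nat \<Rightarrow> nat) \<Rightarrow> 'k::field mpoly \<Rightarrow> 'k mpoly set" where
  "normal_form c a f = trunc_ideal c a +>\<^bsub>poly_ring c\<^esub> restr (- nonbox c a) f"

lemma trunc_ring_normal_form:
  assumes a: "\<forall>i\<in>{1..c}. a i \<ge> 2"
  shows "trunc_ring (truncated_poly_ring c a) (normal_form c a :: 'k::field mpoly \<Rightarrow> _) (nonbox c a)"
proof -
  let ?R = "poly_ring c :: 'k mpoly ring" and ?I = "trunc_ideal c a :: 'k mpoly set" and ?N = "nonbox c a"
  let ?A = "truncated_poly_ring c a :: 'k mpoly set ring"
  interpret R: cring ?R by (rule cring_poly_ring)
  interpret I: ideal ?I ?R by (rule ideal_trunc)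
  have A: "?A = ?R Quot ?I" by (simp only: truncated_poly_ring_def Idl_eq)
  have cos: "?I +>\<^bsub>?R\<^esub> f = {h + f | h. h \<in> ?I}" for f :: "'k mpoly"
    unfolding a_r_coset_def' by (auto simp: poly_ring_simps)
  have cos_eq: "?I +>\<^bsub>?R\<^esub> f = ?I +>\<^bsub>?R\<^esub> g \<longleftrightarrow> f - g \<in> mono_ideal ?N" if fg: "f \<in> bounded_polys c" "g \<in> bounded_polys c" for f g
  proof
    assume "?I +>\<^bsub>?R\<^esub> f = ?I +>\<^bsub>?R\<^esub> g"
    moreover have "f \<in> ?I +>\<^bsub>?R\<^esub> f" unfolding cos using I.zero_closed by (auto simp: poly_ring_simps intro!: exI[of _ 0])
    ultimately obtain h where "f = h + g" "h \<in> ?I" unfolding cos by blast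
    then show "f - g \<in> mono_ideal ?N" by (simp add: trunc_ideal_def)
  next
    assume "f - g \<in> mono_ideal ?N"
    then have d: "f - g \<in> ?I" using bounded_polys_diff[OF fg] by (simp add: trunc_ideal_def)
    then have d': "g - f \<in> ?I" using bounded_polys_diff[OF fg(2,1)] mono_ideal_neg[of "f - g"] by (simp add: trunc_ideal_def)
    have cl: "h + h' \<in> ?I" if "h \<in> ?I" "h' \<in> ?I" for h h' using I.a_closed[OF that] by (simp add: poly_ring_simps)
    show "?I +>\<^bsub>?R\<^esub> f = ?I +>\<^bsub>?R\<^esub> g" unfolding cos
    proof (intro equalityI subsetI)
      fix u assume "u \<in> {h + f | h. h \<in> ?I}"
      then obtain h where h: "u = h + f" "h \<in> ?I" by blast
      have "u = (h + (f - g)) + g" by (simp add: h)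
      then show "u \<in> {h + g | h. h \<in> ?I}" using cl[OF h(2) d] by blast
    next
      fix u assume "u \<in> {h + g | h. h \<in> ?I}"
      then obtain h where h: "u = h + g" "h \<in> ?I" by blast
      have "u = (h + (g - f)) + f" by (simp add: h)
      then show "u \<in> {h + f | h. h \<in> ?I}" using cl[OF h(2) d'] by blast
    qed
  qed
  let ?r = "restr (- ?N) :: 'k mpoly \<Rightarrow> 'k mpoly"
  have rB: "?r f \<in> bounded_polys c" for f
  proof -
    have "m \<notin> ?N" if "m \<in> ks (?r f)" for m using that by (auto simp: in_keys_iff lookup_restr split: if_splits)
    then show ?thesis unfolding bounded_polys_def nonbox_def by blast
  qed
  have rd: "f - ?r f \<in> mono_ideal ?N" for f
    by (simp add: mono_ideal_iff lookup_minus lookup_restr)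
  have NF: "normal_form c a f = ?I +>\<^bsub>?R\<^esub> g" if g: "g \<in> bounded_polys c" "f - g \<in> mono_ideal ?N" for f g
  proof -
    have "(f - g) - (f - ?r f) \<in> mono_ideal ?N" by (rule mono_ideal_diff[OF g(2) rd])
    then have "?r f - g \<in> mono_ideal ?N" by simp
    then show ?thesis unfolding normal_form_def using cos_eq[OF rB g(1)] by blast
  qed
  have N0: "0 \<notin> ?N" using a by (force simp: nonbox_def)
  have hom: "(+>\<^bsub>?R\<^esub>) ?I \<in> ring_hom ?R ?A" unfolding A by (rule I.rcos_ring_hom)
  show ?thesis
  proof (rule trunc_ring.intro)
    show "cring ?A" unfolding A by (rule I.quotient_is_cring[OF R.cring_axioms])
    show "range (normal_form c a) = carrier ?A"
    proof (intro equalityI subsetI)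
      fix u assume "u \<in> range (normal_form c a :: 'k mpoly \<Rightarrow> _)"
      then show "u \<in> carrier ?A" unfolding A FactRing_def A_RCOSETS_def' normal_form_def using rB by (auto simp: poly_ring_simps)
    next
      fix u assume "u \<in> carrier ?A"
      then obtain f where f: "f \<in> bounded_polys c" "u = ?I +>\<^bsub>?R\<^esub> f" unfolding A FactRing_def A_RCOSETS_def' by (auto simp: poly_ring_simps)
      have "u = normal_form c a f" using NF[OF f(1), of f] f(2) by simp
      then show "u \<in> range (normal_form c a :: 'k mpoly \<Rightarrow> _)" by (rule range_eqI)
    qed
    fix x y :: "'k mpoly"
    have "(x + y) - (?r x + ?r y) \<in> mono_ideal ?N" using mono_ideal_add[OF rd[of x] rd[of y]] by (simp add: algebra_simps)
    from NF[OF bounded_polys_add[OF rB rB] this]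
    show "normal_form c a (x + y) = normal_form c a x \<oplus>\<^bsub>?A\<^esub> normal_form c a y"
      using ring_hom_add[OF hom, of "?r x" "?r y"] rB by (simp add: normal_form_def poly_ring_simps)
    have "x * (y - ?r y) + ?r y * (x - ?r x) \<in> mono_ideal ?N" by (intro mono_ideal_add mono_ideal_mult upset_nonbox rd)
    moreover have "x * (y - ?r y) + ?r y * (x - ?r x) = x * y - ?r x * ?r y" by (simp add: algebra_simps)
    ultimately have "x * y - ?r x * ?r y \<in> mono_ideal ?N" by simp
    from NF[OF bounded_polys_mult[OF rB rB] this]
    show "normal_form c a (x * y) = normal_form c a x \<otimes>\<^bsub>?A\<^esub> normal_form c a y"
      using ring_hom_mult[OF hom, of "?r x" "?r y"] rB by (simp add: normal_form_def poly_ring_simps)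
    show "normal_form c a (1 :: 'k mpoly) = \<one>\<^bsub>?A\<^esub>"
      using NF[OF bounded_polys_one, of 1] ring_hom_one[OF hom] by (simp add: poly_ring_simps)
    show "normal_form c a x = normal_form c a y \<longleftrightarrow> x - y \<in> mono_ideal ?N"
    proof -
      have "normal_form c a x = normal_form c a y \<longleftrightarrow> ?r x - ?r y \<in> mono_ideal ?N"
        unfolding normal_form_def by (rule cos_eq[OF rB rB])
      also have "\<dots> \<longleftrightarrow> x - y \<in> mono_ideal ?N" by (auto simp: mono_ideal_iff lookup_minus lookup_restr)
      finally show ?thesis .
    qed
    show "0 \<notin> ?N" by (rule N0)
  qed (rule upset_nonbox finite_box)+
qed

section \<open>Divisibility of the length\<close>

text \<open>Over k, \<open>E\<close> is \<open>CS 0\<close> modulo \<open>syz 0\<close>. Its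
  dimension \<open>l\<close> is the length by \<open>module_length_eq\<close>, and p divides it by
  \<open>dvd_quotient_dim\<close>, whose bound on the homology is \<open>spanned_homology\<close>
  for the zeroth syzygy module.\<close>

lemma (in resolved_module) dvd_length:
  assumes E: "module A E" and nd: "some_resolution A E = (n, d)" and b: "\<And>i. betti A i E \<le> b"
    and N: "N = nonbox c a" and tp: "two_powers c a i j p \<alpha> \<beta>"
  shows "\<exists>l. module_length A E = enat l \<and> p dvd l"
proof -
  interpret t: tate_resolution c a i j p \<alpha> \<beta> n D syz
    using tp poly_resolution_axioms unfolding N tate_resolution_def by blast
  obtain l f where f: "Vector_Spaces.linear poly_scale vec_scale f" "f ` CS 0 = coord_space l"
    "\<And>x. x \<in> CS 0 \<Longrightarrow> f x = 0 \<longleftrightarrow> x \<in> syz 0" using quotient_dim[OF E] by blast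
  have sp: "pv.spanned_mod (cyc (- {0}) k) (bnd (- {0}) k) b" for k
    using pv.spanned_mod_mono[OF spanned_betti[OF nd] b order_refl] .
  have u: "t.uop = smul (vp i \<alpha>)" "t.vop = smul (vp j \<beta>)"
    by (simp_all add: fun_eq_iff t.uop_def t.vop_def smul_def)
  have lin: "Vector_Spaces.linear poly_scale poly_scale (smul x :: (nat \<Rightarrow> 'k mpoly) \<Rightarrow> _)" for x
    using pv.vector_space_axioms by (auto simp: Vector_Spaces.linear_iff poly_scale_smul smul_add mult.commute)
  have pw: "(smul x ^^ q) z \<in> CS 0" if "z \<in> CS 0" for x q z using that by (induction q) (auto intro: smul_coord)
  have "p dvd l"
  proof (rule pv.dvd_quotient_dim[OF subspace_CS[OF E] subspace_syz syz_CS[OF E], where u = t.uop and v = t.vop and f = f])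
    show "(t.uop ^^ p) x \<in> syz 0" if "x \<in> CS 0" for x
    proof (rule ideal_syz)
      have "(t.uop ^^ p) x \<in> CS 0" unfolding u by (rule pw[OF that])
      moreover have "(t.uop ^^ p) x t \<in> mono_ideal N" for t unfolding N by (rule t.uop_pow(1))
      ultimately show "(t.uop ^^ p) x \<in> vec_ideal N (n 0)" by (simp only: vec_ideal_def mem_Collect_eq simp_thms)
    qed
    show "(t.vop ^^ p) x \<in> syz 0" if "x \<in> CS 0" for x
    proof (rule ideal_syz)
      have "(t.vop ^^ p) x \<in> CS 0" unfolding u by (rule pw[OF that])
      moreover have "(t.vop ^^ p) x t \<in> mono_ideal N" for t unfolding N by (rule t.uop_pow(2))
      ultimately show "(t.vop ^^ p) x \<in> vec_ideal N (n 0)" by (simp only: vec_ideal_def mem_Collect_eq simp_thms)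
    qed
    show "k_space.spanned_mod pv.fscale
        {z \<in> chains (CS 0) i. tate t.uop t.vop p i z \<in> chains (syz 0) (i - 1)}
        {z \<in> chains (CS 0) i. \<exists>y\<in>chains (CS 0) (i + 1). z - tate t.uop t.vop p (i + 1) y \<in> chains (syz 0) i}
        (card (- t.J) * b)" if "i \<ge> 1" for i
      using t.spanned_homology[OF sp that, of 0] unfolding t.Zc_def t.Bc_def .
    show "p \<ge> 2" by (rule t.p2)
    show "Vector_Spaces.linear poly_scale poly_scale (t.uop :: (nat \<Rightarrow> 'k mpoly) \<Rightarrow> _)"
      "Vector_Spaces.linear poly_scale poly_scale (t.vop :: (nat \<Rightarrow> 'k mpoly) \<Rightarrow> _)"
      unfolding u by (rule lin)+
    show "t.uop (t.vop x) = t.vop (t.uop x)" for x :: "nat \<Rightarrow> 'k mpoly" unfolding u by (simp add: smul_add mult.commute)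
    show "t.uop x \<in> CS 0" "t.vop x \<in> CS 0" if "x \<in> CS 0" for x unfolding u using that by (auto intro: smul_coord)
    show "t.uop x \<in> syz 0" "t.vop x \<in> syz 0" if "x \<in> syz 0" for x unfolding u using that by (auto intro: syz_smul)
  qed (use f in auto)
  moreover have "module_length A E = enat l" by (rule module_length_eq[OF E f])
  ultimately show ?thesis by blast
qed

theorem theorem1p5:
  fixes c :: nat and a :: "nat \<Rightarrow> nat" and p :: nat
    and A :: "((nat \<Rightarrow>\<^sub>0 nat) \<Rightarrow>\<^sub>0 'k::field) set ring"
    and E :: "(((nat \<Rightarrow>\<^sub>0 nat) \<Rightarrow>\<^sub>0 'k) set, 'm) module"
  assumes "c \<ge> 2"
    and "\<forall>i \<in> {1..c}. a i \<ge> 2"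
    and "A = truncated_poly_ring c a"
    and "Factorial_Ring.prime p"
    and "\<exists>i \<in> {1..c}. \<exists>j \<in> {1..c}. i \<noteq> j \<and> p dvd a i \<and> p dvd a j"
    and "module A E"
    and "finitely_generated A E"
    and "cx_le_one A E"
  shows "\<exists>l. module_length A E = enat l \<and> p dvd l"
proof -
  obtain i j where ij: "i \<in> {1..c}" "j \<in> {1..c}" "i \<noteq> j" "p dvd a i" "p dvd a j" using assms(5) by blast
  obtain \<alpha> \<beta> where \<alpha>\<beta>: "a i = p * \<alpha>" "a j = p * \<beta>" using ij(4,5) by (auto elim!: dvdE)
  have "a i \<ge> 2" "a j \<ge> 2" using assms(2) ij(1,2) by auto
  then have "\<alpha> > 0" "\<beta> > 0" using \<alpha>\<beta> by (auto intro!: Nat.gr0I)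
  then have tp: "two_powers c a i j p \<alpha> \<beta>"
    using ij \<alpha>\<beta> prime_ge_2_nat[OF assms(4)] by (intro two_powers.intro) auto
  interpret trunc_ring A "normal_form c a :: 'k mpoly \<Rightarrow> _" "nonbox c a"
    unfolding assms(3) by (rule trunc_ring_normal_form[OF assms(2)])
  \<comment> \<open>The Betti numbers refer to the resolution picked by
    \<open>some_resolution\<close>, so exactly this one has to be fixed before the bound on them can
    be used.\<close>
  have "\<exists>x. case x of (n, d) \<Rightarrow> \<exists>\<epsilon>. free_resolution A E n d \<epsilon>"
    using free_resolution_exists[OF assms(6,7)] by auto
  from someI_ex[OF this] obtain n d \<epsilon> where nd: "some_resolution A E = (n, d)" and res: "free_resolution A E n d \<epsilon>"
    unfolding some_resolution_def[symmetric] by (auto split: prod.splits)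
  interpret resolved_module A "normal_form c a :: 'k mpoly \<Rightarrow> _" "nonbox c a" E n d \<epsilon>
    by unfold_locales (rule res)
  obtain b where "\<And>i. betti A i E \<le> b" using assms(8) by (auto simp: cx_le_one_def)
  from dvd_length[OF assms(6) nd this refl tp] show ?thesis .
qed

end
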